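(* Let $Z\in\mathbb{D}^{1,2}$ have zero mean, let $g(z)=E(\langle DZ,-DL^{-1}Z\rangle_{\mathfrak{H}}\mid Z=z)$, and let $\sigma_{\min}>0$. Assume that (i) $g(Z)\geq\sigma_{\min}^{2}$ almost surely (this ensures that $Z$ has a density $\rho$). First part. Fix $\alpha>0$ and $\beta>1$ and assume in addition that (ii) the function $h(x):=x^{1+\beta}\rho(x)$ is decreasing on $[\alpha,+\infty)$. Then, for all $z\geq\alpha$, $$P(Z\geq z)\geq\frac{1}{2}\left(1-\frac{1}{\beta}\right)E|Z|\;\frac{1}{z}\,\exp\left(-\frac{z^{2}}{2\sigma_{\min}^{2}}\right).$$ Second part. Alternately, instead of (ii), assume in addition to (i) that there exists $0<\alpha<2$ such that (ii)' $\limsup_{z\to\infty}z^{-\alpha}\log g(z)<\infty$. Then, for any $\varepsilon\in(0,2)$, there exist $K,z_{0}>0$ such that, for all $z>z_{0}$, $$P(Z\geq z)\geq K\,\exp\left(-\frac{z^{2}}{(2-\varepsilon)\sigma_{\min}^{2}}\right).$$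
   Context: $\mathfrak{H}$ is a real separable Hilbert space and $X=\{X(h):h\in\mathfrak{H}\}$ is a centered isonormal Gaussian process over $\mathfrak{H}$ on a probability space $(\Omega,\mathscr{F},P)$, i.e. a centered jointly Gaussian family with $E(X(h)X(k))=\langle h,k\rangle_{\mathfrak{H}}$; $\mathscr{F}$ is the $\sigma$-field generated by $X$. Malliavin derivative: for a smooth cylindrical variable $F=\psi(X(\phi_1),\ldots,X(\phi_n))$ ($\psi:\mathbb{R}^n\to\mathbb{R}$ smooth with compact support, $\phi_i\in\mathfrak{H}$), $DF=\sum_{i}\frac{\partial\psi}{\partial x_i}(X(\phi_1),\ldots,X(\phi_n))\phi_i\in L^2(\Omega,\mathfrak{H})$. $\mathbb{D}^{1,2}$ is the closure of the set of smooth cylindrical variables under the norm $\|F\|_{1,2}^2=E(F^2)+E(\|DF\|_{\mathfrak{H}}^2)$, and $D$ is extended to it by closure. $J_m$ is the orthogonal projection of $L^2(\Omega,\mathscr{F},P)$ onto the $m$-th Wiener chaos of $X$. For $Z\in L^2(\Omega,\mathscr{F},P)$, $L^{-1}Z=\sum_{m\ge1}-\frac1m J_m(Z)$, which lies in $\mathbb{D}^{1,2}$. The function $g:\mathbb{R}\to\mathbb{R}$ is a Borel function, determined almost everywhere with respect to the law of $Z$, with $g(Z)=E(\langle DZ,-DL^{-1}Z\rangle_{\mathfrak{H}}\mid Z)$ almost surely. "Density" means density of the law of $Z$ with respect to Lebesgue measure. Since $\rho$ and $g$ are determined only almost everywhere, conditions (ii) and (ii)' are understood as holding for some version of $\rho$,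 respectively $g$. *)

theory Defs
  imports "HOL-Probability.Probability"
begin

section \<open>Square-integrable variables\<close>

definition L2 :: "'a measure \<Rightarrow> ('a \<Rightarrow> 'b::{real_normed_vector, second_countable_topology}) set" where
  "L2 M = {f \<in> borel_measurable M. integrable M (\<lambda>\<omega>. (norm (f \<omega>))\<^sup>2)}"

definition tendsto_L2 ::
  "'a measure \<Rightarrow> (nat \<Rightarrow> 'a \<Rightarrow> 'b::{real_normed_vector, second_countable_topology}) \<Rightarrow> ('a \<Rightarrow> 'b) \<Rightarrow> bool" where
  "tendsto_L2 M fs f \<longleftrightarrow>
     f \<in> L2 M \<and> (\<forall>k. fs k \<in> L2 M) \<and>
     (\<lambda>k. \<integral>\<omega>. (norm (fs k \<omega> - f \<omega>))\<^sup>2 \<partial>M) \<longlonglongrightarrow> 0"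


section \<open>Isonormal Gaussian processes\<close>

text \<open>The degenerate law (Dirac mass at 0) counts as a centered Gaussian law.\<close>

definition centered_gaussian :: "'a measure \<Rightarrow> ('a \<Rightarrow> real) \<Rightarrow> bool" where
  "centered_gaussian M Y \<longleftrightarrow>
     Y \<in> borel_measurable M \<and>
     ((AE \<omega> in M. Y \<omega> = 0) \<or>
      (\<exists>s>0. distributed M lborel Y (\<lambda>x. ennreal (normal_density 0 s x))))"

text \<open>The real separable Hilbert space is the type \<open>'h\<close>. The last assumption says that the
  \<open>\<sigma>\<close>-field of \<open>M\<close> is the one generated by \<open>X\<close>.\<close>

locale isonormal_gaussian = prob_space M
  for M :: "'a measure"
    and X :: "'h::{real_inner, banach, second_countable_topology} \<Rightarrow> 'a \<Rightarrow> real" +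
  assumes jointly_gaussian:
      "finite S \<Longrightarrow> centered_gaussian M (\<lambda>\<omega>. \<Sum>h\<in>S. c h * X h \<omega>)"
    and covariance: "expectation (\<lambda>\<omega>. X h \<omega> * X k \<omega>) = h \<bullet> k"
    and generated_sets:
      "sets M = sigma_sets (space M) {X h -` A \<inter> space M | h A. A \<in> sets borel}"


section \<open>Malliavin derivative\<close>

text \<open>Since \<open>n\<close> varies, a function on \<open>\<real>\<^sup>n\<close> is represented by a function on \<open>nat \<Rightarrow> real\<close> that
  depends only on the coordinates below \<open>n\<close>. For such functions, continuity in the product
  topology is the same as continuity on \<open>\<real>\<^sup>n\<close>.\<close>

definition depends_on_first :: "nat \<Rightarrow> ((nat \<Rightarrow> real) \<Rightarrow> real) \<Rightarrow> bool" where
  "depends_on_first n \<psi> \<longleftrightarrow> (\<forall>x y. (\<forall>i<n. x i = y i) \<longrightarrow> \<psi> x = \<psi> y)"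

definition partial_deriv :: "nat \<Rightarrow> ((nat \<Rightarrow> real) \<Rightarrow> real) \<Rightarrow> (nat \<Rightarrow> real) \<Rightarrow> real" where
  "partial_deriv i \<psi> x = deriv (\<lambda>t. \<psi> (x(i := t))) (x i)"

fun iter_partial_deriv :: "nat list \<Rightarrow> ((nat \<Rightarrow> real) \<Rightarrow> real) \<Rightarrow> (nat \<Rightarrow> real) \<Rightarrow> real" where
  "iter_partial_deriv [] \<psi> = \<psi>"
| "iter_partial_deriv (i # is) \<psi> = partial_deriv i (iter_partial_deriv is \<psi>)"

text \<open>\<open>C\<^sup>\<infinity>\<close> on \<open>\<real>\<^sup>n\<close>: the partial derivatives of all orders exist and are continuous.\<close>

definition smooth :: "nat \<Rightarrow> ((nat \<Rightarrow> real) \<Rightarrow> real) \<Rightarrow> bool" where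
  "smooth n \<psi> \<longleftrightarrow>
     (\<forall>is \<in> lists {..<n}.
        continuous_on UNIV (iter_partial_deriv is \<psi>) \<and>
        (\<forall>i<n. \<forall>x. (\<lambda>t. iter_partial_deriv is \<psi> (x(i := t))) differentiable (at (x i))))"

definition compactly_supported :: "nat \<Rightarrow> ((nat \<Rightarrow> real) \<Rightarrow> real) \<Rightarrow> bool" where
  "compactly_supported n \<psi> \<longleftrightarrow> (\<exists>R. \<forall>x. \<psi> x \<noteq> 0 \<longrightarrow> (\<forall>i<n. \<bar>x i\<bar> \<le> R))"

text \<open>The graph of the derivative on smooth cylindrical variables: pairs \<open>(F, DF)\<close>.\<close>

definition cylindrical_graph ::
  "('h::real_inner \<Rightarrow> 'a \<Rightarrow> real) \<Rightarrow> (('a \<Rightarrow> real) \<times> ('a \<Rightarrow> 'h)) set" where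
  "cylindrical_graph X =
     {(\<lambda>\<omega>. \<psi> (\<lambda>j. X (\<phi> j) \<omega>),
       \<lambda>\<omega>. \<Sum>i<n. partial_deriv i \<psi> (\<lambda>j. X (\<phi> j) \<omega>) *\<^sub>R \<phi> i) | n \<psi> \<phi>.
       depends_on_first n \<psi> \<and> smooth n \<psi> \<and> compactly_supported n \<psi>}"

text \<open>The closure of that graph in \<open>L\<^sup>2(\<Omega>) \<times> L\<^sup>2(\<Omega>; 'h)\<close>, which is the closure under
  \<open>\<parallel>\<cdot>\<parallel>\<^sub>1\<^sub>,\<^sub>2\<close>. As the derivative is closable, \<open>G\<close> is almost surely determined by \<open>F\<close>;
  \<open>malliavin_D\<close> selects one version.\<close>

definition has_malliavin_derivative ::
  "'a measure \<Rightarrow> ('h::{real_inner, banach, second_countable_topology} \<Rightarrow> 'a \<Rightarrow> real) \<Rightarrow>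
   ('a \<Rightarrow> real) \<Rightarrow> ('a \<Rightarrow> 'h) \<Rightarrow> bool" where
  "has_malliavin_derivative M X F G \<longleftrightarrow>
     (\<exists>Fs Gs. (\<forall>k. (Fs k, Gs k) \<in> cylindrical_graph X) \<and>
        tendsto_L2 M Fs F \<and> tendsto_L2 M Gs G)"

definition D12 ::
  "'a measure \<Rightarrow> ('h::{real_inner, banach, second_countable_topology} \<Rightarrow> 'a \<Rightarrow> real) \<Rightarrow>
   ('a \<Rightarrow> real) set" where
  "D12 M X = {F. \<exists>G. has_malliavin_derivative M X F G}"

definition malliavin_D ::
  "'a measure \<Rightarrow> ('h::{real_inner, banach, second_countable_topology} \<Rightarrow> 'a \<Rightarrow> real) \<Rightarrow>
   ('a \<Rightarrow> real) \<Rightarrow> 'a \<Rightarrow> 'h" where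
  "malliavin_D M X F = (SOME G. has_malliavin_derivative M X F G)"


section \<open>Wiener chaos and the operator \<open>L\<^sup>-\<^sup>1\<close>\<close>

text \<open>Probabilists' Hermite polynomials.\<close>

fun hermite :: "nat \<Rightarrow> real \<Rightarrow> real" where
  "hermite 0 x = 1"
| "hermite (Suc 0) x = x"
| "hermite (Suc (Suc m)) x = x * hermite (Suc m) x - real (Suc m) * hermite m x"

text \<open>The \<open>m\<close>-th chaos is the \<open>L\<^sup>2\<close>-closure of the linear span of the variables \<open>H\<^sub>m(X(h))\<close>
  with \<open>\<parallel>h\<parallel> = 1\<close>.\<close>

definition chaos_span ::
  "('h::real_inner \<Rightarrow> 'a \<Rightarrow> real) \<Rightarrow> nat \<Rightarrow> ('a \<Rightarrow> real) set" where
  "chaos_span X m =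
     {\<lambda>\<omega>. \<Sum>h\<in>S. c h * hermite m (X h \<omega>) | S c. finite S \<and> (\<forall>h\<in>S. norm h = 1)}"

definition wiener_chaos ::
  "'a measure \<Rightarrow> ('h::real_inner \<Rightarrow> 'a \<Rightarrow> real) \<Rightarrow> nat \<Rightarrow> ('a \<Rightarrow> real) set" where
  "wiener_chaos M X m =
     {Y. \<exists>Ys. (\<forall>k. Ys k \<in> chaos_span X m) \<and> tendsto_L2 M Ys Y}"

text \<open>For \<open>Z\<close> in \<open>L\<^sup>2\<close> the choices below are unique up to almost sure equality.\<close>

definition chaos_proj ::
  "'a measure \<Rightarrow> ('h::real_inner \<Rightarrow> 'a \<Rightarrow> real) \<Rightarrow> nat \<Rightarrow> ('a \<Rightarrow> real) \<Rightarrow> 'a \<Rightarrow> real" where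
  "chaos_proj M X m Z =
     (SOME Y. Y \<in> wiener_chaos M X m \<and>
        (\<forall>W \<in> wiener_chaos M X m. (\<integral>\<omega>. (Z \<omega> - Y \<omega>) * W \<omega> \<partial>M) = 0))"

definition L_inv ::
  "'a measure \<Rightarrow> ('h::real_inner \<Rightarrow> 'a \<Rightarrow> real) \<Rightarrow> ('a \<Rightarrow> real) \<Rightarrow> 'a \<Rightarrow> real" where
  "L_inv M X Z =
     (SOME W. tendsto_L2 M
        (\<lambda>N \<omega>. \<Sum>m=1..N. - (1 / real m) * chaos_proj M X m Z \<omega>) W)"


section \<open>Versions of \<open>g\<close> and of the density\<close>

definition is_g_version ::
  "'a measure \<Rightarrow> ('h::{real_inner, banach, second_countable_topology} \<Rightarrow> 'a \<Rightarrow> real) \<Rightarrow>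
   ('a \<Rightarrow> real) \<Rightarrow> (real \<Rightarrow> real) \<Rightarrow> bool" where
  "is_g_version M X Z g \<longleftrightarrow>
     g \<in> borel_measurable borel \<and>
     (AE \<omega> in M. g (Z \<omega>) =
        real_cond_exp M (vimage_algebra (space M) Z borel)
          (\<lambda>\<omega>. malliavin_D M X Z \<omega> \<bullet> (- malliavin_D M X (L_inv M X Z) \<omega>)) \<omega>)"

definition is_density :: "'a measure \<Rightarrow> ('a \<Rightarrow> real) \<Rightarrow> (real \<Rightarrow> real) \<Rightarrow> bool" where
  "is_density M Z \<rho> \<longleftrightarrow>
     \<rho> \<in> borel_measurable borel \<and> (\<forall>x. 0 \<le> \<rho> x) \<and>
     distributed M lborel Z (\<lambda>x. ennreal (\<rho> x))"

end

theory Submission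
  imports Defs
begin

text \<open>
  Integration by parts against the Gaussian process gives
  \<open>E ((f(Z) - f(0)) Z) = E (f'(Z) \<langle>DZ, -DL\<^sup>-\<^sup>1Z\<rangle>) = E (f'(Z) g(Z))\<close>. For smooth \<open>f\<close> that approximate
  \<open>\<lambda>x. \<bar>x - b\<bar>\<close> this becomes \<open>E (\<bar>Z - b\<bar> Z) = E (sgn (Z - b) g(Z))\<close>, which says that the image under \<open>Z\<close> of
  the measure with density \<open>g(Z)\<close> has the Lebesgue density \<open>T(x) = E (Z; Z > x)\<close>. As \<open>g(Z)\<close> is bounded below,
  the law of \<open>Z\<close> is absolutely continuous and \<open>g \<rho> = T\<close>. Since also \<open>T' = -x \<rho> \<ge> -x T / \<sigma>min\<^sup>2\<close>, the
  function \<open>T(x)\<close> is at least \<open>T(0) exp (-x\<^sup>2 / (2 \<sigma>min\<^sup>2))\<close>, where \<open>T(0) = E \<bar>Z\<bar> / 2\<close>. Under the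
  monotonicity condition \<open>P(Z \<ge> z)\<close> is bounded below by \<open>(1 - 1/\<beta>) T(z) / z\<close>; under the growth condition on
  \<open>g\<close> it is bounded below by the integral of \<open>\<rho> = T / g\<close> over \<open>[z, z + 1]\<close>.
\<close>

section \<open>The space \<open>L\<^sup>2\<close>\<close>

text \<open>The integration by parts formula rests on one auxiliary variable. For a cylindrical
  \<psi> and F = f(\<psi>) - f(0), the divergence U of DF has two properties at once: paired with a
  variable that has a derivative G it gives E<DF, G>, and paired with an element Y of the m-th chaos
  it gives m E(F Y). As L^{-1} multiplies the m-th chaos by -1/m, these factors cancel in E(L^{-1}Z
  U), which is therefore both -E(F Z) and E<DF, DL^{-1}Z>. Both properties come from the
  one-dimensional Gaussian formula, once X(h) has been split off from an independent remainder. The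
  objects J_m, L^{-1} and D are choices by \<open>SOME\<close>, so a witness must be produced for
  each. This shapes the middle of the proof: projections need completeness of L^2, the chaos
  expansion needs totality of the Hermite variables, and DL^{-1}Z needs cutoffs, since Hermite
  polynomials are not compactly supported. Statements about a chaos are tested on its generators
  H_m(X(h)), which turns them into computations with one or two Gaussian variables.\<close>

lemma L2_measurable [measurable_dest]: "f \<in> L2 M \<Longrightarrow> f \<in> borel_measurable M"
  by (simp add: L2_def)

lemma L2_integrable_norm_sq: "f \<in> L2 M \<Longrightarrow> integrable M (\<lambda>\<omega>. (norm (f \<omega>))\<^sup>2)"
  by (simp add: L2_def)

lemma norm_add_sq_le: "(norm (x + y))\<^sup>2 \<le> 2 * (norm x)\<^sup>2 + 2 * (norm (y::'b::real_normed_vector))\<^sup>2"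
proof -
  have "(norm (x + y))\<^sup>2 \<le> (norm x + norm y)\<^sup>2"
    by (intro power_mono norm_triangle_ineq) auto
  also have "\<dots> \<le> 2 * (norm x)\<^sup>2 + 2 * (norm y)\<^sup>2"
    using sum_squares_bound[of "norm x" "norm y"] by (simp add: power2_sum)
  finally show ?thesis .
qed

lemma norm_diff_sq_le: "(norm (x - y))\<^sup>2 \<le> 2 * (norm x)\<^sup>2 + 2 * (norm (y::'b::real_normed_vector))\<^sup>2"
  using norm_add_sq_le[of x "-y"] by simp

lemma L2_add:
  assumes "f \<in> L2 M" "g \<in> L2 M"
  shows "(\<lambda>\<omega>. f \<omega> + g \<omega>) \<in> L2 M"
proof -
  have [measurable]: "f \<in> borel_measurable M" "g \<in> borel_measurable M"
    using assms by (auto simp: L2_def)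
  have "integrable M (\<lambda>\<omega>. (norm (f \<omega> + g \<omega>))\<^sup>2)"
    by (rule Bochner_Integration.integrable_bound
        [where f = "\<lambda>\<omega>. 2 * (norm (f \<omega>))\<^sup>2 + 2 * (norm (g \<omega>))\<^sup>2"])
      (use assms in \<open>auto simp: L2_def intro!: norm_add_sq_le\<close>)
  then show ?thesis by (simp add: L2_def)
qed

lemma L2_scaleR: "f \<in> L2 M \<Longrightarrow> (\<lambda>\<omega>. c *\<^sub>R f \<omega>) \<in> L2 M"
  by (auto simp: L2_def power_mult_distrib)

lemma L2_cmult: "f \<in> L2 M \<Longrightarrow> (\<lambda>\<omega>. c * f \<omega>) \<in> L2 M" for f :: "'a \<Rightarrow> real"
  using L2_scaleR[of f M c] by simp

lemma L2_minus: "f \<in> L2 M \<Longrightarrow> (\<lambda>\<omega>. - f \<omega>) \<in> L2 M"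
  using L2_scaleR[of f M "-1"] by simp

lemma L2_diff: "f \<in> L2 M \<Longrightarrow> g \<in> L2 M \<Longrightarrow> (\<lambda>\<omega>. f \<omega> - g \<omega>) \<in> L2 M"
  using L2_add[of f M "\<lambda>\<omega>. - g \<omega>"] L2_minus[of g M] by simp

lemma L2_zero: "(\<lambda>\<omega>. 0) \<in> L2 M"
  by (simp add: L2_def)

lemma L2_sum: "(\<And>i. i \<in> I \<Longrightarrow> f i \<in> L2 M) \<Longrightarrow> (\<lambda>\<omega>. \<Sum>i\<in>I. f i \<omega>) \<in> L2 M"
  by (induction I rule: infinite_finite_induct) (auto simp: L2_zero L2_add)

lemma L2_norm: "f \<in> L2 M \<Longrightarrow> (\<lambda>\<omega>. norm (f \<omega>)) \<in> L2 M"
  by (simp add: L2_def measurable_compose[OF _ borel_measurable_norm])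

lemma L2_const: "finite_measure M \<Longrightarrow> (\<lambda>\<omega>. c) \<in> L2 M"
  by (simp add: L2_def finite_measure.integrable_const)

lemma integrable_norm_mult_L2:
  assumes "f \<in> L2 M" "g \<in> L2 M"
  shows "integrable M (\<lambda>\<omega>. norm (f \<omega>) * norm (g \<omega>))"
proof -
  have [measurable]: "f \<in> borel_measurable M" "g \<in> borel_measurable M"
    using assms by (auto simp: L2_def)
  have "norm (f \<omega>) * norm (g \<omega>) \<le> (norm (f \<omega>))\<^sup>2 + (norm (g \<omega>))\<^sup>2" for \<omega>
    using sum_squares_bound[of "norm (f \<omega>)" "norm (g \<omega>)"] mult_nonneg_nonneg[of "norm (f \<omega>)" "norm (g \<omega>)"]
    using norm_ge_zero[of "f \<omega>"] norm_ge_zero[of "g \<omega>"] by linarith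
  then show ?thesis
    by (intro Bochner_Integration.integrable_bound
        [where f = "\<lambda>\<omega>. (norm (f \<omega>))\<^sup>2 + (norm (g \<omega>))\<^sup>2"
           and g = "\<lambda>\<omega>. norm (f \<omega>) * norm (g \<omega>)"])
      (use assms in \<open>auto simp: L2_def\<close>)
qed

lemma integrable_inner_L2:
  fixes f g :: "'a \<Rightarrow> 'b::{real_inner, second_countable_topology}"
  assumes "f \<in> L2 M" "g \<in> L2 M"
  shows "integrable M (\<lambda>\<omega>. f \<omega> \<bullet> g \<omega>)"
proof -
  have [measurable]: "f \<in> borel_measurable M" "g \<in> borel_measurable M"
    using assms by (auto simp: L2_def)
  show ?thesis
    by (intro Bochner_Integration.integrable_bound[OF integrable_norm_mult_L2[OF assms]])
      (auto simp: Cauchy_Schwarz_ineq2)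
qed

lemma integrable_mult_L2:
  fixes f g :: "'a \<Rightarrow> real"
  assumes "f \<in> L2 M" "g \<in> L2 M"
  shows "integrable M (\<lambda>\<omega>. f \<omega> * g \<omega>)"
  using integrable_inner_L2[OF assms] by simp

lemma integral_norm_add_sq_le:
  assumes "f \<in> L2 M" "g \<in> L2 M"
  shows "(\<integral>\<omega>. (norm (f \<omega> + g \<omega>))\<^sup>2 \<partial>M) \<le> 2 * (\<integral>\<omega>. (norm (f \<omega>))\<^sup>2 \<partial>M) + 2 * (\<integral>\<omega>. (norm (g \<omega>))\<^sup>2 \<partial>M)"
proof -
  have "(\<integral>\<omega>. (norm (f \<omega> + g \<omega>))\<^sup>2 \<partial>M) \<le> (\<integral>\<omega>. 2 * (norm (f \<omega>))\<^sup>2 + 2 * (norm (g \<omega>))\<^sup>2 \<partial>M)"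
    using assms L2_add[OF assms]
    by (intro integral_mono) (auto simp: L2_def norm_add_sq_le)
  also have "\<dots> = 2 * (\<integral>\<omega>. (norm (f \<omega>))\<^sup>2 \<partial>M) + 2 * (\<integral>\<omega>. (norm (g \<omega>))\<^sup>2 \<partial>M)"
    using assms by (simp add: L2_def)
  finally show ?thesis .
qed

lemma integral_norm_diff_sq_le:
  assumes "f \<in> L2 M" "g \<in> L2 M" "h \<in> L2 M"
  shows "(\<integral>\<omega>. (norm (f \<omega> - h \<omega>))\<^sup>2 \<partial>M)
    \<le> 2 * (\<integral>\<omega>. (norm (f \<omega> - g \<omega>))\<^sup>2 \<partial>M) + 2 * (\<integral>\<omega>. (norm (g \<omega> - h \<omega>))\<^sup>2 \<partial>M)"
  using integral_norm_add_sq_le[OF L2_diff[OF assms(1,2)] L2_diff[OF assms(2,3)]] by simp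

text \<open>The integral of the square of |f| - t|g| is a nonnegative quadratic in t, and its value
  at the minimiser t = C/B is the claim. If B = 0 it is affine in t, which forces C = 0.\<close>

lemma Cauchy_Schwarz_L2:
  fixes f g :: "'a \<Rightarrow> 'b::{real_inner, second_countable_topology}"
  assumes "f \<in> L2 M" "g \<in> L2 M"
  shows "(\<integral>\<omega>. norm (f \<omega>) * norm (g \<omega>) \<partial>M)\<^sup>2
    \<le> (\<integral>\<omega>. (norm (f \<omega>))\<^sup>2 \<partial>M) * (\<integral>\<omega>. (norm (g \<omega>))\<^sup>2 \<partial>M)"
proof -
  define A B C where "A = (\<integral>\<omega>. (norm (f \<omega>))\<^sup>2 \<partial>M)" and "B = (\<integral>\<omega>. (norm (g \<omega>))\<^sup>2 \<partial>M)"
    and "C = (\<integral>\<omega>. norm (f \<omega>) * norm (g \<omega>) \<partial>M)"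
  have *: "0 \<le> A - 2 * t * C + t\<^sup>2 * B" for t
  proof -
    have "0 \<le> (\<integral>\<omega>. (norm (f \<omega>) - t * norm (g \<omega>))\<^sup>2 \<partial>M)" by simp
    also have "\<dots> = (\<integral>\<omega>. (norm (f \<omega>))\<^sup>2 - 2 * t * (norm (f \<omega>) * norm (g \<omega>)) + t\<^sup>2 * (norm (g \<omega>))\<^sup>2 \<partial>M)"
      by (simp add: power2_diff power_mult_distrib algebra_simps)
    also have "\<dots> = A - 2 * t * C + t\<^sup>2 * B"
      using assms integrable_norm_mult_L2[OF assms] unfolding A_def B_def C_def
      by (simp add: L2_integrable_norm_sq)
    finally show ?thesis .
  qed
  have "B \<ge> 0" "A \<ge> 0" by (auto simp: A_def B_def)
  have "C\<^sup>2 \<le> A * B"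
  proof (cases "B = 0")
    case True
    have "C = 0"
    proof (rule ccontr)
      assume "C \<noteq> 0"
      \<comment> \<open>This t would make the affine function equal to -1.\<close>
      have "0 \<le> A - 2 * ((A + 1) / (2 * C)) * C" using *[of "(A + 1) / (2 * C)"] True by simp
      then show False using \<open>C \<noteq> 0\<close> by simp
    qed
    then show ?thesis using True by simp
  next
    case False
    then have "B > 0" using \<open>B \<ge> 0\<close> by simp
    have "0 \<le> B * (A - 2 * (C / B) * C + (C / B)\<^sup>2 * B)"
      using *[of "C / B"] \<open>B > 0\<close> by simp
    also have "\<dots> = A * B - C\<^sup>2"
      using \<open>B > 0\<close> by (simp add: field_simps power2_eq_square)
    finally show ?thesis by simp
  qed
  then show ?thesis by (simp add: A_def B_def C_def)
qed

lemma abs_integral_inner_le: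
  fixes f g :: "'a \<Rightarrow> 'b::{real_inner, second_countable_topology}"
  assumes "f \<in> L2 M" "g \<in> L2 M"
  shows "\<bar>\<integral>\<omega>. f \<omega> \<bullet> g \<omega> \<partial>M\<bar> \<le> sqrt (\<integral>\<omega>. (norm (f \<omega>))\<^sup>2 \<partial>M) * sqrt (\<integral>\<omega>. (norm (g \<omega>))\<^sup>2 \<partial>M)"
proof -
  have "\<bar>\<integral>\<omega>. f \<omega> \<bullet> g \<omega> \<partial>M\<bar> \<le> (\<integral>\<omega>. \<bar>f \<omega> \<bullet> g \<omega>\<bar> \<partial>M)" by simp
  also have "\<dots> \<le> (\<integral>\<omega>. norm (f \<omega>) * norm (g \<omega>) \<partial>M)"
    using integrable_inner_L2[OF assms] integrable_norm_mult_L2[OF assms]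
    by (intro integral_mono) (auto simp: Cauchy_Schwarz_ineq2)
  also have "\<dots> \<le> sqrt ((\<integral>\<omega>. (norm (f \<omega>))\<^sup>2 \<partial>M) * (\<integral>\<omega>. (norm (g \<omega>))\<^sup>2 \<partial>M))"
    by (rule real_le_rsqrt[OF Cauchy_Schwarz_L2[OF assms]])
  finally show ?thesis by (simp add: real_sqrt_mult)
qed

lemma tendsto_L2D:
  assumes "tendsto_L2 M fs f"
  shows "f \<in> L2 M" "fs k \<in> L2 M" "(\<lambda>k. \<integral>\<omega>. (norm (fs k \<omega> - f \<omega>))\<^sup>2 \<partial>M) \<longlonglongrightarrow> 0"
  using assms by (auto simp: tendsto_L2_def)

lemma tendsto_L2_inner_right:
  fixes f :: "'a \<Rightarrow> 'b::{real_inner, second_countable_topology}"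
  assumes "tendsto_L2 M fs f" "g \<in> L2 M"
  shows "(\<lambda>k. \<integral>\<omega>. fs k \<omega> \<bullet> g \<omega> \<partial>M) \<longlonglongrightarrow> (\<integral>\<omega>. f \<omega> \<bullet> g \<omega> \<partial>M)"
proof -
  note D = tendsto_L2D[OF assms(1)]
  have "(\<lambda>k. sqrt (\<integral>\<omega>. (norm (fs k \<omega> - f \<omega>))\<^sup>2 \<partial>M) * sqrt (\<integral>\<omega>. (norm (g \<omega>))\<^sup>2 \<partial>M)) \<longlonglongrightarrow> sqrt 0 * sqrt (\<integral>\<omega>. (norm (g \<omega>))\<^sup>2 \<partial>M)"
    by (intro tendsto_intros D(3))
  then have *: "(\<lambda>k. sqrt (\<integral>\<omega>. (norm (fs k \<omega> - f \<omega>))\<^sup>2 \<partial>M) * sqrt (\<integral>\<omega>. (norm (g \<omega>))\<^sup>2 \<partial>M)) \<longlonglongrightarrow> 0" by simp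
  have "(\<lambda>k. (\<integral>\<omega>. fs k \<omega> \<bullet> g \<omega> \<partial>M) - (\<integral>\<omega>. f \<omega> \<bullet> g \<omega> \<partial>M)) \<longlonglongrightarrow> 0"
  proof (rule Lim_null_comparison[OF _ *], rule always_eventually, rule allI)
    fix k
    have "(\<integral>\<omega>. fs k \<omega> \<bullet> g \<omega> \<partial>M) - (\<integral>\<omega>. f \<omega> \<bullet> g \<omega> \<partial>M) = (\<integral>\<omega>. (fs k \<omega> - f \<omega>) \<bullet> g \<omega> \<partial>M)"
      using D(1) D(2)[of k] assms(2) by (simp add: integrable_inner_L2 inner_diff_left)
    then show "norm ((\<integral>\<omega>. fs k \<omega> \<bullet> g \<omega> \<partial>M) - (\<integral>\<omega>. f \<omega> \<bullet> g \<omega> \<partial>M))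
        \<le> sqrt (\<integral>\<omega>. (norm (fs k \<omega> - f \<omega>))\<^sup>2 \<partial>M) * sqrt (\<integral>\<omega>. (norm (g \<omega>))\<^sup>2 \<partial>M)"
      using abs_integral_inner_le[OF L2_diff[OF D(2)[of k] D(1)] assms(2)] by simp
  qed
  then show ?thesis by (simp add: LIM_zero_iff)
qed

lemma tendsto_L2_mult_right:
  fixes f :: "'a \<Rightarrow> real"
  assumes "tendsto_L2 M fs f" "g \<in> L2 M"
  shows "(\<lambda>k. \<integral>\<omega>. fs k \<omega> * g \<omega> \<partial>M) \<longlonglongrightarrow> (\<integral>\<omega>. f \<omega> * g \<omega> \<partial>M)"
  using tendsto_L2_inner_right[OF assms] by simp

lemma tendsto_L2_const: "f \<in> L2 M \<Longrightarrow> tendsto_L2 M (\<lambda>_. f) f"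
  by (simp add: tendsto_L2_def)

lemma integral_norm_sq_sum_orthogonal:
  fixes Y :: "'i \<Rightarrow> 'a \<Rightarrow> 'b::{real_inner, second_countable_topology}"
  assumes "finite I" and L2: "\<And>i. i \<in> I \<Longrightarrow> Y i \<in> L2 M"
    and orth: "\<And>i j. i \<in> I \<Longrightarrow> j \<in> I \<Longrightarrow> i \<noteq> j \<Longrightarrow> (\<integral>\<omega>. Y i \<omega> \<bullet> Y j \<omega> \<partial>M) = 0"
  shows "(\<integral>\<omega>. (norm (\<Sum>i\<in>I. Y i \<omega>))\<^sup>2 \<partial>M) = (\<Sum>i\<in>I. \<integral>\<omega>. (norm (Y i \<omega>))\<^sup>2 \<partial>M)"
proof -
  have "(\<integral>\<omega>. (norm (\<Sum>i\<in>I. Y i \<omega>))\<^sup>2 \<partial>M) = (\<integral>\<omega>. (\<Sum>i\<in>I. \<Sum>j\<in>I. Y i \<omega> \<bullet> Y j \<omega>) \<partial>M)"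
    by (simp only: power2_norm_eq_inner, simp only: inner_sum_left, simp only: inner_sum_right)
  also have "\<dots> = (\<Sum>i\<in>I. \<Sum>j\<in>I. \<integral>\<omega>. Y i \<omega> \<bullet> Y j \<omega> \<partial>M)"
    using L2 by (subst Bochner_Integration.integral_sum)
      (auto intro!: Bochner_Integration.integrable_sum integrable_inner_L2 sum.cong Bochner_Integration.integral_sum)
  also have "\<dots> = (\<Sum>i\<in>I. \<Sum>j\<in>I. if j = i then \<integral>\<omega>. (norm (Y i \<omega>))\<^sup>2 \<partial>M else 0)"
    using orth by (intro sum.cong) (auto simp: power2_norm_eq_inner)
  also have "\<dots> = (\<Sum>i\<in>I. \<integral>\<omega>. (norm (Y i \<omega>))\<^sup>2 \<partial>M)"
    using \<open>finite I\<close> by (intro sum.cong) (auto simp: sum.delta)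
  finally show ?thesis .
qed

text \<open>For diagonal arguments: approximants may be exchanged for more convenient ones as long
  as the error of the k-th exchange vanishes with k.\<close>

lemma tendsto_L2_perturb:
  assumes f: "tendsto_L2 M fs f" and g: "\<And>k. gs k \<in> L2 M"
    and le: "\<And>k. (\<integral>\<omega>. (norm (gs k \<omega> - fs k \<omega>))\<^sup>2 \<partial>M) \<le> e k" and e: "e \<longlonglongrightarrow> 0"
  shows "tendsto_L2 M gs f"
proof -
  note D = tendsto_L2D[OF f]
  have "(\<lambda>k. 2 * e k + 2 * (\<integral>\<omega>. (norm (fs k \<omega> - f \<omega>))\<^sup>2 \<partial>M)) \<longlonglongrightarrow> 2 * 0 + 2 * 0"
    by (intro tendsto_intros e D)
  then have lim: "(\<lambda>k. 2 * e k + 2 * (\<integral>\<omega>. (norm (fs k \<omega> - f \<omega>))\<^sup>2 \<partial>M)) \<longlonglongrightarrow> 0" by simp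
  have "(\<lambda>k. \<integral>\<omega>. (norm (gs k \<omega> - f \<omega>))\<^sup>2 \<partial>M) \<longlonglongrightarrow> 0"
  proof (rule Lim_null_comparison[OF always_eventually lim], rule allI)
    fix k
    show "norm (\<integral>\<omega>. (norm (gs k \<omega> - f \<omega>))\<^sup>2 \<partial>M) \<le> 2 * e k + 2 * (\<integral>\<omega>. (norm (fs k \<omega> - f \<omega>))\<^sup>2 \<partial>M)"
      using integral_norm_diff_sq_le[OF g[of k] D(2)[of k] D(1)] le[of k] by simp
  qed
  then show ?thesis using D g by (auto simp: tendsto_L2_def)
qed

lemma tendsto_L2_dominated:
  fixes f :: "'a \<Rightarrow> 'b::{real_inner, banach, second_countable_topology}"
  assumes meas: "\<And>k. fs k \<in> borel_measurable M" "f \<in> borel_measurable M"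
    and lim: "\<And>\<omega>. (\<lambda>k. fs k \<omega>) \<longlonglongrightarrow> f \<omega>"
    and w: "w \<in> L2 M" and bound: "\<And>k \<omega>. norm (fs k \<omega>) \<le> w \<omega>"
  shows "tendsto_L2 M fs f"
proof -
  have [measurable]: "w \<in> borel_measurable M" using w by (auto simp: L2_def)
  note [measurable] = meas
  have bf: "norm (f \<omega>) \<le> w \<omega>" for \<omega>
    by (rule LIMSEQ_le_const2[OF tendsto_norm[OF lim]]) (use bound in auto)
  have w2: "integrable M (\<lambda>\<omega>. (w \<omega>)\<^sup>2)" using w by (simp add: L2_def)
  have sq: "(norm x)\<^sup>2 \<le> (w \<omega>)\<^sup>2" if "norm x \<le> w \<omega>" for x :: 'b and \<omega>
    by (rule power_mono[OF that]) simp
  have "integrable M (\<lambda>\<omega>. (norm (fs k \<omega>))\<^sup>2)" "integrable M (\<lambda>\<omega>. (norm (f \<omega>))\<^sup>2)" for k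
    by (rule Bochner_Integration.integrable_bound[OF w2]; use sq[OF bound] sq[OF bf] in simp)+
  then have L2: "fs k \<in> L2 M" "f \<in> L2 M" for k by (auto simp: L2_def)
  have "(\<lambda>k. \<integral>\<omega>. (norm (fs k \<omega> - f \<omega>))\<^sup>2 \<partial>M) \<longlonglongrightarrow> (\<integral>\<omega>. 0 \<partial>M)"
  proof (rule integral_dominated_convergence[where w = "\<lambda>\<omega>. 4 * (w \<omega>)\<^sup>2"])
    show "AE \<omega> in M. (\<lambda>k. (norm (fs k \<omega> - f \<omega>))\<^sup>2) \<longlonglongrightarrow> 0"
      using tendsto_power[OF tendsto_norm[OF LIM_zero[OF lim]], where n = 2] by simp
    show "AE \<omega> in M. norm ((norm (fs k \<omega> - f \<omega>))\<^sup>2) \<le> 4 * (w \<omega>)\<^sup>2" for k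
    proof (rule AE_I2)
      fix \<omega>
      show "norm ((norm (fs k \<omega> - f \<omega>))\<^sup>2) \<le> 4 * (w \<omega>)\<^sup>2"
        using norm_diff_sq_le[of "fs k \<omega>" "f \<omega>"] sq[OF bound[of k \<omega>]] sq[OF bf[of \<omega>]] by simp
    qed
  qed (use w2 in auto)
  then show ?thesis using L2 by (simp add: tendsto_L2_def)
qed

section \<open>Completeness, orthogonal projection and orthogonal series in L^2\<close>

context finite_measure
begin

lemma L2_imp_integrable:
  fixes f :: "'a \<Rightarrow> 'b::{real_inner, banach, second_countable_topology}"
  assumes "f \<in> L2 M"
  shows "integrable M f"
proof -
  have "integrable M (\<lambda>\<omega>. norm (f \<omega>))"
    by (rule square_integrable_imp_integrable) (use assms in \<open>auto simp: L2_def\<close>)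
  then show ?thesis using assms by (simp add: L2_def integrable_norm_iff)
qed

end

context prob_space
begin

lemma integral_norm_le_sqrt:
  fixes f :: "'a \<Rightarrow> 'b::{real_inner, banach, second_countable_topology}"
  assumes "f \<in> L2 M"
  shows "(\<integral>\<omega>. norm (f \<omega>) \<partial>M) \<le> sqrt (\<integral>\<omega>. (norm (f \<omega>))\<^sup>2 \<partial>M)"
  by (rule real_le_rsqrt)
    (use Cauchy_Schwarz_L2[OF L2_norm[OF assms] L2_const[OF finite_measure_axioms, of 1]]
      in \<open>simp add: prob_space\<close>)

text \<open>On a probability space the L^1 norm is at most the L^2 norm, so the subsequence theorem
  for L^1 applies; this is why the Cauchy bound is requested at e^2.\<close>

lemma L2_Cauchy_AE_subseq:
  fixes fs :: "nat \<Rightarrow> 'a \<Rightarrow> 'b::{real_inner, banach, second_countable_topology}"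
  assumes L2: "\<And>k. fs k \<in> L2 M"
    and Cauchy: "\<And>e. e > 0 \<Longrightarrow> \<exists>N. \<forall>i\<ge>N. \<forall>j\<ge>N. (\<integral>\<omega>. (norm (fs i \<omega> - fs j \<omega>))\<^sup>2 \<partial>M) < e"
  obtains r where "strict_mono r" "AE \<omega> in M. Cauchy (\<lambda>i. fs (r i) \<omega>)"
proof (rule cauchy_L1_AE_cauchy_subseq[of M fs])
  show "integrable M (fs n)" for n using L2 by (rule L2_imp_integrable)
  fix e :: real assume "e > 0"
  then obtain N where N: "\<And>i j. i \<ge> N \<Longrightarrow> j \<ge> N \<Longrightarrow> (\<integral>\<omega>. (norm (fs i \<omega> - fs j \<omega>))\<^sup>2 \<partial>M) < e\<^sup>2"
    using Cauchy[of "e\<^sup>2"] by auto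
  have "(\<integral>\<omega>. norm (fs i \<omega> - fs j \<omega>) \<partial>M) < e" if "i \<ge> N" "j \<ge> N" for i j
  proof -
    have "(\<integral>\<omega>. norm (fs i \<omega> - fs j \<omega>) \<partial>M) \<le> sqrt (\<integral>\<omega>. (norm (fs i \<omega> - fs j \<omega>))\<^sup>2 \<partial>M)"
      by (rule integral_norm_le_sqrt[OF L2_diff[OF L2 L2]])
    also have "\<dots> < e" using N[OF that] \<open>e > 0\<close> by (intro real_less_lsqrt) auto
    finally show ?thesis .
  qed
  then show "\<exists>N. \<forall>i\<ge>N. \<forall>j\<ge>N. (\<integral>\<omega>. norm (fs i \<omega> - fs j \<omega>) \<partial>M) < e" by blast
qed (use that in auto)

text \<open>The limit is defined pointwise along an almost surely convergent subsequence, and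
  Fatou's lemma carries the Cauchy bound over to it.\<close>

lemma L2_complete:
  fixes fs :: "nat \<Rightarrow> 'a \<Rightarrow> 'b::{real_inner, banach, second_countable_topology}"
  assumes L2: "\<And>k. fs k \<in> L2 M"
    and Cauchy: "\<And>e. e > 0 \<Longrightarrow> \<exists>N. \<forall>i\<ge>N. \<forall>j\<ge>N. (\<integral>\<omega>. (norm (fs i \<omega> - fs j \<omega>))\<^sup>2 \<partial>M) < e"
  shows "\<exists>f. tendsto_L2 M fs f"
proof -
  have [measurable]: "fs k \<in> borel_measurable M" for k using L2 by (auto simp: L2_def)
  obtain r where r: "strict_mono r" "AE \<omega> in M. Cauchy (\<lambda>i. fs (r i) \<omega>)"
    using L2_Cauchy_AE_subseq[OF assms] by blast
  define f where "f = (\<lambda>\<omega>. lim (\<lambda>i. fs (r i) \<omega>))"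
  have [measurable]: "f \<in> borel_measurable M" unfolding f_def by measurable
  have lim: "AE \<omega> in M. (\<lambda>i. fs (r i) \<omega>) \<longlonglongrightarrow> f \<omega>"
    using r(2) by eventually_elim (simp add: f_def Cauchy_convergent_iff convergent_LIMSEQ_iff)
  have *: "\<exists>N. \<forall>n\<ge>N. (\<integral>\<^sup>+\<omega>. ennreal ((norm (fs n \<omega> - f \<omega>))\<^sup>2) \<partial>M) \<le> ennreal e" if "e > 0" for e
  proof -
    obtain N where N: "\<And>i j. i \<ge> N \<Longrightarrow> j \<ge> N \<Longrightarrow> (\<integral>\<omega>. (norm (fs i \<omega> - fs j \<omega>))\<^sup>2 \<partial>M) < e"
      using Cauchy[OF \<open>e > 0\<close>] by auto
    have "(\<integral>\<^sup>+\<omega>. ennreal ((norm (fs n \<omega> - f \<omega>))\<^sup>2) \<partial>M) \<le> ennreal e" if "n \<ge> N" for n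
    proof -
      have "(\<integral>\<^sup>+\<omega>. ennreal ((norm (fs n \<omega> - f \<omega>))\<^sup>2) \<partial>M)
          = (\<integral>\<^sup>+\<omega>. liminf (\<lambda>k. ennreal ((norm (fs n \<omega> - fs (r k) \<omega>))\<^sup>2)) \<partial>M)"
      proof (rule nn_integral_cong_AE)
        show "AE \<omega> in M. ennreal ((norm (fs n \<omega> - f \<omega>))\<^sup>2) = liminf (\<lambda>k. ennreal ((norm (fs n \<omega> - fs (r k) \<omega>))\<^sup>2))"
          using lim
        proof eventually_elim
          case (elim \<omega>)
          then have "(\<lambda>k. ennreal ((norm (fs n \<omega> - fs (r k) \<omega>))\<^sup>2)) \<longlonglongrightarrow> ennreal ((norm (fs n \<omega> - f \<omega>))\<^sup>2)"
            by (intro tendsto_ennrealI tendsto_intros)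
          then show ?case by (rule lim_imp_Liminf[OF sequentially_bot, symmetric])
        qed
      qed
      also have "\<dots> \<le> liminf (\<lambda>k. \<integral>\<^sup>+\<omega>. ennreal ((norm (fs n \<omega> - fs (r k) \<omega>))\<^sup>2) \<partial>M)"
        by (rule nn_integral_liminf) measurable
      also have "\<dots> \<le> limsup (\<lambda>k. \<integral>\<^sup>+\<omega>. ennreal ((norm (fs n \<omega> - fs (r k) \<omega>))\<^sup>2) \<partial>M)"
        by (rule Liminf_le_Limsup) simp
      also have "\<dots> \<le> ennreal e"
      proof (rule Limsup_bounded)
        show "\<forall>\<^sub>F k in sequentially. (\<integral>\<^sup>+\<omega>. ennreal ((norm (fs n \<omega> - fs (r k) \<omega>))\<^sup>2) \<partial>M) \<le> ennreal e"
          using eventually_ge_at_top[of N]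
        proof eventually_elim
          case (elim k)
          have "r k \<ge> N" using elim seq_suble[OF r(1), of k] by simp
          have "(\<integral>\<^sup>+\<omega>. ennreal ((norm (fs n \<omega> - fs (r k) \<omega>))\<^sup>2) \<partial>M)
              = ennreal (\<integral>\<omega>. (norm (fs n \<omega> - fs (r k) \<omega>))\<^sup>2 \<partial>M)"
            using L2_diff[OF L2[of n] L2[of "r k"]]
            by (intro nn_integral_eq_integral) (auto simp: L2_def)
          also have "\<dots> \<le> ennreal e"
            using N[OF \<open>n \<ge> N\<close> \<open>r k \<ge> N\<close>] by (intro ennreal_leI) simp
          finally show ?case .
        qed
      qed
      finally show ?thesis .
    qed
    then show ?thesis by blast
  qed
  have diff_L2: "\<exists>N. \<forall>n\<ge>N. (\<lambda>\<omega>. fs n \<omega> - f \<omega>) \<in> L2 M \<and> (\<integral>\<omega>. (norm (fs n \<omega> - f \<omega>))\<^sup>2 \<partial>M) \<le> e" if e: "e > 0" for e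
  proof -
    obtain N where N: "\<And>n. n \<ge> N \<Longrightarrow> (\<integral>\<^sup>+\<omega>. ennreal ((norm (fs n \<omega> - f \<omega>))\<^sup>2) \<partial>M) \<le> ennreal e"
      using *[OF e] by blast
    have "(\<lambda>\<omega>. fs n \<omega> - f \<omega>) \<in> L2 M \<and> (\<integral>\<omega>. (norm (fs n \<omega> - f \<omega>))\<^sup>2 \<partial>M) \<le> e" if "n \<ge> N" for n
    proof -
      have "(\<integral>\<^sup>+\<omega>. ennreal ((norm (fs n \<omega> - f \<omega>))\<^sup>2) \<partial>M) < \<infinity>"
        using N[OF that] by (simp add: le_less_trans ennreal_less_top)
      then have i: "integrable M (\<lambda>\<omega>. (norm (fs n \<omega> - f \<omega>))\<^sup>2)"
        by (subst integrable_iff_bounded) auto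
      have "ennreal (\<integral>\<omega>. (norm (fs n \<omega> - f \<omega>))\<^sup>2 \<partial>M) \<le> ennreal e"
        using N[OF that] i by (subst nn_integral_eq_integral[symmetric]) auto
      then show ?thesis using i e by (auto simp: L2_def)
    qed
    then show ?thesis by blast
  qed
  have "f \<in> L2 M"
  proof -
    obtain n where "(\<lambda>\<omega>. fs n \<omega> - f \<omega>) \<in> L2 M" using diff_L2[of 1] by fastforce
    from L2_diff[OF L2[of n] this] show ?thesis by simp
  qed
  moreover have "(\<lambda>k. \<integral>\<omega>. (norm (fs k \<omega> - f \<omega>))\<^sup>2 \<partial>M) \<longlonglongrightarrow> 0"
  proof (rule LIMSEQ_I)
    fix e :: real assume "e > 0"
    then obtain N where "\<forall>n\<ge>N. (\<integral>\<omega>. (norm (fs n \<omega> - f \<omega>))\<^sup>2 \<partial>M) \<le> e / 2" using diff_L2[of "e/2"] by auto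
    then show "\<exists>no. \<forall>n\<ge>no. norm ((\<integral>\<omega>. (norm (fs n \<omega> - f \<omega>))\<^sup>2 \<partial>M) - 0) < e"
      using \<open>e > 0\<close> by (intro exI[of _ N]) fastforce
  qed
  ultimately have "tendsto_L2 M fs f" using L2 by (simp add: tendsto_L2_def)
  then show ?thesis by blast
qed

lemma tendsto_L2_AE_subseq:
  fixes f :: "'a \<Rightarrow> 'b::{real_inner, banach, second_countable_topology}"
  assumes "tendsto_L2 M fs f"
  obtains r where "strict_mono r" "AE \<omega> in M. (\<lambda>i. fs (r i) \<omega>) \<longlonglongrightarrow> f \<omega>"
proof -
  note D = tendsto_L2D[OF assms(1)]
  have "(\<lambda>k. \<integral>\<omega>. norm (fs k \<omega> - f \<omega>) \<partial>M) \<longlonglongrightarrow> 0"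
  proof (rule Lim_null_comparison)
    show "\<forall>\<^sub>F k in sequentially. norm (\<integral>\<omega>. norm (fs k \<omega> - f \<omega>) \<partial>M) \<le> sqrt (\<integral>\<omega>. (norm (fs k \<omega> - f \<omega>))\<^sup>2 \<partial>M)"
      using integral_norm_le_sqrt[OF L2_diff[OF D(2) D(1)]] by simp
    show "(\<lambda>k. sqrt (\<integral>\<omega>. (norm (fs k \<omega> - f \<omega>))\<^sup>2 \<partial>M)) \<longlonglongrightarrow> 0"
      using tendsto_real_sqrt[OF D(3)] by simp
  qed
  then have "\<exists>r. strict_mono r \<and> (AE \<omega> in M. (\<lambda>n. (\<lambda>k \<omega>. fs k \<omega> - f \<omega>) (r n) \<omega>) \<longlonglongrightarrow> 0)"
    by (intro tendsto_L1_AE_subseq L2_imp_integrable[OF L2_diff[OF D(2) D(1)]])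
  then show ?thesis using that by (auto simp: LIM_zero_iff)
qed

text \<open>The subspace \<open>K\<close> need not be closed, so the minimising sequence
  \<open>Ys\<close> stays in \<open>K\<close> while its limit \<open>Y\<close> may leave it. This is
  the situation of a chaos, which is defined as the closure of a span.\<close>

lemma L2_projection:
  fixes Z :: "'a \<Rightarrow> real"
  assumes Z: "Z \<in> L2 M" and K: "K \<subseteq> L2 M" "(\<lambda>\<omega>. 0) \<in> K"
    and add: "\<And>f g. f \<in> K \<Longrightarrow> g \<in> K \<Longrightarrow> (\<lambda>\<omega>. f \<omega> + g \<omega>) \<in> K"
    and scale: "\<And>c f. f \<in> K \<Longrightarrow> (\<lambda>\<omega>. c * f \<omega>) \<in> K"
  shows "\<exists>Y Ys. (\<forall>k. Ys k \<in> K) \<and> tendsto_L2 M Ys Y \<and> (\<forall>W\<in>K. (\<integral>\<omega>. (Z \<omega> - Y \<omega>) * W \<omega> \<partial>M) = 0)"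
proof -
  define q where "q f = (\<integral>\<omega>. (Z \<omega> - f \<omega>)\<^sup>2 \<partial>M)" for f
  define d where "d = Inf (q ` K)"
  have q_nonneg: "q f \<ge> 0" for f by (simp add: q_def)
  have bdd: "bdd_below (q ` K)" by (rule bdd_belowI[of _ 0]) (auto simp: q_nonneg)
  have d_le: "d \<le> q f" if "f \<in> K" for f
    unfolding d_def using bdd that by (intro cInf_lower) auto
  have "\<exists>f\<in>K. q f < d + 1 / real (Suc k)" for k
  proof -
    have "Inf (q ` K) < d + 1 / real (Suc k)" by (simp add: d_def)
    then show ?thesis using cInf_lessD[of "q ` K"] K(2) by auto
  qed
  then obtain Ys where Ys: "Ys k \<in> K" "q (Ys k) < d + 1 / real (Suc k)" for k by metis
  have Ys_L2: "Ys k \<in> L2 M" for k using Ys(1) K(1) by auto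
  have sq_int: "integrable M (\<lambda>\<omega>. (f \<omega>)\<^sup>2)" if "f \<in> L2 M" for f :: "'a \<Rightarrow> real"
    using that by (simp add: L2_def)
  have par: "(\<integral>\<omega>. (norm (Ys i \<omega> - Ys j \<omega>))\<^sup>2 \<partial>M) \<le> 2 / real (Suc i) + 2 / real (Suc j)" for i j
  proof -
    let ?m = "\<lambda>\<omega>. (1/2) * (Ys i \<omega> + Ys j \<omega>)"
    have m: "?m \<in> K" by (intro scale add Ys)
    then have mL: "?m \<in> L2 M" using K(1) by auto
    \<comment> \<open>The parallelogram identity: the midpoint lies in \<open>K\<close>, hence at
      squared distance at least d from Z, and so a minimising sequence is Cauchy.\<close>
    have "(\<integral>\<omega>. (norm (Ys i \<omega> - Ys j \<omega>))\<^sup>2 \<partial>M)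
      = (\<integral>\<omega>. 2 * (Z \<omega> - Ys i \<omega>)\<^sup>2 + 2 * (Z \<omega> - Ys j \<omega>)\<^sup>2 - 4 * (Z \<omega> - ?m \<omega>)\<^sup>2 \<partial>M)"
      by (intro Bochner_Integration.integral_cong) (auto simp: power2_eq_square field_simps)
    also have "\<dots> = 2 * q (Ys i) + 2 * q (Ys j) - 4 * q ?m"
      unfolding q_def using sq_int[OF L2_diff[OF Z Ys_L2]] sq_int[OF L2_diff[OF Z mL]] by simp
    also have "\<dots> \<le> 2 / real (Suc i) + 2 / real (Suc j)"
      using Ys(2)[of i] Ys(2)[of j] d_le[OF m] by simp
    finally show ?thesis .
  qed
  have "\<exists>Y. tendsto_L2 M Ys Y"
  proof (rule L2_complete[OF Ys_L2])
    fix e :: real assume "e > 0"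
    then obtain N where N: "4 / e < real N" using reals_Archimedean2 by blast
    have "(\<integral>\<omega>. (norm (Ys i \<omega> - Ys j \<omega>))\<^sup>2 \<partial>M) < e" if "i \<ge> N" "j \<ge> N" for i j
    proof -
      have *: "2 / real (Suc k) < e / 2" if "k \<ge> N" for k
        using N that \<open>e > 0\<close> by (simp add: field_simps) (smt (verit) mult_left_mono of_nat_mono)
      show ?thesis using par[of i j] *[OF that(1)] *[OF that(2)] by simp
    qed
    then show "\<exists>N. \<forall>i\<ge>N. \<forall>j\<ge>N. (\<integral>\<omega>. (norm (Ys i \<omega> - Ys j \<omega>))\<^sup>2 \<partial>M) < e" by blast
  qed
  then obtain Y where Y: "tendsto_L2 M Ys Y" by blast
  note Y_L2 = tendsto_L2D(1)[OF Y]
  have q_lim: "(\<lambda>k. q (Ys k)) \<longlonglongrightarrow> d"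
  proof (rule tendsto_sandwich[where f = "\<lambda>_. d" and h = "\<lambda>k. d + 1 / real (Suc k)"])
    show "(\<lambda>k. d + 1 / real (Suc k)) \<longlonglongrightarrow> d"
      using tendsto_add[OF tendsto_const LIMSEQ_inverse_real_of_nat, of d] by (simp add: inverse_eq_divide)
  qed (use d_le[OF Ys(1)] Ys(2) in \<open>auto intro!: always_eventually less_imp_le\<close>)
  have "(\<integral>\<omega>. (Z \<omega> - Y \<omega>) * W \<omega> \<partial>M) = 0" if W: "W \<in> K" for W
  proof -
    have WL: "W \<in> L2 M" using W K(1) by auto
    define c w where "c = (\<integral>\<omega>. (Z \<omega> - Y \<omega>) * W \<omega> \<partial>M)" and "w = (\<integral>\<omega>. (W \<omega>)\<^sup>2 \<partial>M)"
    have lim: "(\<lambda>k. \<integral>\<omega>. (Z \<omega> - Ys k \<omega>) * W \<omega> \<partial>M) \<longlonglongrightarrow> c"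
    proof -
      have "(\<lambda>k. (\<integral>\<omega>. Z \<omega> * W \<omega> \<partial>M) - (\<integral>\<omega>. Ys k \<omega> * W \<omega> \<partial>M)) \<longlonglongrightarrow> (\<integral>\<omega>. Z \<omega> * W \<omega> \<partial>M) - (\<integral>\<omega>. Y \<omega> * W \<omega> \<partial>M)"
        by (intro tendsto_intros tendsto_L2_mult_right Y WL)
      then show ?thesis
        unfolding c_def by (simp add: left_diff_distrib integrable_mult_L2 Z WL Ys_L2 Y_L2)
    qed
    have "0 \<le> t\<^sup>2 * w - 2 * t * c" for t
    proof -
      have "d \<le> q (Ys k) - 2 * t * (\<integral>\<omega>. (Z \<omega> - Ys k \<omega>) * W \<omega> \<partial>M) + t\<^sup>2 * w" for k
      proof -
        have "d \<le> q (\<lambda>\<omega>. Ys k \<omega> + t * W \<omega>)" by (intro d_le add scale Ys W)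
        also have "\<dots> = (\<integral>\<omega>. (Z \<omega> - Ys k \<omega>)\<^sup>2 - 2 * t * ((Z \<omega> - Ys k \<omega>) * W \<omega>) + t\<^sup>2 * (W \<omega>)\<^sup>2 \<partial>M)"
          unfolding q_def by (intro Bochner_Integration.integral_cong) (auto simp: power2_eq_square algebra_simps)
        also have "\<dots> = q (Ys k) - 2 * t * (\<integral>\<omega>. (Z \<omega> - Ys k \<omega>) * W \<omega> \<partial>M) + t\<^sup>2 * w"
          unfolding q_def w_def
          using sq_int[OF L2_diff[OF Z Ys_L2[of k]]] sq_int[OF WL] integrable_mult_L2[OF L2_diff[OF Z Ys_L2[of k]] WL]
          by simp
        finally show ?thesis .
      qed
      moreover have "(\<lambda>k. q (Ys k) - 2 * t * (\<integral>\<omega>. (Z \<omega> - Ys k \<omega>) * W \<omega> \<partial>M) + t\<^sup>2 * w) \<longlonglongrightarrow> d - 2 * t * c + t\<^sup>2 * w"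
        by (intro tendsto_intros q_lim lim)
      ultimately have "d \<le> d - 2 * t * c + t\<^sup>2 * w" by (intro LIMSEQ_le_const) auto
      then show ?thesis by simp
    qed
    \<comment> \<open>The optimal t would be c/w, but w may be 0. With w + 1 in its place the
      quadratic is still -(c/(w + 1))^2 (w + 2), so that c must vanish.\<close>
    from this[of "c / (w + 1)"] have *: "0 \<le> (c / (w + 1))\<^sup>2 * w - 2 * (c / (w + 1)) * c" .
    define v where "v = c / (w + 1)"
    have w: "w \<ge> 0" by (simp add: w_def)
    then have c: "c = v * (w + 1)" by (simp add: v_def)
    have "0 \<le> v\<^sup>2 * w - 2 * v * c" using * by (simp add: v_def)
    also have "\<dots> = - (v\<^sup>2 * (w + 2))" unfolding c by (simp add: algebra_simps power2_eq_square)
    finally have "v\<^sup>2 * (w + 2) \<le> 0" by simp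
    then have "c = 0" using w by (simp add: mult_le_0_iff c)
    then show ?thesis by (simp add: c_def)
  qed
  then show ?thesis using Ys(1) Y by blast
qed

lemma integral_sq_sum_orthogonal:
  fixes Y :: "'i \<Rightarrow> 'a \<Rightarrow> real"
  assumes "finite I" and L2: "\<And>i. i \<in> I \<Longrightarrow> Y i \<in> L2 M"
    and orth: "\<And>i j. i \<in> I \<Longrightarrow> j \<in> I \<Longrightarrow> i \<noteq> j \<Longrightarrow> (\<integral>\<omega>. Y i \<omega> * Y j \<omega> \<partial>M) = 0"
  shows "(\<integral>\<omega>. (\<Sum>i\<in>I. Y i \<omega>)\<^sup>2 \<partial>M) = (\<Sum>i\<in>I. \<integral>\<omega>. (Y i \<omega>)\<^sup>2 \<partial>M)"
  using integral_norm_sq_sum_orthogonal[of I Y M] assms by simp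

text \<open>For the sum S of the projections, E(Z S) = E(S^2) by orthogonality, hence 0 <= E((Z -
  S)^2) = E(Z^2) - E(S^2).\<close>

lemma Bessel_L2:
  fixes Y :: "'i \<Rightarrow> 'a \<Rightarrow> real"
  assumes I: "finite I" and L2: "\<And>i. Y i \<in> L2 M" and Z: "Z \<in> L2 M"
    and orth: "\<And>i j. i \<noteq> j \<Longrightarrow> (\<integral>\<omega>. Y i \<omega> * Y j \<omega> \<partial>M) = 0"
    and proj: "\<And>i. (\<integral>\<omega>. (Z \<omega> - Y i \<omega>) * Y i \<omega> \<partial>M) = 0"
  shows "(\<Sum>i\<in>I. \<integral>\<omega>. (Y i \<omega>)\<^sup>2 \<partial>M) \<le> (\<integral>\<omega>. (Z \<omega>)\<^sup>2 \<partial>M)"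
proof -
  let ?S = "\<lambda>\<omega>. \<Sum>i\<in>I. Y i \<omega>"
  have S: "?S \<in> L2 M" by (intro L2_sum L2)
  have ZY: "(\<integral>\<omega>. Z \<omega> * Y i \<omega> \<partial>M) = (\<integral>\<omega>. (Y i \<omega>)\<^sup>2 \<partial>M)" for i
    using proj[of i] integrable_mult_L2[OF Z L2[of i]] integrable_mult_L2[OF L2 L2, of i i]
    by (simp add: left_diff_distrib power2_eq_square)
  have "(\<integral>\<omega>. Z \<omega> * ?S \<omega> \<partial>M) = (\<Sum>i\<in>I. \<integral>\<omega>. Z \<omega> * Y i \<omega> \<partial>M)"
    by (simp add: sum_distrib_left Bochner_Integration.integral_sum integrable_mult_L2 Z L2)
  then have *: "(\<integral>\<omega>. Z \<omega> * ?S \<omega> \<partial>M) = (\<integral>\<omega>. (?S \<omega>)\<^sup>2 \<partial>M)"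
    using integral_sq_sum_orthogonal[OF I L2 orth] by (simp add: ZY)
  have "0 \<le> (\<integral>\<omega>. (Z \<omega> - ?S \<omega>)\<^sup>2 \<partial>M)" by simp
  also have "\<dots> = (\<integral>\<omega>. (Z \<omega>)\<^sup>2 - 2 * (Z \<omega> * ?S \<omega>) + (?S \<omega>)\<^sup>2 \<partial>M)"
    by (intro Bochner_Integration.integral_cong) (auto simp: power2_eq_square algebra_simps)
  also have "\<dots> = (\<integral>\<omega>. (Z \<omega>)\<^sup>2 \<partial>M) - (\<integral>\<omega>. (?S \<omega>)\<^sup>2 \<partial>M)"
    using integrable_mult_L2[OF Z S] L2_integrable_norm_sq[OF Z] L2_integrable_norm_sq[OF S] * by simp
  finally show ?thesis using integral_sq_sum_orthogonal[OF I L2 orth] by simp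
qed

text \<open>The coefficients are there for two applications: c = 1 gives the chaos expansion of Z,
  and c = -1/m gives the series that defines \<open>L_inv\<close>.\<close>

lemma orthogonal_series_L2:
  fixes Y :: "nat \<Rightarrow> 'a \<Rightarrow> real"
  assumes L2: "\<And>i. Y i \<in> L2 M"
    and orth: "\<And>i j. i \<noteq> j \<Longrightarrow> (\<integral>\<omega>. Y i \<omega> * Y j \<omega> \<partial>M) = 0"
    and summable: "summable (\<lambda>i. \<integral>\<omega>. (Y i \<omega>)\<^sup>2 \<partial>M)"
    and c: "\<And>i. \<bar>c i\<bar> \<le> 1"
  shows "\<exists>f. tendsto_L2 M (\<lambda>N \<omega>. \<Sum>i=1..N. c i * Y i \<omega>) f"
proof (rule L2_complete)
  show "(\<lambda>\<omega>. \<Sum>i = 1..k. c i * Y i \<omega>) \<in> L2 M" for k by (intro L2_sum L2_cmult L2)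
  fix e :: real assume "e > 0"
  define a where "a i = (\<integral>\<omega>. (Y i \<omega>)\<^sup>2 \<partial>M)" for i
  obtain N where N: "\<And>m n. m \<ge> N \<Longrightarrow> norm (sum a {m..<n}) < e"
    using summable \<open>e > 0\<close> unfolding summable_Cauchy a_def by blast
  have half: "(\<integral>\<omega>. (norm ((\<Sum>k=1..i. c k * Y k \<omega>) - (\<Sum>k=1..j. c k * Y k \<omega>)))\<^sup>2 \<partial>M) < e"
    if "N \<le> j" "j \<le> i" for i j
  proof -
    have "(\<Sum>k=1..i. c k * Y k \<omega>) - (\<Sum>k=1..j. c k * Y k \<omega>) = (\<Sum>k\<in>{Suc j..<Suc i}. c k * Y k \<omega>)" for \<omega>
      using \<open>j \<le> i\<close> sum.ub_add_nat[of 1 j "\<lambda>k. c k * Y k \<omega>" "i - j"]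
      by (simp add: atLeastLessThanSuc_atLeastAtMost)
    then have "(\<integral>\<omega>. (norm ((\<Sum>k=1..i. c k * Y k \<omega>) - (\<Sum>k=1..j. c k * Y k \<omega>)))\<^sup>2 \<partial>M)
      = (\<integral>\<omega>. (\<Sum>k\<in>{Suc j..<Suc i}. c k * Y k \<omega>)\<^sup>2 \<partial>M)" by simp
    also have "\<dots> = (\<Sum>k\<in>{Suc j..<Suc i}. \<integral>\<omega>. (c k * Y k \<omega>)\<^sup>2 \<partial>M)"
    proof (rule integral_sq_sum_orthogonal)
      fix m n :: nat assume "m \<noteq> n"
      have "(\<integral>\<omega>. c m * Y m \<omega> * (c n * Y n \<omega>) \<partial>M) = (\<integral>\<omega>. (c m * c n) * (Y m \<omega> * Y n \<omega>) \<partial>M)"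
        by (simp add: algebra_simps)
      then show "(\<integral>\<omega>. c m * Y m \<omega> * (c n * Y n \<omega>) \<partial>M) = 0"
        using orth[OF \<open>m \<noteq> n\<close>] by simp
    qed (auto intro: L2_cmult L2)
    also have "\<dots> \<le> sum a {Suc j..<Suc i}"
    proof (rule sum_mono)
      fix k
      have "(\<integral>\<omega>. (c k * Y k \<omega>)\<^sup>2 \<partial>M) = (c k)\<^sup>2 * a k" by (simp add: a_def power_mult_distrib)
      also have "\<dots> \<le> 1 * a k"
        using c[of k] by (intro mult_right_mono) (auto simp: a_def abs_square_le_1)
      finally show "(\<integral>\<omega>. (c k * Y k \<omega>)\<^sup>2 \<partial>M) \<le> a k" by simp
    qed
    also have "\<dots> < e" using N[of "Suc j" "Suc i"] \<open>N \<le> j\<close> by (simp add: abs_less_iff)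
    finally show ?thesis .
  qed
  have "(\<integral>\<omega>. (norm ((\<Sum>k=1..i. c k * Y k \<omega>) - (\<Sum>k=1..j. c k * Y k \<omega>)))\<^sup>2 \<partial>M) < e"
    if "N \<le> i" "N \<le> j" for i j
  proof (cases "j \<le> i")
    case False
    then show ?thesis using half[of i j] that by (subst norm_minus_commute) auto
  qed (use half that in auto)
  then show "\<exists>N. \<forall>i\<ge>N. \<forall>j\<ge>N. (\<integral>\<omega>. (norm ((\<Sum>k=1..i. c k * Y k \<omega>) - (\<Sum>k=1..j. c k * Y k \<omega>)))\<^sup>2 \<partial>M) < e" by blast
qed

end

section \<open>Fourier uniqueness\<close>

text \<open>Since \<open>ennreal\<close> sends negative numbers to 0, the densities \<open>U\<close>
  and \<open>- U\<close> give the positive and the negative part. A signed measure is thus handled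
  as a pair of measures, and two such parts being equal on B means that the signed measure vanishes
  there.\<close>

lemma emeasure_distr_density_real:
  assumes U: "integrable M U" and [measurable]: "T \<in> measurable M N" "B \<in> sets N"
  shows "emeasure (distr (density M (\<lambda>\<omega>. ennreal (U \<omega>))) N T) B
    = ennreal (\<integral>\<omega>. max 0 (U \<omega>) * indicator B (T \<omega>) \<partial>M)"
proof -
  have [measurable]: "U \<in> borel_measurable M" using U by auto
  have int: "integrable M (\<lambda>\<omega>. max 0 (U \<omega>) * indicator B (T \<omega>))"
    by (rule Bochner_Integration.integrable_bound[OF U]) (auto simp: indicator_def)
  have "emeasure (distr (density M (\<lambda>\<omega>. ennreal (U \<omega>))) N T) B
      = (\<integral>\<^sup>+\<omega>. ennreal (U \<omega>) * indicator (T -` B \<inter> space M) \<omega> \<partial>M)"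
    by (simp add: emeasure_distr emeasure_density)
  also have "\<dots> = (\<integral>\<^sup>+\<omega>. ennreal (max 0 (U \<omega>) * indicator B (T \<omega>)) \<partial>M)"
    by (intro nn_integral_cong) (auto simp: indicator_def max_def ennreal_neg)
  also have "\<dots> = ennreal (\<integral>\<omega>. max 0 (U \<omega>) * indicator B (T \<omega>) \<partial>M)"
    by (intro nn_integral_eq_integral int) auto
  finally show ?thesis .
qed

lemma emeasure_distr_density_real_eq_iff:
  assumes U: "integrable M U" and [measurable]: "T \<in> measurable M N" "B \<in> sets N"
  shows "emeasure (distr (density M (\<lambda>\<omega>. ennreal (U \<omega>))) N T) B
      = emeasure (distr (density M (\<lambda>\<omega>. ennreal (- U \<omega>))) N T) B
    \<longleftrightarrow> (\<integral>\<omega>. U \<omega> * indicator B (T \<omega>) \<partial>M) = 0"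
proof -
  have [measurable]: "U \<in> borel_measurable M" using U by auto
  have int: "integrable M (\<lambda>\<omega>. max 0 (U \<omega>) * indicator B (T \<omega>))"
    "integrable M (\<lambda>\<omega>. max 0 (- U \<omega>) * indicator B (T \<omega>))"
    by (rule Bochner_Integration.integrable_bound[OF U]; auto simp: indicator_def)+
  have "(\<integral>\<omega>. U \<omega> * indicator B (T \<omega>) \<partial>M)
    = (\<integral>\<omega>. max 0 (U \<omega>) * indicator B (T \<omega>) - max 0 (- U \<omega>) * indicator B (T \<omega>) \<partial>M)"
    by (intro Bochner_Integration.integral_cong) (auto simp: max_def indicator_def)
  also have "\<dots> = (\<integral>\<omega>. max 0 (U \<omega>) * indicator B (T \<omega>) \<partial>M) - (\<integral>\<omega>. max 0 (- U \<omega>) * indicator B (T \<omega>) \<partial>M)"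
    by (intro Bochner_Integration.integral_diff int)
  finally have "(\<integral>\<omega>. U \<omega> * indicator B (T \<omega>) \<partial>M) = 0 \<longleftrightarrow>
    (\<integral>\<omega>. max 0 (U \<omega>) * indicator B (T \<omega>) \<partial>M) = (\<integral>\<omega>. max 0 (- U \<omega>) * indicator B (T \<omega>) \<partial>M)" by simp
  then show ?thesis
    using U by (simp add: emeasure_distr_density_real)
qed

lemma integrable_mult_bounded:
  fixes U b :: "'a \<Rightarrow> real"
  assumes "integrable M U" and [measurable]: "b \<in> borel_measurable M" and "\<And>\<omega>. \<bar>b \<omega>\<bar> \<le> C"
  shows "integrable M (\<lambda>\<omega>. U \<omega> * b \<omega>)"
proof -
  have [measurable]: "U \<in> borel_measurable M" using assms by auto
  have "\<bar>b \<omega>\<bar> \<le> \<bar>C\<bar>" for \<omega> using assms(3)[of \<omega>] by linarith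
  then have "\<bar>U \<omega> * b \<omega>\<bar> \<le> \<bar>U \<omega> * C\<bar>" for \<omega>
    by (auto simp: abs_mult intro: mult_left_mono)
  then show ?thesis
    by (intro Bochner_Integration.integrable_bound[where f = "\<lambda>\<omega>. U \<omega> * C" and g = "\<lambda>\<omega>. U \<omega> * b \<omega>"])
      (use assms(1) in auto)
qed

text \<open>Uniqueness of the Fourier transform for the signed image measure of V under Y: its
  positive and negative parts, normalised to probability laws, have the same characteristic function
  and coincide by Levy's theorem.\<close>

lemma (in prob_space) fourier_zero_imp:
  fixes V Y :: "'a \<Rightarrow> real"
  assumes V: "integrable M V" and [measurable]: "Y \<in> borel_measurable M"
    and cos0: "\<And>t. (\<integral>\<omega>. V \<omega> * cos (t * Y \<omega>) \<partial>M) = 0"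
    and sin0: "\<And>t. (\<integral>\<omega>. V \<omega> * sin (t * Y \<omega>) \<partial>M) = 0"
    and [measurable]: "A \<in> sets borel"
  shows "(\<integral>\<omega>. V \<omega> * indicator A (Y \<omega>) \<partial>M) = 0"
proof -
  have [measurable]: "V \<in> borel_measurable M" using V by auto
  have V': "integrable M (\<lambda>\<omega>. max 0 (V \<omega>))" "integrable M (\<lambda>\<omega>. max 0 (- V \<omega>))"
    by (rule Bochner_Integration.integrable_bound[OF V]; auto)+
  define c where "c = (\<integral>\<omega>. max 0 (V \<omega>) \<partial>M)"
  \<comment> \<open>The frequency t = 0 says that both parts have the same total mass, so that one
    constant normalises both.\<close>
  have c': "c = (\<integral>\<omega>. max 0 (- V \<omega>) \<partial>M)"
  proof -
    have "c - (\<integral>\<omega>. max 0 (- V \<omega>) \<partial>M) = (\<integral>\<omega>. max 0 (V \<omega>) - max 0 (- V \<omega>) \<partial>M)"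
      unfolding c_def using V' by simp
    also have "\<dots> = (\<integral>\<omega>. V \<omega> * cos (0 * Y \<omega>) \<partial>M)"
      by (intro Bochner_Integration.integral_cong) auto
    finally show ?thesis using cos0[of 0] by simp
  qed
  show ?thesis
  proof (cases "c = 0")
    case True
    have "AE \<omega> in M. max 0 (V \<omega>) = 0" "AE \<omega> in M. max 0 (- V \<omega>) = 0"
      using True c' V' integral_nonneg_eq_0_iff_AE[of M "\<lambda>\<omega>. max 0 (V \<omega>)"]
        integral_nonneg_eq_0_iff_AE[of M "\<lambda>\<omega>. max 0 (- V \<omega>)"]
      by (auto simp: c_def)
    then have "AE \<omega> in M. V \<omega> * indicator A (Y \<omega>) = 0" by eventually_elim auto
    then show ?thesis by (rule integral_eq_zero_AE)
  next
    case False
    have "c \<ge> 0" by (auto simp: c_def)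
    then have "c > 0" using False by simp
    define W where "W \<omega> = V \<omega> / c" for \<omega>
    have W: "integrable M W" using V by (simp add: W_def[abs_def])
    then have W_neg: "integrable M (\<lambda>\<omega>. - W \<omega>)" by simp
    have [measurable]: "W \<in> borel_measurable M" using W by auto
    define Mp Mm where "Mp = distr (density M (\<lambda>\<omega>. ennreal (W \<omega>))) borel Y"
      and "Mm = distr (density M (\<lambda>\<omega>. ennreal (- W \<omega>))) borel Y"
    have mx: "max 0 (W \<omega>) = max 0 (V \<omega>) / c" "max 0 (- W \<omega>) = max 0 (- V \<omega>) / c" for \<omega>
      using \<open>c > 0\<close> by (auto simp: W_def max_def field_simps divide_le_0_iff zero_le_divide_iff)
    have "emeasure Mp UNIV = 1" "emeasure Mm UNIV = 1"
      unfolding Mp_def Mm_def using \<open>c > 0\<close>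
      by (subst emeasure_distr_density_real; simp add: W mx flip: c_def c')+
    then have rd: "real_distribution Mp" "real_distribution Mm"
      by (auto intro!: prob_spaceI simp: real_distribution_def real_distribution_axioms_def Mp_def Mm_def)
    have "char Mp = char Mm"
    proof
      fix t
      have p: "char Mp t = (\<integral>\<omega>. max 0 (W \<omega>) *\<^sub>R iexp (t * Y \<omega>) \<partial>M)"
      proof -
        have "density M (\<lambda>\<omega>. ennreal (W \<omega>)) = density M (\<lambda>\<omega>. ennreal (max 0 (W \<omega>)))"
          by (intro density_cong) (auto simp: max_def ennreal_neg)
        then have "char Mp t = (CLINT x|distr (density M (\<lambda>\<omega>. ennreal (max 0 (W \<omega>)))) borel Y. iexp (t * x))"
          unfolding char_def Mp_def by (simp only:)
        also have "\<dots> = (\<integral>\<omega>. max 0 (W \<omega>) *\<^sub>R iexp (t * Y \<omega>) \<partial>M)"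
          by (subst integral_distr, simp, simp, subst integral_density) auto
        finally show ?thesis .
      qed
      have m: "char Mm t = (\<integral>\<omega>. max 0 (- W \<omega>) *\<^sub>R iexp (t * Y \<omega>) \<partial>M)"
      proof -
        have "density M (\<lambda>\<omega>. ennreal (- W \<omega>)) = density M (\<lambda>\<omega>. ennreal (max 0 (- W \<omega>)))"
          by (intro density_cong) (auto simp: max_def ennreal_neg)
        then have "char Mm t = (CLINT x|distr (density M (\<lambda>\<omega>. ennreal (max 0 (- W \<omega>)))) borel Y. iexp (t * x))"
          unfolding char_def Mm_def by (simp only:)
        also have "\<dots> = (\<integral>\<omega>. max 0 (- W \<omega>) *\<^sub>R iexp (t * Y \<omega>) \<partial>M)"
          by (subst integral_distr, simp, simp, subst integral_density) auto
        finally show ?thesis .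
      qed
      have ip: "integrable M (\<lambda>\<omega>. max 0 (W \<omega>) *\<^sub>R iexp (t * Y \<omega>))"
        "integrable M (\<lambda>\<omega>. max 0 (- W \<omega>) *\<^sub>R iexp (t * Y \<omega>))"
        "integrable M (\<lambda>\<omega>. W \<omega> *\<^sub>R iexp (t * Y \<omega>))"
        by (rule Bochner_Integration.integrable_bound[OF W]; auto)+
      have "char Mp t - char Mm t = (\<integral>\<omega>. max 0 (W \<omega>) *\<^sub>R iexp (t * Y \<omega>) - max 0 (- W \<omega>) *\<^sub>R iexp (t * Y \<omega>) \<partial>M)"
        unfolding p m using ip by simp
      also have "\<dots> = (\<integral>\<omega>. W \<omega> *\<^sub>R iexp (t * Y \<omega>) \<partial>M)"
        by (intro Bochner_Integration.integral_cong) (auto simp: max_def)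
      also have "\<dots> = 0"
      proof (rule complex_eqI)
        have "Re (\<integral>\<omega>. W \<omega> *\<^sub>R iexp (t * Y \<omega>) \<partial>M) = (\<integral>\<omega>. Re (W \<omega> *\<^sub>R iexp (t * Y \<omega>)) \<partial>M)"
          by (rule integral_Re[symmetric, OF ip(3)])
        also have "\<dots> = (\<integral>\<omega>. V \<omega> * cos (t * Y \<omega>) \<partial>M) / c"
          by (simp add: W_def Re_exp)
        finally show "Re (\<integral>\<omega>. W \<omega> *\<^sub>R iexp (t * Y \<omega>) \<partial>M) = Re 0" using cos0 by simp
        have "Im (\<integral>\<omega>. W \<omega> *\<^sub>R iexp (t * Y \<omega>) \<partial>M) = (\<integral>\<omega>. Im (W \<omega> *\<^sub>R iexp (t * Y \<omega>)) \<partial>M)"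
          by (rule integral_Im[symmetric, OF ip(3)])
        also have "\<dots> = (\<integral>\<omega>. V \<omega> * sin (t * Y \<omega>) \<partial>M) / c"
          by (simp add: W_def Im_exp)
        finally show "Im (\<integral>\<omega>. W \<omega> *\<^sub>R iexp (t * Y \<omega>) \<partial>M) = Im 0" using sin0 by simp
      qed
      finally show "char Mp t = char Mm t" by simp
    qed
    then have "Mp = Mm" by (intro Levy_uniqueness rd)
    then have "(\<integral>\<omega>. W \<omega> * indicator A (Y \<omega>) \<partial>M) = 0"
      by (subst emeasure_distr_density_real_eq_iff[symmetric, OF W, of Y borel])
        (simp_all add: Mp_def Mm_def)
    then show ?thesis using \<open>c > 0\<close> by (simp add: W_def)
  qed
qed

section \<open>Isonormal Gaussian processes\<close>

context isonormal_gaussian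
begin

lemma X_measurable [measurable]: "X h \<in> borel_measurable M"
  using jointly_gaussian[of "{h}" "\<lambda>_. 1"] by (simp add: centered_gaussian_def)

text \<open>The second moment identifies the unknown parameter of the Gaussian law as the norm of h,
  and rules out the degenerate law.\<close>

lemma distributed_X:
  assumes "h \<noteq> 0"
  shows "distributed M lborel (X h) (\<lambda>x. ennreal (normal_density 0 (norm h) x))"
proof -
  have cov: "expectation (\<lambda>\<omega>. (X h \<omega>)\<^sup>2) = (norm h)\<^sup>2"
    using covariance[of h h] by (simp add: power2_eq_square power2_norm_eq_inner[symmetric] flip: power2_eq_square)
  from jointly_gaussian[of "{h}" "\<lambda>_. 1"]
  consider "AE \<omega> in M. X h \<omega> = 0" | s where "s > 0" "distributed M lborel (X h) (\<lambda>x. ennreal (normal_density 0 s x))"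
    by (auto simp: centered_gaussian_def)
  then show ?thesis
  proof cases
    case 1
    then have "AE \<omega> in M. (X h \<omega>)\<^sup>2 = 0" by eventually_elim auto
    then have "expectation (\<lambda>\<omega>. (X h \<omega>)\<^sup>2) = 0" by (rule integral_eq_zero_AE)
    with cov assms show ?thesis by simp
  next
    case 2
    have "variance (X h) = s\<^sup>2" by (rule normal_distributed_variance[OF 2])
    moreover have "expectation (X h) = 0" by (rule normal_distributed_expectation[OF 2])
    ultimately have "s\<^sup>2 = (norm h)\<^sup>2" using cov by simp
    then have "s = norm h" using \<open>s > 0\<close> by simp
    then show ?thesis using 2 by simp
  qed
qed

lemma X_zero: "AE \<omega> in M. X 0 \<omega> = 0"
proof -
  have cov: "expectation (\<lambda>\<omega>. (X 0 \<omega>)\<^sup>2) = 0"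
    using covariance[of 0 0] by (simp add: power2_eq_square)
  from jointly_gaussian[of "{0}" "\<lambda>_. 1"]
  consider "AE \<omega> in M. X 0 \<omega> = 0" | s where "s > 0" "distributed M lborel (X 0) (\<lambda>x. ennreal (normal_density 0 s x))"
    by (auto simp: centered_gaussian_def)
  then show ?thesis
  proof cases
    case 2
    have "variance (X 0) = s\<^sup>2" by (rule normal_distributed_variance[OF 2])
    moreover have "expectation (X 0) = 0" by (rule normal_distributed_expectation[OF 2])
    ultimately show ?thesis using cov \<open>s > 0\<close> by simp
  qed
qed

lemma X_abs_moments: "integrable M (\<lambda>\<omega>. \<bar>X h \<omega>\<bar> ^ p)"
proof (cases "h = 0")
  case True
  have "AE \<omega> in M. \<bar>X h \<omega>\<bar> ^ p = 0 ^ p"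
    using X_zero unfolding True by eventually_elim auto
  then show ?thesis by (subst integrable_cong_AE[where g = "\<lambda>_. 0 ^ p"]) auto
next
  case False
  have "integrable lborel (\<lambda>x. normal_density 0 (norm h) x * \<bar>x\<bar> ^ p)"
    using integrable_normal_moment_abs[of "norm h" 0 p] False by simp
  then show ?thesis
    by (subst (asm) distributed_integrable[OF distributed_X[OF False]]) auto
qed

lemma X_L2: "X h \<in> L2 M"
  using X_abs_moments[of h 2] by (simp add: L2_def)

lemma integrable_X_mult_X: "integrable M (\<lambda>\<omega>. X h \<omega> * X k \<omega>)"
  by (intro integrable_mult_L2 X_L2)

text \<open>Linearity of X is a consequence of the covariance: the second moment of the difference
  expands into inner products that cancel.\<close>

lemma X_linear: "AE \<omega> in M. X (a *\<^sub>R h + b *\<^sub>R k) \<omega> = a * X h \<omega> + b * X k \<omega>"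
proof -
  let ?l = "a *\<^sub>R h + b *\<^sub>R k"
  note [simp] = integrable_X_mult_X covariance
  have D: "(\<lambda>\<omega>. X ?l \<omega> - a * X h \<omega> - b * X k \<omega>) \<in> L2 M"
    by (intro L2_diff L2_cmult X_L2)
  have "(\<integral>\<omega>. (X ?l \<omega> - a * X h \<omega> - b * X k \<omega>)\<^sup>2 \<partial>M)
     = (\<integral>\<omega>. X ?l \<omega> * X ?l \<omega> + a\<^sup>2 * (X h \<omega> * X h \<omega>) + b\<^sup>2 * (X k \<omega> * X k \<omega>)
         - 2 * a * (X ?l \<omega> * X h \<omega>) - 2 * b * (X ?l \<omega> * X k \<omega>) + 2 * a * b * (X h \<omega> * X k \<omega>) \<partial>M)"
    by (intro Bochner_Integration.integral_cong) (auto simp: power2_eq_square algebra_simps)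
  also have "\<dots> = ?l \<bullet> ?l + a\<^sup>2 * (h \<bullet> h) + b\<^sup>2 * (k \<bullet> k) - 2 * a * (?l \<bullet> h) - 2 * b * (?l \<bullet> k) + 2 * a * b * (h \<bullet> k)"
    by simp
  also have "\<dots> = 0"
    by (simp add: inner_add_left inner_add_right power2_eq_square algebra_simps inner_commute)
  finally have "AE \<omega> in M. (X ?l \<omega> - a * X h \<omega> - b * X k \<omega>)\<^sup>2 = 0"
    using D by (subst (asm) integral_nonneg_eq_0_iff_AE) (auto simp: L2_def)
  then show ?thesis by eventually_elim auto
qed

lemma X_add_scale: "AE \<omega> in M. X (h + t *\<^sub>R k) \<omega> = X h \<omega> + t * X k \<omega>"
  using X_linear[of 1 h t k] by simp

lemma X_diff_scale: "AE \<omega> in M. X (h - t *\<^sub>R k) \<omega> = X h \<omega> - t * X k \<omega>"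
  using X_linear[of 1 h "-t" k] by simp

lemma X_scale: "AE \<omega> in M. X (t *\<^sub>R k) \<omega> = t * X k \<omega>"
  using X_linear[of 0 0 t k] by simp

section \<open>Characteristic functions and totality of the trigonometric variables\<close>

lemma expectation_cos_sin_X:
  "expectation (\<lambda>\<omega>. cos (X h \<omega>)) = exp (- (norm h)\<^sup>2 / 2)"
  "expectation (\<lambda>\<omega>. sin (X h \<omega>)) = 0"
proof -
  have "expectation (\<lambda>\<omega>. cos (X h \<omega>)) = exp (- (norm h)\<^sup>2 / 2) \<and> expectation (\<lambda>\<omega>. sin (X h \<omega>)) = 0"
  proof (cases "h = 0")
    case True
    have "expectation (\<lambda>\<omega>. cos (X h \<omega>)) = expectation (\<lambda>\<omega>. 1)"
      by (rule integral_cong_AE) (use X_zero True in auto)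
    moreover have "expectation (\<lambda>\<omega>. sin (X h \<omega>)) = expectation (\<lambda>\<omega>. 0)"
      by (rule integral_cong_AE) (use X_zero True in auto)
    ultimately
    show ?thesis using True by (simp add: prob_space)
  next
    case False
    have "distributed M lborel (\<lambda>\<omega>. 0 + (1 / norm h) * X h \<omega>) (normal_density (0 + (1 / norm h) * 0) (\<bar>1 / norm h\<bar> * norm h))"
      by (rule normal_density_affine[OF distributed_X[OF False]]) (use False in auto)
    then have D: "distributed M lborel (\<lambda>\<omega>. X h \<omega> / norm h) (\<lambda>x. ennreal (std_normal_density x))"
      using False by simp
    let ?f = "\<lambda>x. iexp (norm h * x)"
    have "(\<integral>\<omega>. iexp (X h \<omega>) \<partial>M) = (\<integral>\<omega>. ?f (X h \<omega> / norm h) \<partial>M)"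
      using False by simp
    also have "\<dots> = (\<integral>x. std_normal_density x *\<^sub>R ?f x \<partial>lborel)"
    proof -
      have "(\<integral>\<omega>. ?f (X h \<omega> / norm h) \<partial>M) = integral\<^sup>L (distr M lborel (\<lambda>\<omega>. X h \<omega> / norm h)) ?f"
        by (subst integral_distr) auto
      also have "distr M lborel (\<lambda>\<omega>. X h \<omega> / norm h) = density lborel (\<lambda>x. ennreal (std_normal_density x))"
        by (rule distributed_distr_eq_density[OF D])
      also have "integral\<^sup>L (density lborel (\<lambda>x. ennreal (std_normal_density x))) ?f = (\<integral>x. std_normal_density x *\<^sub>R ?f x \<partial>lborel)"
        by (subst integral_density) auto
      finally show ?thesis .
    qed
    also have "\<dots> = char std_normal_distribution (norm h)"
      unfolding char_def by (subst integral_density) auto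
    also have "\<dots> = complex_of_real (exp (- (norm h)\<^sup>2 / 2))" by (simp add: char_std_normal_distribution)
    finally have *: "(\<integral>\<omega>. iexp (X h \<omega>) \<partial>M) = complex_of_real (exp (- (norm h)\<^sup>2 / 2))" .
    have "integrable M (\<lambda>\<omega>. iexp (X h \<omega>))" by (rule integrable_const_bound[where B = 1]) auto
    from integral_Re[OF this] integral_Im[OF this] show ?thesis unfolding * by (simp add: Re_exp Im_exp)
  qed
  then show "expectation (\<lambda>\<omega>. cos (X h \<omega>)) = exp (- (norm h)\<^sup>2 / 2)" "expectation (\<lambda>\<omega>. sin (X h \<omega>)) = 0" by auto
qed

text \<open>By linearity of X, multiplying with a trigonometric function of t X(l) only shifts the
  argument k by t l and -t l. Orthogonality to all trigonometric variables is therefore stable under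
  such multiplications, which allows one coordinate after another to be treated by
  \<open>fourier_zero_imp\<close>.\<close>

lemma trig_products:
  assumes V: "integrable M V"
  shows "(\<integral>\<omega>. V \<omega> * cos (X k \<omega>) * cos (t * X l \<omega>) \<partial>M)
      = ((\<integral>\<omega>. V \<omega> * cos (X (k - t *\<^sub>R l) \<omega>) \<partial>M) + (\<integral>\<omega>. V \<omega> * cos (X (k + t *\<^sub>R l) \<omega>) \<partial>M)) / 2"
    and "(\<integral>\<omega>. V \<omega> * cos (X k \<omega>) * sin (t * X l \<omega>) \<partial>M)
      = ((\<integral>\<omega>. V \<omega> * sin (X (k + t *\<^sub>R l) \<omega>) \<partial>M) - (\<integral>\<omega>. V \<omega> * sin (X (k - t *\<^sub>R l) \<omega>) \<partial>M)) / 2"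
    and "(\<integral>\<omega>. V \<omega> * sin (X k \<omega>) * cos (t * X l \<omega>) \<partial>M)
      = ((\<integral>\<omega>. V \<omega> * sin (X (k + t *\<^sub>R l) \<omega>) \<partial>M) + (\<integral>\<omega>. V \<omega> * sin (X (k - t *\<^sub>R l) \<omega>) \<partial>M)) / 2"
    and "(\<integral>\<omega>. V \<omega> * sin (X k \<omega>) * sin (t * X l \<omega>) \<partial>M)
      = ((\<integral>\<omega>. V \<omega> * cos (X (k - t *\<^sub>R l) \<omega>) \<partial>M) - (\<integral>\<omega>. V \<omega> * cos (X (k + t *\<^sub>R l) \<omega>) \<partial>M)) / 2"
proof -
  have [measurable]: "V \<in> borel_measurable M" using V by auto
  have i: "integrable M (\<lambda>\<omega>. V \<omega> * cos (X h \<omega>))" "integrable M (\<lambda>\<omega>. V \<omega> * sin (X h \<omega>))" for h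
    by (rule integrable_mult_bounded[OF V, where C = 1]; simp)+
  note ae = X_diff_scale[of k t l] X_add_scale[of k t l]
  have "(\<integral>\<omega>. V \<omega> * cos (X k \<omega>) * cos (t * X l \<omega>) \<partial>M)
      = (\<integral>\<omega>. (V \<omega> * cos (X (k - t *\<^sub>R l) \<omega>) + V \<omega> * cos (X (k + t *\<^sub>R l) \<omega>)) / 2 \<partial>M)"
    by (rule integral_cong_AE, measurable, use ae in eventually_elim) (simp add: mult.assoc cos_times_cos distrib_left right_diff_distrib)
  then show "(\<integral>\<omega>. V \<omega> * cos (X k \<omega>) * cos (t * X l \<omega>) \<partial>M)
      = ((\<integral>\<omega>. V \<omega> * cos (X (k - t *\<^sub>R l) \<omega>) \<partial>M) + (\<integral>\<omega>. V \<omega> * cos (X (k + t *\<^sub>R l) \<omega>) \<partial>M)) / 2"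
    using i by simp
  have "(\<integral>\<omega>. V \<omega> * cos (X k \<omega>) * sin (t * X l \<omega>) \<partial>M)
      = (\<integral>\<omega>. (V \<omega> * sin (X (k + t *\<^sub>R l) \<omega>) - V \<omega> * sin (X (k - t *\<^sub>R l) \<omega>)) / 2 \<partial>M)"
    by (rule integral_cong_AE, measurable, use ae in eventually_elim) (simp add: mult.assoc cos_times_sin distrib_left right_diff_distrib)
  then show "(\<integral>\<omega>. V \<omega> * cos (X k \<omega>) * sin (t * X l \<omega>) \<partial>M)
      = ((\<integral>\<omega>. V \<omega> * sin (X (k + t *\<^sub>R l) \<omega>) \<partial>M) - (\<integral>\<omega>. V \<omega> * sin (X (k - t *\<^sub>R l) \<omega>) \<partial>M)) / 2"
    using i by simp
  have "(\<integral>\<omega>. V \<omega> * sin (X k \<omega>) * cos (t * X l \<omega>) \<partial>M)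
      = (\<integral>\<omega>. (V \<omega> * sin (X (k + t *\<^sub>R l) \<omega>) + V \<omega> * sin (X (k - t *\<^sub>R l) \<omega>)) / 2 \<partial>M)"
    by (rule integral_cong_AE, measurable, use ae in eventually_elim) (simp add: mult.assoc sin_times_cos distrib_left right_diff_distrib)
  then show "(\<integral>\<omega>. V \<omega> * sin (X k \<omega>) * cos (t * X l \<omega>) \<partial>M)
      = ((\<integral>\<omega>. V \<omega> * sin (X (k + t *\<^sub>R l) \<omega>) \<partial>M) + (\<integral>\<omega>. V \<omega> * sin (X (k - t *\<^sub>R l) \<omega>) \<partial>M)) / 2"
    using i by simp
  have "(\<integral>\<omega>. V \<omega> * sin (X k \<omega>) * sin (t * X l \<omega>) \<partial>M)
      = (\<integral>\<omega>. (V \<omega> * cos (X (k - t *\<^sub>R l) \<omega>) - V \<omega> * cos (X (k + t *\<^sub>R l) \<omega>)) / 2 \<partial>M)"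
    by (rule integral_cong_AE, measurable, use ae in eventually_elim) (simp add: mult.assoc sin_times_sin distrib_left right_diff_distrib)
  then show "(\<integral>\<omega>. V \<omega> * sin (X k \<omega>) * sin (t * X l \<omega>) \<partial>M)
      = ((\<integral>\<omega>. V \<omega> * cos (X (k - t *\<^sub>R l) \<omega>) \<partial>M) - (\<integral>\<omega>. V \<omega> * cos (X (k + t *\<^sub>R l) \<omega>) \<partial>M)) / 2"
    using i by simp
qed

text \<open>One coordinate at a time, orthogonality to trigonometric functions is converted into
  orthogonality to indicators. This reaches the finite-dimensional cylinders, and these determine a
  finite measure on the infinite product.\<close>

lemma fourier_zero_family:
  fixes \<phi> :: "'i \<Rightarrow> 'h"
  assumes U: "integrable M U"
    and cos0: "\<And>k. k \<in> span (range \<phi>) \<Longrightarrow> (\<integral>\<omega>. U \<omega> * cos (X k \<omega>) \<partial>M) = 0"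
    and sin0: "\<And>k. k \<in> span (range \<phi>) \<Longrightarrow> (\<integral>\<omega>. U \<omega> * sin (X k \<omega>) \<partial>M) = 0"
    and B: "B \<in> sets (Pi\<^sub>M UNIV (\<lambda>_::'i. borel))"
  shows "(\<integral>\<omega>. U \<omega> * indicator B (\<lambda>i. X (\<phi> i) \<omega>) \<partial>M) = 0"
proof -
  have [measurable]: "U \<in> borel_measurable M" using U by auto
  let ?T = "\<lambda>\<omega> i. X (\<phi> i) \<omega>"
  have T[measurable]: "?T \<in> measurable M (Pi\<^sub>M UNIV (\<lambda>_. borel))"
    by (rule measurable_PiM_single') auto
  \<comment> \<open>The trigonometric factor stays in the induction statement, because inserting a
    coordinate j uses the hypothesis at k + t \<phi>(j) and k - t \<phi>(j) for all t.\<close>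
  have step: "(\<forall>k\<in>span (range \<phi>). (\<integral>\<omega>. U \<omega> * (\<Prod>j\<in>J. indicator (A j) (X (\<phi> j) \<omega>)) * cos (X k \<omega>) \<partial>M) = 0
        \<and> (\<integral>\<omega>. U \<omega> * (\<Prod>j\<in>J. indicator (A j) (X (\<phi> j) \<omega>)) * sin (X k \<omega>) \<partial>M) = 0)"
    if "finite J" "\<And>j. j \<in> J \<Longrightarrow> A j \<in> sets borel" for J and A :: "'i \<Rightarrow> real set"
    using that
  proof (induction J)
    case empty
    then show ?case using cos0 sin0 by simp
  next
    case (insert j J)
    note [measurable] = insert.prems
    define V where "V \<omega> = U \<omega> * (\<Prod>j\<in>J. indicator (A j) (X (\<phi> j) \<omega>))" for \<omega>
    have "0 \<le> (\<Prod>j\<in>J. indicator (A j) (X (\<phi> j) \<omega>) :: real)" "(\<Prod>j\<in>J. indicator (A j) (X (\<phi> j) \<omega>) :: real) \<le> 1" for \<omega>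
      by (auto intro!: prod_nonneg prod_le_1 simp: indicator_def)
    then have V: "integrable M V" unfolding V_def
      by (intro integrable_mult_bounded[OF U, where C = 1]) (auto intro!: borel_measurable_prod insert.prems borel_measurable_indicator' simp: abs_le_iff intro: order_trans[of _ 0])
    have [measurable]: "V \<in> borel_measurable M" using V by auto
    have IH: "(\<integral>\<omega>. V \<omega> * cos (X k \<omega>) \<partial>M) = 0" "(\<integral>\<omega>. V \<omega> * sin (X k \<omega>) \<partial>M) = 0"
      if "k \<in> span (range \<phi>)" for k
      using insert.IH insert.prems that by (auto simp: V_def)
    have "(\<integral>\<omega>. V \<omega> * cos (X k \<omega>) * indicator (A j) (X (\<phi> j) \<omega>) \<partial>M) = 0
        \<and> (\<integral>\<omega>. V \<omega> * sin (X k \<omega>) * indicator (A j) (X (\<phi> j) \<omega>) \<partial>M) = 0"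
      if k: "k \<in> span (range \<phi>)" for k
    proof -
      have s: "k - t *\<^sub>R \<phi> j \<in> span (range \<phi>)" "k + t *\<^sub>R \<phi> j \<in> span (range \<phi>)" for t
        using k span_scale[OF span_base[OF rangeI[of \<phi> j]], of t] by (simp_all add: span_diff span_add)
      have i: "integrable M (\<lambda>\<omega>. V \<omega> * cos (X k \<omega>))" "integrable M (\<lambda>\<omega>. V \<omega> * sin (X k \<omega>))"
        by (rule integrable_mult_bounded[OF V, where C = 1]; simp)+
      show ?thesis
        by (intro conjI fourier_zero_imp i)
          (use insert.prems in \<open>auto simp: trig_products[OF V] IH s\<close>)
    qed
    then show ?case
      using insert.hyps by (auto simp: V_def mult_ac)
  qed
  let ?P = "distr (density M (\<lambda>\<omega>. ennreal (U \<omega>))) (Pi\<^sub>M UNIV (\<lambda>_. borel)) ?T"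
  let ?Q = "distr (density M (\<lambda>\<omega>. ennreal (- U \<omega>))) (Pi\<^sub>M UNIV (\<lambda>_. borel)) ?T"
  have "?P = ?Q"
  proof (rule measure_eqI_PiM_infinite)
    fix A :: "'i \<Rightarrow> real set" and J :: "'i set"
    assume J: "finite J" "\<And>i. i \<in> J \<Longrightarrow> A i \<in> sets borel"
    let ?E = "prod_emb UNIV (\<lambda>_::'i. borel) J (Pi\<^sub>E J A)"
    have E: "?E \<in> sets (Pi\<^sub>M UNIV (\<lambda>_. borel))"
      using J by (intro sets_PiM_I) auto
    have ind: "indicator ?E (?T \<omega>) = (\<Prod>j\<in>J. indicator (A j) (X (\<phi> j) \<omega>) :: real)" for \<omega>
      using J(1) by (auto simp: prod_emb_def indicator_def PiE_iff prod_eq_1_iff intro!: prod_zero[symmetric])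
    \<comment> \<open>The factor cos(X(0)) is almost surely 1 and brings the integral into the form
      of \<open>step\<close> with k = 0.\<close>
    have "(\<integral>\<omega>. U \<omega> * indicator ?E (?T \<omega>) \<partial>M)
      = (\<integral>\<omega>. U \<omega> * (\<Prod>j\<in>J. indicator (A j) (X (\<phi> j) \<omega>)) * cos (X 0 \<omega>) \<partial>M)"
    proof (rule integral_cong_AE)
      show "(\<lambda>\<omega>. U \<omega> * indicator ?E (?T \<omega>)) \<in> borel_measurable M"
        using E by measurable
      then show "(\<lambda>\<omega>. U \<omega> * (\<Prod>j\<in>J. indicator (A j) (X (\<phi> j) \<omega>)) * cos (X 0 \<omega>)) \<in> borel_measurable M"
        unfolding ind by (rule borel_measurable_times) measurable
      show "AE \<omega> in M. U \<omega> * indicator ?E (?T \<omega>) = U \<omega> * (\<Prod>j\<in>J. indicator (A j) (X (\<phi> j) \<omega>)) * cos (X 0 \<omega>)"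
        using X_zero unfolding ind by eventually_elim simp
    qed
    also have "\<dots> = 0" using step[of J A] J span_zero by blast
    finally show "emeasure ?P ?E = emeasure ?Q ?E"
      by (subst emeasure_distr_density_real_eq_iff[OF U T E])
  next
    show "finite_measure ?P"
      by (rule finite_measureI) (subst emeasure_distr_density_real[OF U T]; simp)
  qed auto
  then show ?thesis
    using emeasure_distr_density_real_eq_iff[OF U T B] by simp
qed

text \<open>Here the assumption on the \<sigma>-field enters: every event is the preimage of a
  measurable set of the product space under the whole family X, so
  \<open>fourier_zero_family\<close> makes the integral of U over every event vanish.\<close>

lemma trig_total:
  assumes U: "integrable M U"
    and "\<And>k. (\<integral>\<omega>. U \<omega> * cos (X k \<omega>) \<partial>M) = 0" "\<And>k. (\<integral>\<omega>. U \<omega> * sin (X k \<omega>) \<partial>M) = 0"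
  shows "AE \<omega> in M. U \<omega> = 0"
proof -
  have [measurable]: "U \<in> borel_measurable M" using U by auto
  let ?T = "\<lambda>\<omega> i. X i \<omega>"
  have T: "?T \<in> measurable M (Pi\<^sub>M UNIV (\<lambda>_. borel))"
    by (rule measurable_PiM_single') auto
  have rep: "\<exists>B\<in>sets (Pi\<^sub>M UNIV (\<lambda>_. borel)). A = ?T -` B \<inter> space M" if "A \<in> sets M" for A
  proof -
    let ?V = "vimage_algebra (space M) ?T (Pi\<^sub>M UNIV (\<lambda>_. borel))"
    have gen: "X h -` C \<inter> space M \<in> sets ?V" if [measurable]: "C \<in> sets borel" for h C
    proof -
      have "{y \<in> space (Pi\<^sub>M UNIV (\<lambda>_. borel)). y h \<in> C} \<in> sets (Pi\<^sub>M UNIV (\<lambda>_::'h. borel))"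
        by measurable
      from in_vimage_algebra[OF this, of ?T "space M"]
      show ?thesis by (simp add: space_PiM vimage_def Int_def)
    qed
    have "A \<in> sigma_sets (space M) {X h -` A \<inter> space M |h A. A \<in> sets borel}"
      using that unfolding generated_sets .
    also have "\<dots> \<subseteq> sets ?V"
      using sets.sigma_sets_subset[of "{X h -` A \<inter> space M |h A. A \<in> sets borel}" ?V] gen by auto
    also have "sets ?V = {?T -` B \<inter> space M |B. B \<in> sets (Pi\<^sub>M UNIV (\<lambda>_. borel))}"
      by (rule sets_vimage_algebra2) (simp add: space_PiM)
    finally show ?thesis by blast
  qed
  have z: "(\<integral>\<omega>. U \<omega> * indicator A \<omega> \<partial>M) = 0" if A: "A \<in> sets M" for A
  proof -
    obtain B where B: "B \<in> sets (Pi\<^sub>M UNIV (\<lambda>_. borel))" "A = ?T -` B \<inter> space M" using rep[OF A] by blast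
    have "(\<integral>\<omega>. U \<omega> * indicator A \<omega> \<partial>M) = (\<integral>\<omega>. U \<omega> * indicator B (?T \<omega>) \<partial>M)"
      by (intro Bochner_Integration.integral_cong) (auto simp: B indicator_def)
    also have "\<dots> = 0" using fourier_zero_family[of U "\<lambda>k. k" B] assms B by simp
    finally show ?thesis .
  qed
  show ?thesis
    by (rule density_unique_real[OF U, of "\<lambda>_. 0"])
      (use z in \<open>auto simp: set_lebesgue_integral_def mult.commute\<close>)
qed

end

section \<open>Gaussian integration by parts\<close>

text \<open>The differences w(b) - w(-b) tend to the integral I. If I were not 0, they would stay
  away from 0 on a half-line of infinite length, against the integrability of w.\<close>

lemma integral_derivative_eq_0:
  fixes w w' :: "real \<Rightarrow> real"
  assumes deriv: "\<And>x. (w has_real_derivative w' x) (at x)"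
    and cont: "continuous_on UNIV w'"
    and w: "integrable lborel w" and w': "integrable lborel w'"
  shows "(\<integral>x. w' x \<partial>lborel) = 0"
proof (rule ccontr)
  define I where "I = (\<integral>x. w' x \<partial>lborel)"
  assume "(\<integral>x. w' x \<partial>lborel) \<noteq> 0"
  then have "I \<noteq> 0" by (simp add: I_def)
  have [measurable]: "w' \<in> borel_measurable borel" using w' by auto
  have FTC: "(\<integral>x. indicator {-b..b} x *\<^sub>R w' x \<partial>lborel) = w b - w (- b)" if "b \<ge> 0" for b
    by (rule integral_FTC_atLeastAtMost)
      (use that deriv cont in \<open>auto intro: has_vector_derivative_at_within continuous_on_subset
        simp: has_real_derivative_iff_has_vector_derivative\<close>)
  have "((\<lambda>b. \<integral>x. indicator {-b..b} x *\<^sub>R w' x \<partial>lborel) \<longlongrightarrow> I) at_top"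
    unfolding I_def
  proof (rule integral_dominated_convergence_at_top[where w = "\<lambda>x. \<bar>w' x\<bar>"])
    show "\<forall>\<^sub>F b in at_top. AE x in lborel. norm (indicator {-b..b} x *\<^sub>R w' x) \<le> \<bar>w' x\<bar>"
      by (auto simp: indicator_def)
    show "AE x in lborel. ((\<lambda>b. indicator {-b..b} x *\<^sub>R w' x) \<longlongrightarrow> w' x) at_top"
    proof (intro AE_I2)
      fix x :: real
      have "\<forall>\<^sub>F b in at_top. indicator {-b..b} x *\<^sub>R w' x = w' x"
        using eventually_ge_at_top[of "\<bar>x\<bar>"] by eventually_elim (auto simp: indicator_def)
      then show "((\<lambda>b. indicator {-b..b} x *\<^sub>R w' x) \<longlongrightarrow> w' x) at_top"
        by (rule tendsto_eventually)
    qed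
  qed (use w' in auto)
  then have "\<forall>\<^sub>F b in at_top. dist (\<integral>x. indicator {-b..b} x *\<^sub>R w' x \<partial>lborel) I < \<bar>I\<bar> / 2"
    using \<open>I \<noteq> 0\<close> by (intro tendstoD) auto
  then have "\<forall>\<^sub>F b in at_top. \<bar>I\<bar> / 2 \<le> \<bar>w b - w (- b)\<bar>"
    using eventually_ge_at_top[of 0]
  proof eventually_elim
    case (elim b)
    have "dist (w b - w (- b)) I < \<bar>I\<bar> / 2" using elim(1) unfolding FTC[OF elim(2)] .
    then show ?case unfolding dist_real_def by linarith
  qed
  then obtain b0 where b0: "\<And>b. b \<ge> b0 \<Longrightarrow> \<bar>I\<bar> / 2 \<le> \<bar>w b - w (- b)\<bar>"
    by (auto simp: eventually_at_top_linorder)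
  have "integrable lborel (\<lambda>x. w (0 + (-1) * x))"
    by (rule lborel_integrable_real_affine[OF w]) simp
  then have D: "integrable lborel (\<lambda>b. w b - w (- b))" using w by simp
  have "integrable lborel (\<lambda>b. indicator {b0..} b * (\<bar>I\<bar> / 2))"
    by (rule Bochner_Integration.integrable_bound[OF D]) (use b0 in \<open>auto simp: indicator_def\<close>)
  then have "integrable lborel (\<lambda>b. (2 / \<bar>I\<bar>) * (indicator {b0..} b * (\<bar>I\<bar> / 2)))"
    by (rule integrable_mult_right)
  moreover have "(\<lambda>b. (2 / \<bar>I\<bar>) * (indicator {b0..} b * (\<bar>I\<bar> / 2))) = (indicator {b0..} :: real \<Rightarrow> real)"
    using \<open>I \<noteq> 0\<close> by (auto simp: fun_eq_iff)
  ultimately have "integrable lborel (indicator {b0..} :: real \<Rightarrow> real)" by simp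
  then have "emeasure lborel {b0..} < \<infinity>"
    by (simp add: integrable_indicator_iff)
  obtain n :: nat where n: "measure lborel {b0..} < real n" using reals_Archimedean2 by blast
  have "ennreal (real n) = emeasure lborel {b0..b0 + real n}" by simp
  also have "\<dots> \<le> emeasure lborel {b0..}" by (rule emeasure_mono) auto
  also have "\<dots> = ennreal (measure lborel {b0..})"
    using \<open>emeasure lborel {b0..} < \<infinity>\<close> by (intro emeasure_eq_ennreal_measure) auto
  finally show False using n by (auto simp: ennreal_le_iff2)
qed

lemma DERIV_std_normal_density:
  "(std_normal_density has_real_derivative - x * std_normal_density x) (at x)"
proof -
  define c where "c = 1 / sqrt (2 * pi)"
  have "std_normal_density = (\<lambda>x. c * exp (- (x\<^sup>2 / 2)))"
    by (simp add: std_normal_density_def fun_eq_iff c_def)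
  then show ?thesis by (auto intro!: derivative_eq_intros)
qed

text \<open>The integrand times the Gaussian density is the derivative of u times the density,
  because the density \<phi> satisfies \<phi>'(x) = -x \<phi>(x).\<close>

lemma integral_by_parts_std_normal:
  fixes u u' :: "real \<Rightarrow> real"
  assumes deriv: "\<And>x. (u has_real_derivative u' x) (at x)"
    and cont: "continuous_on UNIV u'"
    and u': "integrable std_normal_distribution u'"
    and xu: "integrable std_normal_distribution (\<lambda>x. x * u x)"
  shows "(\<integral>x. u' x - x * u x \<partial>std_normal_distribution) = 0"
proof -
  have cu: "continuous_on UNIV u"
    using deriv DERIV_isCont by (auto intro!: continuous_at_imp_continuous_on)
  have cphi: "continuous_on UNIV (std_normal_density :: real \<Rightarrow> real)"
    using DERIV_std_normal_density DERIV_isCont by (blast intro: continuous_at_imp_continuous_on)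
  have [measurable]: "u \<in> borel_measurable borel" "u' \<in> borel_measurable borel"
    using cu cont by (auto intro: borel_measurable_continuous_onI)
  have i1: "integrable lborel (\<lambda>x. std_normal_density x * u' x)"
    using u' by (subst (asm) integrable_density) auto
  have i2: "integrable lborel (\<lambda>x. std_normal_density x * (x * u x))"
    using xu by (subst (asm) integrable_density) auto
  define w where "w x = std_normal_density x * u x" for x
  define w' where "w' x = std_normal_density x * (u' x - x * u x)" for x
  have "integrable lborel (\<lambda>x. indicator {-1..1} x *\<^sub>R w x)"
    unfolding w_def
    using borel_integrable_atLeastAtMost'[of "-1" 1 "\<lambda>x. std_normal_density x * u x"] cu cphi
    by (auto simp: set_integrable_def intro: continuous_on_subset continuous_on_mult)
  \<comment> \<open>Integrability of x u(x) controls u only away from 0: for |x| > 1 the factor x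
    helps, and on [-1, 1] continuity takes over.\<close>
  then have b: "integrable lborel (\<lambda>x. \<bar>indicator {-1..1} x *\<^sub>R w x\<bar> + \<bar>std_normal_density x * (x * u x)\<bar>)"
    using i2 by auto
  have "\<bar>w x\<bar> \<le> \<bar>indicator {-1..1} x *\<^sub>R w x\<bar> + \<bar>std_normal_density x * (x * u x)\<bar>" for x
  proof (cases "x \<in> {-1..1}")
    case False
    then have "1 * \<bar>w x\<bar> \<le> \<bar>x\<bar> * \<bar>w x\<bar>" by (intro mult_right_mono) auto
    then have "\<bar>w x\<bar> \<le> \<bar>std_normal_density x * (x * u x)\<bar>" by (simp add: w_def abs_mult mult_ac)
    then show ?thesis by linarith
  qed simp
  then have "integrable lborel w"
    by (intro Bochner_Integration.integrable_bound[OF b]) (auto simp: w_def[abs_def])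
  moreover have "integrable lborel w'"
    using Bochner_Integration.integrable_diff[OF i1 i2] by (simp add: w'_def[abs_def] algebra_simps)
  moreover have "(w has_real_derivative w' x) (at x)" for x
    unfolding w_def[abs_def] w'_def
    by (auto intro!: derivative_eq_intros deriv DERIV_std_normal_density simp: algebra_simps)
  moreover have "continuous_on UNIV w'"
    unfolding w'_def[abs_def] by (intro continuous_intros cphi cont cu)
  ultimately have "(\<integral>x. w' x \<partial>lborel) = 0" by (intro integral_derivative_eq_0)
  then show ?thesis by (subst integral_density) (auto simp: w'_def)
qed

context isonormal_gaussian
begin

lemma X_sequence_measurable [measurable]: "(\<lambda>\<omega> j. X (\<phi> j) \<omega>) \<in> measurable M (borel :: (nat \<Rightarrow> real) measure)"
  by (rule measurable_coordinatewise_then_product) simp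

text \<open>For k orthogonal to h the mean of a product of trigonometric functions of X(k) and t
  X(h) factorises, since norms of k + t h and k - t h add by Pythagoras. Fourier uniqueness in the
  variable X(h) extends the factorisation to indicators of X(h).\<close>

lemma trig_X_orthogonal:
  assumes "k \<bullet> h = 0" and [measurable]: "A \<in> sets borel"
  shows "(\<integral>\<omega>. (indicator A (X h \<omega>) - measure M {\<omega>\<in>space M. X h \<omega> \<in> A}) * cos (X k \<omega>) \<partial>M) = 0"
    and "(\<integral>\<omega>. (indicator A (X h \<omega>) - measure M {\<omega>\<in>space M. X h \<omega> \<in> A}) * sin (X k \<omega>) \<partial>M) = 0"
proof -
  let ?p = "measure M {\<omega>\<in>space M. X h \<omega> \<in> A}"
  have n: "(norm (k + t *\<^sub>R h))\<^sup>2 = (norm k)\<^sup>2 + t\<^sup>2 * (norm h)\<^sup>2"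
    "(norm (k - t *\<^sub>R h))\<^sup>2 = (norm k)\<^sup>2 + t\<^sup>2 * (norm h)\<^sup>2" for t
    using assms(1) unfolding power2_norm_eq_inner
    by (auto simp: inner_add_left inner_add_right inner_diff_left inner_diff_right inner_commute power2_eq_square)
  have E_scale: "(\<integral>\<omega>. cos (t * X h \<omega>) \<partial>M) = exp (- (t\<^sup>2 * (norm h)\<^sup>2) / 2)" "(\<integral>\<omega>. sin (t * X h \<omega>) \<partial>M) = 0" for t
  proof -
    have "(\<integral>\<omega>. cos (t * X h \<omega>) \<partial>M) = (\<integral>\<omega>. cos (X (t *\<^sub>R h) \<omega>) \<partial>M)"
      by (rule integral_cong_AE, measurable, use X_scale[of t h] in eventually_elim) simp
    then show "(\<integral>\<omega>. cos (t * X h \<omega>) \<partial>M) = exp (- (t\<^sup>2 * (norm h)\<^sup>2) / 2)"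
      by (simp add: expectation_cos_sin_X power_mult_distrib)
    have "(\<integral>\<omega>. sin (t * X h \<omega>) \<partial>M) = (\<integral>\<omega>. sin (X (t *\<^sub>R h) \<omega>) \<partial>M)"
      by (rule integral_cong_AE, measurable, use X_scale[of t h] in eventually_elim) simp
    then show "(\<integral>\<omega>. sin (t * X h \<omega>) \<partial>M) = 0"
      by (simp add: expectation_cos_sin_X)
  qed
  have i_ts: "integrable M (\<lambda>\<omega>. cos (t * X h \<omega>))" "integrable M (\<lambda>\<omega>. sin (t * X h \<omega>))" for t
    by (rule integrable_const_bound[where B = 1]; simp)+
  have i_ind: "integrable M (\<lambda>\<omega>. indicator A (X h \<omega>) :: real)"
    by (rule integrable_const_bound[where B = 1]) (auto simp: indicator_def)
  have E_ind: "(\<integral>\<omega>. indicator A (X h \<omega>) \<partial>M) = ?p"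
  proof -
    have "(\<integral>\<omega>. indicator A (X h \<omega>) \<partial>M) = (\<integral>\<omega>. indicator {\<omega>\<in>space M. X h \<omega> \<in> A} \<omega> \<partial>M)"
      by (intro Bochner_Integration.integral_cong) (auto simp: indicator_def)
    also have "\<dots> = ?p"
      by (rule trans[OF Bochner_Integration.integral_indicator]) (auto intro!: arg_cong[where f = "measure M"])
    finally show ?thesis .
  qed
  have key: "(\<integral>\<omega>. (indicator A (X h \<omega>) - ?p) * b \<omega> \<partial>M) = 0"
    if b: "b \<in> borel_measurable M" "\<And>\<omega>. \<bar>b \<omega>\<bar> \<le> 1"
      and c: "\<And>t. (\<integral>\<omega>. b \<omega> * cos (t * X h \<omega>) \<partial>M) = expectation b * (\<integral>\<omega>. cos (t * X h \<omega>) \<partial>M)"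
      and s: "\<And>t. (\<integral>\<omega>. b \<omega> * sin (t * X h \<omega>) \<partial>M) = expectation b * (\<integral>\<omega>. sin (t * X h \<omega>) \<partial>M)" for b
  proof -
    have [measurable]: "b \<in> borel_measurable M" by fact
    have ib: "integrable M b" by (rule integrable_const_bound[where B = 1]) (use b in auto)
    have ibt: "integrable M (\<lambda>\<omega>. b \<omega> * cos (t * X h \<omega>))" "integrable M (\<lambda>\<omega>. b \<omega> * sin (t * X h \<omega>))" for t
      by (rule integrable_mult_bounded[OF ib, where C = 1]; simp)+
    have ibi: "integrable M (\<lambda>\<omega>. b \<omega> * indicator A (X h \<omega>))"
      by (rule integrable_mult_bounded[OF ib, where C = 1]) (auto simp: indicator_def)
    have "(\<integral>\<omega>. (b \<omega> - expectation b) * indicator A (X h \<omega>) \<partial>M) = 0"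
      by (rule fourier_zero_imp) (auto simp: left_diff_distrib ib ibt i_ts c s)
    then have "(\<integral>\<omega>. b \<omega> * indicator A (X h \<omega>) \<partial>M) = expectation b * ?p"
      by (simp add: left_diff_distrib ibi i_ind E_ind)
    moreover have "(\<integral>\<omega>. (indicator A (X h \<omega>) - ?p) * b \<omega> \<partial>M) = (\<integral>\<omega>. b \<omega> * indicator A (X h \<omega>) - ?p * b \<omega> \<partial>M)"
      by (simp add: algebra_simps)
    ultimately show ?thesis by (simp add: ibi ib)
  qed
  have e: "exp ((- (norm k)\<^sup>2 - t\<^sup>2 * (norm h)\<^sup>2) / 2) = exp (- ((norm k)\<^sup>2 / 2)) * exp (- (t\<^sup>2 * (norm h)\<^sup>2 / 2))" for t
    by (simp add: exp_add[symmetric] field_simps)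
  note tp = trig_products[OF integrable_const[of 1], unfolded mult_1_left]
  show "(\<integral>\<omega>. (indicator A (X h \<omega>) - ?p) * cos (X k \<omega>) \<partial>M) = 0"
    by (rule key) (auto simp: tp E_scale expectation_cos_sin_X n e)
  show "(\<integral>\<omega>. (indicator A (X h \<omega>) - ?p) * sin (X k \<omega>) \<partial>M) = 0"
    by (rule key) (auto simp: tp E_scale expectation_cos_sin_X n e)
qed

text \<open>Orthogonal Gaussian variables are independent: the centred indicator of an event about
  X(h) annihilates the trigonometric functions of all vectors orthogonal to h, hence all events
  about the sequence Y. The law of the pair is therefore a product.\<close>

lemma distr_orthogonal_decomposition:
  fixes \<phi> :: "nat \<Rightarrow> 'h"
  assumes h: "norm h = 1"
  defines "Y \<equiv> \<lambda>\<omega> j. X (\<phi> j) \<omega> - (\<phi> j \<bullet> h) * X h \<omega>"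
  shows "Y \<in> measurable M borel"
    and "distr M (borel \<Otimes>\<^sub>M borel) (\<lambda>\<omega>. (Y \<omega>, X h \<omega>)) = distr M borel Y \<Otimes>\<^sub>M std_normal_distribution"
proof -
  show Ym[measurable]: "Y \<in> measurable M borel"
    unfolding Y_def by (rule measurable_coordinatewise_then_product) simp
  interpret Yd: prob_space "distr M borel Y" by (rule prob_space_distr) simp
  interpret S: real_distribution std_normal_distribution by (rule real_dist_normal_dist)
  have "h \<noteq> 0" using h by auto
  have law_X: "distr M borel (X h) = std_normal_distribution"
    using distributed_distr_eq_density[OF distributed_X[OF \<open>h \<noteq> 0\<close>]] h
    by (metis distr_cong sets_lborel)
  have "distr M borel Y \<Otimes>\<^sub>M std_normal_distribution = distr M (borel \<Otimes>\<^sub>M borel) (\<lambda>\<omega>. (Y \<omega>, X h \<omega>))"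
  proof (rule pair_measure_eqI)
    show "sigma_finite_measure (distr M borel Y)" "sigma_finite_measure std_normal_distribution" ..
    show "sets (distr M borel Y \<Otimes>\<^sub>M std_normal_distribution) = sets (distr M (borel \<Otimes>\<^sub>M borel) (\<lambda>\<omega>. (Y \<omega>, X h \<omega>)))"
      by (simp cong: sets_pair_measure_cong)
    fix B and A :: "real set"
    assume "B \<in> sets (distr M borel Y)" "A \<in> sets std_normal_distribution"
    then have [measurable]: "B \<in> sets borel" "A \<in> sets borel" by auto
    define p where "p = measure M {\<omega>\<in>space M. X h \<omega> \<in> A}"
    define U where "U \<omega> = indicator A (X h \<omega>) - p" for \<omega>
    have U: "integrable M U"
      unfolding U_def by (rule integrable_const_bound[where B = "1 + \<bar>p\<bar>"]) (auto simp: indicator_def)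
    \<comment> \<open>The component along h is removed; by linearity X(\<phi>'(j)) = Y(j) almost
      surely, and simultaneously for all j because the index set is countable.\<close>
    define \<phi>' where "\<phi>' j = \<phi> j - (\<phi> j \<bullet> h) *\<^sub>R h" for j
    have orth: "k \<bullet> h = 0" if "k \<in> span (range \<phi>')" for k
      using that
    proof (induction rule: span_induct_alt)
      case (step c x y)
      then show ?case using h by (auto simp: inner_add_left \<phi>'_def inner_diff_left norm_eq_1)
    qed simp
    have "(\<integral>\<omega>. U \<omega> * indicator B (\<lambda>i. X (\<phi>' i) \<omega>) \<partial>M) = 0"
    proof (rule fourier_zero_family[OF U])
      show "B \<in> sets (Pi\<^sub>M UNIV (\<lambda>_. borel))" by (simp add: sets_PiM_equal_borel)
    qed (auto simp: U_def p_def trig_X_orthogonal orth)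
    moreover have "AE \<omega> in M. \<forall>i. X (\<phi>' i) \<omega> = Y \<omega> i"
      unfolding AE_all_countable \<phi>'_def Y_def using X_diff_scale by blast
    then have "AE \<omega> in M. U \<omega> * indicator B (\<lambda>i. X (\<phi>' i) \<omega>) = U \<omega> * indicator B (Y \<omega>)"
      by eventually_elim (simp add: fun_eq_iff)
    then have "(\<integral>\<omega>. U \<omega> * indicator B (\<lambda>i. X (\<phi>' i) \<omega>) \<partial>M) = (\<integral>\<omega>. U \<omega> * indicator B (Y \<omega>) \<partial>M)"
    proof (intro integral_cong_AE)
      have [measurable]: "U \<in> borel_measurable M" using U by auto
      have B: "indicator B \<in> borel_measurable borel" by simp
      note [measurable] = measurable_compose[OF X_sequence_measurable B] measurable_compose[OF Ym B]
      show "(\<lambda>\<omega>. U \<omega> * indicator B (\<lambda>i. X (\<phi>' i) \<omega>)) \<in> borel_measurable M" by measurable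
      show "(\<lambda>\<omega>. U \<omega> * indicator B (Y \<omega>)) \<in> borel_measurable M" by measurable
    qed
    ultimately have "(\<integral>\<omega>. U \<omega> * indicator B (Y \<omega>) \<partial>M) = 0" by simp
    moreover have "(\<integral>\<omega>. U \<omega> * indicator B (Y \<omega>) \<partial>M)
        = (\<integral>\<omega>. indicator {\<omega>\<in>space M. Y \<omega> \<in> B \<and> X h \<omega> \<in> A} \<omega> - p * indicator {\<omega>\<in>space M. Y \<omega> \<in> B} \<omega> \<partial>M)"
      by (intro Bochner_Integration.integral_cong) (auto simp: U_def indicator_def)
    moreover have "\<dots> = measure M {\<omega>\<in>space M. Y \<omega> \<in> B \<and> X h \<omega> \<in> A} - p * measure M {\<omega>\<in>space M. Y \<omega> \<in> B}"
      by (subst Bochner_Integration.integral_diff) (auto intro!: integrable_real_indicator simp: emeasure_eq_measure)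
    ultimately have *: "measure M {\<omega>\<in>space M. Y \<omega> \<in> B \<and> X h \<omega> \<in> A} = measure M {\<omega>\<in>space M. Y \<omega> \<in> B} * p"
      by simp
    have "emeasure (distr M borel Y) B = measure M {\<omega>\<in>space M. Y \<omega> \<in> B}"
      by (simp add: emeasure_distr emeasure_eq_measure vimage_def Int_def conj_commute)
    moreover have "emeasure std_normal_distribution A = p"
      unfolding law_X[symmetric] p_def
      by (simp add: emeasure_distr emeasure_eq_measure vimage_def Int_def conj_commute)
    moreover have "emeasure (distr M (borel \<Otimes>\<^sub>M borel) (\<lambda>\<omega>. (Y \<omega>, X h \<omega>))) (B \<times> A) = measure M {\<omega>\<in>space M. Y \<omega> \<in> B \<and> X h \<omega> \<in> A}"
      by (subst emeasure_distr) (auto simp: emeasure_eq_measure intro!: arg_cong[where f = "measure M"])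
    ultimately show "emeasure (distr M borel Y) B * emeasure std_normal_distribution A
        = emeasure (distr M (borel \<Otimes>\<^sub>M borel) (\<lambda>\<omega>. (Y \<omega>, X h \<omega>))) (B \<times> A)"
      using * by (simp add: ennreal_mult p_def)
  qed
  then show "distr M (borel \<Otimes>\<^sub>M borel) (\<lambda>\<omega>. (Y \<omega>, X h \<omega>)) = distr M borel Y \<Otimes>\<^sub>M std_normal_distribution" ..
qed

text \<open>With the independent remainder Y frozen, moving along h changes only the value s of
  X(h), and the claim becomes the one-dimensional formula in s. Fubini on the product law assembles
  these formulas.\<close>

lemma integration_by_parts_unit:
  fixes \<phi> :: "nat \<Rightarrow> 'h" and \<Psi> \<Psi>' :: "(nat \<Rightarrow> real) \<Rightarrow> real"
  assumes h: "norm h = 1"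
    and cont: "continuous_on UNIV \<Psi>" "continuous_on UNIV \<Psi>'"
    and deriv: "\<And>x. ((\<lambda>t. \<Psi> (\<lambda>j. x j + t * (\<phi> j \<bullet> h))) has_real_derivative \<Psi>' x) (at 0)"
    and int1: "integrable M (\<lambda>\<omega>. \<Psi>' (\<lambda>j. X (\<phi> j) \<omega>))"
    and int2: "integrable M (\<lambda>\<omega>. \<Psi> (\<lambda>j. X (\<phi> j) \<omega>) * X h \<omega>)"
  shows "(\<integral>\<omega>. \<Psi>' (\<lambda>j. X (\<phi> j) \<omega>) \<partial>M) = (\<integral>\<omega>. \<Psi> (\<lambda>j. X (\<phi> j) \<omega>) * X h \<omega> \<partial>M)"
proof -
  have [measurable]: "\<Psi> \<in> borel_measurable borel" "\<Psi>' \<in> borel_measurable borel"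
    using cont by (auto intro: borel_measurable_continuous_onI)
  define Y where "Y = (\<lambda>\<omega> j. X (\<phi> j) \<omega> - (\<phi> j \<bullet> h) * X h \<omega>)"
  \<comment> \<open>The inverse of the decomposition: it rebuilds the sequence X(\<phi>(j)) from the
    remainder y and the value s of X(h).\<close>
  define sh where "sh = (\<lambda>(y::nat \<Rightarrow> real, s::real) j. y j + s * (\<phi> j \<bullet> h))"
  have sh[measurable]: "sh \<in> measurable (borel \<Otimes>\<^sub>M borel) borel"
  proof (rule measurable_coordinatewise_then_product)
    fix j
    have "(\<lambda>y. y j) \<in> borel_measurable (borel :: (nat \<Rightarrow> real) measure)"
      by (rule measurable_product_coordinates)
    then have [measurable]: "(\<lambda>x. fst x j) \<in> borel_measurable ((borel :: (nat \<Rightarrow> real) measure) \<Otimes>\<^sub>M (borel::real measure))"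
      by (rule measurable_compose[OF measurable_fst])
    show "(\<lambda>x. sh x j) \<in> borel_measurable (borel \<Otimes>\<^sub>M borel)"
      unfolding sh_def case_prod_beta by measurable
  qed
  have Ym[measurable]: "Y \<in> measurable M borel"
    and law: "distr M (borel \<Otimes>\<^sub>M borel) (\<lambda>\<omega>. (Y \<omega>, X h \<omega>)) = distr M borel Y \<Otimes>\<^sub>M std_normal_distribution"
    using distr_orthogonal_decomposition[OF h, of \<phi>] by (auto simp: Y_def)
  interpret Yd: prob_space "distr M borel Y" by (rule prob_space_distr) simp
  interpret S: real_distribution std_normal_distribution by (rule real_dist_normal_dist)
  interpret P: pair_sigma_finite "distr M borel Y" std_normal_distribution ..
  have sh_Y: "sh (Y \<omega>, X h \<omega>) = (\<lambda>j. X (\<phi> j) \<omega>)" for \<omega>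
    by (simp add: sh_def Y_def algebra_simps)
  let ?P = "distr M borel Y \<Otimes>\<^sub>M std_normal_distribution"
  have i1: "integrable ?P (\<lambda>p. \<Psi>' (sh p))" and i2: "integrable ?P (\<lambda>p. snd p * \<Psi> (sh p))"
    unfolding law[symmetric]
    by (subst integrable_distr_eq; use int1 int2 in \<open>simp add: sh_Y mult.commute\<close>)+
  have "(\<integral>\<omega>. \<Psi>' (\<lambda>j. X (\<phi> j) \<omega>) \<partial>M) - (\<integral>\<omega>. \<Psi> (\<lambda>j. X (\<phi> j) \<omega>) * X h \<omega> \<partial>M)
    = (\<integral>\<omega>. \<Psi>' (sh (Y \<omega>, X h \<omega>)) - snd (Y \<omega>, X h \<omega>) * \<Psi> (sh (Y \<omega>, X h \<omega>)) \<partial>M)"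
    using int1 int2 by (simp add: sh_Y mult.commute)
  also have "\<dots> = (\<integral>p. \<Psi>' (sh p) - snd p * \<Psi> (sh p) \<partial>?P)"
    unfolding law[symmetric] by (subst integral_distr) auto
  also have "\<dots> = (\<integral>y. (\<integral>s. \<Psi>' (sh (y, s)) - snd (y, s) * \<Psi> (sh (y, s)) \<partial>std_normal_distribution) \<partial>distr M borel Y)"
    by (rule P.integral_fst'[symmetric]) (use i1 i2 in auto)
  also have "\<dots> = 0"
  proof (rule integral_eq_zero_AE)
    show "AE y in distr M borel Y. (\<integral>s. \<Psi>' (sh (y, s)) - snd (y, s) * \<Psi> (sh (y, s)) \<partial>std_normal_distribution) = 0"
      using P.AE_integrable_fst'[OF i1] P.AE_integrable_fst'[OF i2]
    proof eventually_elim
      case (elim y)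
      \<comment> \<open>The hypothesis gives a derivative at time 0 from every base point; the base
        point sh(y, s) turns it into the derivative at time s along the line through y.\<close>
      have "((\<lambda>s. \<Psi> (sh (y, s))) has_real_derivative \<Psi>' (sh (y, s))) (at s)" for s
      proof -
        have "((\<lambda>t. \<Psi> (sh (y, t + s))) has_real_derivative \<Psi>' (sh (y, s))) (at 0)"
          using deriv[of "sh (y, s)"] by (simp add: sh_def algebra_simps)
        then have "((\<lambda>s. \<Psi> (sh (y, s))) has_real_derivative \<Psi>' (sh (y, s))) (at (0 + s))"
          by (subst DERIV_shift)
        then show ?thesis by simp
      qed
      moreover have "continuous_on UNIV (\<lambda>s. \<Psi>' (sh (y, s)))"
        by (rule continuous_on_compose2[OF cont(2)])
          (auto simp: sh_def intro!: continuous_on_coordinatewise_then_product continuous_intros)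
      ultimately show ?case
        using integral_by_parts_std_normal[of "\<lambda>s. \<Psi> (sh (y, s))" "\<lambda>s. \<Psi>' (sh (y, s))"] elim by simp
    qed
  qed
  finally show ?thesis by simp
qed

lemma integration_by_parts:
  fixes \<phi> :: "nat \<Rightarrow> 'h" and \<Psi> \<Psi>' :: "(nat \<Rightarrow> real) \<Rightarrow> real"
  assumes cont: "continuous_on UNIV \<Psi>" "continuous_on UNIV \<Psi>'"
    and deriv: "\<And>x. ((\<lambda>t. \<Psi> (\<lambda>j. x j + t * (\<phi> j \<bullet> h))) has_real_derivative \<Psi>' x) (at 0)"
    and int1: "integrable M (\<lambda>\<omega>. \<Psi>' (\<lambda>j. X (\<phi> j) \<omega>))"
    and int2: "integrable M (\<lambda>\<omega>. \<Psi> (\<lambda>j. X (\<phi> j) \<omega>) * X h \<omega>)"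
  shows "(\<integral>\<omega>. \<Psi>' (\<lambda>j. X (\<phi> j) \<omega>) \<partial>M) = (\<integral>\<omega>. \<Psi> (\<lambda>j. X (\<phi> j) \<omega>) * X h \<omega> \<partial>M)"
proof (cases "h = 0")
  case True
  have "\<Psi>' x = 0" for x
    using DERIV_unique[OF deriv[of x], of 0] True by simp
  moreover have "(\<integral>\<omega>. \<Psi> (\<lambda>j. X (\<phi> j) \<omega>) * X h \<omega> \<partial>M) = 0"
    by (rule integral_eq_zero_AE) (use X_zero True in auto)
  ultimately show ?thesis by simp
next
  case False
  define e where "e = (1 / norm h) *\<^sub>R h"
  have e: "norm e = 1" and h: "h = norm h *\<^sub>R e" using False by (auto simp: e_def)
  have ae: "AE \<omega> in M. X h \<omega> = norm h * X e \<omega>" using X_scale[of "norm h" e] h by simp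
  have [measurable]: "\<Psi> \<in> borel_measurable borel"
    using cont by (auto intro: borel_measurable_continuous_onI)
  have "((\<lambda>t. \<Psi> (\<lambda>j. x j + t * (\<phi> j \<bullet> e))) has_real_derivative \<Psi>' x / norm h) (at 0)" for x
  proof -
    have "((\<lambda>t. \<Psi> (\<lambda>j. x j + t * (\<phi> j \<bullet> h))) has_real_derivative \<Psi>' x) (at (0 / norm h))"
      using deriv[of x] by simp
    then have "((\<lambda>s. \<Psi> (\<lambda>j. x j + (s / norm h) * (\<phi> j \<bullet> h))) has_real_derivative \<Psi>' x * (1 / norm h)) (at 0)"
      by (rule DERIV_chain2) (use False in \<open>auto intro!: derivative_eq_intros\<close>)
    then show ?thesis by (simp add: e_def)
  qed
  moreover have "continuous_on UNIV (\<lambda>x. \<Psi>' x / norm h)"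
    using cont False by (intro continuous_intros) auto
  moreover have "integrable M (\<lambda>\<omega>. \<Psi> (\<lambda>j. X (\<phi> j) \<omega>) * X e \<omega>)"
  proof -
    have "integrable M (\<lambda>\<omega>. (\<Psi> (\<lambda>j. X (\<phi> j) \<omega>) * X h \<omega>) / norm h)" using int2 by simp
    moreover have "AE \<omega> in M. (\<Psi> (\<lambda>j. X (\<phi> j) \<omega>) * X h \<omega>) / norm h = \<Psi> (\<lambda>j. X (\<phi> j) \<omega>) * X e \<omega>"
      using ae by eventually_elim (use False in simp)
    ultimately show ?thesis by (subst (asm) integrable_cong_AE) auto
  qed
  ultimately have "(\<integral>\<omega>. \<Psi>' (\<lambda>j. X (\<phi> j) \<omega>) / norm h \<partial>M) = (\<integral>\<omega>. \<Psi> (\<lambda>j. X (\<phi> j) \<omega>) * X e \<omega> \<partial>M)"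
    using int1 cont(1) by (intro integration_by_parts_unit[OF e]) auto
  moreover have "(\<integral>\<omega>. \<Psi> (\<lambda>j. X (\<phi> j) \<omega>) * X h \<omega> \<partial>M) = (\<integral>\<omega>. norm h * (\<Psi> (\<lambda>j. X (\<phi> j) \<omega>) * X e \<omega>) \<partial>M)"
    by (rule integral_cong_AE, measurable, use ae in eventually_elim) simp
  ultimately show ?thesis using False by (simp add: field_simps)
qed

end

section \<open>Variables with moments of all orders\<close>

text \<open>A class inside L^2 that, unlike L^2, is closed under products. Integrability of the
  products of Hermite polynomials, Gaussian variables and bounded factors below then follows from
  closure rules alone.\<close>

definition all_moments :: "'a measure \<Rightarrow> ('a \<Rightarrow> real) \<Rightarrow> bool" where
  "all_moments M Y \<longleftrightarrow> Y \<in> borel_measurable M \<and> (\<forall>p::nat. integrable M (\<lambda>\<omega>. \<bar>Y \<omega>\<bar> ^ p))"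

lemma all_moments_measurable [measurable_dest]: "all_moments M Y \<Longrightarrow> Y \<in> borel_measurable M"
  by (simp add: all_moments_def)

lemma all_moments_integrable: "all_moments M Y \<Longrightarrow> integrable M Y"
proof -
  assume *: "all_moments M Y"
  then have "integrable M (\<lambda>\<omega>. \<bar>Y \<omega>\<bar> ^ 1)" unfolding all_moments_def by blast
  then show ?thesis using * by (simp add: all_moments_def integrable_abs_iff)
qed

lemma all_moments_L2: "all_moments M Y \<Longrightarrow> Y \<in> L2 M"
  unfolding all_moments_def L2_def by (auto dest: spec[of _ 2])

lemma all_moments_mult:
  assumes "all_moments M Y" "all_moments M Z"
  shows "all_moments M (\<lambda>\<omega>. Y \<omega> * Z \<omega>)"
  unfolding all_moments_def
proof safe
  have [measurable]: "Y \<in> borel_measurable M" "Z \<in> borel_measurable M"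
    using assms by (auto simp: all_moments_def)
  show "(\<lambda>\<omega>. Y \<omega> * Z \<omega>) \<in> borel_measurable M" by measurable
  fix p :: nat
  have i: "integrable M (\<lambda>\<omega>. \<bar>Y \<omega>\<bar> ^ (2 * p) + \<bar>Z \<omega>\<bar> ^ (2 * p))"
    using assms unfolding all_moments_def by (intro Bochner_Integration.integrable_add) blast+
  have "\<bar>Y \<omega> * Z \<omega>\<bar> ^ p \<le> \<bar>Y \<omega>\<bar> ^ (2 * p) + \<bar>Z \<omega>\<bar> ^ (2 * p)" for \<omega>
  proof -
    let ?a = "\<bar>Y \<omega>\<bar> ^ p" and ?b = "\<bar>Z \<omega>\<bar> ^ p"
    have "2 * ?a * ?b \<le> ?a\<^sup>2 + ?b\<^sup>2" by (rule sum_squares_bound)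
    moreover have "0 \<le> ?a * ?b" by simp
    ultimately have "?a * ?b \<le> ?a\<^sup>2 + ?b\<^sup>2" by linarith
    then show ?thesis by (simp add: abs_mult power_mult_distrib power_even_eq)
  qed
  then show "integrable M (\<lambda>\<omega>. \<bar>Y \<omega> * Z \<omega>\<bar> ^ p)"
    by (intro Bochner_Integration.integrable_bound[OF i]) auto
qed

lemma all_moments_add:
  assumes "all_moments M Y" "all_moments M Z"
  shows "all_moments M (\<lambda>\<omega>. Y \<omega> + Z \<omega>)"
  unfolding all_moments_def
proof safe
  have [measurable]: "Y \<in> borel_measurable M" "Z \<in> borel_measurable M"
    using assms by (auto simp: all_moments_def)
  show "(\<lambda>\<omega>. Y \<omega> + Z \<omega>) \<in> borel_measurable M" by measurable
  fix p :: nat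
  have i: "integrable M (\<lambda>\<omega>. 2 ^ p * (\<bar>Y \<omega>\<bar> ^ p + \<bar>Z \<omega>\<bar> ^ p))"
    using assms unfolding all_moments_def
    by (intro Bochner_Integration.integrable_add integrable_mult_right) blast+
  have "\<bar>Y \<omega> + Z \<omega>\<bar> ^ p \<le> 2 ^ p * (\<bar>Y \<omega>\<bar> ^ p + \<bar>Z \<omega>\<bar> ^ p)" for \<omega>
  proof -
    have "\<bar>Y \<omega> + Z \<omega>\<bar> ^ p \<le> (2 * max \<bar>Y \<omega>\<bar> \<bar>Z \<omega>\<bar>) ^ p"
      by (intro power_mono) (auto simp: max_def)
    also have "\<dots> \<le> 2 ^ p * (\<bar>Y \<omega>\<bar> ^ p + \<bar>Z \<omega>\<bar> ^ p)"
      by (auto simp: power_mult_distrib max_def)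
    finally show ?thesis .
  qed
  then show "integrable M (\<lambda>\<omega>. \<bar>Y \<omega> + Z \<omega>\<bar> ^ p)"
    by (intro Bochner_Integration.integrable_bound[OF i]) auto
qed

lemma (in finite_measure) all_moments_bounded:
  assumes [measurable]: "Y \<in> borel_measurable M" and "\<And>\<omega>. \<bar>Y \<omega>\<bar> \<le> C"
  shows "all_moments M Y"
  unfolding all_moments_def
proof safe
  fix p :: nat
  show "integrable M (\<lambda>\<omega>. \<bar>Y \<omega>\<bar> ^ p)"
    by (rule integrable_const_bound[where B = "C ^ p"]) (auto intro!: power_mono assms AE_I2)
qed simp

lemma (in finite_measure) all_moments_const: "all_moments M (\<lambda>\<omega>. c)"
  by (rule all_moments_bounded[where C = "\<bar>c\<bar>"]) auto

lemma (in finite_measure) all_moments_cmult: "all_moments M Y \<Longrightarrow> all_moments M (\<lambda>\<omega>. c * Y \<omega>)"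
  by (intro all_moments_mult all_moments_const)

lemma (in finite_measure) all_moments_diff:
  "all_moments M Y \<Longrightarrow> all_moments M Z \<Longrightarrow> all_moments M (\<lambda>\<omega>. Y \<omega> - Z \<omega>)"
  using all_moments_add[OF _ all_moments_cmult[of Z "-1"], of Y] by simp

lemma (in finite_measure) all_moments_sum:
  "(\<And>i. i \<in> I \<Longrightarrow> all_moments M (Y i)) \<Longrightarrow> all_moments M (\<lambda>\<omega>. \<Sum>i\<in>I. Y i \<omega>)"
  by (induction I rule: infinite_finite_induct) (auto intro: all_moments_add all_moments_const)

section \<open>Hermite polynomials\<close>

text \<open>Covers all m at once: at m = 0 the truncated subtraction in m - 1 is harmless because
  its term has the factor m.\<close>

lemma hermite_Suc: "hermite (Suc m) x = x * hermite m x - real m * hermite (m - 1) x"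
  by (cases m) auto

lemma hermite_deriv:
  "(hermite m has_real_derivative real m * hermite (m - 1) x) (at x)"
proof (induction m rule: less_induct)
  case (less m)
  consider "m = 0" | "m = 1" | k where "m = Suc (Suc k)" by (metis One_nat_def old.nat.exhaust)
  then show ?case
  proof cases
    case 1
    then show ?thesis by (auto simp: hermite.simps(1)[abs_def] intro!: derivative_eq_intros)
  next
    case 2
    then show ?thesis by (auto simp: hermite.simps(2)[abs_def] intro!: derivative_eq_intros)
  next
    case 3
    have "(hermite (Suc k) has_real_derivative real (Suc k) * hermite k x) (at x)"
      using less.IH[of "Suc k"] 3 by simp
    moreover have "(hermite k has_real_derivative real k * hermite (k - 1) x) (at x)"
      using less.IH[of k] 3 by simp
    ultimately have "((\<lambda>x. x * hermite (Suc k) x - real (Suc k) * hermite k x) has_real_derivative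
      (hermite (Suc k) x + x * (real (Suc k) * hermite k x)) - real (Suc k) * (real k * hermite (k - 1) x)) (at x)"
      by (auto intro!: derivative_eq_intros)
    also have "(hermite (Suc k) x + x * (real (Suc k) * hermite k x)) - real (Suc k) * (real k * hermite (k - 1) x)
      = hermite (Suc k) x + real (Suc k) * (x * hermite k x - real k * hermite (k - 1) x)"
      by (simp add: algebra_simps)
    also have "\<dots> = real m * hermite (m - 1) x"
      unfolding hermite_Suc[of k, symmetric] 3 by (simp add: algebra_simps)
    finally show ?thesis unfolding 3 hermite.simps(3)[abs_def] .
  qed
qed

text \<open>Besides continuity this yields the polynomial prefactors through which Hermite
  polynomials are fitted into the smooth cutoffs.\<close>

lemma hermite_poly: "\<exists>p. \<forall>x. hermite m x = poly p x"
proof (induction m rule: less_induct)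
  case (less m)
  consider "m = 0" | "m = 1" | k where "m = Suc (Suc k)" by (metis One_nat_def old.nat.exhaust)
  then show ?case
  proof cases
    case 1
    then show ?thesis by (intro exI[of _ "[:1:]"]) simp
  next
    case 2
    then show ?thesis by (intro exI[of _ "[:0, 1:]"]) simp
  next
    case 3
    then obtain p q where "\<And>x. hermite (Suc k) x = poly p x" "\<And>x. hermite k x = poly q x"
      using less.IH[of "Suc k"] less.IH[of k] by auto
    then show ?thesis using 3
      by (intro exI[of _ "[:0, 1:] * p - smult (real (Suc k)) q"]) simp
  qed
qed

lemma continuous_on_hermite [continuous_intros]:
  "continuous_on S f \<Longrightarrow> continuous_on S (\<lambda>x. hermite m (f x))"
proof -
  obtain p where "\<And>x. hermite m x = poly p x" using hermite_poly by blast
  then show "continuous_on S f \<Longrightarrow> continuous_on S (\<lambda>x. hermite m (f x))" by (simp add: continuous_intros)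
qed

lemma hermite_measurable [measurable]: "hermite m \<in> borel_measurable borel"
  by (rule borel_measurable_continuous_onI) (rule continuous_on_hermite, simp)

section \<open>Directional and partial derivatives\<close>

lemma tendsto_coordinatewise:
  fixes f :: "'c \<Rightarrow> 'i \<Rightarrow> 'b::topological_space"
  assumes "\<And>i. ((\<lambda>c. f c i) \<longlongrightarrow> l i) F"
  shows "(f \<longlongrightarrow> l) F"
proof -
  have "limitin (product_topology (\<lambda>_. euclidean) UNIV) f l F"
    unfolding limitin_componentwise using assms by simp
  then show ?thesis by (simp add: euclidean_product_topology)
qed

lemma partial_has_derivative:
  assumes "\<And>x. (\<lambda>t. \<psi> (x(i := t))) differentiable (at (x i))"
  shows "((\<lambda>t. \<psi> (x(i := t))) has_real_derivative partial_deriv i \<psi> (x(i := s))) (at s)"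
proof -
  have "(\<lambda>t. \<psi> (x(i := t))) differentiable (at s)"
    using assms[of "x(i := s)"] by simp
  then show ?thesis
    by (auto simp: partial_deriv_def DERIV_deriv_iff_real_differentiable)
qed

text \<open>The chain rule for continuous partial derivatives: the displacement is performed one
  coordinate at a time, and the mean value theorem turns each increment into a partial derivative at
  a point that tends to x.\<close>

lemma directional_derivative:
  fixes \<psi> :: "(nat \<Rightarrow> real) \<Rightarrow> real"
  assumes dep: "depends_on_first n \<psi>"
    and diff: "\<And>i x. i < n \<Longrightarrow> (\<lambda>t. \<psi> (x(i := t))) differentiable (at (x i))"
    and cont: "\<And>i. i < n \<Longrightarrow> continuous_on UNIV (partial_deriv i \<psi>)"
  shows "((\<lambda>t. \<psi> (\<lambda>j. x j + t * a j)) has_real_derivative (\<Sum>i<n. a i * partial_deriv i \<psi> x)) (at 0)"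
proof -
  \<comment> \<open>The displaced point in which only the coordinates below k have moved; the
    induction runs over k up to n.\<close>
  define \<gamma> where "\<gamma> k t j = (if j < k then x j + t * a j else x j)" for k :: nat and t :: real and j
  have "((\<lambda>t. \<psi> (\<gamma> k t)) has_real_derivative (\<Sum>i<k. a i * partial_deriv i \<psi> x)) (at 0)" if "k \<le> n" for k
    using that
  proof (induction k)
    case 0
    then show ?case by (simp add: \<gamma>_def)
  next
    case (Suc k)
    define D where "D t = \<psi> (\<gamma> (Suc k) t) - \<psi> (\<gamma> k t)" for t
    have \<gamma>1: "\<gamma> (Suc k) t = (\<gamma> k t)(k := x k + 1 * t * a k)" and \<gamma>0: "\<gamma> k t = (\<gamma> k t)(k := x k + 0 * t * a k)" for t
      by (auto simp: \<gamma>_def fun_eq_iff)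
    have "\<exists>\<theta>. 0 < \<theta> \<and> \<theta> < 1 \<and> D t = t * a k * partial_deriv k \<psi> ((\<gamma> k t)(k := x k + \<theta> * t * a k))" for t
    proof -
      have "((\<lambda>r. \<psi> ((\<gamma> k t)(k := x k + r * t * a k))) has_real_derivative
          partial_deriv k \<psi> ((\<gamma> k t)(k := x k + r * t * a k)) * (t * a k)) (at r)" for r
      proof (rule DERIV_chain2[where f = "\<lambda>s. \<psi> ((\<gamma> k t)(k := s))" and g = "\<lambda>r. x k + r * t * a k"])
        show "((\<lambda>s. \<psi> ((\<gamma> k t)(k := s))) has_real_derivative
          partial_deriv k \<psi> ((\<gamma> k t)(k := x k + r * t * a k))) (at (x k + r * t * a k))"
          by (rule partial_has_derivative) (use diff Suc.prems in auto)
      qed (auto intro!: derivative_eq_intros)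
      from MVT2[of 0 1, OF _ this] obtain \<theta> where "0 < \<theta>" "\<theta> < 1"
        "\<psi> ((\<gamma> k t)(k := x k + 1 * t * a k)) - \<psi> ((\<gamma> k t)(k := x k + 0 * t * a k))
          = (1 - 0) * (partial_deriv k \<psi> ((\<gamma> k t)(k := x k + \<theta> * t * a k)) * (t * a k))"
        by auto
      then show ?thesis unfolding D_def \<gamma>1[symmetric] \<gamma>0[symmetric]
        by (intro exI[of _ \<theta>]) simp
    qed
    then obtain \<theta> where \<theta>: "0 < \<theta> t" "\<theta> t < 1"
      "D t = t * a k * partial_deriv k \<psi> ((\<gamma> k t)(k := x k + \<theta> t * t * a k))" for t by metis
    have lim: "((\<lambda>t. (\<gamma> k t)(k := x k + \<theta> t * t * a k)) \<longlongrightarrow> x) (at 0)"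
    proof (rule tendsto_coordinatewise)
      fix i
      have "((\<lambda>t. \<theta> t * t * a k) \<longlongrightarrow> 0) (at 0)"
      proof (rule Lim_null_comparison)
        show "\<forall>\<^sub>F t in at 0. norm (\<theta> t * t * a k) \<le> \<bar>t\<bar> * \<bar>a k\<bar>"
        proof (intro always_eventually allI)
          fix t
          have "\<bar>\<theta> t\<bar> * (\<bar>t\<bar> * \<bar>a k\<bar>) \<le> 1 * (\<bar>t\<bar> * \<bar>a k\<bar>)"
            using \<theta>(1,2)[of t] by (intro mult_right_mono) auto
          then show "norm (\<theta> t * t * a k) \<le> \<bar>t\<bar> * \<bar>a k\<bar>" by (simp add: abs_mult mult_ac)
        qed
        show "((\<lambda>t. \<bar>t\<bar> * \<bar>a k\<bar>) \<longlongrightarrow> 0) (at 0)"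
          by (auto intro!: tendsto_eq_intros)
      qed
      from tendsto_add[OF tendsto_const[of "x k"] this]
      have "((\<lambda>t. x k + \<theta> t * t * a k) \<longlongrightarrow> x k) (at 0)" by simp
      moreover have "((\<lambda>t. \<gamma> k t i) \<longlongrightarrow> x i) (at 0)"
        by (cases "i < k") (auto simp: \<gamma>_def intro!: tendsto_eq_intros)
      ultimately show "((\<lambda>t. ((\<gamma> k t)(k := x k + \<theta> t * t * a k)) i) \<longlongrightarrow> x i) (at 0)"
        by (cases "i = k") auto
    qed
    have "isCont (partial_deriv k \<psi>) x"
      using cont[of k] Suc.prems by (simp add: continuous_on_eq_continuous_at)
    then have "((\<lambda>t. a k * partial_deriv k \<psi> ((\<gamma> k t)(k := x k + \<theta> t * t * a k))) \<longlongrightarrow> a k * partial_deriv k \<psi> x) (at 0)"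
      by (intro tendsto_mult tendsto_const isCont_tendsto_compose[OF _ lim])
    moreover have "\<forall>\<^sub>F t in at 0. a k * partial_deriv k \<psi> ((\<gamma> k t)(k := x k + \<theta> t * t * a k)) = (D (0 + t) - D 0) / t"
      using eventually_at_filter[of "\<lambda>t. t \<noteq> 0" 0 UNIV]
      by (auto simp: eventually_at_filter \<theta>(3))
    ultimately have "((\<lambda>t. (D (0 + t) - D 0) / t) \<longlongrightarrow> a k * partial_deriv k \<psi> x) (at 0)"
      by (rule Lim_transform_eventually)
    then have "(D has_real_derivative a k * partial_deriv k \<psi> x) (at 0)"
      unfolding DERIV_def by simp
    then have "((\<lambda>t. \<psi> (\<gamma> k t) + D t) has_real_derivative (\<Sum>i<k. a i * partial_deriv i \<psi> x) + a k * partial_deriv k \<psi> x) (at 0)"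
      using Suc by (intro DERIV_add) auto
    then show ?case by (simp add: D_def)
  qed
  from this[of n] have "((\<lambda>t. \<psi> (\<gamma> n t)) has_real_derivative (\<Sum>i<n. a i * partial_deriv i \<psi> x)) (at 0)" by simp
  moreover have "\<psi> (\<gamma> n t) = \<psi> (\<lambda>j. x j + t * a j)" for t
    using dep unfolding depends_on_first_def by (auto simp: \<gamma>_def)
  ultimately show ?thesis by simp
qed

lemma depends_on_first_partial_deriv:
  assumes "depends_on_first n \<psi>"
  shows "depends_on_first n (partial_deriv i \<psi>)"
  unfolding depends_on_first_def
proof safe
  fix x y :: "nat \<Rightarrow> real" assume eq: "\<forall>i<n. x i = y i"
  show "partial_deriv i \<psi> x = partial_deriv i \<psi> y"
  proof (cases "i < n")
    case True
    have "\<psi> (x(i := t)) = \<psi> (y(i := t))" for t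
      using assms eq unfolding depends_on_first_def by auto
    then show ?thesis using eq True by (simp add: partial_deriv_def)
  next
    case False
    have "\<psi> (x(i := t)) = \<psi> x" "\<psi> (y(i := t)) = \<psi> y" for t
      using assms False unfolding depends_on_first_def by (metis fun_upd_other)+
    then show ?thesis by (simp add: partial_deriv_def)
  qed
qed

lemma compactly_supported_partial_deriv:
  assumes "compactly_supported n \<psi>" "i < n"
  shows "compactly_supported n (partial_deriv i \<psi>)"
proof -
  obtain R where R: "\<And>x. \<psi> x \<noteq> 0 \<Longrightarrow> \<forall>i<n. \<bar>x i\<bar> \<le> R"
    using assms by (auto simp: compactly_supported_def)
  have "\<bar>x j\<bar> \<le> R" if "partial_deriv i \<psi> x \<noteq> 0" "j < n" for x j
  proof (rule ccontr)
    assume j: "\<not> \<bar>x j\<bar> \<le> R"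
    have "\<forall>\<^sub>F t in nhds (x i). \<psi> (x(i := t)) = 0"
    proof (cases "i = j")
      case True
      have "open {t. R < \<bar>t\<bar>}" by (intro open_Collect_less continuous_intros)
      then have "\<forall>\<^sub>F t in nhds (x i). t \<in> {t. R < \<bar>t\<bar>}"
        using j True by (intro eventually_nhds_in_open) auto
      then show ?thesis by eventually_elim (use R \<open>j < n\<close> True in \<open>force\<close>)
    next
      case False
      then show ?thesis using R[of "x(i := t)" for t] j \<open>j < n\<close>
        by (intro always_eventually allI) (metis fun_upd_other)
    qed
    then have "deriv (\<lambda>t. \<psi> (x(i := t))) (x i) = deriv (\<lambda>t. 0) (x i)"
      by (rule deriv_cong_ev) simp
    then show False using that by (simp add: partial_deriv_def)
  qed
  then show ?thesis unfolding compactly_supported_def by blast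
qed

text \<open>The support is bounded only in the first n coordinates. Setting the other coordinates to
  0 does not change the value and places the point in a product of intervals and singletons, which
  is compact by Tychonoff.\<close>

lemma compactly_supported_bounded:
  assumes cont: "continuous_on UNIV \<psi>" and dep: "depends_on_first n \<psi>" and supp: "compactly_supported n \<psi>"
  shows "\<exists>C. \<forall>x. \<bar>\<psi> x\<bar> \<le> C"
proof -
  obtain R where R: "\<And>x. \<psi> x \<noteq> 0 \<Longrightarrow> \<forall>i<n. \<bar>x i\<bar> \<le> R"
    using supp by (auto simp: compactly_supported_def)
  let ?S = "\<lambda>i. if i < n then {-R..R} else {0::real}"
  have "compactin (product_topology (\<lambda>_. euclidean) UNIV) (PiE UNIV ?S)"
    unfolding compactin_PiE by auto
  then have "compact (PiE UNIV ?S)"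
    by (simp add: euclidean_product_topology)
  then have "compact (\<psi> ` PiE UNIV ?S)"
    by (intro compact_continuous_image continuous_on_subset[OF cont]) auto
  then obtain C where C: "\<And>y. y \<in> PiE UNIV ?S \<Longrightarrow> \<bar>\<psi> y\<bar> \<le> C"
    using compact_imp_bounded bounded_iff by (metis imageI real_norm_def)
  have "\<bar>\<psi> x\<bar> \<le> \<bar>C\<bar>" for x
  proof (cases "\<psi> x = 0")
    case False
    let ?y = "\<lambda>i. if i < n then x i else 0"
    have "\<psi> x = \<psi> ?y" using dep unfolding depends_on_first_def by auto
    moreover have "?y \<in> PiE UNIV ?S" using R[OF False] by (auto simp: abs_le_iff minus_le_iff)
    ultimately show ?thesis using C[of ?y] by linarith
  qed simp
  then show ?thesis by blast
qed

lemma smooth_iter: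
  assumes "smooth n \<psi>" "set is \<subseteq> {..<n}"
  shows "continuous_on UNIV (iter_partial_deriv is \<psi>)"
    and "i < n \<Longrightarrow> (\<lambda>t. iter_partial_deriv is \<psi> (x(i := t))) differentiable (at (x i))"
  using assms by (auto simp: smooth_def lists_eq_set)

section \<open>Directional derivatives of cylindrical variables\<close>

context isonormal_gaussian
begin

text \<open>\<open>F'\<close> is the pairing of the Malliavin derivative of \<open>F\<close> with \<open>h\<close>; in contrast to
  \<^const>\<open>cylindrical_graph\<close>, unbounded variables such as Hermite polynomials are included.\<close>

definition cyl_deriv :: "'h \<Rightarrow> ('a \<Rightarrow> real) \<Rightarrow> ('a \<Rightarrow> real) \<Rightarrow> bool" where
  "cyl_deriv h F F' \<longleftrightarrow> (\<exists>(\<phi> :: nat \<Rightarrow> 'h) \<Psi> \<Psi>'.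
     continuous_on UNIV \<Psi> \<and> continuous_on UNIV \<Psi>' \<and>
     (\<forall>x. ((\<lambda>t. \<Psi> (\<lambda>j. x j + t * (\<phi> j \<bullet> h))) has_real_derivative \<Psi>' x) (at 0)) \<and>
     F = (\<lambda>\<omega>. \<Psi> (\<lambda>j. X (\<phi> j) \<omega>)) \<and> F' = (\<lambda>\<omega>. \<Psi>' (\<lambda>j. X (\<phi> j) \<omega>)))"

lemma cyl_derivI:
  fixes \<phi> :: "nat \<Rightarrow> 'h"
  assumes "continuous_on UNIV \<Psi>" "continuous_on UNIV \<Psi>'"
    and "\<And>x. ((\<lambda>t. \<Psi> (\<lambda>j. x j + t * (\<phi> j \<bullet> h))) has_real_derivative \<Psi>' x) (at 0)"
  shows "cyl_deriv h (\<lambda>\<omega>. \<Psi> (\<lambda>j. X (\<phi> j) \<omega>)) (\<lambda>\<omega>. \<Psi>' (\<lambda>j. X (\<phi> j) \<omega>))"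
  unfolding cyl_deriv_def using assms by blast

lemma cyl_derivE:
  assumes "cyl_deriv h F F'"
  obtains \<phi> :: "nat \<Rightarrow> 'h" and \<Psi> \<Psi>' where "continuous_on UNIV \<Psi>" "continuous_on UNIV \<Psi>'"
    and "\<And>x. ((\<lambda>t. \<Psi> (\<lambda>j. x j + t * (\<phi> j \<bullet> h))) has_real_derivative \<Psi>' x) (at 0)"
    and "F = (\<lambda>\<omega>. \<Psi> (\<lambda>j. X (\<phi> j) \<omega>))" "F' = (\<lambda>\<omega>. \<Psi>' (\<lambda>j. X (\<phi> j) \<omega>))"
  using assms unfolding cyl_deriv_def by blast

lemma cyl_deriv_by_parts:
  assumes "cyl_deriv h F F'" "integrable M F'" "integrable M (\<lambda>\<omega>. F \<omega> * X h \<omega>)"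
  shows "(\<integral>\<omega>. F' \<omega> \<partial>M) = (\<integral>\<omega>. F \<omega> * X h \<omega> \<partial>M)"
  using assms(1)
proof (rule cyl_derivE)
  fix \<phi> :: "nat \<Rightarrow> 'h" and \<Psi> \<Psi>'
  assume *: "continuous_on UNIV \<Psi>" "continuous_on UNIV \<Psi>'"
    "\<And>x. ((\<lambda>t. \<Psi> (\<lambda>j. x j + t * (\<phi> j \<bullet> h))) has_real_derivative \<Psi>' x) (at 0)"
    "F = (\<lambda>\<omega>. \<Psi> (\<lambda>j. X (\<phi> j) \<omega>))" "F' = (\<lambda>\<omega>. \<Psi>' (\<lambda>j. X (\<phi> j) \<omega>))"
  show ?thesis
    using integration_by_parts[OF *(1-3)] assms(2,3) unfolding *(4,5) by blast
qed

lemma cyl_deriv_X: "cyl_deriv h (X k) (\<lambda>\<omega>. k \<bullet> h)"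
proof -
  have "cyl_deriv h (\<lambda>\<omega>. (\<lambda>x. x 0) (\<lambda>j. X ((\<lambda>_. k) j) \<omega>)) (\<lambda>\<omega>. (\<lambda>_. k \<bullet> h) (\<lambda>j. X ((\<lambda>_. k) j) \<omega>))"
    by (rule cyl_derivI) (auto intro!: derivative_eq_intros continuous_on_product_coordinates)
  then show ?thesis by simp
qed

lemma cyl_deriv_mult:
  assumes F: "cyl_deriv h F F'" and G: "cyl_deriv h G G'"
  shows "cyl_deriv h (\<lambda>\<omega>. F \<omega> * G \<omega>) (\<lambda>\<omega>. F' \<omega> * G \<omega> + F \<omega> * G' \<omega>)"
proof -
  obtain \<phi> :: "nat \<Rightarrow> 'h" and \<Psi> \<Psi>' where F: "continuous_on UNIV \<Psi>" "continuous_on UNIV \<Psi>'"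
    "\<And>x. ((\<lambda>t. \<Psi> (\<lambda>j. x j + t * (\<phi> j \<bullet> h))) has_real_derivative \<Psi>' x) (at 0)"
    "F = (\<lambda>\<omega>. \<Psi> (\<lambda>j. X (\<phi> j) \<omega>))" "F' = (\<lambda>\<omega>. \<Psi>' (\<lambda>j. X (\<phi> j) \<omega>))"
    using F by (rule cyl_derivE) blast
  obtain \<gamma> :: "nat \<Rightarrow> 'h" and \<Gamma> \<Gamma>' where G: "continuous_on UNIV \<Gamma>" "continuous_on UNIV \<Gamma>'"
    "\<And>x. ((\<lambda>t. \<Gamma> (\<lambda>j. x j + t * (\<gamma> j \<bullet> h))) has_real_derivative \<Gamma>' x) (at 0)"
    "G = (\<lambda>\<omega>. \<Gamma> (\<lambda>j. X (\<gamma> j) \<omega>))" "G' = (\<lambda>\<omega>. \<Gamma>' (\<lambda>j. X (\<gamma> j) \<omega>))"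
    using G by (rule cyl_derivE) blast
  \<comment> \<open>Interleaving makes both variables functions of the same sequence.\<close>
  define \<kappa> where "\<kappa> j = (if even j then \<phi> (j div 2) else \<gamma> (j div 2))" for j
  have c: "continuous_on UNIV (\<lambda>x :: nat \<Rightarrow> real. \<Theta> (\<lambda>j. x (2 * j)))"
    "continuous_on UNIV (\<lambda>x :: nat \<Rightarrow> real. \<Theta> (\<lambda>j. x (2 * j + 1)))"
    if "continuous_on UNIV \<Theta>" for \<Theta> :: "(nat \<Rightarrow> real) \<Rightarrow> real"
    by (rule continuous_on_compose2[OF that];
        auto intro!: continuous_on_coordinatewise_then_product continuous_on_product_coordinates)+
  have "cyl_deriv h (\<lambda>\<omega>. (\<lambda>x. \<Psi> (\<lambda>j. x (2 * j)) * \<Gamma> (\<lambda>j. x (2 * j + 1))) (\<lambda>j. X (\<kappa> j) \<omega>))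
     (\<lambda>\<omega>. (\<lambda>x. \<Psi>' (\<lambda>j. x (2 * j)) * \<Gamma> (\<lambda>j. x (2 * j + 1)) + \<Psi> (\<lambda>j. x (2 * j)) * \<Gamma>' (\<lambda>j. x (2 * j + 1)))
        (\<lambda>j. X (\<kappa> j) \<omega>))"
  proof (rule cyl_derivI)
    fix x :: "nat \<Rightarrow> real"
    have "((\<lambda>t. \<Psi> (\<lambda>j. x (2 * j) + t * (\<phi> j \<bullet> h)) * \<Gamma> (\<lambda>j. x (2 * j + 1) + t * (\<gamma> j \<bullet> h))) has_real_derivative
       \<Psi>' (\<lambda>j. x (2 * j)) * \<Gamma> (\<lambda>j. x (2 * j + 1) + 0 * (\<gamma> j \<bullet> h))
       + \<Gamma>' (\<lambda>j. x (2 * j + 1)) * \<Psi> (\<lambda>j. x (2 * j) + 0 * (\<phi> j \<bullet> h))) (at 0)"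
      by (rule DERIV_mult[OF F(3) G(3)])
    then show "((\<lambda>t. \<Psi> (\<lambda>j. x (2 * j) + t * (\<kappa> (2 * j) \<bullet> h)) * \<Gamma> (\<lambda>j. x (2 * j + 1) + t * (\<kappa> (2 * j + 1) \<bullet> h)))
      has_real_derivative
       \<Psi>' (\<lambda>j. x (2 * j)) * \<Gamma> (\<lambda>j. x (2 * j + 1)) + \<Psi> (\<lambda>j. x (2 * j)) * \<Gamma>' (\<lambda>j. x (2 * j + 1))) (at 0)"
      by (simp add: \<kappa>_def mult.commute)
  qed (intro continuous_intros c F G)+
  then show ?thesis by (simp add: F G \<kappa>_def)
qed

lemma cyl_deriv_compose:
  assumes F: "cyl_deriv h F F'" and f: "\<And>x. (f has_real_derivative f' x) (at x)" and f': "continuous_on UNIV f'"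
  shows "cyl_deriv h (\<lambda>\<omega>. f (F \<omega>)) (\<lambda>\<omega>. f' (F \<omega>) * F' \<omega>)"
proof -
  obtain \<phi> :: "nat \<Rightarrow> 'h" and \<Psi> \<Psi>' where F: "continuous_on UNIV \<Psi>" "continuous_on UNIV \<Psi>'"
    "\<And>x. ((\<lambda>t. \<Psi> (\<lambda>j. x j + t * (\<phi> j \<bullet> h))) has_real_derivative \<Psi>' x) (at 0)"
    "F = (\<lambda>\<omega>. \<Psi> (\<lambda>j. X (\<phi> j) \<omega>))" "F' = (\<lambda>\<omega>. \<Psi>' (\<lambda>j. X (\<phi> j) \<omega>))"
    using F by (rule cyl_derivE) blast
  have cf: "continuous_on UNIV f"
    using f DERIV_isCont by (blast intro: continuous_at_imp_continuous_on)
  have "cyl_deriv h (\<lambda>\<omega>. (\<lambda>x. f (\<Psi> x)) (\<lambda>j. X (\<phi> j) \<omega>)) (\<lambda>\<omega>. (\<lambda>x. f' (\<Psi> x) * \<Psi>' x) (\<lambda>j. X (\<phi> j) \<omega>))"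
  proof (rule cyl_derivI)
    fix x :: "nat \<Rightarrow> real"
    have "(f has_real_derivative f' (\<Psi> x)) (at (\<Psi> (\<lambda>j. x j + 0 * (\<phi> j \<bullet> h))))" using f by simp
    from DERIV_chain2[OF this F(3)]
    show "((\<lambda>t. f (\<Psi> (\<lambda>j. x j + t * (\<phi> j \<bullet> h)))) has_real_derivative f' (\<Psi> x) * \<Psi>' x) (at 0)" .
  qed (auto intro!: continuous_intros continuous_on_compose2[OF cf] continuous_on_compose2[OF f'] F)
  then show ?thesis by (simp add: F)
qed

lemma cyl_deriv_hermite:
  "cyl_deriv h (\<lambda>\<omega>. hermite m (X k \<omega>)) (\<lambda>\<omega>. real m * hermite (m - 1) (X k \<omega>) * (k \<bullet> h))"
  by (rule cyl_deriv_compose[OF cyl_deriv_X hermite_deriv]) (intro continuous_intros)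

lemma cyl_deriv_partials:
  assumes "depends_on_first n \<psi>" "continuous_on UNIV \<psi>"
    and "\<And>i x. i < n \<Longrightarrow> (\<lambda>t. \<psi> (x(i := t))) differentiable (at (x i))"
    and "\<And>i. i < n \<Longrightarrow> continuous_on UNIV (partial_deriv i \<psi>)"
  shows "cyl_deriv h (\<lambda>\<omega>. \<psi> (\<lambda>j. X (\<phi> j) \<omega>)) (\<lambda>\<omega>. \<Sum>i<n. (\<phi> i \<bullet> h) * partial_deriv i \<psi> (\<lambda>j. X (\<phi> j) \<omega>))"
  by (rule cyl_derivI[where \<Psi>' = "\<lambda>x. \<Sum>i<n. (\<phi> i \<bullet> h) * partial_deriv i \<psi> x"])
    (use assms in \<open>auto intro!: directional_derivative continuous_intros\<close>)

lemma all_moments_X: "all_moments M (X h)"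
  using X_abs_moments by (auto simp: all_moments_def)

lemma all_moments_hermite: "all_moments M (\<lambda>\<omega>. hermite m (X h \<omega>))"
proof (induction m rule: less_induct)
  case (less m)
  consider "m = 0" | "m = 1" | k where "m = Suc (Suc k)" by (metis One_nat_def old.nat.exhaust)
  then show ?case
  proof cases
    case 3
    then show ?thesis using less
      by (auto intro!: all_moments_diff all_moments_mult all_moments_cmult all_moments_X)
  qed (auto simp: all_moments_X all_moments_const)
qed

lemmas all_moments_intros = all_moments_mult all_moments_hermite all_moments_X all_moments_const
  all_moments_add all_moments_diff all_moments_sum

text \<open>H_(n+1)(X(k)) is the divergence of H_n(X(k)) k. Integration by parts for G H_n(X(k))
  produces X(k) H_n(X(k)) minus the derivative n H_(n-1)(X(k)), which the recurrence recognises as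
  H_(n+1)(X(k)).\<close>

lemma hermite_by_parts:
  assumes k: "norm k = 1" and G: "cyl_deriv k G G'" and m: "all_moments M G" "all_moments M G'"
  shows "(\<integral>\<omega>. G \<omega> * hermite (Suc n) (X k \<omega>) \<partial>M) = (\<integral>\<omega>. G' \<omega> * hermite n (X k \<omega>) \<partial>M)"
proof -
  have kk: "k \<bullet> k = 1" using k by (simp add: norm_eq_1)
  have "cyl_deriv k (\<lambda>\<omega>. G \<omega> * hermite n (X k \<omega>))
      (\<lambda>\<omega>. G' \<omega> * hermite n (X k \<omega>) + G \<omega> * (real n * hermite (n - 1) (X k \<omega>) * (k \<bullet> k)))"
    by (rule cyl_deriv_mult[OF G cyl_deriv_hermite])
  then have "(\<integral>\<omega>. G' \<omega> * hermite n (X k \<omega>) + G \<omega> * (real n * hermite (n - 1) (X k \<omega>) * (k \<bullet> k)) \<partial>M)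
     = (\<integral>\<omega>. G \<omega> * hermite n (X k \<omega>) * X k \<omega> \<partial>M)"
    by (rule cyl_deriv_by_parts) (intro all_moments_integrable all_moments_intros m)+
  then have *: "(\<integral>\<omega>. G \<omega> * hermite n (X k \<omega>) * X k \<omega> \<partial>M)
     = (\<integral>\<omega>. G' \<omega> * hermite n (X k \<omega>) \<partial>M) + (\<integral>\<omega>. G \<omega> * (real n * hermite (n - 1) (X k \<omega>)) \<partial>M)"
    unfolding kk mult_1_right
    by (subst (asm) Bochner_Integration.integral_add) ((intro all_moments_integrable all_moments_intros m)+, simp)
  have "(\<integral>\<omega>. G \<omega> * hermite (Suc n) (X k \<omega>) \<partial>M)
     = (\<integral>\<omega>. G \<omega> * hermite n (X k \<omega>) * X k \<omega> - G \<omega> * (real n * hermite (n - 1) (X k \<omega>)) \<partial>M)"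
    by (simp add: hermite_Suc[of n] algebra_simps)
  also have "\<dots> = (\<integral>\<omega>. G \<omega> * hermite n (X k \<omega>) * X k \<omega> \<partial>M) - (\<integral>\<omega>. G \<omega> * (real n * hermite (n - 1) (X k \<omega>)) \<partial>M)"
    by (rule Bochner_Integration.integral_diff) (intro all_moments_integrable all_moments_intros m)+
  finally show ?thesis using * by simp
qed

text \<open>Both indices drop by one, so different indices end in the mean of a single Hermite
  variable of positive order, which is 0. The same identity gives the norm of the derivative on a
  chaos.\<close>

lemma expectation_hermite_mult_Suc:
  assumes k: "norm k = 1"
  shows "(\<integral>\<omega>. hermite m (X h \<omega>) * hermite (Suc n) (X k \<omega>) \<partial>M)
    = real m * (h \<bullet> k) * (\<integral>\<omega>. hermite (m - 1) (X h \<omega>) * hermite n (X k \<omega>) \<partial>M)"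
proof -
  have "(\<integral>\<omega>. hermite m (X h \<omega>) * hermite (Suc n) (X k \<omega>) \<partial>M)
    = (\<integral>\<omega>. (real m * hermite (m - 1) (X h \<omega>) * (h \<bullet> k)) * hermite n (X k \<omega>) \<partial>M)"
    by (rule hermite_by_parts[OF k cyl_deriv_hermite])
      (auto intro!: all_moments_mult all_moments_hermite all_moments_const)
  also have "\<dots> = (\<integral>\<omega>. (real m * (h \<bullet> k)) * (hermite (m - 1) (X h \<omega>) * hermite n (X k \<omega>)) \<partial>M)"
    by (simp add: mult_ac)
  finally show ?thesis by simp
qed

lemma expectation_hermite: "norm k = 1 \<Longrightarrow> n > 0 \<Longrightarrow> (\<integral>\<omega>. hermite n (X k \<omega>) \<partial>M) = 0"
  using expectation_hermite_mult_Suc[of k 0 k "n - 1"] by simp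

lemma hermite_orthogonal:
  assumes "norm h = 1" "norm k = 1" "m \<noteq> n"
  shows "(\<integral>\<omega>. hermite m (X h \<omega>) * hermite n (X k \<omega>) \<partial>M) = 0"
  using assms(3)
proof (induction n arbitrary: m)
  case 0
  then show ?case using expectation_hermite[OF assms(1), of m] by simp
next
  case (Suc n)
  then show ?case
    by (cases m) (auto simp: expectation_hermite_mult_Suc[OF assms(2)] expectation_hermite[OF assms(2)])
qed

section \<open>The divergence of the gradient of a test variable\<close>

lemma cylindrical_bounds:
  assumes dep: "depends_on_first n \<psi>" and sm: "smooth n \<psi>" and supp: "compactly_supported n \<psi>"
    and idx: "set is \<subseteq> {..<n}"
  shows "depends_on_first n (iter_partial_deriv is \<psi>)" "compactly_supported n (iter_partial_deriv is \<psi>)"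
    and "\<exists>C. \<forall>x. \<bar>iter_partial_deriv is \<psi> x\<bar> \<le> C"
proof -
  show d: "depends_on_first n (iter_partial_deriv is \<psi>)"
    by (induction "is") (auto simp: dep depends_on_first_partial_deriv)
  show c: "compactly_supported n (iter_partial_deriv is \<psi>)"
    using idx by (induction "is") (auto simp: supp compactly_supported_partial_deriv)
  show "\<exists>C. \<forall>x. \<bar>iter_partial_deriv is \<psi> x\<bar> \<le> C"
    by (rule compactly_supported_bounded[OF smooth_iter(1)[OF sm idx] d c])
qed

lemma all_moments_cylindrical:
  assumes "depends_on_first n \<psi>" "smooth n \<psi>" "compactly_supported n \<psi>" "set is \<subseteq> {..<n}"
  shows "all_moments M (\<lambda>\<omega>. iter_partial_deriv is \<psi> (\<lambda>j. X (\<phi> j) \<omega>))"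
proof -
  obtain C where C: "\<And>x. \<bar>iter_partial_deriv is \<psi> x\<bar> \<le> C" using cylindrical_bounds(3)[OF assms] by blast
  show ?thesis
    by (rule all_moments_bounded[where C = C])
      (auto intro!: measurable_compose[OF X_sequence_measurable] borel_measurable_continuous_onI smooth_iter(1)[OF assms(2,4)] C)
qed

lemma cyl_deriv_cylindrical:
  assumes "depends_on_first n \<psi>" "smooth n \<psi>" "compactly_supported n \<psi>" "set is \<subseteq> {..<n}"
  shows "cyl_deriv h (\<lambda>\<omega>. iter_partial_deriv is \<psi> (\<lambda>j. X (\<phi> j) \<omega>))
    (\<lambda>\<omega>. \<Sum>i<n. (\<phi> i \<bullet> h) * iter_partial_deriv (i # is) \<psi> (\<lambda>j. X (\<phi> j) \<omega>))"
  unfolding iter_partial_deriv.simps(2)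
proof (rule cyl_deriv_partials)
  fix i assume "i < n"
  then show "continuous_on UNIV (partial_deriv i (iter_partial_deriv is \<psi>))"
    using smooth_iter(1)[OF assms(2), of "i # is"] assms(4) by simp
qed (fact cylindrical_bounds(1)[OF assms] smooth_iter[OF assms(2,4)])+

text \<open>The witness is the divergence of the gradient of \<open>F\<close>, that is
  \<open>U = (\<Sum>i<n. p i * X (\<phi> i) - \<langle>D (p i), \<phi> i\<rangle>)\<close> for \<open>DF = (\<Sum>i<n. p i * \<phi> i)\<close>.\<close>

lemma divergence_of_test_gradient:
  fixes \<phi> :: "nat \<Rightarrow> 'h"
  assumes cyl: "depends_on_first n \<psi>" "smooth n \<psi>" "compactly_supported n \<psi>"
    and f: "\<And>x. (f has_real_derivative f' x) (at x)" "\<And>x. (f' has_real_derivative f'' x) (at x)"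
      "continuous_on UNIV f''"
    and bdd: "\<And>x. \<bar>f' x\<bar> \<le> C1" "\<And>x. \<bar>f'' x\<bar> \<le> C2"
  defines "F \<equiv> \<lambda>\<omega>. f (\<psi> (\<lambda>j. X (\<phi> j) \<omega>)) - f 0"
    and "DF \<equiv> \<lambda>\<omega>. \<Sum>i<n. (f' (\<psi> (\<lambda>j. X (\<phi> j) \<omega>)) * partial_deriv i \<psi> (\<lambda>j. X (\<phi> j) \<omega>)) *\<^sub>R \<phi> i"
  shows "F \<in> L2 M"
    and "\<exists>U\<in>L2 M. (\<forall>(F1, G1) \<in> cylindrical_graph X. (\<integral>\<omega>. F1 \<omega> * U \<omega> \<partial>M) = (\<integral>\<omega>. DF \<omega> \<bullet> G1 \<omega> \<partial>M))
    \<and> (\<forall>m h. norm h = 1 \<longrightarrow> (\<integral>\<omega>. hermite m (X h \<omega>) * U \<omega> \<partial>M) = real m * (\<integral>\<omega>. F \<omega> * hermite m (X h \<omega>) \<partial>M))"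
proof -
  let ?V = "\<lambda>\<omega> j. X (\<phi> j) \<omega>"
  define d where "d i \<omega> = partial_deriv i \<psi> (?V \<omega>)" for i \<omega>
  define d2 where "d2 j i \<omega> = partial_deriv j (partial_deriv i \<psi>) (?V \<omega>)" for j i \<omega>
  have cf: "continuous_on UNIV f" "continuous_on UNIV f'"
    using f(1,2) DERIV_isCont by (blast intro: continuous_at_imp_continuous_on)+
  have \<psi>m: "(\<lambda>\<omega>. \<psi> (?V \<omega>)) \<in> borel_measurable M"
    using smooth_iter(1)[OF cyl(2), of "[]"] by (auto intro!: measurable_compose[OF X_sequence_measurable] borel_measurable_continuous_onI)
  have mf: "(\<lambda>\<omega>. f (\<psi> (?V \<omega>))) \<in> borel_measurable M" "(\<lambda>\<omega>. f' (\<psi> (?V \<omega>))) \<in> borel_measurable M" "(\<lambda>\<omega>. f'' (\<psi> (?V \<omega>))) \<in> borel_measurable M"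
    by (rule measurable_compose[OF \<psi>m borel_measurable_continuous_onI], fact)+
  have am_f': "all_moments M (\<lambda>\<omega>. f' (\<psi> (?V \<omega>)))" by (rule all_moments_bounded[OF mf(2) bdd(1)])
  have am_f'': "all_moments M (\<lambda>\<omega>. f'' (\<psi> (?V \<omega>)))" by (rule all_moments_bounded[OF mf(3) bdd(2)])
  have am_d: "all_moments M (d i)" if "i < n" for i
    using all_moments_cylindrical[OF cyl, of "[i]" \<phi>] that by (simp add: d_def[abs_def])
  have am_d2: "all_moments M (d2 j i)" if "i < n" "j < n" for i j
    using all_moments_cylindrical[OF cyl, of "[j, i]" \<phi>] that by (simp add: d2_def[abs_def])
  have cyl_\<psi>: "cyl_deriv h (\<lambda>\<omega>. \<psi> (?V \<omega>)) (\<lambda>\<omega>. \<Sum>i<n. (\<phi> i \<bullet> h) * d i \<omega>)" for h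
    using cyl_deriv_cylindrical[OF cyl, of "[]" h \<phi>] by (simp add: d_def)
  have cyl_d: "cyl_deriv h (d i) (\<lambda>\<omega>. \<Sum>j<n. (\<phi> j \<bullet> h) * d2 j i \<omega>)" if "i < n" for i h
    using cyl_deriv_cylindrical[OF cyl, of "[i]" h \<phi>] that by (simp add: d_def[abs_def] d2_def)
  define p where "p i \<omega> = f' (\<psi> (?V \<omega>)) * d i \<omega>" for i \<omega>
  define q where "q i \<omega> = (f'' (\<psi> (?V \<omega>)) * (\<Sum>j<n. (\<phi> j \<bullet> \<phi> i) * d j \<omega>)) * d i \<omega>
      + f' (\<psi> (?V \<omega>)) * (\<Sum>j<n. (\<phi> j \<bullet> \<phi> i) * d2 j i \<omega>)" for i \<omega>
  have am_p: "all_moments M (p i)" if "i < n" for i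
    unfolding p_def[abs_def] by (intro all_moments_mult am_f' am_d that)
  have am_q: "all_moments M (q i)" if "i < n" for i
    unfolding q_def[abs_def]
    by (intro all_moments_add all_moments_mult all_moments_sum all_moments_const am_f' am_f'' am_d am_d2 that) auto
  have cyl_p: "cyl_deriv (\<phi> i) (p i) (q i)" if "i < n" for i
    unfolding p_def[abs_def] q_def[abs_def]
    by (rule cyl_deriv_mult[OF cyl_deriv_compose[OF cyl_\<psi> f(2,3)] cyl_d[OF that]])
  have cyl_F: "cyl_deriv h F (\<lambda>\<omega>. \<Sum>i<n. (\<phi> i \<bullet> h) * p i \<omega>)" for h
  proof -
    have "cyl_deriv h (\<lambda>\<omega>. (\<lambda>x. f x - f 0) (\<psi> (?V \<omega>))) (\<lambda>\<omega>. f' (\<psi> (?V \<omega>)) * (\<Sum>i<n. (\<phi> i \<bullet> h) * d i \<omega>))"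
      by (rule cyl_deriv_compose[OF cyl_\<psi> _ cf(2)]) (auto intro!: derivative_eq_intros f)
    then show ?thesis by (simp add: F_def p_def sum_distrib_left mult_ac)
  qed
  have am_F: "all_moments M F"
  proof -
    obtain C where C: "\<And>x. \<bar>\<psi> x\<bar> \<le> C" using cylindrical_bounds(3)[OF cyl, of "[]"] by auto
    have "compact (f ` {-C..C})" by (intro compact_continuous_image continuous_on_subset[OF cf(1)]) auto
    then obtain B where B: "\<And>y. y \<in> {-C..C} \<Longrightarrow> \<bar>f y\<bar> \<le> B"
      using compact_imp_bounded bounded_iff by (metis imageI real_norm_def)
    have "all_moments M (\<lambda>\<omega>. f (\<psi> (?V \<omega>)))"
    proof (rule all_moments_bounded[OF mf(1)])
      show "\<bar>f (\<psi> (?V \<omega>))\<bar> \<le> B" for \<omega>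
        by (rule B) (use C[of "?V \<omega>"] in \<open>auto simp: abs_le_iff minus_le_iff\<close>)
    qed
    then show ?thesis unfolding F_def by (intro all_moments_diff all_moments_const)
  qed
  show "F \<in> L2 M" by (rule all_moments_L2[OF am_F])
  define U where "U \<omega> = (\<Sum>i<n. p i \<omega> * X (\<phi> i) \<omega> - q i \<omega>)" for \<omega>
  have am_U: "all_moments M U"
    unfolding U_def[abs_def] by (intro all_moments_sum all_moments_diff all_moments_mult all_moments_X am_p am_q) auto
  \<comment> \<open>Integration by parts for \<open>Y * p i\<close> in the direction
    \<open>\<phi> i\<close>: the product rule produces \<open>Y * q i\<close>, which is exactly what
    U subtracts. It is applied to cylindrical Y and to Hermite variables alike.\<close>
  have duality: "(\<integral>\<omega>. Y \<omega> * U \<omega> \<partial>M) = (\<Sum>i<n. \<integral>\<omega>. Y' i \<omega> * p i \<omega> \<partial>M)"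
    if Y: "all_moments M Y" "\<And>i. i < n \<Longrightarrow> all_moments M (Y' i)" "\<And>i. i < n \<Longrightarrow> cyl_deriv (\<phi> i) Y (Y' i)" for Y Y'
  proof -
    have int: "integrable M (\<lambda>\<omega>. Y \<omega> * p i \<omega> * X (\<phi> i) \<omega>)" "integrable M (\<lambda>\<omega>. Y \<omega> * q i \<omega>)" if "i < n" for i
      by (intro all_moments_integrable all_moments_mult Y am_p am_q all_moments_X that)+
    have "(\<integral>\<omega>. Y \<omega> * U \<omega> \<partial>M) = (\<integral>\<omega>. (\<Sum>i<n. Y \<omega> * p i \<omega> * X (\<phi> i) \<omega> - Y \<omega> * q i \<omega>) \<partial>M)"
      by (simp add: U_def sum_distrib_left right_diff_distrib mult.assoc)
    also have "\<dots> = (\<Sum>i<n. (\<integral>\<omega>. Y \<omega> * p i \<omega> * X (\<phi> i) \<omega> \<partial>M) - (\<integral>\<omega>. Y \<omega> * q i \<omega> \<partial>M))"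
      using int by (subst Bochner_Integration.integral_sum) auto
    also have "\<dots> = (\<Sum>i<n. \<integral>\<omega>. Y' i \<omega> * p i \<omega> \<partial>M)"
    proof (rule sum.cong[OF refl])
      fix i assume "i \<in> {..<n}"
      then have i: "i < n" by simp
      have "(\<integral>\<omega>. Y' i \<omega> * p i \<omega> + Y \<omega> * q i \<omega> \<partial>M) = (\<integral>\<omega>. Y \<omega> * p i \<omega> * X (\<phi> i) \<omega> \<partial>M)"
        by (rule cyl_deriv_by_parts[OF cyl_deriv_mult[OF Y(3)[OF i] cyl_p[OF i]]])
          (intro all_moments_integrable all_moments_add all_moments_mult Y am_p am_q all_moments_X i)+
      moreover have "integrable M (\<lambda>\<omega>. Y' i \<omega> * p i \<omega>)" "integrable M (\<lambda>\<omega>. Y \<omega> * q i \<omega>)"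
        by (intro all_moments_integrable all_moments_mult Y am_p am_q i)+
      ultimately show "(\<integral>\<omega>. Y \<omega> * p i \<omega> * X (\<phi> i) \<omega> \<partial>M) - (\<integral>\<omega>. Y \<omega> * q i \<omega> \<partial>M) = (\<integral>\<omega>. Y' i \<omega> * p i \<omega> \<partial>M)"
        by simp
    qed
    finally show ?thesis .
  qed
  have "(\<integral>\<omega>. F1 \<omega> * U \<omega> \<partial>M) = (\<integral>\<omega>. DF \<omega> \<bullet> G1 \<omega> \<partial>M)" if graph: "(F1, G1) \<in> cylindrical_graph X" for F1 G1
  proof -
    obtain l \<psi>1 and \<phi>1 :: "nat \<Rightarrow> 'h" where F1: "F1 = (\<lambda>\<omega>. \<psi>1 (\<lambda>j. X (\<phi>1 j) \<omega>))"
      and G1: "G1 = (\<lambda>\<omega>. \<Sum>i<l. partial_deriv i \<psi>1 (\<lambda>j. X (\<phi>1 j) \<omega>) *\<^sub>R \<phi>1 i)"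
      and cyl1: "depends_on_first l \<psi>1" "smooth l \<psi>1" "compactly_supported l \<psi>1"
      using graph unfolding cylindrical_graph_def by blast
    have am: "all_moments M (\<lambda>\<omega>. partial_deriv i \<psi>1 (\<lambda>j. X (\<phi>1 j) \<omega>))" if "i < l" for i
      using all_moments_cylindrical[OF cyl1, of "[i]" \<phi>1] that by simp
    have am': "all_moments M (\<lambda>\<omega>. G1 \<omega> \<bullet> \<phi> i)" for i
      unfolding G1 inner_sum_left inner_scaleR_left
      by (intro all_moments_sum all_moments_mult am all_moments_const) auto
    have "(\<integral>\<omega>. F1 \<omega> * U \<omega> \<partial>M) = (\<Sum>i<n. \<integral>\<omega>. (G1 \<omega> \<bullet> \<phi> i) * p i \<omega> \<partial>M)"
    proof (rule duality)
      show "all_moments M F1"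
        using all_moments_cylindrical[OF cyl1, of "[]" \<phi>1] by (simp add: F1)
      fix i
      show "cyl_deriv (\<phi> i) F1 (\<lambda>\<omega>. G1 \<omega> \<bullet> \<phi> i)"
        using cyl_deriv_cylindrical[OF cyl1, of "[]" "\<phi> i" \<phi>1]
        by (simp add: F1 G1 inner_sum_left mult.commute)
    qed (rule am')
    also have "\<dots> = (\<integral>\<omega>. (\<Sum>i<n. (G1 \<omega> \<bullet> \<phi> i) * p i \<omega>) \<partial>M)"
      by (rule Bochner_Integration.integral_sum[symmetric]) (intro all_moments_integrable all_moments_mult am' am_p, simp)
    also have "\<dots> = (\<integral>\<omega>. DF \<omega> \<bullet> G1 \<omega> \<partial>M)"
      by (simp add: DF_def inner_sum_left inner_sum_right p_def d_def inner_commute mult_ac)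
    finally show ?thesis .
  qed
  \<comment> \<open>This expresses that U is -LF, with L the Ornstein-Uhlenbeck operator: duality
    lowers the Hermite index and brings out m, and integration by parts on F raises the index
    again.\<close>
  moreover have "(\<integral>\<omega>. hermite m (X h \<omega>) * U \<omega> \<partial>M) = real m * (\<integral>\<omega>. F \<omega> * hermite m (X h \<omega>) \<partial>M)"
    if h: "norm h = 1" for m h
  proof -
    have "(\<integral>\<omega>. hermite m (X h \<omega>) * U \<omega> \<partial>M)
      = (\<Sum>i<n. \<integral>\<omega>. (real m * hermite (m - 1) (X h \<omega>) * (h \<bullet> \<phi> i)) * p i \<omega> \<partial>M)"
      by (rule duality[OF _ _ cyl_deriv_hermite]) (intro all_moments_hermite all_moments_mult all_moments_const)+
    also have "\<dots> = (\<integral>\<omega>. (\<Sum>i<n. (real m * hermite (m - 1) (X h \<omega>) * (h \<bullet> \<phi> i)) * p i \<omega>) \<partial>M)"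
      by (rule Bochner_Integration.integral_sum[symmetric])
        (intro all_moments_integrable all_moments_mult all_moments_hermite all_moments_const am_p, simp)
    also have "\<dots> = (\<integral>\<omega>. real m * ((\<Sum>i<n. (\<phi> i \<bullet> h) * p i \<omega>) * hermite (m - 1) (X h \<omega>)) \<partial>M)"
      by (simp add: sum_distrib_left sum_distrib_right mult_ac inner_commute)
    also have "\<dots> = real m * (\<integral>\<omega>. (\<Sum>i<n. (\<phi> i \<bullet> h) * p i \<omega>) * hermite (m - 1) (X h \<omega>) \<partial>M)"
      by simp
    also have "\<dots> = real m * (\<integral>\<omega>. F \<omega> * hermite m (X h \<omega>) \<partial>M)"
    proof (cases m)
      case (Suc l)
      have "(\<integral>\<omega>. F \<omega> * hermite (Suc l) (X h \<omega>) \<partial>M) = (\<integral>\<omega>. (\<Sum>i<n. (\<phi> i \<bullet> h) * p i \<omega>) * hermite l (X h \<omega>) \<partial>M)"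
        by (rule hermite_by_parts[OF h cyl_F am_F]) (intro all_moments_sum all_moments_mult all_moments_const am_p, simp)
      then show ?thesis by (simp add: Suc)
    qed simp
    finally show ?thesis .
  qed
  ultimately show "\<exists>U\<in>L2 M. (\<forall>(F1, G1) \<in> cylindrical_graph X. (\<integral>\<omega>. F1 \<omega> * U \<omega> \<partial>M) = (\<integral>\<omega>. DF \<omega> \<bullet> G1 \<omega> \<partial>M))
    \<and> (\<forall>m h. norm h = 1 \<longrightarrow> (\<integral>\<omega>. hermite m (X h \<omega>) * U \<omega> \<partial>M) = real m * (\<integral>\<omega>. F \<omega> * hermite m (X h \<omega>) \<partial>M))"
    using all_moments_L2[OF am_U] by blast
qed

end

section \<open>Wiener chaos expansion\<close>

text \<open>The quotient (2n)!/(n!)^2 is a central binomial coefficient, hence at most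
  2^(2n).\<close>

lemma fact_double_le: "fact (2 * n) \<le> (4 ^ n * (fact n)\<^sup>2 :: real)"
proof -
  have "(fact n * fact (2 * n - n) * ((2 * n) choose n) :: nat) = fact (2 * n)"
    by (rule binomial_fact_lemma) simp
  then have "real (fact (2 * n)) = real (fact n) * real (fact n) * real ((2 * n) choose n)"
    by (metis add_diff_cancel_right' mult_2 of_nat_mult)
  also have "\<dots> \<le> real (fact n) * real (fact n) * real (2 ^ (2 * n))"
    using binomial_le_pow2[of "2 * n" n] by (intro mult_left_mono) (auto simp del: of_nat_power)
  also have "\<dots> = 4 ^ n * (fact n)\<^sup>2" by (simp add: power_mult power2_eq_square)
  finally show ?thesis by simp
qed

context isonormal_gaussian
begin

text \<open>The bound contains a single factorial, so it loses against the squared factorial of an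
  exponential Taylor remainder.\<close>

lemma X_even_moment_le:
  assumes "norm h = 1"
  shows "(\<integral>\<omega>. (X h \<omega>) ^ (2 * n) \<partial>M) \<le> 2 ^ n * fact n"
proof -
  have "h \<noteq> 0" using assms by auto
  have "(\<integral>\<omega>. (X h \<omega>) ^ (2 * n) \<partial>M) = (\<integral>x. std_normal_density x * x ^ (2 * n) \<partial>lborel)"
    using distributed_integral[OF distributed_X[OF \<open>h \<noteq> 0\<close>], of "\<lambda>x. x ^ (2 * n)"] assms by simp
  also have "\<dots> = fact (2 * n) / (2 ^ n * fact n)" by (rule integral_std_normal_moment_even)
  also have "\<dots> \<le> (4 ^ n * (fact n)\<^sup>2) / (2 ^ n * fact n)"
    by (intro divide_right_mono fact_double_le) auto
  also have "\<dots> = 2 ^ n * fact n"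
    by (simp add: field_simps power2_eq_square flip: power_mult_distrib)
  finally show ?thesis .
qed

text \<open>Orthogonality to Hermite polynomials passes to all monomials in X(h), then through the
  Taylor series to exp(i t X(h)), and \<open>trig_total\<close> concludes.\<close>

lemma hermite_total:
  assumes U: "U \<in> L2 M" and mean: "(\<integral>\<omega>. U \<omega> \<partial>M) = 0"
    and orth: "\<And>m h. m > 0 \<Longrightarrow> norm h = 1 \<Longrightarrow> (\<integral>\<omega>. U \<omega> * hermite m (X h \<omega>) \<partial>M) = 0"
  shows "AE \<omega> in M. U \<omega> = 0"
proof -
  have [measurable]: "U \<in> borel_measurable M" using U by (auto simp: L2_def)
  have iU: "integrable M U" by (rule L2_imp_integrable[OF U])
  have am_pow: "all_moments M (\<lambda>\<omega>. X h \<omega> ^ n)" for h n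
    by (induction n) (auto intro!: all_moments_intros)
  have iUm: "integrable M (\<lambda>\<omega>. U \<omega> * Y \<omega>)" if "all_moments M Y" for Y
    by (rule integrable_mult_L2[OF U all_moments_L2[OF that]])
  \<comment> \<open>The additional Hermite factor makes the induction close: x H_m = H_(m+1) + m
    H_(m-1) trades a power of x for a change of m.\<close>
  have "(\<integral>\<omega>. U \<omega> * (X h \<omega> ^ n * hermite m (X h \<omega>)) \<partial>M) = 0" if h: "norm h = 1" for h n m
  proof (induction n arbitrary: m)
    case 0
    then show ?case using mean orth[OF _ h, of m] by (cases m) auto
  next
    case (Suc n)
    have "(\<integral>\<omega>. U \<omega> * (X h \<omega> ^ Suc n * hermite m (X h \<omega>)) \<partial>M)
      = (\<integral>\<omega>. U \<omega> * (X h \<omega> ^ n * hermite (Suc m) (X h \<omega>)) + real m * (U \<omega> * (X h \<omega> ^ n * hermite (m - 1) (X h \<omega>))) \<partial>M)"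
      by (simp add: hermite_Suc algebra_simps)
    also have "\<dots> = 0"
      using Suc by (subst Bochner_Integration.integral_add)
        (auto intro!: integrable_mult_right iUm all_moments_intros am_pow)
    finally show ?case .
  qed
  from this[of _ _ 0] have pow0: "(\<integral>\<omega>. U \<omega> * X h \<omega> ^ n \<partial>M) = 0" if "norm h = 1" for h n
    using that by simp
  define B where "B = (\<integral>\<omega>. (norm (U \<omega>))\<^sup>2 \<partial>M)"
  have exp0: "(CLINT \<omega>|M. U \<omega> *\<^sub>R iexp (t * X h \<omega>)) = 0" if h: "norm h = 1" for h t
  proof -
    define c where "c = (CLINT \<omega>|M. U \<omega> *\<^sub>R iexp (t * X h \<omega>))"
    have ic: "integrable M (\<lambda>\<omega>. U \<omega> *\<^sub>R iexp (t * X h \<omega>))"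
      by (rule Bochner_Integration.integrable_bound[OF iU]) auto
    \<comment> \<open>All Taylor terms up to order n have mean 0, so only the remainder is left.
      After Cauchy-Schwarz the moment bound cancels one of its two factorials (n+1)!, and the other
      sends the bound to 0.\<close>
    have bound: "(cmod c)\<^sup>2 \<le> B * ((2 * t\<^sup>2) ^ Suc n /\<^sub>R fact (Suc n))" for n
    proof -
      let ?r = "\<lambda>\<omega>. iexp (t * X h \<omega>) - (\<Sum>k\<le>n. (\<i> * (t * X h \<omega>)) ^ k / fact k)"
      have t_int: "integrable M (\<lambda>\<omega>. U \<omega> *\<^sub>R ((\<i> * (t * X h \<omega>)) ^ k / fact k))"
        and t_zero: "(CLINT \<omega>|M. U \<omega> *\<^sub>R ((\<i> * (t * X h \<omega>)) ^ k / fact k)) = 0" for k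
      proof -
        have e: "U \<omega> *\<^sub>R ((\<i> * (t * X h \<omega>)) ^ k / fact k) = ((\<i> * t) ^ k / fact k) * complex_of_real (U \<omega> * X h \<omega> ^ k)" for \<omega>
          by (simp add: power_mult_distrib scaleR_conv_of_real mult_ac)
        have i: "integrable M (\<lambda>\<omega>. U \<omega> * X h \<omega> ^ k)" by (rule iUm[OF am_pow])
        show "integrable M (\<lambda>\<omega>. U \<omega> *\<^sub>R ((\<i> * (t * X h \<omega>)) ^ k / fact k))"
          unfolding e using i by (intro integrable_mult_right integrable_of_real)
        show "(CLINT \<omega>|M. U \<omega> *\<^sub>R ((\<i> * (t * X h \<omega>)) ^ k / fact k)) = 0"
          unfolding e by (simp only: integral_mult_right_zero integral_complex_of_real pow0[OF h]) simp
      qed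
      have "c = (CLINT \<omega>|M. U \<omega> *\<^sub>R ?r \<omega>)"
        unfolding c_def scaleR_diff_right scaleR_sum_right using ic t_int t_zero by simp
      then have "cmod c \<le> (\<integral>\<omega>. cmod (U \<omega> *\<^sub>R ?r \<omega>) \<partial>M)"
        by (simp only: integral_norm_bound)
      also have "\<dots> \<le> (\<integral>\<omega>. norm (U \<omega>) * norm (\<bar>t * X h \<omega>\<bar> ^ Suc n / fact (Suc n)) \<partial>M)"
      proof (rule integral_mono)
        show "integrable M (\<lambda>\<omega>. cmod (U \<omega> *\<^sub>R ?r \<omega>))"
          unfolding scaleR_diff_right scaleR_sum_right
          by (intro integrable_norm Bochner_Integration.integrable_diff Bochner_Integration.integrable_sum ic t_int)
        have "all_moments M (\<lambda>\<omega>. (\<bar>t\<bar> ^ Suc n / fact (Suc n)) * \<bar>X h \<omega>\<bar> ^ Suc n)"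
        proof (rule all_moments_cmult)
          have "integrable M (\<lambda>\<omega>. \<bar>X h \<omega>\<bar> ^ (Suc n * p))" for p by (rule X_abs_moments)
          then show "all_moments M (\<lambda>\<omega>. \<bar>X h \<omega>\<bar> ^ Suc n)"
            unfolding all_moments_def by (auto simp: abs_mult power_abs power_mult[symmetric] simp del: power_Suc mult_Suc)
        qed
        from integrable_norm_mult_L2[OF U all_moments_L2[OF this]]
        show "integrable M (\<lambda>\<omega>. norm (U \<omega>) * norm (\<bar>t * X h \<omega>\<bar> ^ Suc n / fact (Suc n)))"
          by (simp add: abs_mult power_mult_distrib mult_ac del: power_Suc)
        show "cmod (U \<omega> *\<^sub>R ?r \<omega>) \<le> norm (U \<omega>) * norm (\<bar>t * X h \<omega>\<bar> ^ Suc n / fact (Suc n))" for \<omega>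
        proof -
          have "cmod (U \<omega> *\<^sub>R ?r \<omega>) = \<bar>U \<omega>\<bar> * cmod (?r \<omega>)" by (rule norm_scaleR)
          also have "\<dots> \<le> \<bar>U \<omega>\<bar> * (\<bar>t * X h \<omega>\<bar> ^ Suc n / fact (Suc n))"
            by (rule mult_left_mono[OF iexp_approx1]) simp
          finally show ?thesis by simp
        qed
      qed
      finally have "(cmod c)\<^sup>2 \<le> (\<integral>\<omega>. norm (U \<omega>) * norm (\<bar>t * X h \<omega>\<bar> ^ Suc n / fact (Suc n)) \<partial>M)\<^sup>2"
        by (intro power_mono) auto
      also have "\<dots> \<le> B * (\<integral>\<omega>. (norm (\<bar>t * X h \<omega>\<bar> ^ Suc n / fact (Suc n)))\<^sup>2 \<partial>M)"
        unfolding B_def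
      proof (rule Cauchy_Schwarz_L2[OF U])
        have "integrable M (\<lambda>\<omega>. (\<bar>t\<bar> ^ Suc n / fact (Suc n))\<^sup>2 * \<bar>X h \<omega>\<bar> ^ (Suc n * 2))"
          by (intro integrable_mult_right X_abs_moments)
        then show "(\<lambda>\<omega>. \<bar>t * X h \<omega>\<bar> ^ Suc n / fact (Suc n)) \<in> L2 M"
          unfolding L2_def
          by (auto simp: abs_mult power_mult_distrib power_divide power_mult simp del: power_Suc mult_Suc fact_Suc)
      qed
      finally have CS: "(cmod c)\<^sup>2 \<le> B * (\<integral>\<omega>. (norm (\<bar>t * X h \<omega>\<bar> ^ Suc n / fact (Suc n)))\<^sup>2 \<partial>M)" .
      have "(\<integral>\<omega>. (norm (\<bar>t * X h \<omega>\<bar> ^ Suc n / fact (Suc n)))\<^sup>2 \<partial>M)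
          = (\<integral>\<omega>. ((t\<^sup>2) ^ Suc n / (fact (Suc n))\<^sup>2) * (X h \<omega>) ^ (2 * Suc n) \<partial>M)"
        by (intro Bochner_Integration.integral_cong)
          (auto simp: power_mult_distrib power_divide abs_mult power_abs[symmetric] power_mult[symmetric] mult.commute[of _ 2] power2_abs
            simp del: power_Suc mult_Suc fact_Suc mult_Suc_right)
      also have "\<dots> \<le> ((t\<^sup>2) ^ Suc n / (fact (Suc n))\<^sup>2) * (2 ^ Suc n * fact (Suc n))"
        unfolding integral_mult_right_zero by (rule mult_left_mono[OF X_even_moment_le[OF h]]) simp
      also have "\<dots> = (2 * t\<^sup>2) ^ Suc n /\<^sub>R fact (Suc n)"
        by (simp add: power_mult_distrib power2_eq_square divide_inverse mult_ac del: power_Suc fact_Suc)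
      finally have "B * (\<integral>\<omega>. (norm (\<bar>t * X h \<omega>\<bar> ^ Suc n / fact (Suc n)))\<^sup>2 \<partial>M) \<le> B * ((2 * t\<^sup>2) ^ Suc n /\<^sub>R fact (Suc n))"
        by (rule mult_left_mono) (simp add: B_def)
      with CS show ?thesis by (rule order_trans)
    qed
    have "(\<lambda>n. (2 * t\<^sup>2) ^ Suc n /\<^sub>R fact (Suc n)) \<longlonglongrightarrow> 0"
      using LIMSEQ_Suc[OF summable_LIMSEQ_zero[OF summable_exp_generic[of "2 * t\<^sup>2"]]] .
    then have "(\<lambda>n. B * ((2 * t\<^sup>2) ^ Suc n /\<^sub>R fact (Suc n))) \<longlonglongrightarrow> B * 0" by (intro tendsto_intros)
    then have "(cmod c)\<^sup>2 \<le> B * 0" by (rule LIMSEQ_le_const) (use bound in blast)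
    then show ?thesis by (simp add: c_def)
  qed
  have unit: "(\<integral>\<omega>. U \<omega> * cos (t * X h \<omega>) \<partial>M) = 0" "(\<integral>\<omega>. U \<omega> * sin (t * X h \<omega>) \<partial>M) = 0" if h: "norm h = 1" for h t
  proof -
    have "integrable M (\<lambda>\<omega>. U \<omega> *\<^sub>R iexp (t * X h \<omega>))"
      by (rule Bochner_Integration.integrable_bound[OF iU]) auto
    from integral_Re[OF this] integral_Im[OF this] exp0[OF h, of t]
    show "(\<integral>\<omega>. U \<omega> * cos (t * X h \<omega>) \<partial>M) = 0" "(\<integral>\<omega>. U \<omega> * sin (t * X h \<omega>) \<partial>M) = 0"
      by (simp_all add: Re_exp Im_exp)
  qed
  have "(\<integral>\<omega>. U \<omega> * cos (X k \<omega>) \<partial>M) = 0 \<and> (\<integral>\<omega>. U \<omega> * sin (X k \<omega>) \<partial>M) = 0" for k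
  proof (cases "k = 0")
    case True
    have "(\<integral>\<omega>. U \<omega> * cos (X k \<omega>) \<partial>M) = (\<integral>\<omega>. U \<omega> \<partial>M)" "(\<integral>\<omega>. U \<omega> * sin (X k \<omega>) \<partial>M) = (\<integral>\<omega>. 0 \<partial>M)"
      unfolding True by (rule integral_cong_AE, measurable, use X_zero in eventually_elim, simp)+
    then show ?thesis using mean by simp
  next
    case False
    define e where "e = (1 / norm k) *\<^sub>R k"
    have e: "norm e = 1" "k = norm k *\<^sub>R e" using False by (auto simp: e_def)
    have ae: "AE \<omega> in M. X k \<omega> = norm k * X e \<omega>" using X_scale[of "norm k" e] e by simp
    have "(\<integral>\<omega>. U \<omega> * cos (X k \<omega>) \<partial>M) = (\<integral>\<omega>. U \<omega> * cos (norm k * X e \<omega>) \<partial>M)"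
      "(\<integral>\<omega>. U \<omega> * sin (X k \<omega>) \<partial>M) = (\<integral>\<omega>. U \<omega> * sin (norm k * X e \<omega>) \<partial>M)"
      by (rule integral_cong_AE, measurable, use ae in eventually_elim, simp)+
    then show ?thesis using unit[OF e(1)] by simp
  qed
  then show ?thesis by (intro trig_total[OF iU]) auto
qed

section \<open>The chaoses, their orthogonality and their projections\<close>

lemma chaos_spanI: "finite S \<Longrightarrow> (\<And>h. h \<in> S \<Longrightarrow> norm h = 1) \<Longrightarrow> (\<lambda>\<omega>. \<Sum>h\<in>S. c h * hermite m (X h \<omega>)) \<in> chaos_span X m"
  unfolding chaos_span_def by blast

lemma chaos_span_L2: "chaos_span X m \<subseteq> L2 M"
  unfolding chaos_span_def
  by (auto intro!: all_moments_L2 all_moments_intros)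

lemma chaos_span_zero: "(\<lambda>\<omega>. 0) \<in> chaos_span X m"
  using chaos_spanI[of "{}"] by simp

lemma chaos_span_hermite: "norm h = 1 \<Longrightarrow> (\<lambda>\<omega>. hermite m (X h \<omega>)) \<in> chaos_span X m"
  using chaos_spanI[of "{h}" "\<lambda>_. 1" m] by simp

lemma chaos_span_scale:
  assumes "f \<in> chaos_span X m"
  shows "(\<lambda>\<omega>. c * f \<omega>) \<in> chaos_span X m"
proof -
  obtain S a where S: "finite S" "\<And>h. h \<in> S \<Longrightarrow> norm h = 1" "f = (\<lambda>\<omega>. \<Sum>h\<in>S. a h * hermite m (X h \<omega>))"
    using assms unfolding chaos_span_def by blast
  have "(\<lambda>\<omega>. c * f \<omega>) = (\<lambda>\<omega>. \<Sum>h\<in>S. (c * a h) * hermite m (X h \<omega>))"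
    by (simp add: S sum_distrib_left mult.assoc)
  then show ?thesis using chaos_spanI[OF S(1,2)] by simp
qed

lemma chaos_span_add:
  assumes "f \<in> chaos_span X m" "g \<in> chaos_span X m"
  shows "(\<lambda>\<omega>. f \<omega> + g \<omega>) \<in> chaos_span X m"
proof -
  obtain S a where S: "finite S" "\<And>h. h \<in> S \<Longrightarrow> norm h = 1" "f = (\<lambda>\<omega>. \<Sum>h\<in>S. a h * hermite m (X h \<omega>))"
    using assms unfolding chaos_span_def by blast
  obtain T b where T: "finite T" "\<And>h. h \<in> T \<Longrightarrow> norm h = 1" "g = (\<lambda>\<omega>. \<Sum>h\<in>T. b h * hermite m (X h \<omega>))"
    using assms unfolding chaos_span_def by blast
  define c where "c h = (if h \<in> S then a h else 0) + (if h \<in> T then b h else 0)" for h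
  have "(\<Sum>h\<in>S \<union> T. c h * hermite m (X h \<omega>)) = f \<omega> + g \<omega>" for \<omega>
  proof -
    have "(\<Sum>h\<in>S \<union> T. c h * hermite m (X h \<omega>)) = (\<Sum>h\<in>S \<union> T. (if h \<in> S then a h * hermite m (X h \<omega>) else 0))
      + (\<Sum>h\<in>S \<union> T. (if h \<in> T then b h * hermite m (X h \<omega>) else 0))"
      unfolding sum.distrib[symmetric] by (intro sum.cong) (auto simp: c_def algebra_simps)
    also have "\<dots> = f \<omega> + g \<omega>"
      using S T by (simp add: sum.inter_restrict[symmetric] Int_absorb1)
    finally show ?thesis .
  qed
  then show ?thesis using chaos_spanI[of "S \<union> T" c m] S T by auto
qed

lemma wiener_chaosE:
  assumes "Y \<in> wiener_chaos M X m"
  obtains Ys where "\<And>k. Ys k \<in> chaos_span X m" "tendsto_L2 M Ys Y"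
  using assms unfolding wiener_chaos_def by blast

lemma wiener_chaos_L2: "Y \<in> wiener_chaos M X m \<Longrightarrow> Y \<in> L2 M"
  by (auto elim!: wiener_chaosE dest: tendsto_L2D)

lemma chaos_span_subset: "f \<in> chaos_span X m \<Longrightarrow> f \<in> wiener_chaos M X m"
  unfolding wiener_chaos_def using tendsto_L2_const[of f M] chaos_span_L2[of m] by (auto intro!: exI[of _ "\<lambda>_. f"])

text \<open>A continuous linear functional on a chaos is determined by the generators H_m(X(h)).
  Orthogonality of the chaoses, their vanishing means and the action of U on them are all
  instances.\<close>

lemma wiener_chaos_functional_eq:
  assumes Y: "Y \<in> wiener_chaos M X m" and U: "U \<in> L2 M" and V: "V \<in> L2 M"
    and eq: "\<And>h. norm h = 1 \<Longrightarrow> (\<integral>\<omega>. hermite m (X h \<omega>) * U \<omega> \<partial>M) = (\<integral>\<omega>. hermite m (X h \<omega>) * V \<omega> \<partial>M)"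
  shows "(\<integral>\<omega>. Y \<omega> * U \<omega> \<partial>M) = (\<integral>\<omega>. Y \<omega> * V \<omega> \<partial>M)"
proof -
  have span: "(\<integral>\<omega>. f \<omega> * U \<omega> \<partial>M) = (\<integral>\<omega>. f \<omega> * V \<omega> \<partial>M)" if f: "f \<in> chaos_span X m" for f
  proof -
    obtain S a where S: "finite S" "\<And>h. h \<in> S \<Longrightarrow> norm h = 1" "f = (\<lambda>\<omega>. \<Sum>h\<in>S. a h * hermite m (X h \<omega>))"
      using f unfolding chaos_span_def by blast
    have *: "(\<integral>\<omega>. f \<omega> * W \<omega> \<partial>M) = (\<Sum>h\<in>S. a h * (\<integral>\<omega>. hermite m (X h \<omega>) * W \<omega> \<partial>M))" if "W \<in> L2 M" for W
      unfolding S(3) sum_distrib_right mult.assoc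
      by (subst Bochner_Integration.integral_sum)
        (auto intro!: integrable_mult_right integrable_mult_L2 that all_moments_L2 all_moments_hermite)
    show ?thesis unfolding *[OF U] *[OF V] using S(2) eq by (intro sum.cong) auto
  qed
  obtain Ys where Ys: "\<And>k. Ys k \<in> chaos_span X m" "tendsto_L2 M Ys Y" using Y by (rule wiener_chaosE) blast
  have "(\<lambda>k. \<integral>\<omega>. Ys k \<omega> * U \<omega> \<partial>M) \<longlonglongrightarrow> (\<integral>\<omega>. Y \<omega> * U \<omega> \<partial>M)"
    by (rule tendsto_L2_mult_right[OF Ys(2) U])
  moreover have "(\<lambda>k. \<integral>\<omega>. Ys k \<omega> * U \<omega> \<partial>M) \<longlonglongrightarrow> (\<integral>\<omega>. Y \<omega> * V \<omega> \<partial>M)"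
    using tendsto_L2_mult_right[OF Ys(2) V] span[OF Ys(1)] by simp
  ultimately show ?thesis by (rule LIMSEQ_unique)
qed

text \<open>The passage from generators to the closed span is made twice, once in each
  argument.\<close>

lemma wiener_chaos_orthogonal:
  assumes "Y \<in> wiener_chaos M X m" "W \<in> wiener_chaos M X n" "m \<noteq> n"
  shows "(\<integral>\<omega>. Y \<omega> * W \<omega> \<partial>M) = 0"
proof -
  have "(\<integral>\<omega>. Y \<omega> * W \<omega> \<partial>M) = (\<integral>\<omega>. Y \<omega> * 0 \<partial>M)"
  proof (rule wiener_chaos_functional_eq[OF assms(1) wiener_chaos_L2[OF assms(2)] L2_zero])
    fix h :: 'h assume h: "norm h = 1"
    have "(\<integral>\<omega>. W \<omega> * hermite m (X h \<omega>) \<partial>M) = (\<integral>\<omega>. W \<omega> * 0 \<partial>M)"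
      by (rule wiener_chaos_functional_eq[OF assms(2) all_moments_L2[OF all_moments_hermite] L2_zero])
        (use hermite_orthogonal[OF _ h] assms(3) in auto)
    then show "(\<integral>\<omega>. hermite m (X h \<omega>) * W \<omega> \<partial>M) = (\<integral>\<omega>. hermite m (X h \<omega>) * 0 \<partial>M)"
      by (simp add: mult.commute)
  qed
  then show ?thesis by simp
qed

lemma wiener_chaos_mean:
  assumes "Y \<in> wiener_chaos M X m" "m > 0"
  shows "(\<integral>\<omega>. Y \<omega> \<partial>M) = 0"
  using wiener_chaos_functional_eq[OF assms(1) L2_const[OF finite_measure_axioms, of 1] L2_zero]
    expectation_hermite assms(2) by simp

text \<open>Supplies the witness behind \<open>SOME\<close>. The projection lemma gives
  orthogonality to the span, and continuity extends it to the closure.\<close>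

lemma chaos_proj:
  assumes Z: "Z \<in> L2 M"
  shows "chaos_proj M X m Z \<in> wiener_chaos M X m"
    and "W \<in> wiener_chaos M X m \<Longrightarrow> (\<integral>\<omega>. (Z \<omega> - chaos_proj M X m Z \<omega>) * W \<omega> \<partial>M) = 0"
proof -
  obtain Y Ys where Y: "\<And>k. Ys k \<in> chaos_span X m" "tendsto_L2 M Ys Y"
    "\<And>W. W \<in> chaos_span X m \<Longrightarrow> (\<integral>\<omega>. (Z \<omega> - Y \<omega>) * W \<omega> \<partial>M) = 0"
    using L2_projection[OF Z chaos_span_L2 chaos_span_zero chaos_span_add chaos_span_scale, of m] by blast
  have "Y \<in> wiener_chaos M X m" unfolding wiener_chaos_def using Y by blast
  moreover have "(\<integral>\<omega>. (Z \<omega> - Y \<omega>) * W \<omega> \<partial>M) = 0" if "W \<in> wiener_chaos M X m" for W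
  proof -
    have "(\<integral>\<omega>. W \<omega> * (Z \<omega> - Y \<omega>) \<partial>M) = (\<integral>\<omega>. W \<omega> * 0 \<partial>M)"
      by (rule wiener_chaos_functional_eq[OF that L2_diff[OF Z tendsto_L2D(1)[OF Y(2)]] L2_zero])
        (use Y(3)[OF chaos_span_hermite] in \<open>simp add: mult.commute\<close>)
    then show ?thesis by (simp add: mult.commute)
  qed
  ultimately have "\<exists>Y. Y \<in> wiener_chaos M X m \<and> (\<forall>W \<in> wiener_chaos M X m. (\<integral>\<omega>. (Z \<omega> - Y \<omega>) * W \<omega> \<partial>M) = 0)"
    by blast
  from someI_ex[OF this]
  show "chaos_proj M X m Z \<in> wiener_chaos M X m"
    and "W \<in> wiener_chaos M X m \<Longrightarrow> (\<integral>\<omega>. (Z \<omega> - chaos_proj M X m Z \<omega>) * W \<omega> \<partial>M) = 0"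
    unfolding chaos_proj_def by blast+
qed

lemma chaos_proj_L2: "Z \<in> L2 M \<Longrightarrow> chaos_proj M X m Z \<in> L2 M"
  by (rule wiener_chaos_L2[OF chaos_proj(1)])

lemma chaos_proj_orthogonal:
  "Z \<in> L2 M \<Longrightarrow> m \<noteq> n \<Longrightarrow> (\<integral>\<omega>. chaos_proj M X m Z \<omega> * chaos_proj M X n Z \<omega> \<partial>M) = 0"
  by (rule wiener_chaos_orthogonal[OF chaos_proj(1) chaos_proj(1)])

lemma chaos_proj_summable:
  assumes Z: "Z \<in> L2 M"
  shows "summable (\<lambda>m. \<integral>\<omega>. (chaos_proj M X m Z \<omega>)\<^sup>2 \<partial>M)"
proof (rule summableI_nonneg_bounded)
  show "(\<Sum>m<n. \<integral>\<omega>. (chaos_proj M X m Z \<omega>)\<^sup>2 \<partial>M) \<le> (\<integral>\<omega>. (Z \<omega>)\<^sup>2 \<partial>M)" for n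
    by (rule Bessel_L2) (use Z in \<open>auto intro: chaos_proj_L2 chaos_proj_orthogonal chaos_proj\<close>)
qed simp

text \<open>The projections sum to some Z' in L^2, and Z - Z' is orthogonal to every Hermite
  variable, hence 0 by totality. The order 0 is accounted for by the fact that Z and Z' both have
  mean 0.\<close>

lemma chaos_expansion:
  assumes Z: "Z \<in> L2 M" and mean: "(\<integral>\<omega>. Z \<omega> \<partial>M) = 0" and V: "V \<in> L2 M"
  shows "(\<lambda>N. \<Sum>m=1..N. \<integral>\<omega>. chaos_proj M X m Z \<omega> * V \<omega> \<partial>M) \<longlonglongrightarrow> (\<integral>\<omega>. Z \<omega> * V \<omega> \<partial>M)"
proof -
  let ?J = "\<lambda>m. chaos_proj M X m Z"
  note J = chaos_proj_L2[OF Z]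
  obtain Z' where Z': "tendsto_L2 M (\<lambda>N \<omega>. \<Sum>m=1..N. 1 * ?J m \<omega>) Z'"
    using orthogonal_series_L2[OF J chaos_proj_orthogonal[OF Z] chaos_proj_summable[OF Z], of "\<lambda>_. 1"] by auto
  note Z'L = tendsto_L2D(1)[OF Z']
  have lim: "(\<lambda>N. \<Sum>m=1..N. \<integral>\<omega>. ?J m \<omega> * W \<omega> \<partial>M) \<longlonglongrightarrow> (\<integral>\<omega>. Z' \<omega> * W \<omega> \<partial>M)" if W: "W \<in> L2 M" for W
    using tendsto_L2_mult_right[OF Z' W]
    by (simp add: sum_distrib_right Bochner_Integration.integral_sum integrable_mult_L2 J W)
  have "AE \<omega> in M. Z \<omega> - Z' \<omega> = 0"
  proof (rule hermite_total)
    show D: "(\<lambda>\<omega>. Z \<omega> - Z' \<omega>) \<in> L2 M" by (rule L2_diff[OF Z Z'L])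
    have "(\<integral>\<omega>. ?J m \<omega> \<partial>M) = 0" if "m > 0" for m
      by (rule wiener_chaos_mean[OF chaos_proj(1)[OF Z] that])
    then have "(\<integral>\<omega>. Z' \<omega> \<partial>M) = 0"
      using LIMSEQ_unique[OF lim[OF L2_const[OF finite_measure_axioms, of 1]], of 0] by simp
    then show "(\<integral>\<omega>. Z \<omega> - Z' \<omega> \<partial>M) = 0"
      using mean L2_imp_integrable[OF Z] L2_imp_integrable[OF Z'L] by simp
    fix n :: nat and h :: 'h assume n: "n > 0" and h: "norm h = 1"
    let ?H = "\<lambda>\<omega>. hermite n (X h \<omega>)"
    have HL: "?H \<in> L2 M" by (rule all_moments_L2[OF all_moments_hermite])
    have HW: "?H \<in> wiener_chaos M X n" by (rule chaos_span_subset[OF chaos_span_hermite[OF h]])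
    \<comment> \<open>Only the summand m = n survives, so the partial sums are constant from N = n
      on; n > 0 puts that summand in range.\<close>
    have "(\<lambda>N. \<Sum>m=1..N. \<integral>\<omega>. ?J m \<omega> * ?H \<omega> \<partial>M) \<longlonglongrightarrow> (\<integral>\<omega>. ?J n \<omega> * ?H \<omega> \<partial>M)"
    proof (rule tendsto_eventually)
      show "\<forall>\<^sub>F N in sequentially. (\<Sum>m=1..N. \<integral>\<omega>. ?J m \<omega> * ?H \<omega> \<partial>M) = (\<integral>\<omega>. ?J n \<omega> * ?H \<omega> \<partial>M)"
        using eventually_ge_at_top[of n]
      proof eventually_elim
        case (elim N)
        have "(\<Sum>m=1..N. \<integral>\<omega>. ?J m \<omega> * ?H \<omega> \<partial>M) = (\<Sum>m=1..N. if m = n then \<integral>\<omega>. ?J n \<omega> * ?H \<omega> \<partial>M else 0)"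
          by (intro sum.cong) (auto intro: wiener_chaos_orthogonal[OF chaos_proj(1)[OF Z] HW])
        then show ?case using elim n by (simp add: sum.delta)
      qed
    qed
    then have "(\<integral>\<omega>. Z' \<omega> * ?H \<omega> \<partial>M) = (\<integral>\<omega>. ?J n \<omega> * ?H \<omega> \<partial>M)"
      using LIMSEQ_unique lim[OF HL] by blast
    then show "(\<integral>\<omega>. (Z \<omega> - Z' \<omega>) * ?H \<omega> \<partial>M) = 0"
      using chaos_proj(2)[OF Z HW]
      by (simp add: left_diff_distrib integrable_mult_L2 Z Z'L J HL)
  qed
  then have "AE \<omega> in M. Z' \<omega> * V \<omega> = Z \<omega> * V \<omega>" by eventually_elim simp
  then have "(\<integral>\<omega>. Z' \<omega> * V \<omega> \<partial>M) = (\<integral>\<omega>. Z \<omega> * V \<omega> \<partial>M)"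
    using integrable_mult_L2[OF Z'L V] integrable_mult_L2[OF Z V] by (intro integral_cong_AE) auto
  then show ?thesis using lim[OF V] by simp
qed

section \<open>Pairing the inverse operator with the divergence of a test gradient\<close>

lemma L_inv_tendsto:
  assumes Z: "Z \<in> L2 M"
  shows "tendsto_L2 M (\<lambda>N \<omega>. \<Sum>m=1..N. - (1 / real m) * chaos_proj M X m Z \<omega>) (L_inv M X Z)"
proof -
  \<comment> \<open>At m = 0 the coefficient is 0, because division by zero yields 0.\<close>
  have "\<bar>- (1 / real m)\<bar> \<le> 1" for m by (cases m) auto
  from orthogonal_series_L2[OF chaos_proj_L2[OF Z] chaos_proj_orthogonal[OF Z] chaos_proj_summable[OF Z], of "\<lambda>m. - (1 / real m)"] this
  have "\<exists>W. tendsto_L2 M (\<lambda>N \<omega>. \<Sum>m=1..N. - (1 / real m) * chaos_proj M X m Z \<omega>) W" by blast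
  from someI_ex[OF this] show ?thesis unfolding L_inv_def .
qed

text \<open>The mean of \<open>L_inv M X Z\<close> times U is computed twice: through the chaos
  expansion it is minus the mean of Z F, and through cylindrical approximants of
  \<open>L_inv M X Z\<close> it is the pairing of DF with G.\<close>

lemma L_inv_duality:
  fixes \<phi> :: "nat \<Rightarrow> 'h"
  assumes Z: "Z \<in> L2 M" and mean: "(\<integral>\<omega>. Z \<omega> \<partial>M) = 0"
    and G: "has_malliavin_derivative M X (L_inv M X Z) G"
    and cyl: "depends_on_first n \<psi>" "smooth n \<psi>" "compactly_supported n \<psi>"
    and f: "\<And>x. (f has_real_derivative f' x) (at x)" "\<And>x. (f' has_real_derivative f'' x) (at x)"
      "continuous_on UNIV f''"
    and bdd: "\<And>x. \<bar>f' x\<bar> \<le> C1" "\<And>x. \<bar>f'' x\<bar> \<le> C2"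
  shows "(\<integral>\<omega>. f' (\<psi> (\<lambda>j. X (\<phi> j) \<omega>)) * ((\<Sum>i<n. partial_deriv i \<psi> (\<lambda>j. X (\<phi> j) \<omega>) *\<^sub>R \<phi> i) \<bullet> (- G \<omega>)) \<partial>M)
    = (\<integral>\<omega>. (f (\<psi> (\<lambda>j. X (\<phi> j) \<omega>)) - f 0) * Z \<omega> \<partial>M)"
proof -
  define F where "F \<omega> = f (\<psi> (\<lambda>j. X (\<phi> j) \<omega>)) - f 0" for \<omega>
  define DF where "DF \<omega> = (\<Sum>i<n. (f' (\<psi> (\<lambda>j. X (\<phi> j) \<omega>)) * partial_deriv i \<psi> (\<lambda>j. X (\<phi> j) \<omega>)) *\<^sub>R \<phi> i)" for \<omega>
  note div = divergence_of_test_gradient[OF cyl f bdd, of \<phi>, folded F_def DF_def]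
  have FL: "F \<in> L2 M" using div(1) .
  obtain U where U: "U \<in> L2 M"
    and U1: "\<And>F1 G1. (F1, G1) \<in> cylindrical_graph X \<Longrightarrow> (\<integral>\<omega>. F1 \<omega> * U \<omega> \<partial>M) = (\<integral>\<omega>. DF \<omega> \<bullet> G1 \<omega> \<partial>M)"
    and U2: "\<And>m h. norm h = 1 \<Longrightarrow> (\<integral>\<omega>. hermite m (X h \<omega>) * U \<omega> \<partial>M) = real m * (\<integral>\<omega>. F \<omega> * hermite m (X h \<omega>) \<partial>M)"
    using div(2) by blast
  let ?W = "L_inv M X Z" and ?J = "\<lambda>m. chaos_proj M X m Z"
  have U_chaos: "(\<integral>\<omega>. ?J m \<omega> * U \<omega> \<partial>M) = real m * (\<integral>\<omega>. ?J m \<omega> * F \<omega> \<partial>M)" for m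
  proof -
    have e: "(\<integral>\<omega>. Y \<omega> * (real m * F \<omega>) \<partial>M) = real m * (\<integral>\<omega>. F \<omega> * Y \<omega> \<partial>M)" for Y
    proof -
      have "Y \<omega> * (real m * F \<omega>) = real m * (F \<omega> * Y \<omega>)" for \<omega> by simp
      then show ?thesis by (simp only: integral_mult_right_zero)
    qed
    have "(\<integral>\<omega>. ?J m \<omega> * U \<omega> \<partial>M) = (\<integral>\<omega>. ?J m \<omega> * (real m * F \<omega>) \<partial>M)"
      by (rule wiener_chaos_functional_eq[OF chaos_proj(1)[OF Z, of m] U L2_cmult[OF FL]]) (simp only: e U2)
    moreover have "(\<integral>\<omega>. F \<omega> * ?J m \<omega> \<partial>M) = (\<integral>\<omega>. ?J m \<omega> * F \<omega> \<partial>M)"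
      by (rule Bochner_Integration.integral_cong) simp_all
    ultimately show ?thesis unfolding e by simp
  qed
  \<comment> \<open>The factor m coming from U and the factor -1/m coming from \<open>L_inv\<close>
    cancel term by term.\<close>
  have "(\<lambda>N. \<Sum>m=1..N. \<integral>\<omega>. ?J m \<omega> * F \<omega> \<partial>M) \<longlonglongrightarrow> - (\<integral>\<omega>. ?W \<omega> * U \<omega> \<partial>M)"
  proof -
    have "(\<integral>\<omega>. (\<Sum>m=1..N. - (1 / real m) * ?J m \<omega>) * U \<omega> \<partial>M) = - (\<Sum>m=1..N. \<integral>\<omega>. ?J m \<omega> * F \<omega> \<partial>M)" for N
    proof -
      have "(\<integral>\<omega>. (\<Sum>m=1..N. - (1 / real m) * ?J m \<omega>) * U \<omega> \<partial>M) = (\<Sum>m=1..N. - (1 / real m) * (\<integral>\<omega>. ?J m \<omega> * U \<omega> \<partial>M))"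
        unfolding sum_distrib_right mult.assoc
        by (subst Bochner_Integration.integral_sum) (auto intro!: integrable_mult_right integrable_minus integrable_divide integrable_mult_L2 chaos_proj_L2[OF Z] U)
      also have "\<dots> = (\<Sum>m=1..N. - (\<integral>\<omega>. ?J m \<omega> * F \<omega> \<partial>M))"
        by (intro sum.cong) (auto simp: U_chaos)
      finally show ?thesis by (simp add: sum_negf)
    qed
    then show ?thesis
      using tendsto_minus[OF tendsto_L2_mult_right[OF L_inv_tendsto[OF Z] U]] by simp
  qed
  then have W: "(\<integral>\<omega>. ?W \<omega> * U \<omega> \<partial>M) = - (\<integral>\<omega>. Z \<omega> * F \<omega> \<partial>M)"
    using LIMSEQ_unique[OF chaos_expansion[OF Z mean FL]] by fastforce
  obtain Fs Gs where graph: "\<And>k. (Fs k, Gs k) \<in> cylindrical_graph X"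
    and Fs: "tendsto_L2 M Fs ?W" and Gs: "tendsto_L2 M Gs G"
    using G unfolding has_malliavin_derivative_def by blast
  have DFL: "DF \<in> L2 M"
  proof -
    have cf: "continuous_on UNIV f'" using f(2) DERIV_isCont by (blast intro: continuous_at_imp_continuous_on)
    have "(\<lambda>\<omega>. \<psi> (\<lambda>j. X (\<phi> j) \<omega>)) \<in> borel_measurable M"
      using all_moments_cylindrical[OF cyl, of "[]" \<phi>] by (simp add: all_moments_def)
    then have "(\<lambda>\<omega>. f' (\<psi> (\<lambda>j. X (\<phi> j) \<omega>))) \<in> borel_measurable M"
      by (rule measurable_compose[OF _ borel_measurable_continuous_onI[OF cf]])
    then have am: "all_moments M (\<lambda>\<omega>. f' (\<psi> (\<lambda>j. X (\<phi> j) \<omega>)))"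
      by (rule all_moments_bounded) (rule bdd)
    have "(\<lambda>\<omega>. Y \<omega> *\<^sub>R k) \<in> L2 M" if "all_moments M Y" for Y and k :: 'h
      using all_moments_L2[OF that] by (auto simp: L2_def power_mult_distrib)
    moreover have "all_moments M (\<lambda>\<omega>. f' (\<psi> (\<lambda>j. X (\<phi> j) \<omega>)) * partial_deriv i \<psi> (\<lambda>j. X (\<phi> j) \<omega>))" if "i < n" for i
      using all_moments_cylindrical[OF cyl, of "[i]" \<phi>] that by (intro all_moments_mult am) simp
    ultimately show ?thesis unfolding DF_def[abs_def] by (intro L2_sum) auto
  qed
  have "(\<lambda>k. \<integral>\<omega>. Fs k \<omega> * U \<omega> \<partial>M) \<longlonglongrightarrow> (\<integral>\<omega>. ?W \<omega> * U \<omega> \<partial>M)"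
    by (rule tendsto_L2_mult_right[OF Fs U])
  \<comment> \<open>The same sequence as before, now evaluated through the gradients
    \<open>Gs\<close>; uniqueness of limits joins the two computations.\<close>
  moreover have "(\<lambda>k. \<integral>\<omega>. Fs k \<omega> * U \<omega> \<partial>M) \<longlonglongrightarrow> (\<integral>\<omega>. DF \<omega> \<bullet> G \<omega> \<partial>M)"
    using tendsto_L2_inner_right[OF Gs DFL] U1[OF graph] by (simp add: inner_commute)
  ultimately have "(\<integral>\<omega>. DF \<omega> \<bullet> G \<omega> \<partial>M) = (\<integral>\<omega>. ?W \<omega> * U \<omega> \<partial>M)"
    using LIMSEQ_unique by blast
  then have "(\<integral>\<omega>. DF \<omega> \<bullet> G \<omega> \<partial>M) = - (\<integral>\<omega>. Z \<omega> * F \<omega> \<partial>M)" using W by simp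
  moreover have "DF \<omega> \<bullet> G \<omega> = - (f' (\<psi> (\<lambda>j. X (\<phi> j) \<omega>)) * ((\<Sum>i<n. partial_deriv i \<psi> (\<lambda>j. X (\<phi> j) \<omega>) *\<^sub>R \<phi> i) \<bullet> (- G \<omega>)))" for \<omega>
    by (simp add: DF_def inner_sum_left sum_distrib_left mult.assoc)
  ultimately show ?thesis by (simp add: F_def mult.commute)
qed

end

section \<open>Smooth cutoff functions\<close>

text \<open>The standard mollifier with a rational prefactor. The prefactor makes the family closed
  under differentiation, so one derivative rule yields smoothness of every order.\<close>

definition bump :: "real poly \<Rightarrow> nat \<Rightarrow> real \<Rightarrow> real" where
  "bump p k x = (if \<bar>x\<bar> < 1 then poly p x / (1 - x\<^sup>2) ^ k * exp (- (1 / (1 - x\<^sup>2))) else 0)"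

text \<open>The numerator of the derivative over the common denominator (1 - x^2)^(k + 2);
  \<open>[:1, 0, -1:]\<close> is 1 - x^2.\<close>

definition bump_dpoly :: "real poly \<Rightarrow> nat \<Rightarrow> real poly" where
  "bump_dpoly p k = pderiv p * [:1, 0, -1:]\<^sup>2 + smult (2 * real k) ([:0, 1:] * p * [:1, 0, -1:]) - smult 2 ([:0, 1:] * p)"

text \<open>With q = 1 - y^2, the exponential absorbs the denominator and leaves q^2, while q is at
  most twice the distance of y to the endpoint x. This flatness gives the derivative 0 at the
  endpoints.\<close>

lemma bump_quadratic_bound:
  "\<exists>C. \<forall>x y. \<bar>x\<bar> = 1 \<longrightarrow> \<bar>bump p k y\<bar> \<le> C * (y - x)\<^sup>2"
proof -
  \<comment> \<open>Two powers of q more than the denominator consumes.\<close>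
  define n where "n = k + 2"
  have "compact (poly p ` {-1..1})"
    by (intro compact_continuous_image continuous_intros) auto
  then obtain B where B: "\<And>y. y \<in> {-1..1} \<Longrightarrow> \<bar>poly p y\<bar> \<le> B"
    using compact_imp_bounded bounded_iff by (metis imageI real_norm_def)
  have "B \<ge> 0" using B[of 0] by simp
  have "\<bar>bump p k y\<bar> \<le> (B * real n ^ n * 4) * (y - x)\<^sup>2" if x: "\<bar>x\<bar> = 1" for x y
  proof (cases "\<bar>y\<bar> < 1")
    case True
    define q where "q = 1 - y\<^sup>2"
    have q: "0 < q" using True by (simp add: q_def abs_square_less_1)
    have "q = (1 - \<bar>y\<bar>) * (1 + \<bar>y\<bar>)" by (simp add: q_def algebra_simps power2_eq_square)
    also have "\<dots> \<le> \<bar>y - x\<bar> * 2" using True x by (intro mult_mono) auto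
    finally have q2: "q\<^sup>2 \<le> (2 * \<bar>y - x\<bar>)\<^sup>2" using q by (intro power_mono) auto
    \<comment> \<open>Raising exp(u) >= u at u = 1/(n q) to the n-th power yields exp(-1/q) <= (n
      q)^n.\<close>
    have "1 / (real n * q) \<le> exp (1 / (real n * q))" using exp_ge_add_one_self[of "1 / (real n * q)"] by linarith
    then have "(1 / (real n * q)) ^ n \<le> exp (1 / (real n * q)) ^ n"
      using q by (intro power_mono) auto
    also have "\<dots> = exp (real n * (1 / (real n * q)))" by (rule exp_of_nat_mult[symmetric])
    also have "real n * (1 / (real n * q)) = 1 / q" by (simp add: n_def)
    finally have "(1 / (real n * q)) ^ n \<le> exp (1 / q)" .
    then have "inverse (exp (1 / q)) \<le> inverse ((1 / (real n * q)) ^ n)"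
      using q by (intro le_imp_inverse_le) (auto simp: n_def)
    then have "exp (- (1 / q)) \<le> (real n * q) ^ n"
      by (simp add: exp_minus power_one_over inverse_eq_divide)
    then have "exp (- (1 / q)) / q ^ k \<le> (real n * q) ^ n / q ^ k"
      using q by (intro divide_right_mono) auto
    also have "\<dots> = real n ^ n * q\<^sup>2"
    proof -
      have "q ^ n = q ^ k * q\<^sup>2" by (simp only: n_def power_add)
      then show ?thesis using q by (simp add: power_mult_distrib)
    qed
    finally have e: "exp (- (1 / q)) / q ^ k \<le> real n ^ n * q\<^sup>2" .
    have "\<bar>bump p k y\<bar> = \<bar>poly p y\<bar> * (exp (- (1 / q)) / q ^ k)"
      using True q by (simp add: bump_def q_def abs_mult)
    also have "\<dots> \<le> B * (real n ^ n * q\<^sup>2)"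
    proof -
      have "y \<in> {-1..1}" using True by auto
      from B[OF this] show ?thesis using e q \<open>B \<ge> 0\<close> by (intro mult_mono) auto
    qed
    also have "\<dots> \<le> B * (real n ^ n * (2 * \<bar>y - x\<bar>)\<^sup>2)"
      using q2 \<open>B \<ge> 0\<close> by (intro mult_left_mono) auto
    finally show ?thesis by (simp add: power_mult_distrib mult_ac)
  next
    case False
    then show ?thesis using \<open>B \<ge> 0\<close> by (simp add: bump_def)
  qed
  then show ?thesis by blast
qed

lemma DERIV_zero_quadratic:
  fixes f :: "real \<Rightarrow> real"
  assumes "\<And>y. \<bar>f y - f x\<bar> \<le> C * (y - x)\<^sup>2"
  shows "(f has_real_derivative 0) (at x)"
  unfolding DERIV_def
proof (rule Lim_null_comparison)
  show "\<forall>\<^sub>F h in at 0. norm ((f (x + h) - f x) / h) \<le> C * \<bar>h\<bar>"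
    unfolding eventually_at_filter
  proof (intro always_eventually allI impI)
    fix h :: real assume "h \<noteq> 0"
    have "\<bar>f (x + h) - f x\<bar> \<le> C * (\<bar>h\<bar> * \<bar>h\<bar>)" using assms[of "x + h"] by (simp add: power2_eq_square)
    then show "norm ((f (x + h) - f x) / h) \<le> C * \<bar>h\<bar>"
      using \<open>h \<noteq> 0\<close> by (simp add: field_simps)
  qed
  show "((\<lambda>h. C * \<bar>h\<bar>) \<longlongrightarrow> 0) (at 0)" by (auto intro!: tendsto_eq_intros)
qed

text \<open>Inside the interval this is the quotient and product rule, outside the function is
  locally 0, and at the endpoints the quadratic bound makes the difference quotient vanish.\<close>

lemma bump_deriv: "(bump p k has_real_derivative bump (bump_dpoly p k) (k + 2) x) (at x)"
proof -
  consider "\<bar>x\<bar> < 1" | "\<bar>x\<bar> = 1" | "\<bar>x\<bar> > 1" by linarith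
  then show ?thesis
  proof cases
    case 1
    define q where "q = 1 - x\<^sup>2"
    have q: "0 < q" using 1 by (simp add: q_def abs_square_less_1)
    have e1: "((\<lambda>x. exp (- (1 / (1 - x\<^sup>2)))) has_real_derivative exp (- (1 / q)) * (- 2 * x / q\<^sup>2)) (at x)"
      using q unfolding q_def by (auto intro!: derivative_eq_intros simp: power2_eq_square)
    have e2: "((\<lambda>x. (1 - x\<^sup>2) ^ k) has_real_derivative real k * q ^ (k - 1) * (- 2 * x)) (at x)"
      unfolding q_def by (auto intro!: derivative_eq_intros)
    have "((\<lambda>x. poly p x / (1 - x\<^sup>2) ^ k) has_real_derivative
        (poly (pderiv p) x * q ^ k - poly p x * (real k * q ^ (k - 1) * (- 2 * x))) / (q ^ k * q ^ k)) (at x)"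
      using DERIV_divide[OF poly_DERIV e2] q by (simp add: q_def)
    from DERIV_mult[OF this e1]
    have "((\<lambda>x. poly p x / (1 - x\<^sup>2) ^ k * exp (- (1 / (1 - x\<^sup>2)))) has_real_derivative
        (poly (pderiv p) x * q ^ k - poly p x * (real k * q ^ (k - 1) * (- 2 * x))) / (q ^ k * q ^ k) * exp (- (1 / q))
        + exp (- (1 / q)) * (- 2 * x / q\<^sup>2) * (poly p x / q ^ k)) (at x)" by (simp add: q_def)
    also have "(poly (pderiv p) x * q ^ k - poly p x * (real k * q ^ (k - 1) * (- 2 * x))) / (q ^ k * q ^ k) * exp (- (1 / q))
        + exp (- (1 / q)) * (- 2 * x / q\<^sup>2) * (poly p x / q ^ k) = bump (bump_dpoly p k) (k + 2) x"
    proof -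
      have p1: "poly [:1, 0, - 1:] x = q" by (simp add: q_def power2_eq_square)
      have P: "poly (bump_dpoly p k) x = poly (pderiv p) x * q\<^sup>2 + 2 * real k * (x * poly p x * q) - 2 * (x * poly p x)"
        unfolding bump_dpoly_def poly_diff poly_add poly_mult poly_power poly_smult p1 by simp
      have B: "bump (bump_dpoly p k) (k + 2) x = poly (bump_dpoly p k) x / q ^ (k + 2) * exp (- (1 / q))"
        using 1 by (simp add: bump_def q_def)
      show ?thesis
      \<comment> \<open>The exponent k - 1 from differentiating q^k is truncated at k = 0, where the
        factor k removes that term.\<close>
      proof (cases k)
        case 0
        then show ?thesis unfolding B P using q by (simp add: field_simps power2_eq_square)
      next
        case (Suc l)
        then show ?thesis unfolding B P using q by (simp add: field_simps power2_eq_square)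
      qed
    qed
    finally have "((\<lambda>x. poly p x / (1 - x\<^sup>2) ^ k * exp (- (1 / (1 - x\<^sup>2)))) has_real_derivative
        bump (bump_dpoly p k) (k + 2) x) (at x)" .
    moreover have "open {x :: real. \<bar>x\<bar> < 1}" by (intro open_Collect_less continuous_intros)
    ultimately show ?thesis
      by (rule has_field_derivative_transform_within_open) (use 1 in \<open>auto simp: bump_def\<close>)
  next
    case 2
    then have z: "bump p k x = 0" "bump (bump_dpoly p k) (k + 2) x = 0" by (auto simp: bump_def)
    obtain C where "\<forall>x y. \<bar>x\<bar> = 1 \<longrightarrow> \<bar>bump p k y\<bar> \<le> C * (y - x)\<^sup>2" using bump_quadratic_bound by blast
    then show ?thesis using 2 z DERIV_zero_quadratic[of "bump p k" x C] by simp
  next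
    case 3
    have "open {x :: real. 1 < \<bar>x\<bar>}" by (intro open_Collect_less continuous_intros)
    moreover have "((\<lambda>_. 0) has_real_derivative bump (bump_dpoly p k) (k + 2) x) (at x)"
      using 3 by (auto simp: bump_def)
    ultimately show ?thesis
      using has_field_derivative_transform_within_open[of "\<lambda>_. 0" "bump (bump_dpoly p k) (k + 2) x" x "{x. 1 < \<bar>x\<bar>}" "bump p k"] 3
      by (auto simp: bump_def)
  qed
qed

lemma continuous_on_bump [continuous_intros]:
  "continuous_on S f \<Longrightarrow> continuous_on S (\<lambda>x. bump p k (f x))"
proof -
  have "continuous_on UNIV (bump p k)"
    using bump_deriv DERIV_isCont by (blast intro: continuous_at_imp_continuous_on)
  then show "continuous_on S f \<Longrightarrow> continuous_on S (\<lambda>x. bump p k (f x))"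
    by (rule continuous_on_compose2) auto
qed

lemma bump_bounded: "\<exists>C. \<forall>x. \<bar>bump p k x\<bar> \<le> C"
proof -
  have "compact (bump p k ` {-1..1})" by (intro compact_continuous_image continuous_intros) auto
  then obtain B where B: "\<And>y. y \<in> {-1..1} \<Longrightarrow> \<bar>bump p k y\<bar> \<le> B"
    using compact_imp_bounded bounded_iff by (metis imageI real_norm_def)
  have "\<bar>bump p k x\<bar> \<le> \<bar>B\<bar>" for x
  proof (cases "\<bar>x\<bar> < 1")
    case True
    then have "x \<in> {-1..1}" by auto
    from B[OF this] show ?thesis by linarith
  qed (simp add: bump_def)
  then show ?thesis by blast
qed

text \<open>Sums of products of one-dimensional bumps. A partial derivative replaces one factor in
  each product and stays in the family, so continuity and partial differentiability of its members
  already mean smoothness.\<close>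

definition bump_sums :: "real \<Rightarrow> nat \<Rightarrow> ((nat \<Rightarrow> real) \<Rightarrow> real) set" where
  "bump_sums R n = {\<lambda>x. \<Sum>j<N. \<Prod>i<n. bump (P j i) (K j i) (x i / R) | (N :: nat) P K. True}"

lemma bump_sumsI:
  fixes N :: nat
  shows "(\<lambda>x. \<Sum>j<N. \<Prod>i<n. bump (P j i) (K j i) (x i / R)) \<in> bump_sums R n"
  unfolding bump_sums_def by blast

lemma bump_sums_partial:
  assumes \<psi>: "\<psi> \<in> bump_sums R n" and l: "l < n" and R: "R > 0"
  shows "(\<lambda>t. \<psi> (x(l := t))) differentiable (at (x l))" "partial_deriv l \<psi> \<in> bump_sums R n"
proof -
  obtain N :: nat and P K where \<psi>: "\<psi> = (\<lambda>x. \<Sum>j<N. \<Prod>i<n. bump (P j i) (K j i) (x i / R))"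
    using \<psi> unfolding bump_sums_def by blast
  define P' where "P' j = (P j)(l := smult (1 / R) (bump_dpoly (P j l) (K j l)))" for j
  define K' where "K' j = (K j)(l := K j l + 2)" for j
  have smult_bump: "bump (smult c p) k y = c * bump p k y" for c p k y
    by (simp add: bump_def)
  have d: "((\<lambda>t. \<psi> (x(l := t))) has_real_derivative (\<Sum>j<N. \<Prod>i<n. bump (P' j i) (K' j i) (x i / R))) (at (x l))" for x
  proof -
    have split: "(\<Prod>i<n. f i) = f l * (\<Prod>i\<in>{..<n} - {l}. f i)" for f :: "nat \<Rightarrow> real"
      using l by (subst prod.remove[of _ l]) auto
    have "((\<lambda>t. bump (P j l) (K j l) (t / R)) has_real_derivative bump (P' j l) (K' j l) (x l / R)) (at (x l))" for j
    proof -
      have "((\<lambda>t. bump (P j l) (K j l) (t / R)) has_real_derivative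
        bump (bump_dpoly (P j l) (K j l)) (K j l + 2) (x l / R) * (1 / R)) (at (x l))"
        by (rule DERIV_chain2[OF bump_deriv]) (use R in \<open>auto intro!: derivative_eq_intros\<close>)
      then show ?thesis by (simp add: P'_def K'_def smult_bump)
    qed
    from DERIV_cmult_right[OF this]
    have "((\<lambda>t. \<Sum>j<N. bump (P j l) (K j l) (t / R) * (\<Prod>i\<in>{..<n} - {l}. bump (P j i) (K j i) (x i / R)))
      has_real_derivative (\<Sum>j<N. bump (P' j l) (K' j l) (x l / R) * (\<Prod>i\<in>{..<n} - {l}. bump (P j i) (K j i) (x i / R)))) (at (x l))"
      by (intro DERIV_sum)
    moreover have "(\<lambda>t. \<psi> (x(l := t))) = (\<lambda>t. \<Sum>j<N. bump (P j l) (K j l) (t / R) * (\<Prod>i\<in>{..<n} - {l}. bump (P j i) (K j i) (x i / R)))"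
      unfolding \<psi> split by (auto intro!: ext sum.cong prod.cong)
    moreover have "(\<Sum>j<N. \<Prod>i<n. bump (P' j i) (K' j i) (x i / R))
        = (\<Sum>j<N. bump (P' j l) (K' j l) (x l / R) * (\<Prod>i\<in>{..<n} - {l}. bump (P j i) (K j i) (x i / R)))"
      unfolding split by (auto intro!: sum.cong prod.cong simp: P'_def K'_def)
    ultimately show ?thesis by simp
  qed
  then show "(\<lambda>t. \<psi> (x(l := t))) differentiable (at (x l))"
    by (auto simp: real_differentiable_def)
  have "partial_deriv l \<psi> = (\<lambda>x. \<Sum>j<N. \<Prod>i<n. bump (P' j i) (K' j i) (x i / R))"
    unfolding partial_deriv_def using DERIV_imp_deriv[OF d] by (intro ext) simp
  then show "partial_deriv l \<psi> \<in> bump_sums R n" unfolding bump_sums_def by blast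
qed

lemma bump_sums_test:
  assumes \<psi>: "\<psi> \<in> bump_sums R n" and R: "R > 0"
  shows "depends_on_first n \<psi>" "smooth n \<psi>" "compactly_supported n \<psi>"
proof -
  obtain N :: nat and P K where \<psi>': "\<psi> = (\<lambda>x. \<Sum>j<N. \<Prod>i<n. bump (P j i) (K j i) (x i / R))"
    using \<psi> unfolding bump_sums_def by blast
  show "depends_on_first n \<psi>"
    unfolding depends_on_first_def \<psi>' by (auto intro!: sum.cong prod.cong)
  show "compactly_supported n \<psi>"
    unfolding compactly_supported_def
  proof (intro exI allI impI)
    fix x i assume nz: "\<psi> x \<noteq> 0" and i: "i < n"
    then obtain j where "(\<Prod>i<n. bump (P j i) (K j i) (x i / R)) \<noteq> 0"
      unfolding \<psi>' by (meson sum.not_neutral_contains_not_neutral)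
    then have "bump (P j i) (K j i) (x i / R) \<noteq> 0" using i by auto
    then have "\<bar>x i / R\<bar> < 1" by (auto simp: bump_def split: if_splits)
    then show "\<bar>x i\<bar> \<le> R" using R by (simp add: field_simps)
  qed
  have it: "iter_partial_deriv is \<psi> \<in> bump_sums R n" if "is \<in> lists {..<n}" for "is"
    using that by (induction "is") (auto simp: \<psi> bump_sums_partial R)
  have cont: "continuous_on UNIV \<theta>" if "\<theta> \<in> bump_sums R n" for \<theta>
    using that R unfolding bump_sums_def
    by (auto intro!: continuous_intros continuous_on_product_coordinates)
  show "smooth n \<psi>"
    unfolding smooth_def using it cont bump_sums_partial(1)[OF _ _ R] by blast
qed

section \<open>Malliavin derivatives of Hermite polynomials\<close>

context isonormal_gaussian
begin

text \<open>A Hermite sum reaches the domain as a limit of its products with cutoffs of width R(k) =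
  k + 1. The cutoffs tend to 1 and their derivatives are of order 1/R(k), so in the limit only the
  derivative of the sum itself remains.\<close>

lemma hermite_sum_malliavin:
  fixes \<phi> :: "nat \<Rightarrow> 'h" and c :: "nat \<Rightarrow> real" and m :: "nat \<Rightarrow> nat"
  shows "has_malliavin_derivative M X
    (\<lambda>\<omega>. \<Sum>j<n. c j * hermite (m j) (X (\<phi> j) \<omega>))
    (\<lambda>\<omega>. \<Sum>j<n. (c j * (real (m j) * hermite (m j - 1) (X (\<phi> j) \<omega>))) *\<^sub>R \<phi> j)"
proof -
  \<comment> \<open>The constant exp(1) normalises the cutoff to 1 at the origin, where the
    mollifier has the value exp(-1).\<close>
  define \<kappa> where "\<kappa> R x = bump [:exp 1:] 0 (x / R)" for R x :: real
  define \<kappa>' where "\<kappa>' R x = bump (bump_dpoly [:exp 1:] 0) 2 (x / R) / R" for R x :: real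
  define a where "a j x = c j * hermite (m j) x" for j x
  define a' where "a' j x = c j * (real (m j) * hermite (m j - 1) x)" for j x
  have \<kappa>_deriv: "(\<kappa> R has_real_derivative \<kappa>' R x) (at x)" if R: "R > 0" for R x
  proof -
    have "((\<lambda>x. bump [:exp 1:] 0 (x / R)) has_real_derivative bump (bump_dpoly [:exp 1:] 0) (0 + 2) (x / R) * (1 / R)) (at x)"
      by (rule DERIV_chain2[OF bump_deriv]) (use R in \<open>auto intro!: derivative_eq_intros\<close>)
    then show ?thesis by (simp add: \<kappa>_def[abs_def] \<kappa>'_def numeral_2_eq_2)
  qed
  have a_deriv: "(a j has_real_derivative a' j x) (at x)" for j x
    unfolding a_def[abs_def] a'_def by (rule DERIV_cmult[OF hermite_deriv])
  have \<kappa>_nonneg: "0 \<le> \<kappa> R x" for R x by (simp add: \<kappa>_def bump_def)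
  have \<kappa>_le_1: "\<kappa> R x \<le> 1" for R x
  proof (cases "\<bar>x / R\<bar> < 1")
    case True
    then have "0 < 1 - (x / R)\<^sup>2" by (simp only: abs_square_less_1 diff_gt_0_iff_gt)
    then have "1 \<le> 1 / (1 - (x / R)\<^sup>2)" by simp
    moreover have "\<kappa> R x = exp (1 - 1 / (1 - (x / R)\<^sup>2))"
      using True by (simp add: \<kappa>_def bump_def exp_diff exp_minus field_simps)
    ultimately show ?thesis by simp
  qed (simp add: \<kappa>_def bump_def)
  obtain C where C: "\<And>x. \<bar>bump (bump_dpoly [:exp 1:] 0) 2 x\<bar> \<le> C" using bump_bounded by blast
  define R where "R k = real (Suc k)" for k
  have R: "R k > 0" "R k \<ge> 1" for k by (auto simp: R_def)
  have R_lim: "(\<lambda>k. x / R k) \<longlonglongrightarrow> 0" for x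
    using LIMSEQ_Suc[OF lim_const_over_n[of x]] by (simp add: R_def)
  have \<kappa>_lim: "(\<lambda>k. \<kappa> (R k) x) \<longlonglongrightarrow> 1" for x
  proof -
    have "isCont (bump [:exp 1:] 0) 0" using bump_deriv DERIV_isCont by blast
    from isCont_tendsto_compose[OF this R_lim]
    show ?thesis by (simp add: \<kappa>_def bump_def exp_minus)
  qed
  have \<kappa>'_bound: "\<bar>\<kappa>' (R k) x\<bar> \<le> C / R k" for k x
    using C[of "x / R k"] R(1)[of k] by (simp add: \<kappa>'_def divide_right_mono)
  have "C \<ge> 0" using C[of 0] by linarith
  then have \<kappa>'_le: "\<bar>\<kappa>' (R k) x\<bar> \<le> C" for k x
  proof -
    have "C / R k \<le> C / 1" using \<open>C \<ge> 0\<close> R[of k] by (intro divide_left_mono) auto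
    then show ?thesis using \<kappa>'_bound[of k x] by simp
  qed
  have \<kappa>'_lim: "(\<lambda>k. \<kappa>' (R k) x) \<longlonglongrightarrow> 0" for x
    by (rule Lim_null_comparison[OF _ R_lim[of C]]) (use \<kappa>'_bound in simp)
  define A where "A x = (\<Sum>j<n. a j (x j))" for x :: "nat \<Rightarrow> real"
  define \<psi> where "\<psi> k x = A x * (\<Prod>i<n. \<kappa> (R k) (x i))" for k x
  have "\<psi> k \<in> bump_sums (R k) n" for k
  proof -
    obtain hp where hp: "\<And>m x. hermite m x = poly (hp m) x" using hermite_poly by metis
    \<comment> \<open>In the j-th product the factor j carries the Hermite polynomial, precomposed
      with multiplication by R(k) to undo the scaling of the argument; the other factors are plain
      cutoffs.\<close>
    define P where "P j i = (if i = j then smult (c j * exp 1) (pcompose (hp (m j)) [:0, R k:]) else [:exp 1:])" for j i :: nat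
    have "\<psi> k x = (\<Sum>j<n. \<Prod>i<n. bump (P j i) 0 (x i / R k))" for x
      unfolding \<psi>_def A_def sum_distrib_right
    proof (rule sum.cong[OF refl])
      fix j assume "j \<in> {..<n}"
      then have split: "(\<Prod>i<n. f i) = f j * (\<Prod>i\<in>{..<n} - {j}. f i)" for f :: "nat \<Rightarrow> real"
        by (subst prod.remove[of _ j]) auto
      have "bump (P j j) 0 (x j / R k) = a j (x j) * \<kappa> (R k) (x j)"
        using R(1)[of k] by (simp add: P_def a_def \<kappa>_def bump_def hp poly_pcompose)
      moreover have "(\<Prod>i\<in>{..<n} - {j}. bump (P j i) 0 (x i / R k)) = (\<Prod>i\<in>{..<n} - {j}. \<kappa> (R k) (x i))"
        by (intro prod.cong) (auto simp: P_def \<kappa>_def)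
      ultimately show "a j (x j) * (\<Prod>i<n. \<kappa> (R k) (x i)) = (\<Prod>i<n. bump (P j i) 0 (x i / R k))"
        unfolding split by simp
    qed
    then have "\<psi> k = (\<lambda>x. \<Sum>j<n. \<Prod>i<n. bump (P j i) 0 (x i / R k))" by auto
    then show ?thesis using bump_sumsI[where N = n and P = P and K = "\<lambda>_ _. 0"] by simp
  qed
  note test = bump_sums_test[OF this R(1)]
  have pd: "partial_deriv l (\<psi> k) x = a' l (x l) * (\<Prod>i<n. \<kappa> (R k) (x i))
      + A x * (\<kappa>' (R k) (x l) * (\<Prod>i\<in>{..<n} - {l}. \<kappa> (R k) (x i)))" if l: "l < n" for l k x
  proof -
    have split: "(\<Prod>i<n. f i) = f l * (\<Prod>i\<in>{..<n} - {l}. f i)" for f :: "nat \<Rightarrow> real"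
      using l by (subst prod.remove[of _ l]) auto
    have split': "(\<Sum>i<n. f i) = f l + (\<Sum>i\<in>{..<n} - {l}. f i)" for f :: "nat \<Rightarrow> real"
      using l by (subst sum.remove[of _ l]) auto
    have "((\<lambda>t. (a l t + (\<Sum>i\<in>{..<n} - {l}. a i (x i))) * (\<kappa> (R k) t * (\<Prod>i\<in>{..<n} - {l}. \<kappa> (R k) (x i))))
      has_real_derivative a' l (x l) * (\<Prod>i<n. \<kappa> (R k) (x i))
      + A x * (\<kappa>' (R k) (x l) * (\<Prod>i\<in>{..<n} - {l}. \<kappa> (R k) (x i)))) (at (x l))"
      unfolding A_def split split'
      by (auto intro!: derivative_eq_intros a_deriv \<kappa>_deriv[OF R(1)] simp: algebra_simps)
    moreover have "(\<lambda>t. \<psi> k (x(l := t))) = (\<lambda>t. (a l t + (\<Sum>i\<in>{..<n} - {l}. a i (x i))) * (\<kappa> (R k) t * (\<Prod>i\<in>{..<n} - {l}. \<kappa> (R k) (x i))))"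
      unfolding \<psi>_def A_def split split' by (auto intro!: ext arg_cong2[where f = "(*)"] arg_cong2[where f = "(+)"] sum.cong prod.cong)
    ultimately show ?thesis unfolding partial_deriv_def using DERIV_imp_deriv by metis
  qed
  have prod_le: "0 \<le> (\<Prod>i\<in>I. \<kappa> (R k) (x i))" "(\<Prod>i\<in>I. \<kappa> (R k) (x i)) \<le> 1" for I k and x :: "nat \<Rightarrow> real"
    using \<kappa>_nonneg \<kappa>_le_1 by (auto intro!: prod_nonneg prod_le_1)
  have prod_lim: "(\<lambda>k. \<Prod>i\<in>I. \<kappa> (R k) (x i)) \<longlonglongrightarrow> 1" for I and x :: "nat \<Rightarrow> real"
    using tendsto_prod[of I "\<lambda>i k. \<kappa> (R k) (x i)" "\<lambda>_. 1" sequentially] \<kappa>_lim by simp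
  let ?V = "\<lambda>\<omega> j. X (\<phi> j) \<omega>"
  \<comment> \<open>Majorants uniform in k for the cut-off sum and its partial derivatives: the
    cutoff is at most 1 and its derivative is at most C because R(k) >= 1.\<close>
  define w where "w \<omega> = (\<Sum>j<n. \<bar>a j (X (\<phi> j) \<omega>)\<bar>)" for \<omega>
  define w' where "w' l \<omega> = \<bar>a' l (X (\<phi> l) \<omega>)\<bar> + C * w \<omega>" for l \<omega>
  have A_le: "\<bar>A (?V \<omega>)\<bar> \<le> w \<omega>" for \<omega> unfolding A_def w_def by (rule sum_abs)
  have am_a: "all_moments M (\<lambda>\<omega>. a j (X (\<phi> j) \<omega>))" "all_moments M (\<lambda>\<omega>. a' j (X (\<phi> j) \<omega>))" for j
    unfolding a_def a'_def by (intro all_moments_intros)+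
  have am_abs: "all_moments M (\<lambda>\<omega>. \<bar>Y \<omega>\<bar>)" if "all_moments M Y" for Y
    using that unfolding all_moments_def by (auto intro: borel_measurable_abs)
  have am_w: "all_moments M w" unfolding w_def[abs_def] by (intro all_moments_intros am_abs am_a)
  have am_w': "all_moments M (w' l)" for l unfolding w'_def[abs_def] by (intro all_moments_intros am_abs am_a am_w)
  have meas: "(\<lambda>\<omega>. \<psi> k (?V \<omega>)) \<in> borel_measurable M" for k
    using all_moments_cylindrical[OF test(1-3)[of k], of "[]" \<phi>] by (simp add: all_moments_def)
  have meas': "(\<lambda>\<omega>. partial_deriv l (\<psi> k) (?V \<omega>)) \<in> borel_measurable M" if "l < n" for k l
    using all_moments_cylindrical[OF test(1-3)[of k], of "[l]" \<phi>] that by (simp add: all_moments_def)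
  have F: "tendsto_L2 M (\<lambda>k \<omega>. \<psi> k (?V \<omega>)) (\<lambda>\<omega>. A (?V \<omega>))"
  proof (rule tendsto_L2_dominated[OF meas _ _ all_moments_L2[OF am_w]])
    show "(\<lambda>\<omega>. A (?V \<omega>)) \<in> borel_measurable M"
      unfolding A_def using am_a by (intro borel_measurable_sum) (auto simp: all_moments_def)
    show "(\<lambda>k. \<psi> k (?V \<omega>)) \<longlonglongrightarrow> A (?V \<omega>)" for \<omega>
      unfolding \<psi>_def using tendsto_mult[OF tendsto_const prod_lim, of "A (?V \<omega>)" "?V \<omega>" "{..<n}"] by simp
    show "norm (\<psi> k (?V \<omega>)) \<le> w \<omega>" for k \<omega>
      unfolding \<psi>_def using A_le[of \<omega>] prod_le[of k "?V \<omega>" "{..<n}"]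
      by (auto simp: abs_mult intro!: order_trans[OF mult_left_le])
  qed
  have G: "tendsto_L2 M (\<lambda>k \<omega>. \<Sum>l<n. partial_deriv l (\<psi> k) (?V \<omega>) *\<^sub>R \<phi> l) (\<lambda>\<omega>. \<Sum>l<n. a' l (X (\<phi> l) \<omega>) *\<^sub>R \<phi> l)"
  proof (rule tendsto_L2_dominated[where w = "\<lambda>\<omega>. \<Sum>l<n. w' l \<omega> * norm (\<phi> l)"])
    show "(\<lambda>\<omega>. \<Sum>l<n. partial_deriv l (\<psi> k) (?V \<omega>) *\<^sub>R \<phi> l) \<in> borel_measurable M" for k
      using meas' by (intro borel_measurable_sum borel_measurable_scaleR) auto
    show "(\<lambda>\<omega>. \<Sum>l<n. a' l (X (\<phi> l) \<omega>) *\<^sub>R \<phi> l) \<in> borel_measurable M"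
      using am_a by (intro borel_measurable_sum borel_measurable_scaleR) (auto simp: all_moments_def)
    show "(\<lambda>\<omega>. \<Sum>l<n. w' l \<omega> * norm (\<phi> l)) \<in> L2 M"
      by (intro all_moments_L2 all_moments_intros am_w')
    show "(\<lambda>k. \<Sum>l<n. partial_deriv l (\<psi> k) (?V \<omega>) *\<^sub>R \<phi> l) \<longlonglongrightarrow> (\<Sum>l<n. a' l (X (\<phi> l) \<omega>) *\<^sub>R \<phi> l)" for \<omega>
    proof (intro tendsto_sum tendsto_scaleR tendsto_const)
      fix l assume "l \<in> {..<n}"
      then have l: "l < n" by simp
      have "(\<lambda>k. a' l (X (\<phi> l) \<omega>) * (\<Prod>i<n. \<kappa> (R k) (X (\<phi> i) \<omega>))
      + A (?V \<omega>) * (\<kappa>' (R k) (X (\<phi> l) \<omega>) * (\<Prod>i\<in>{..<n} - {l}. \<kappa> (R k) (X (\<phi> i) \<omega>))))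
        \<longlonglongrightarrow> a' l (X (\<phi> l) \<omega>) * 1 + A (?V \<omega>) * (0 * 1)"
        by (intro tendsto_add tendsto_mult tendsto_const prod_lim \<kappa>'_lim)
      then show "(\<lambda>k. partial_deriv l (\<psi> k) (?V \<omega>)) \<longlonglongrightarrow> a' l (X (\<phi> l) \<omega>)"
        by (simp add: pd[OF l])
    qed
    show "norm (\<Sum>l<n. partial_deriv l (\<psi> k) (?V \<omega>) *\<^sub>R \<phi> l) \<le> (\<Sum>l<n. w' l \<omega> * norm (\<phi> l))" for k \<omega>
    proof (rule sum_norm_le)
      fix l assume "l \<in> {..<n}"
      then have l: "l < n" by simp
      let ?p = "\<Prod>i<n. \<kappa> (R k) (X (\<phi> i) \<omega>)" and ?q = "\<Prod>i\<in>{..<n} - {l}. \<kappa> (R k) (X (\<phi> i) \<omega>)"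
      have "\<bar>partial_deriv l (\<psi> k) (?V \<omega>)\<bar> \<le> \<bar>a' l (X (\<phi> l) \<omega>)\<bar> * \<bar>?p\<bar> + \<bar>A (?V \<omega>)\<bar> * (\<bar>\<kappa>' (R k) (X (\<phi> l) \<omega>)\<bar> * \<bar>?q\<bar>)"
        unfolding pd[OF l] by (rule order_trans[OF abs_triangle_ineq]) (simp add: abs_mult)
      also have "\<dots> \<le> \<bar>a' l (X (\<phi> l) \<omega>)\<bar> * 1 + w \<omega> * (C * 1)"
        using prod_le[of k "?V \<omega>"] A_le[of \<omega>] \<kappa>'_le \<open>C \<ge> 0\<close>
        by (intro add_mono mult_mono order_trans[OF abs_ge_zero A_le[of \<omega>]]) auto
      finally have "\<bar>partial_deriv l (\<psi> k) (?V \<omega>)\<bar> \<le> w' l \<omega>" by (simp add: w'_def mult.commute)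
      then show "norm (partial_deriv l (\<psi> k) (?V \<omega>) *\<^sub>R \<phi> l) \<le> w' l \<omega> * norm (\<phi> l)"
        by (simp add: mult_right_mono)
    qed
  qed
  have "((\<lambda>\<omega>. \<psi> k (?V \<omega>)), (\<lambda>\<omega>. \<Sum>l<n. partial_deriv l (\<psi> k) (?V \<omega>) *\<^sub>R \<phi> l)) \<in> cylindrical_graph X" for k
    unfolding cylindrical_graph_def using test[of k] by blast
  then show ?thesis
    using F G unfolding has_malliavin_derivative_def A_def a_def a'_def
    by (intro exI[of _ "\<lambda>k \<omega>. \<psi> k (?V \<omega>)"] exI[of _ "\<lambda>k \<omega>. \<Sum>l<n. partial_deriv l (\<psi> k) (?V \<omega>) *\<^sub>R \<phi> l"] conjI allI)
qed

end

section \<open>The operator \<open>L\<^sup>-\<^sup>1\<close> maps into the domain of the Malliavin derivative\<close>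

context isonormal_gaussian
begin

text \<open>A relation rather than a function, because one variable of the span may have several
  representations by S and c; the variable and the gradient are read off from the same one.\<close>

definition chaos_deriv :: "nat \<Rightarrow> ('a \<Rightarrow> real) \<Rightarrow> ('a \<Rightarrow> 'h) \<Rightarrow> bool" where
  "chaos_deriv m y D \<longleftrightarrow> (\<exists>S c. finite S \<and> (\<forall>h\<in>S. norm h = 1) \<and>
     y = (\<lambda>\<omega>. \<Sum>h\<in>S. c h * hermite m (X h \<omega>)) \<and>
     D = (\<lambda>\<omega>. \<Sum>h\<in>S. (c h * (real m * hermite (m - 1) (X h \<omega>))) *\<^sub>R h))"

lemma chaos_derivE:
  assumes "chaos_deriv m y D"
  obtains S c where "finite S" "\<And>h. h \<in> S \<Longrightarrow> norm h = 1"
     "y = (\<lambda>\<omega>. \<Sum>h\<in>S. c h * hermite m (X h \<omega>))"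
     "D = (\<lambda>\<omega>. \<Sum>h\<in>S. (c h * (real m * hermite (m - 1) (X h \<omega>))) *\<^sub>R h)"
  using assms unfolding chaos_deriv_def by blast

lemma chaos_deriv_exists: "y \<in> chaos_span X m \<Longrightarrow> \<exists>D. chaos_deriv m y D"
  unfolding chaos_deriv_def chaos_span_def by blast

lemma chaos_deriv_zero: "chaos_deriv m (\<lambda>\<omega>. 0) (\<lambda>\<omega>. 0)"
  unfolding chaos_deriv_def by (intro exI[of _ "{}"]) simp

lemma chaos_deriv_span: "chaos_deriv m y D \<Longrightarrow> y \<in> chaos_span X m"
  unfolding chaos_deriv_def chaos_span_def by blast

lemma all_moments_scaleR_L2: "all_moments M Y \<Longrightarrow> (\<lambda>\<omega>. Y \<omega> *\<^sub>R k) \<in> L2 M" for k :: 'h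
  using all_moments_L2[of M Y] by (auto simp: L2_def power_mult_distrib)

lemma chaos_deriv_L2:
  assumes "chaos_deriv m y D"
  shows "D \<in> L2 M"
  using assms
proof (rule chaos_derivE)
  fix S c
  assume "D = (\<lambda>\<omega>. \<Sum>h\<in>S. (c h * (real m * hermite (m - 1) (X h \<omega>))) *\<^sub>R h)"
  then show "D \<in> L2 M" by (auto intro!: L2_sum all_moments_scaleR_L2 all_moments_intros)
qed

text \<open>This is the index-lowering identity for Hermite expectations, extended bilinearly. For m
  = n it says that the derivative multiplies squared norms by m, and for different orders it makes
  derivatives orthogonal.\<close>

lemma chaos_deriv_inner:
  assumes y: "chaos_deriv m y D" and z: "chaos_deriv n z E"
  shows "(\<integral>\<omega>. D \<omega> \<bullet> E \<omega> \<partial>M) = real n * (\<integral>\<omega>. y \<omega> * z \<omega> \<partial>M)"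
proof -
  obtain S c where S: "finite S" "\<And>h. h \<in> S \<Longrightarrow> norm h = 1"
     "y = (\<lambda>\<omega>. \<Sum>h\<in>S. c h * hermite m (X h \<omega>))"
     "D = (\<lambda>\<omega>. \<Sum>h\<in>S. (c h * (real m * hermite (m - 1) (X h \<omega>))) *\<^sub>R h)"
    using y by (rule chaos_derivE) blast
  obtain T d where T: "finite T" "\<And>h. h \<in> T \<Longrightarrow> norm h = 1"
     "z = (\<lambda>\<omega>. \<Sum>k\<in>T. d k * hermite n (X k \<omega>))"
     "E = (\<lambda>\<omega>. \<Sum>k\<in>T. (d k * (real n * hermite (n - 1) (X k \<omega>))) *\<^sub>R k)"
    using z by (rule chaos_derivE) blast
  let ?e = "\<lambda>m n h k. \<integral>\<omega>. hermite m (X h \<omega>) * hermite n (X k \<omega>) \<partial>M"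
  have i: "integrable M (\<lambda>\<omega>. hermite m (X h \<omega>) * hermite n (X k \<omega>))" for m n h k
    by (intro all_moments_integrable all_moments_intros)
  have key: "real m * real n * (h \<bullet> k) * ?e (m - 1) (n - 1) h k = real n * ?e m n h k" if "norm k = 1" for h k
    by (cases n) (auto simp: expectation_hermite_mult_Suc[OF that])
  have "D \<omega> \<bullet> E \<omega> = (\<Sum>h\<in>S. \<Sum>k\<in>T. (c h * d k * (real m * real n * (h \<bullet> k))) * (hermite (m - 1) (X h \<omega>) * hermite (n - 1) (X k \<omega>)))" for \<omega>
    unfolding S T by (simp only: inner_sum_left, simp only: inner_sum_right) (simp add: mult_ac)
  then have "(\<integral>\<omega>. D \<omega> \<bullet> E \<omega> \<partial>M) = (\<Sum>h\<in>S. \<Sum>k\<in>T. (c h * d k * (real m * real n * (h \<bullet> k))) * ?e (m - 1) (n - 1) h k)"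
    by (simp add: Bochner_Integration.integral_sum Bochner_Integration.integrable_sum integrable_mult_right i)
  also have "\<dots> = (\<Sum>h\<in>S. \<Sum>k\<in>T. (c h * d k) * (real n * ?e m n h k))"
    using T(2) by (intro sum.cong) (simp_all add: key[symmetric] mult_ac)
  also have "\<dots> = real n * (\<Sum>h\<in>S. \<Sum>k\<in>T. (c h * d k) * ?e m n h k)"
    by (simp add: sum_distrib_left mult_ac)
  also have "(\<Sum>h\<in>S. \<Sum>k\<in>T. (c h * d k) * ?e m n h k) = (\<integral>\<omega>. y \<omega> * z \<omega> \<partial>M)"
  proof -
    have "y \<omega> * z \<omega> = (\<Sum>h\<in>S. \<Sum>k\<in>T. (c h * d k) * (hermite m (X h \<omega>) * hermite n (X k \<omega>)))" for \<omega>
      unfolding S T sum_product by (auto intro!: sum.cong simp: mult_ac)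
    then show ?thesis
      by (simp add: Bochner_Integration.integral_sum Bochner_Integration.integrable_sum integrable_mult_right i)
  qed
  finally show ?thesis .
qed

text \<open>All pairs (m, h) of an order and a vector are enumerated by one finite index, the form
  in which \<open>hermite_sum_malliavin\<close> takes a sum with mixed orders.\<close>

lemma chaos_deriv_sum_malliavin:
  assumes "finite I" and "\<And>m. m \<in> I \<Longrightarrow> chaos_deriv m (y m) (D m)"
  shows "has_malliavin_derivative M X (\<lambda>\<omega>. \<Sum>m\<in>I. y m \<omega>) (\<lambda>\<omega>. \<Sum>m\<in>I. D m \<omega>)"
proof -
  have "\<forall>m\<in>I. \<exists>S c. finite S \<and> y m = (\<lambda>\<omega>. \<Sum>h\<in>S. c h * hermite m (X h \<omega>)) \<and>
     D m = (\<lambda>\<omega>. \<Sum>h\<in>S. (c h * (real m * hermite (m - 1) (X h \<omega>))) *\<^sub>R h)"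
    using assms(2) unfolding chaos_deriv_def by blast
  from bchoice[OF this] obtain S where "\<forall>m\<in>I. \<exists>c. finite (S m) \<and> y m = (\<lambda>\<omega>. \<Sum>h\<in>S m. c h * hermite m (X h \<omega>)) \<and>
     D m = (\<lambda>\<omega>. \<Sum>h\<in>S m. (c h * (real m * hermite (m - 1) (X h \<omega>))) *\<^sub>R h)" ..
  from bchoice[OF this] obtain c where "\<forall>m\<in>I. finite (S m) \<and> y m = (\<lambda>\<omega>. \<Sum>h\<in>S m. c m h * hermite m (X h \<omega>)) \<and>
     D m = (\<lambda>\<omega>. \<Sum>h\<in>S m. (c m h * (real m * hermite (m - 1) (X h \<omega>))) *\<^sub>R h)" ..
  then have S: "finite (S m)" "y m = (\<lambda>\<omega>. \<Sum>h\<in>S m. c m h * hermite m (X h \<omega>))"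
    "D m = (\<lambda>\<omega>. \<Sum>h\<in>S m. (c m h * (real m * hermite (m - 1) (X h \<omega>))) *\<^sub>R h)" if "m \<in> I" for m
    using that by blast+
  have fin: "finite (Sigma I S)" using assms(1) S(1) by auto
  then obtain e where "bij_betw e {0..<card (Sigma I S)} (Sigma I S)" using ex_bij_betw_nat_finite by blast
  then have e: "bij_betw e {..<card (Sigma I S)} (Sigma I S)" by (simp add: atLeast0LessThan)
  have "(\<Sum>j<card (Sigma I S). c (fst (e j)) (snd (e j)) * hermite (fst (e j)) (X (snd (e j)) \<omega>)) = (\<Sum>m\<in>I. y m \<omega>)" for \<omega>
  proof -
    have "(\<Sum>j<card (Sigma I S). c (fst (e j)) (snd (e j)) * hermite (fst (e j)) (X (snd (e j)) \<omega>))
      = (\<Sum>(m, h)\<in>Sigma I S. c m h * hermite m (X h \<omega>))"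
      by (subst sum.reindex_bij_betw[OF e, symmetric]) (auto intro!: sum.cong simp: case_prod_beta)
    also have "\<dots> = (\<Sum>m\<in>I. y m \<omega>)"
      using S assms(1) by (subst sum.Sigma[symmetric]) auto
    finally show ?thesis .
  qed
  moreover have "(\<Sum>j<card (Sigma I S). (c (fst (e j)) (snd (e j)) * (real (fst (e j)) * hermite (fst (e j) - 1) (X (snd (e j)) \<omega>))) *\<^sub>R snd (e j))
      = (\<Sum>m\<in>I. D m \<omega>)" for \<omega>
  proof -
    have "(\<Sum>j<card (Sigma I S). (c (fst (e j)) (snd (e j)) * (real (fst (e j)) * hermite (fst (e j) - 1) (X (snd (e j)) \<omega>))) *\<^sub>R snd (e j))
      = (\<Sum>(m, h)\<in>Sigma I S. (c m h * (real m * hermite (m - 1) (X h \<omega>))) *\<^sub>R h)"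
      by (subst sum.reindex_bij_betw[OF e, symmetric]) (auto intro!: sum.cong simp: case_prod_beta)
    also have "\<dots> = (\<Sum>m\<in>I. D m \<omega>)"
      using S assms(1) by (subst sum.Sigma[symmetric]) auto
    finally show ?thesis .
  qed
  ultimately show ?thesis
    using hermite_sum_malliavin[of "\<lambda>j. c (fst (e j)) (snd (e j))" "\<lambda>j. fst (e j)" "\<lambda>j. snd (e j)" "card (Sigma I S)"]
    by simp
qed

lemma wiener_chaos_approx:
  assumes "Y \<in> wiener_chaos M X m" "\<delta> > 0"
  shows "\<exists>y\<in>chaos_span X m. (\<integral>\<omega>. (c * y \<omega> - c * Y \<omega>)\<^sup>2 \<partial>M) \<le> c\<^sup>2 * \<delta>"
proof -
  obtain Ys where Ys: "\<And>k. Ys k \<in> chaos_span X m" "tendsto_L2 M Ys Y" using assms(1) by (rule wiener_chaosE) blast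
  obtain k where "(\<integral>\<omega>. (norm (Ys k \<omega> - Y \<omega>))\<^sup>2 \<partial>M) < \<delta>"
    using LIMSEQ_D[OF tendsto_L2D(3)[OF Ys(2)] assms(2)] by auto
  then have "c\<^sup>2 * (\<integral>\<omega>. (Ys k \<omega> - Y \<omega>)\<^sup>2 \<partial>M) \<le> c\<^sup>2 * \<delta>" by (intro mult_left_mono) auto
  moreover have "(\<integral>\<omega>. (c * Ys k \<omega> - c * Y \<omega>)\<^sup>2 \<partial>M) = c\<^sup>2 * (\<integral>\<omega>. (Ys k \<omega> - Y \<omega>)\<^sup>2 \<partial>M)"
    by (simp add: power_mult_distrib flip: right_diff_distrib)
  ultimately show ?thesis using Ys(1)[of k] by (intro bexI[of _ "Ys k"]) simp_all
qed

text \<open>On the \<open>m\<close>-th chaos the squared norm of the derivative is \<open>m\<close> times the squared norm, so the factor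
  \<open>1 / m\<close> in \<open>L\<^sup>-\<^sup>1\<close> makes the series of the derivatives converge.\<close>

lemma L_inv_malliavin:
  assumes Z: "Z \<in> L2 M"
  shows "\<exists>G. has_malliavin_derivative M X (L_inv M X Z) G"
proof -
  let ?J = "\<lambda>m. chaos_proj M X m Z"
  define a where "a m \<omega> = - (1 / real m) * ?J m \<omega>" for m \<omega>
  define b where "b m = (\<integral>\<omega>. (?J m \<omega>)\<^sup>2 \<partial>M)" for m
  \<comment> \<open>The cubic rate pays for two factors N. In \<open>YN\<close> they come from
    squaring a sum of N errors; in \<open>DN\<close> they come from N summands, each weighted by its
    order m <= N. What remains is at most 1/(N + 1).\<close>
  define \<delta> where "\<delta> N = 1 / real (Suc N) ^ 3" for N
  have a_L2: "a m \<in> L2 M" for m unfolding a_def[abs_def] by (intro L2_cmult chaos_proj_L2 Z)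
  have "\<exists>y D. chaos_deriv m y D \<and> (\<integral>\<omega>. (y \<omega> - a m \<omega>)\<^sup>2 \<partial>M) \<le> \<delta> N" for N m
  proof -
    have "\<delta> N > 0" by (simp add: \<delta>_def)
    then obtain y where y: "y \<in> chaos_span X m"
      "(\<integral>\<omega>. (- (1 / real m) * y \<omega> - (- (1 / real m)) * ?J m \<omega>)\<^sup>2 \<partial>M) \<le> (- (1 / real m))\<^sup>2 * \<delta> N"
      using wiener_chaos_approx[OF chaos_proj(1)[OF Z, of m], of "\<delta> N" "- (1 / real m)"] by blast
    have "(- (1 / real m))\<^sup>2 * \<delta> N \<le> 1 * \<delta> N"
      using \<open>\<delta> N > 0\<close> by (intro mult_right_mono) (cases m; simp add: abs_square_le_1 power_divide)+
    with y show ?thesis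
      using chaos_deriv_exists[OF chaos_span_scale[OF y(1), of "- (1 / real m)"]] unfolding a_def by fastforce
  qed
  then have "\<exists>p. chaos_deriv m (fst p) (snd p) \<and> (\<integral>\<omega>. (fst p \<omega> - a m \<omega>)\<^sup>2 \<partial>M) \<le> \<delta> N" for N m by simp
  note p = someI_ex[OF this]
  define y where "y N m = fst (SOME p. chaos_deriv m (fst p) (snd p) \<and> (\<integral>\<omega>. (fst p \<omega> - a m \<omega>)\<^sup>2 \<partial>M) \<le> \<delta> N)" for N m
  define D where "D N m = snd (SOME p. chaos_deriv m (fst p) (snd p) \<and> (\<integral>\<omega>. (fst p \<omega> - a m \<omega>)\<^sup>2 \<partial>M) \<le> \<delta> N)" for N m
  have yD: "chaos_deriv m (y N m) (D N m)" "(\<integral>\<omega>. (y N m \<omega> - a m \<omega>)\<^sup>2 \<partial>M) \<le> \<delta> N" for N m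
    using p[of m N] unfolding y_def D_def by blast+
  have y_L2: "y N m \<in> L2 M" for N m using chaos_deriv_span[OF yD(1)] chaos_span_L2 by blast
  note D_L2 = chaos_deriv_L2[OF yD(1)]
  define YN where "YN N \<omega> = (\<Sum>m=1..N. y N m \<omega>)" for N \<omega>
  define DN where "DN N \<omega> = (\<Sum>m=1..N. D N m \<omega>)" for N \<omega>
  have YN_L2: "YN N \<in> L2 M" and DN_L2: "DN N \<in> L2 M" for N
    unfolding YN_def[abs_def] DN_def[abs_def] by (intro L2_sum y_L2 D_L2)+
  have mall: "has_malliavin_derivative M X (YN N) (DN N)" for N
    unfolding YN_def[abs_def] DN_def[abs_def] by (intro chaos_deriv_sum_malliavin yD) auto
  have N2: "(real N)\<^sup>2 * \<delta> N \<le> 1 / real (Suc N)" for N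
  proof -
    have "(real N)\<^sup>2 * \<delta> N \<le> (real (Suc N))\<^sup>2 * \<delta> N" by (intro mult_right_mono power_mono) (auto simp: \<delta>_def)
    also have "\<dots> = 1 / real (Suc N)" unfolding \<delta>_def power3_eq_cube power2_eq_square by (simp del: of_nat_Suc)
    finally show ?thesis .
  qed
  have inv_lim: "(\<lambda>N. 1 / real (Suc N)) \<longlonglongrightarrow> 0"
    using LIMSEQ_inverse_real_of_nat by (simp add: inverse_eq_divide)
  have YN_lim: "tendsto_L2 M YN (L_inv M X Z)"
  proof (rule tendsto_L2_perturb[OF L_inv_tendsto[OF Z] YN_L2 _ inv_lim])
    fix N
    have "(\<integral>\<omega>. (norm (YN N \<omega> - (\<Sum>m=1..N. - (1 / real m) * ?J m \<omega>)))\<^sup>2 \<partial>M)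
      = (\<integral>\<omega>. (\<Sum>m=1..N. y N m \<omega> - a m \<omega>)\<^sup>2 \<partial>M)"
      by (simp only: YN_def a_def sum_subtractf real_norm_def power2_abs)
    also have "\<dots> \<le> (\<integral>\<omega>. real N * (\<Sum>m=1..N. (y N m \<omega> - a m \<omega>)\<^sup>2) \<partial>M)"
    proof (rule integral_mono)
      show "integrable M (\<lambda>\<omega>. (\<Sum>m=1..N. y N m \<omega> - a m \<omega>)\<^sup>2)"
        using L2_sum[of "{1..N}" "\<lambda>m \<omega>. y N m \<omega> - a m \<omega>" M] L2_diff[OF y_L2 a_L2] by (simp add: L2_def)
      show "integrable M (\<lambda>\<omega>. real N * (\<Sum>m=1..N. (y N m \<omega> - a m \<omega>)\<^sup>2))"
        using L2_diff[OF y_L2 a_L2] by (intro integrable_mult_right Bochner_Integration.integrable_sum) (simp add: L2_def)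
      show "(\<Sum>m=1..N. y N m \<omega> - a m \<omega>)\<^sup>2 \<le> real N * (\<Sum>m=1..N. (y N m \<omega> - a m \<omega>)\<^sup>2)" for \<omega>
        using sum_squared_le_sum_of_squares[of "\<lambda>m. y N m \<omega> - a m \<omega>" "{1..N}"] by (simp add: mult.commute)
    qed
    also have "\<dots> = real N * (\<Sum>m=1..N. \<integral>\<omega>. (y N m \<omega> - a m \<omega>)\<^sup>2 \<partial>M)"
      using L2_diff[OF y_L2 a_L2] by (simp add: Bochner_Integration.integral_sum L2_def)
    also have "\<dots> \<le> real N * (\<Sum>m=1..N. \<delta> N)" by (intro mult_left_mono sum_mono yD) auto
    also have "\<dots> \<le> 1 / real (Suc N)" using N2[of N] by (simp add: power2_eq_square)
    finally show "(\<integral>\<omega>. (norm (YN N \<omega> - (\<Sum>m=1..N. - (1 / real m) * ?J m \<omega>)))\<^sup>2 \<partial>M) \<le> 1 / real (Suc N)" .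
  qed
  have DN_diff: "(\<integral>\<omega>. (norm (DN N \<omega> - DN K \<omega>))\<^sup>2 \<partial>M) \<le> 4 / real (Suc N) + 4 / real (Suc K) + 4 * (\<Sum>m\<in>{Suc K..<Suc N}. b m)"
    if KN: "K \<le> N" for N K
  proof -
    \<comment> \<open>The shorter sum is padded with zeros, so that both are sums over 1..N and can
      be compared order by order.\<close>
    define z where "z m = (if m \<le> K then y K m else (\<lambda>_. 0))" for m
    define E where "E m = (if m \<le> K then D K m else (\<lambda>_. 0))" for m
    have zE: "chaos_deriv m (z m) (E m)" for m using yD(1) chaos_deriv_zero by (auto simp: z_def E_def)
    have z_L2: "z m \<in> L2 M" for m using chaos_deriv_span[OF zE] chaos_span_L2 by blast
    note E_L2 = chaos_deriv_L2[OF zE]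
    have DK: "DN K \<omega> = (\<Sum>m=1..N. E m \<omega>)" for \<omega>
      unfolding DN_def using KN by (intro sum.mono_neutral_cong_left) (auto simp: E_def)
    have inner: "(\<integral>\<omega>. (D N m \<omega> - E m \<omega>) \<bullet> (D N n \<omega> - E n \<omega>) \<partial>M) = real n * (\<integral>\<omega>. (y N m \<omega> - z m \<omega>) * (y N n \<omega> - z n \<omega>) \<partial>M)" for m n
    proof -
      have "(\<integral>\<omega>. (D N m \<omega> - E m \<omega>) \<bullet> (D N n \<omega> - E n \<omega>) \<partial>M)
        = (\<integral>\<omega>. D N m \<omega> \<bullet> D N n \<omega> \<partial>M) - (\<integral>\<omega>. D N m \<omega> \<bullet> E n \<omega> \<partial>M) - ((\<integral>\<omega>. E m \<omega> \<bullet> D N n \<omega> \<partial>M) - (\<integral>\<omega>. E m \<omega> \<bullet> E n \<omega> \<partial>M))"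
        using D_L2 E_L2 by (simp add: inner_diff_left inner_diff_right integrable_inner_L2)
      moreover have "(\<integral>\<omega>. (y N m \<omega> - z m \<omega>) * (y N n \<omega> - z n \<omega>) \<partial>M)
        = (\<integral>\<omega>. y N m \<omega> * y N n \<omega> \<partial>M) - (\<integral>\<omega>. y N m \<omega> * z n \<omega> \<partial>M) - ((\<integral>\<omega>. z m \<omega> * y N n \<omega> \<partial>M) - (\<integral>\<omega>. z m \<omega> * z n \<omega> \<partial>M))"
        using y_L2 z_L2 by (simp add: left_diff_distrib right_diff_distrib integrable_mult_L2)
      ultimately show ?thesis
        by (simp add: chaos_deriv_inner[OF yD(1) yD(1)] chaos_deriv_inner[OF yD(1) zE] chaos_deriv_inner[OF zE yD(1)]
            chaos_deriv_inner[OF zE zE] right_diff_distrib)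
    qed
    have "(\<integral>\<omega>. (norm (DN N \<omega> - DN K \<omega>))\<^sup>2 \<partial>M) = (\<integral>\<omega>. (norm (\<Sum>m=1..N. D N m \<omega> - E m \<omega>))\<^sup>2 \<partial>M)"
      unfolding DK by (simp add: DN_def sum_subtractf)
    also have "\<dots> = (\<Sum>m=1..N. \<integral>\<omega>. (norm (D N m \<omega> - E m \<omega>))\<^sup>2 \<partial>M)"
    proof (rule integral_norm_sq_sum_orthogonal)
      fix m n :: nat assume "m \<noteq> n"
      have "y N m \<in> wiener_chaos M X m" "z m \<in> wiener_chaos M X m" for m
        using chaos_deriv_span[OF yD(1)] chaos_deriv_span[OF zE] chaos_span_subset by blast+
      then have "(\<integral>\<omega>. (y N m \<omega> - z m \<omega>) * (y N n \<omega> - z n \<omega>) \<partial>M) = 0"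
        using y_L2 z_L2
        by (simp add: left_diff_distrib right_diff_distrib integrable_mult_L2 wiener_chaos_orthogonal[OF _ _ \<open>m \<noteq> n\<close>])
      then show "(\<integral>\<omega>. (D N m \<omega> - E m \<omega>) \<bullet> (D N n \<omega> - E n \<omega>) \<partial>M) = 0" unfolding inner by simp
    qed (auto intro: L2_diff D_L2 E_L2)
    also have "\<dots> = (\<Sum>m=1..N. real m * (\<integral>\<omega>. (y N m \<omega> - z m \<omega>)\<^sup>2 \<partial>M))"
      by (simp only: power2_norm_eq_inner inner) (simp only: power2_eq_square)
    \<comment> \<open>Orders up to K are approximated in both sums, which leaves only the two
      errors. For orders beyond K the term m E(a_m^2) equals b_m / m, so the tail of the summable
      sequence b controls it.\<close>
    also have "\<dots> \<le> (\<Sum>m=1..N. 4 * (real N * \<delta> N) + (if m \<le> K then 4 * (real K * \<delta> K) else 4 * b m))"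
    proof (rule sum_mono)
      fix m assume "m \<in> {1..N}"
      then have m: "1 \<le> m" "m \<le> N" by auto
      have \<delta>: "0 \<le> \<delta> N" "0 \<le> \<delta> K" by (auto simp: \<delta>_def)
      show "real m * (\<integral>\<omega>. (y N m \<omega> - z m \<omega>)\<^sup>2 \<partial>M) \<le> 4 * (real N * \<delta> N) + (if m \<le> K then 4 * (real K * \<delta> K) else 4 * b m)"
      proof (cases "m \<le> K")
        case True
        have "(\<integral>\<omega>. (y N m \<omega> - y K m \<omega>)\<^sup>2 \<partial>M) \<le> 2 * \<delta> N + 2 * \<delta> K"
          using integral_norm_diff_sq_le[OF y_L2[of N m] a_L2[of m] y_L2[of K m]] yD(2)[of N m] yD(2)[of K m]
          by (simp add: power2_commute[of "a m _"])
        then have "real m * (\<integral>\<omega>. (y N m \<omega> - y K m \<omega>)\<^sup>2 \<partial>M) \<le> real m * (2 * \<delta> N + 2 * \<delta> K)"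
          by (intro mult_left_mono) auto
        also have "\<dots> = 2 * (real m * \<delta> N) + 2 * (real m * \<delta> K)" by (simp add: algebra_simps)
        also have "\<dots> \<le> 2 * (real N * \<delta> N) + 2 * (real K * \<delta> K)"
          using True m \<delta> by (intro add_mono mult_left_mono mult_right_mono) auto
        also have "\<dots> \<le> 4 * (real N * \<delta> N) + 4 * (real K * \<delta> K)"
          using \<delta> by (intro add_mono mult_right_mono) auto
        finally show ?thesis using True by (simp add: z_def)
      next
        case False
        have "(\<integral>\<omega>. (a m \<omega>)\<^sup>2 \<partial>M) = (1 / real m)\<^sup>2 * b m"
          by (simp add: a_def b_def power_mult_distrib power_divide)
        moreover have "(\<integral>\<omega>. (y N m \<omega>)\<^sup>2 \<partial>M) \<le> 2 * (\<integral>\<omega>. (y N m \<omega> - a m \<omega>)\<^sup>2 \<partial>M) + 2 * (\<integral>\<omega>. (a m \<omega>)\<^sup>2 \<partial>M)"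
          using integral_norm_diff_sq_le[OF y_L2[of N m] a_L2[of m] L2_zero] by simp
        ultimately have "(\<integral>\<omega>. (y N m \<omega>)\<^sup>2 \<partial>M) \<le> 2 * \<delta> N + 2 * ((1 / real m)\<^sup>2 * b m)"
          using yD(2)[of N m] by linarith
        then have "real m * (\<integral>\<omega>. (y N m \<omega>)\<^sup>2 \<partial>M) \<le> real m * (2 * \<delta> N + 2 * ((1 / real m)\<^sup>2 * b m))"
          by (intro mult_left_mono) auto
        also have "\<dots> = 2 * (real m * \<delta> N) + 2 * ((1 / real m) * b m)"
          using m by (simp add: field_simps power2_eq_square)
        also have "\<dots> \<le> 4 * (real N * \<delta> N) + 4 * (1 * b m)"
        proof -
          have "real m * \<delta> N \<le> real N * \<delta> N" "0 \<le> real N * \<delta> N" using m \<delta> by (auto intro: mult_right_mono)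
          moreover have b: "0 \<le> b m" by (simp add: b_def)
          moreover have "(1 / real m) * b m \<le> 1 * b m"
            using m b by (intro mult_right_mono) auto
          ultimately show ?thesis by linarith
        qed
        finally show ?thesis using False by (simp add: z_def)
      qed
    qed
    also have "\<dots> = 4 * ((real N)\<^sup>2 * \<delta> N) + (\<Sum>m=1..N. if m \<le> K then 4 * (real K * \<delta> K) else 4 * b m)"
      by (simp add: sum.distrib power2_eq_square)
    also have "(\<Sum>m=1..N. if m \<le> K then 4 * (real K * \<delta> K) else 4 * b m) = 4 * ((real K)\<^sup>2 * \<delta> K) + 4 * (\<Sum>m\<in>{Suc K..<Suc N}. b m)"
    proof -
      have "{1..N} \<inter> {m. m \<le> K} = {1..K}" "{1..N} \<inter> - {m. m \<le> K} = {Suc K..<Suc N}"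
        using KN by auto
      then show ?thesis by (simp add: sum.If_cases sum_distrib_left power2_eq_square)
    qed
    finally show ?thesis using N2[of N] N2[of K] by simp
  qed
  have "\<exists>G. tendsto_L2 M DN G"
  proof (rule L2_complete[OF DN_L2])
    fix e :: real assume "e > 0"
    then obtain N1 where N1: "\<And>m n. m \<ge> N1 \<Longrightarrow> norm (sum b {m..<n}) < e / 16"
      using chaos_proj_summable[OF Z] unfolding summable_Cauchy b_def by (metis zero_less_divide_iff zero_less_numeral)
    obtain N2 where N2: "\<And>n. n \<ge> N2 \<Longrightarrow> 1 / real (Suc n) < e / 16"
      using LIMSEQ_D[OF inv_lim, of "e / 16"] \<open>e > 0\<close> by auto
    have half: "(\<integral>\<omega>. (norm (DN i \<omega> - DN j \<omega>))\<^sup>2 \<partial>M) < e" if "N1 \<le> j" "N2 \<le> j" "j \<le> i" for i j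
      using DN_diff[OF that(3)] N1[of "Suc j" "Suc i"] N2[of i] N2[of j] that \<open>e > 0\<close> by (simp add: abs_less_iff)
    have "(\<integral>\<omega>. (norm (DN i \<omega> - DN j \<omega>))\<^sup>2 \<partial>M) < e" if "max N1 N2 \<le> i" "max N1 N2 \<le> j" for i j
    proof (cases "j \<le> i")
      case False
      then show ?thesis using half[of i j] that by (subst norm_minus_commute) auto
    qed (use half that in auto)
    then show "\<exists>N. \<forall>i\<ge>N. \<forall>j\<ge>N. (\<integral>\<omega>. (norm (DN i \<omega> - DN j \<omega>))\<^sup>2 \<partial>M) < e" by blast
  qed
  then obtain G where G: "tendsto_L2 M DN G" by blast
  \<comment> \<open>\<open>YN N\<close> and \<open>DN N\<close> are themselves only limits along the
    graph, hence a diagonal choice: one graph pair close to both of them at once.\<close>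
  have "\<exists>F H. (F, H) \<in> cylindrical_graph X \<and> F \<in> L2 M \<and> H \<in> L2 M \<and>
      (\<integral>\<omega>. (norm (F \<omega> - YN N \<omega>))\<^sup>2 \<partial>M) \<le> 1 / real (Suc N) \<and> (\<integral>\<omega>. (norm (H \<omega> - DN N \<omega>))\<^sup>2 \<partial>M) \<le> 1 / real (Suc N)" for N
  proof -
    obtain Fs Hs where FH: "\<And>k. (Fs k, Hs k) \<in> cylindrical_graph X" "tendsto_L2 M Fs (YN N)" "tendsto_L2 M Hs (DN N)"
      using mall[of N] unfolding has_malliavin_derivative_def by blast
    have pos: "0 < 1 / real (Suc N)" by simp
    obtain k1 where k1: "\<And>k. k \<ge> k1 \<Longrightarrow> (\<integral>\<omega>. (norm (Fs k \<omega> - YN N \<omega>))\<^sup>2 \<partial>M) < 1 / real (Suc N)"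
      using LIMSEQ_D[OF tendsto_L2D(3)[OF FH(2)] pos] by auto
    obtain k2 where k2: "\<And>k. k \<ge> k2 \<Longrightarrow> (\<integral>\<omega>. (norm (Hs k \<omega> - DN N \<omega>))\<^sup>2 \<partial>M) < 1 / real (Suc N)"
      using LIMSEQ_D[OF tendsto_L2D(3)[OF FH(3)] pos] by auto
    show ?thesis
      using FH(1)[of "max k1 k2"] tendsto_L2D(2)[OF FH(2), of "max k1 k2"] tendsto_L2D(2)[OF FH(3), of "max k1 k2"]
        k1[of "max k1 k2"] k2[of "max k1 k2"] by (auto intro: less_imp_le)
  qed
  then have "\<forall>N. \<exists>p. p \<in> cylindrical_graph X \<and> fst p \<in> L2 M \<and> snd p \<in> L2 M \<and>
      (\<integral>\<omega>. (norm (fst p \<omega> - YN N \<omega>))\<^sup>2 \<partial>M) \<le> 1 / real (Suc N) \<and> (\<integral>\<omega>. (norm (snd p \<omega> - DN N \<omega>))\<^sup>2 \<partial>M) \<le> 1 / real (Suc N)"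
    by (simp only: split_paired_Ex fst_conv snd_conv) blast
  from choice[OF this] obtain p where p: "\<forall>N. p N \<in> cylindrical_graph X \<and> fst (p N) \<in> L2 M \<and> snd (p N) \<in> L2 M \<and>
      (\<integral>\<omega>. (norm (fst (p N) \<omega> - YN N \<omega>))\<^sup>2 \<partial>M) \<le> 1 / real (Suc N) \<and> (\<integral>\<omega>. (norm (snd (p N) \<omega> - DN N \<omega>))\<^sup>2 \<partial>M) \<le> 1 / real (Suc N)" ..
  define Fs Hs where "Fs N = fst (p N)" and "Hs N = snd (p N)" for N
  have FH: "(Fs N, Hs N) \<in> cylindrical_graph X" "Fs N \<in> L2 M" "Hs N \<in> L2 M"
    "(\<integral>\<omega>. (norm (Fs N \<omega> - YN N \<omega>))\<^sup>2 \<partial>M) \<le> 1 / real (Suc N)"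
    "(\<integral>\<omega>. (norm (Hs N \<omega> - DN N \<omega>))\<^sup>2 \<partial>M) \<le> 1 / real (Suc N)" for N
    using p unfolding Fs_def Hs_def by auto
  have "tendsto_L2 M Fs (L_inv M X Z)" by (rule tendsto_L2_perturb[OF YN_lim FH(2,4) inv_lim])
  moreover have "tendsto_L2 M Hs G" by (rule tendsto_L2_perturb[OF G FH(3,5) inv_lim])
  ultimately show ?thesis using FH(1) unfolding has_malliavin_derivative_def by blast
qed

end

section \<open>The integration by parts formula for \<open>Z\<close>\<close>

lemma lipschitz_of_deriv_bound:
  fixes f :: "real \<Rightarrow> real"
  assumes "\<And>x. (f has_real_derivative f' x) (at x)" "\<And>x. \<bar>f' x\<bar> \<le> C"
  shows "\<bar>f x - f y\<bar> \<le> C * \<bar>x - y\<bar>"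
proof -
  have "norm (f x - f y) \<le> C * norm (x - y)"
    by (rule field_differentiable_bound[where S = UNIV and f' = f'])
      (use assms in \<open>auto intro: has_field_derivative_at_within\<close>)
  then show ?thesis by simp
qed

context isonormal_gaussian
begin

lemma has_malliavin_derivative_L2:
  assumes "has_malliavin_derivative M X F G"
  shows "F \<in> L2 M" "G \<in> L2 M"
  using assms unfolding has_malliavin_derivative_def by (auto dest: tendsto_L2D)

lemma malliavin_D: "Z \<in> D12 M X \<Longrightarrow> has_malliavin_derivative M X Z (malliavin_D M X Z)"
  unfolding D12_def malliavin_D_def mem_Collect_eq by (rule someI_ex[of "has_malliavin_derivative M X Z"])

text \<open>The identity for cylindrical variables is carried to Z. On the right f is Lipschitz and
  preserves L^2 convergence. On the left the gradients converge in L^2 while f' is merely bounded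
  and continuous, so the two changes are made separately.\<close>

lemma malliavin_duality:
  assumes Z: "has_malliavin_derivative M X Z DZ" and mean: "(\<integral>\<omega>. Z \<omega> \<partial>M) = 0"
    and G: "has_malliavin_derivative M X (L_inv M X Z) G"
    and f: "\<And>x. (f has_real_derivative f' x) (at x)" "\<And>x. (f' has_real_derivative f'' x) (at x)"
      "continuous_on UNIV f''"
    and bdd: "\<And>x. \<bar>f' x\<bar> \<le> C1" "\<And>x. \<bar>f'' x\<bar> \<le> C2"
  shows "(\<integral>\<omega>. f' (Z \<omega>) * (DZ \<omega> \<bullet> (- G \<omega>)) \<partial>M) = (\<integral>\<omega>. (f (Z \<omega>) - f 0) * Z \<omega> \<partial>M)"
proof -
  note ZL = has_malliavin_derivative_L2[OF Z]
  define H where "H \<omega> = - G \<omega>" for \<omega>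
  have HL: "H \<in> L2 M" unfolding H_def[abs_def] by (intro L2_minus has_malliavin_derivative_L2[OF G])
  obtain Fs Gs where FG: "\<And>k. (Fs k, Gs k) \<in> cylindrical_graph X" "tendsto_L2 M Fs Z" "tendsto_L2 M Gs DZ"
    using Z unfolding has_malliavin_derivative_def by blast
  note FL = tendsto_L2D[OF FG(2)] and GL = tendsto_L2D[OF FG(3)]
  have cf: "continuous_on UNIV f" "continuous_on UNIV f'"
    using f(1,2) DERIV_isCont by (blast intro: continuous_at_imp_continuous_on)+
  have fm[measurable]: "f \<in> borel_measurable borel" "f' \<in> borel_measurable borel"
    using cf by (auto intro: borel_measurable_continuous_onI)
  have [measurable]: "Z \<in> borel_measurable M" "DZ \<in> borel_measurable M" "H \<in> borel_measurable M"
    "Fs k \<in> borel_measurable M" "Gs k \<in> borel_measurable M" for k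
    using ZL HL FL GL by (auto simp: L2_def)
  have "C1 \<ge> 0" using bdd(1)[of 0] by linarith
  have id: "(\<integral>\<omega>. f' (Fs k \<omega>) * (Gs k \<omega> \<bullet> H \<omega>) \<partial>M) = (\<integral>\<omega>. (f (Fs k \<omega>) - f 0) * Z \<omega> \<partial>M)" for k
  proof -
    obtain n \<psi> and \<phi> :: "nat \<Rightarrow> 'h" where "Fs k = (\<lambda>\<omega>. \<psi> (\<lambda>j. X (\<phi> j) \<omega>))"
      "Gs k = (\<lambda>\<omega>. \<Sum>i<n. partial_deriv i \<psi> (\<lambda>j. X (\<phi> j) \<omega>) *\<^sub>R \<phi> i)"
      "depends_on_first n \<psi>" "smooth n \<psi>" "compactly_supported n \<psi>"
      using FG(1)[of k] unfolding cylindrical_graph_def by blast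
    then show ?thesis
      using L_inv_duality[OF ZL(1) mean G _ _ _ f bdd, of n \<psi> \<phi>] by (simp add: H_def)
  qed
  have f_L2: "(\<lambda>\<omega>. f (Y \<omega>) - f 0) \<in> L2 M" if Y: "Y \<in> L2 M" for Y
  proof -
    have [measurable]: "Y \<in> borel_measurable M" using Y by (simp add: L2_def)
    have "\<bar>f (Y \<omega>) - f 0\<bar> \<le> C1 * \<bar>Y \<omega>\<bar>" for \<omega>
      using lipschitz_of_deriv_bound[OF f(1) bdd(1), of "Y \<omega>" 0] by simp
    then have "(f (Y \<omega>) - f 0)\<^sup>2 \<le> C1\<^sup>2 * (Y \<omega>)\<^sup>2" for \<omega>
      by (metis abs_ge_zero power2_abs power_mono power_mult_distrib)
    then have "integrable M (\<lambda>\<omega>. (f (Y \<omega>) - f 0)\<^sup>2)"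
      using Y by (intro Bochner_Integration.integrable_bound[where f = "\<lambda>\<omega>. C1\<^sup>2 * (Y \<omega>)\<^sup>2" and g = "\<lambda>\<omega>. (f (Y \<omega>) - f 0)\<^sup>2"])
        (auto simp: L2_def)
    then show ?thesis by (simp add: L2_def)
  qed
  have "tendsto_L2 M (\<lambda>k \<omega>. f (Fs k \<omega>) - f 0) (\<lambda>\<omega>. f (Z \<omega>) - f 0)"
  proof -
    have "(\<lambda>k. C1\<^sup>2 * (\<integral>\<omega>. (norm (Fs k \<omega> - Z \<omega>))\<^sup>2 \<partial>M)) \<longlonglongrightarrow> C1\<^sup>2 * 0" by (intro tendsto_intros FL)
    then have lim: "(\<lambda>k. C1\<^sup>2 * (\<integral>\<omega>. (norm (Fs k \<omega> - Z \<omega>))\<^sup>2 \<partial>M)) \<longlonglongrightarrow> 0" by simp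
    have le: "(\<integral>\<omega>. (norm ((f (Fs k \<omega>) - f 0) - (f (Z \<omega>) - f 0)))\<^sup>2 \<partial>M) \<le> C1\<^sup>2 * (\<integral>\<omega>. (norm (Fs k \<omega> - Z \<omega>))\<^sup>2 \<partial>M)" for k
    proof -
      have "(norm ((f (Fs k \<omega>) - f 0) - (f (Z \<omega>) - f 0)))\<^sup>2 \<le> C1\<^sup>2 * (norm (Fs k \<omega> - Z \<omega>))\<^sup>2" for \<omega>
      proof -
        have "norm ((f (Fs k \<omega>) - f 0) - (f (Z \<omega>) - f 0)) \<le> C1 * norm (Fs k \<omega> - Z \<omega>)"
          using lipschitz_of_deriv_bound[OF f(1) bdd(1), of "Fs k \<omega>" "Z \<omega>"] by simp
        from power_mono[OF this norm_ge_zero, of 2] show ?thesis by (simp add: power_mult_distrib)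
      qed
      then have "(\<integral>\<omega>. (norm ((f (Fs k \<omega>) - f 0) - (f (Z \<omega>) - f 0)))\<^sup>2 \<partial>M) \<le> (\<integral>\<omega>. C1\<^sup>2 * (norm (Fs k \<omega> - Z \<omega>))\<^sup>2 \<partial>M)"
        using L2_diff[OF f_L2[OF FL(2)[of k]] f_L2[OF ZL(1)]] L2_diff[OF FL(2)[of k] ZL(1)]
        by (intro integral_mono) (auto simp: L2_def)
      then show ?thesis by simp
    qed
    have "(\<lambda>k. \<integral>\<omega>. (norm ((f (Fs k \<omega>) - f 0) - (f (Z \<omega>) - f 0)))\<^sup>2 \<partial>M) \<longlonglongrightarrow> 0"
      by (rule Lim_null_comparison[OF always_eventually lim]) (use le in simp)
    then show ?thesis using f_L2[OF ZL(1)] f_L2[OF FL(2)] by (simp add: tendsto_L2_def)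
  qed
  from tendsto_L2_mult_right[OF this ZL(1)]
  have rhs: "(\<lambda>k. \<integral>\<omega>. (f (Fs k \<omega>) - f 0) * Z \<omega> \<partial>M) \<longlonglongrightarrow> (\<integral>\<omega>. (f (Z \<omega>) - f 0) * Z \<omega> \<partial>M)" .
  obtain r where r: "strict_mono r" "AE \<omega> in M. (\<lambda>i. Fs (r i) \<omega>) \<longlonglongrightarrow> Z \<omega>"
    using tendsto_L2_AE_subseq[OF FG(2)] by blast
  have bnd: "integrable M (\<lambda>\<omega>. f' (Y \<omega>) * (A \<omega> \<bullet> H \<omega>))"
    if Y: "Y \<in> borel_measurable M" and A: "A \<in> L2 M" for Y A
    using integrable_mult_bounded[OF integrable_inner_L2[OF A HL], of "\<lambda>\<omega>. f' (Y \<omega>)" C1] Y bdd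
    by (simp add: mult.commute)
  have part1: "(\<lambda>k. \<integral>\<omega>. f' (Fs k \<omega>) * ((Gs k \<omega> - DZ \<omega>) \<bullet> H \<omega>) \<partial>M) \<longlonglongrightarrow> 0"
  proof -
    have "(\<lambda>k. C1 * (sqrt (\<integral>\<omega>. (norm (Gs k \<omega> - DZ \<omega>))\<^sup>2 \<partial>M) * sqrt (\<integral>\<omega>. (norm (H \<omega>))\<^sup>2 \<partial>M)))
       \<longlonglongrightarrow> C1 * (sqrt 0 * sqrt (\<integral>\<omega>. (norm (H \<omega>))\<^sup>2 \<partial>M))"
      by (intro tendsto_intros GL)
    then have lim: "(\<lambda>k. C1 * (sqrt (\<integral>\<omega>. (norm (Gs k \<omega> - DZ \<omega>))\<^sup>2 \<partial>M) * sqrt (\<integral>\<omega>. (norm (H \<omega>))\<^sup>2 \<partial>M))) \<longlonglongrightarrow> 0"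
      by simp
    show ?thesis
    proof (rule Lim_null_comparison[OF always_eventually lim], rule allI)
      fix k
      note dL = L2_diff[OF GL(2)[of k] GL(1)]
      have "norm (\<integral>\<omega>. f' (Fs k \<omega>) * ((Gs k \<omega> - DZ \<omega>) \<bullet> H \<omega>) \<partial>M) \<le> (\<integral>\<omega>. norm (f' (Fs k \<omega>) * ((Gs k \<omega> - DZ \<omega>) \<bullet> H \<omega>)) \<partial>M)"
        by (rule integral_norm_bound)
      also have "\<dots> \<le> (\<integral>\<omega>. C1 * (norm (Gs k \<omega> - DZ \<omega>) * norm (H \<omega>)) \<partial>M)"
      proof (rule integral_mono)
        show "integrable M (\<lambda>\<omega>. norm (f' (Fs k \<omega>) * ((Gs k \<omega> - DZ \<omega>) \<bullet> H \<omega>)))"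
          by (intro integrable_norm bnd dL) simp
        show "integrable M (\<lambda>\<omega>. C1 * (norm (Gs k \<omega> - DZ \<omega>) * norm (H \<omega>)))"
          by (intro integrable_mult_right integrable_norm_mult_L2 dL HL)
        show "norm (f' (Fs k \<omega>) * ((Gs k \<omega> - DZ \<omega>) \<bullet> H \<omega>)) \<le> C1 * (norm (Gs k \<omega> - DZ \<omega>) * norm (H \<omega>))" for \<omega>
          using bdd(1)[of "Fs k \<omega>"] \<open>C1 \<ge> 0\<close> Cauchy_Schwarz_ineq2[of "Gs k \<omega> - DZ \<omega>" "H \<omega>"]
          by (simp add: abs_mult mult_mono)
      qed
      also have "\<dots> = C1 * (\<integral>\<omega>. norm (Gs k \<omega> - DZ \<omega>) * norm (H \<omega>) \<partial>M)" by simp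
      also have "\<dots> \<le> C1 * (sqrt (\<integral>\<omega>. (norm (Gs k \<omega> - DZ \<omega>))\<^sup>2 \<partial>M) * sqrt (\<integral>\<omega>. (norm (H \<omega>))\<^sup>2 \<partial>M))"
        using real_le_rsqrt[OF Cauchy_Schwarz_L2[OF dL HL]] \<open>C1 \<ge> 0\<close> by (intro mult_left_mono) (auto simp: real_sqrt_mult)
      finally show "norm (\<integral>\<omega>. f' (Fs k \<omega>) * ((Gs k \<omega> - DZ \<omega>) \<bullet> H \<omega>) \<partial>M)
        \<le> C1 * (sqrt (\<integral>\<omega>. (norm (Gs k \<omega> - DZ \<omega>))\<^sup>2 \<partial>M) * sqrt (\<integral>\<omega>. (norm (H \<omega>))\<^sup>2 \<partial>M))" .
    qed
  qed
  \<comment> \<open>Pointwise convergence holds almost surely along the subsequence r only; with DZ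
    already in place, the integrand has a fixed integrable majorant.\<close>
  have part2: "(\<lambda>k. \<integral>\<omega>. f' (Fs (r k) \<omega>) * (DZ \<omega> \<bullet> H \<omega>) \<partial>M) \<longlonglongrightarrow> (\<integral>\<omega>. f' (Z \<omega>) * (DZ \<omega> \<bullet> H \<omega>) \<partial>M)"
  proof (rule integral_dominated_convergence[where w = "\<lambda>\<omega>. C1 * \<bar>DZ \<omega> \<bullet> H \<omega>\<bar>"])
    show "AE \<omega> in M. (\<lambda>k. f' (Fs (r k) \<omega>) * (DZ \<omega> \<bullet> H \<omega>)) \<longlonglongrightarrow> f' (Z \<omega>) * (DZ \<omega> \<bullet> H \<omega>)"
      using r(2)
    proof eventually_elim
      case (elim \<omega>)
      have "isCont f' (Z \<omega>)" using f(2) DERIV_isCont by blast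
      then show ?case by (intro tendsto_mult tendsto_const isCont_tendsto_compose[OF _ elim])
    qed
    show "AE \<omega> in M. norm (f' (Fs (r k) \<omega>) * (DZ \<omega> \<bullet> H \<omega>)) \<le> C1 * \<bar>DZ \<omega> \<bullet> H \<omega>\<bar>" for k
      using bdd(1) by (intro AE_I2) (simp add: abs_mult mult_right_mono)
    show "integrable M (\<lambda>\<omega>. C1 * \<bar>DZ \<omega> \<bullet> H \<omega>\<bar>)"
      using integrable_inner_L2[OF ZL(2) HL] by simp
  qed auto
  have split: "(\<integral>\<omega>. f' (Fs k \<omega>) * (Gs k \<omega> \<bullet> H \<omega>) \<partial>M)
      = (\<integral>\<omega>. f' (Fs k \<omega>) * ((Gs k \<omega> - DZ \<omega>) \<bullet> H \<omega>) \<partial>M) + (\<integral>\<omega>. f' (Fs k \<omega>) * (DZ \<omega> \<bullet> H \<omega>) \<partial>M)" for k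
    using bnd[of "Fs k", OF _ L2_diff[OF GL(2)[of k] GL(1)]] bnd[of "Fs k", OF _ GL(1)]
    by (subst Bochner_Integration.integral_add[symmetric]) (auto simp: inner_diff_left algebra_simps)
  have "(\<lambda>k. \<integral>\<omega>. f' (Fs (r k) \<omega>) * (Gs (r k) \<omega> \<bullet> H \<omega>) \<partial>M) \<longlonglongrightarrow> 0 + (\<integral>\<omega>. f' (Z \<omega>) * (DZ \<omega> \<bullet> H \<omega>) \<partial>M)"
    unfolding split using LIMSEQ_subseq_LIMSEQ[OF part1 r(1)] by (intro tendsto_add part2) (simp add: comp_def)
  moreover have "(\<lambda>k. \<integral>\<omega>. f' (Fs (r k) \<omega>) * (Gs (r k) \<omega> \<bullet> H \<omega>) \<partial>M) \<longlonglongrightarrow> (\<integral>\<omega>. (f (Z \<omega>) - f 0) * Z \<omega> \<partial>M)"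
    unfolding id using LIMSEQ_subseq_LIMSEQ[OF rhs r(1)] by (simp add: comp_def)
  ultimately show ?thesis using LIMSEQ_unique unfolding H_def by fastforce
qed

text \<open>As f'(Z) is measurable with respect to Z, the conditional expectation may be replaced by
  the inner product itself. \<open>L_inv_malliavin\<close> guarantees that the chosen derivative of
  \<open>L_inv M X Z\<close> is a genuine one.\<close>

lemma g_version_integral:
  assumes Z: "Z \<in> D12 M X" and mean: "(\<integral>\<omega>. Z \<omega> \<partial>M) = 0" and g: "is_g_version M X Z g"
  shows "Z \<in> L2 M" "g \<in> borel_measurable borel" "integrable M (\<lambda>\<omega>. g (Z \<omega>))"
    and "\<lbrakk>\<And>x. (f has_real_derivative f' x) (at x); \<And>x. (f' has_real_derivative f'' x) (at x);
      continuous_on UNIV f''; \<And>x. \<bar>f' x\<bar> \<le> C1; \<And>x. \<bar>f'' x\<bar> \<le> C2\<rbrakk>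
      \<Longrightarrow> (\<integral>\<omega>. f' (Z \<omega>) * g (Z \<omega>) \<partial>M) = (\<integral>\<omega>. (f (Z \<omega>) - f 0) * Z \<omega> \<partial>M)"
proof -
  let ?DZ = "malliavin_D M X Z" and ?G = "malliavin_D M X (L_inv M X Z)"
  have DZ: "has_malliavin_derivative M X Z ?DZ" by (rule malliavin_D[OF Z])
  note ZL = has_malliavin_derivative_L2[OF DZ]
  show "Z \<in> L2 M" by (rule ZL)
  have "L_inv M X Z \<in> D12 M X" using L_inv_malliavin[OF ZL(1)] by (simp add: D12_def)
  then have G: "has_malliavin_derivative M X (L_inv M X Z) ?G" by (rule malliavin_D)
  note GL = has_malliavin_derivative_L2[OF G]
  have Zm[measurable]: "Z \<in> borel_measurable M" using ZL by (simp add: L2_def)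
  show gm[measurable]: "g \<in> borel_measurable borel" using g by (simp add: is_g_version_def)
  let ?Y = "\<lambda>\<omega>. ?DZ \<omega> \<bullet> (- ?G \<omega>)"
  let ?F = "vimage_algebra (space M) Z borel"
  have Y: "integrable M ?Y" by (rule integrable_inner_L2[OF ZL(2) L2_minus[OF GL(2)]])
  have sub: "subalgebra M ?F"
    unfolding subalgebra_def
    using measurable_sets[OF Zm] by (auto simp: sets_vimage_algebra2)
  interpret F: finite_measure_subalgebra M ?F
    by unfold_locales (rule sub)
  have ce: "AE \<omega> in M. g (Z \<omega>) = real_cond_exp M ?F ?Y \<omega>" using g by (simp add: is_g_version_def)
  have ZF: "Z \<in> measurable ?F borel" by (rule measurable_vimage_algebra1) simp
  have ci: "integrable M (real_cond_exp M ?F ?Y)" by (rule F.real_cond_exp_int(1)[OF Y])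
  then show "integrable M (\<lambda>\<omega>. g (Z \<omega>))"
    using ce by (subst integrable_cong_AE) auto
  assume f: "\<And>x. (f has_real_derivative f' x) (at x)" "\<And>x. (f' has_real_derivative f'' x) (at x)"
      "continuous_on UNIV f''" and bdd: "\<And>x. \<bar>f' x\<bar> \<le> C1" "\<And>x. \<bar>f'' x\<bar> \<le> C2"
  have "continuous_on UNIV f'"
    using f(2) DERIV_isCont by (blast intro: continuous_at_imp_continuous_on)
  then have fm[measurable]: "f' \<in> borel_measurable borel" by (rule borel_measurable_continuous_onI)
  have "(\<integral>\<omega>. f' (Z \<omega>) * g (Z \<omega>) \<partial>M) = (\<integral>\<omega>. f' (Z \<omega>) * real_cond_exp M ?F ?Y \<omega> \<partial>M)"
    using ci by (intro integral_cong_AE) (use ce in auto)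
  also have "\<dots> = (\<integral>\<omega>. f' (Z \<omega>) * ?Y \<omega> \<partial>M)"
  proof (rule F.real_cond_exp_intg(2))
    show "integrable M (\<lambda>\<omega>. f' (Z \<omega>) * ?Y \<omega>)"
      using integrable_mult_bounded[OF Y, of "\<lambda>\<omega>. f' (Z \<omega>)" C1] bdd by (simp add: mult.commute)
    show "(\<lambda>\<omega>. f' (Z \<omega>)) \<in> borel_measurable ?F" by (rule measurable_compose[OF ZF fm])
    show "?Y \<in> borel_measurable M" using Y by auto
  qed
  also have "\<dots> = (\<integral>\<omega>. (f (Z \<omega>) - f 0) * Z \<omega> \<partial>M)"
    by (rule malliavin_duality[OF DZ mean G f bdd])
  finally show "(\<integral>\<omega>. f' (Z \<omega>) * g (Z \<omega>) \<partial>M) = (\<integral>\<omega>. (f (Z \<omega>) - f 0) * Z \<omega> \<partial>M)" .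
qed

text \<open>The function |x - b| is approximated by sqrt((x - b)^2 + e^2), whose derivative is
  bounded by 1 and tends to the sign, with value 0 at b.\<close>

lemma g_version_sgn:
  assumes Z: "Z \<in> D12 M X" and mean: "(\<integral>\<omega>. Z \<omega> \<partial>M) = 0" and g: "is_g_version M X Z g"
  shows "(\<integral>\<omega>. sgn (Z \<omega> - b) * g (Z \<omega>) \<partial>M) = (\<integral>\<omega>. \<bar>Z \<omega> - b\<bar> * Z \<omega> \<partial>M)"
proof -
  note gv = g_version_integral[OF Z mean g]
  have [measurable]: "Z \<in> borel_measurable M" "g \<in> borel_measurable borel" using gv by (auto simp: L2_def)
  have iZ: "integrable M Z" by (rule L2_imp_integrable[OF gv(1)])
  have iZ2: "integrable M (\<lambda>\<omega>. (Z \<omega>)\<^sup>2)" using gv(1) by (simp add: L2_def)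
  define e where "e n = 1 / real (Suc n)" for n
  have e: "e n > 0" "e n \<le> 1" for n by (auto simp: e_def)
  have e_lim: "e \<longlonglongrightarrow> 0" unfolding e_def[abs_def] using LIMSEQ_inverse_real_of_nat by (simp add: inverse_eq_divide)
  define s where "s n x = sqrt ((x - b)\<^sup>2 + (e n)\<^sup>2)" for n x
  have pos: "0 < (x - b)\<^sup>2 + (e n)\<^sup>2" for n x using e(1)[of n] by (intro add_nonneg_pos) auto
  have s_pos: "0 < s n x" for n x using pos by (simp add: s_def)
  have s_sq: "(s n x)\<^sup>2 = (x - b)\<^sup>2 + (e n)\<^sup>2" for n x using pos[of x n] by (simp add: s_def)
  have s_ge: "e n \<le> s n x" "\<bar>x - b\<bar> \<le> s n x" for n x
    unfolding s_def using e(1)[of n] by (auto intro!: real_le_rsqrt)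
  have s_le: "s n x \<le> \<bar>x - b\<bar> + e n" for n x
    unfolding s_def using e(1)[of n] by (intro real_le_lsqrt) (auto simp: power2_sum)
  have s_deriv: "(s n has_real_derivative (x - b) / s n x) (at x)" for n x
  proof -
    have "((\<lambda>x. (x - b)\<^sup>2 + (e n)\<^sup>2) has_real_derivative 2 * (x - b)) (at x)"
      by (auto intro!: derivative_eq_intros)
    from DERIV_chain2[OF DERIV_real_sqrt[OF pos] this]
    have "(s n has_real_derivative inverse (s n x) / 2 * (2 * (x - b))) (at x)" unfolding s_def[abs_def] .
    also have "inverse (s n x) / 2 * (2 * (x - b)) = (x - b) / s n x"
      using s_pos[of n x] by (simp add: field_simps)
    finally show ?thesis .
  qed
  have s_deriv2: "((\<lambda>x. (x - b) / s n x) has_real_derivative (e n)\<^sup>2 / (s n x) ^ 3) (at x)" for n x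
  proof -
    have "((\<lambda>x. (x - b) / s n x) has_real_derivative (1 * s n x - (x - b) * ((x - b) / s n x)) / (s n x * s n x)) (at x)"
      using s_pos[of n x] by (auto intro!: derivative_eq_intros s_deriv)
    also have "(1 * s n x - (x - b) * ((x - b) / s n x)) / (s n x * s n x) = ((s n x)\<^sup>2 - (x - b)\<^sup>2) / (s n x) ^ 3"
      using s_pos[of n x] by (simp add: field_simps power2_eq_square power3_eq_cube)
    finally show ?thesis by (simp add: s_sq)
  qed
  have cs: "continuous_on UNIV (s n)" for n
    using s_deriv DERIV_isCont by (blast intro: continuous_at_imp_continuous_on)
  have "(\<integral>\<omega>. (Z \<omega> - b) / s n (Z \<omega>) * g (Z \<omega>) \<partial>M) = (\<integral>\<omega>. (s n (Z \<omega>) - s n 0) * Z \<omega> \<partial>M)" for n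
  proof (rule gv(4)[OF s_deriv s_deriv2])
    show "continuous_on UNIV (\<lambda>x. (e n)\<^sup>2 / (s n x) ^ 3)"
      using s_pos[of n] by (intro continuous_intros cs) (auto simp: less_imp_neq[THEN not_sym])
    show "\<bar>(x - b) / s n x\<bar> \<le> 1" for x
      using s_pos[of n x] s_ge(2)[of x n] by (simp add: abs_divide)
    \<comment> \<open>This bound is 1/e(n) and grows with n, which is admissible since the formula
      is applied for each n separately.\<close>
    show "\<bar>(e n)\<^sup>2 / (s n x) ^ 3\<bar> \<le> (e n)\<^sup>2 / (e n) ^ 3" for x
      using s_pos[of n x] s_ge(1)[of n x] e(1)[of n] by (auto simp: abs_divide intro!: divide_left_mono power_mono)
  qed
  \<comment> \<open>The subtracted constant s(n)(0) disappears because Z has mean 0.\<close>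
  moreover have "(\<integral>\<omega>. (s n (Z \<omega>) - s n 0) * Z \<omega> \<partial>M) = (\<integral>\<omega>. s n (Z \<omega>) * Z \<omega> \<partial>M)" for n
  proof -
    have "integrable M (\<lambda>\<omega>. s n (Z \<omega>) * Z \<omega>)"
    proof (rule Bochner_Integration.integrable_bound)
      show "integrable M (\<lambda>\<omega>. (Z \<omega>)\<^sup>2 + (\<bar>b\<bar> + 1) * \<bar>Z \<omega>\<bar>)" using iZ iZ2 by simp
      show "(\<lambda>\<omega>. s n (Z \<omega>) * Z \<omega>) \<in> borel_measurable M" unfolding s_def by measurable
      show "AE \<omega> in M. norm (s n (Z \<omega>) * Z \<omega>) \<le> norm ((Z \<omega>)\<^sup>2 + (\<bar>b\<bar> + 1) * \<bar>Z \<omega>\<bar>)"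
      proof (rule AE_I2)
        fix \<omega>
        have "s n (Z \<omega>) \<le> \<bar>Z \<omega>\<bar> + (\<bar>b\<bar> + 1)" using s_le[of n "Z \<omega>"] e(2)[of n] by linarith
        then have "s n (Z \<omega>) * \<bar>Z \<omega>\<bar> \<le> (\<bar>Z \<omega>\<bar> + (\<bar>b\<bar> + 1)) * \<bar>Z \<omega>\<bar>" by (intro mult_right_mono) auto
        then show "norm (s n (Z \<omega>) * Z \<omega>) \<le> norm ((Z \<omega>)\<^sup>2 + (\<bar>b\<bar> + 1) * \<bar>Z \<omega>\<bar>)"
          using s_pos[of n "Z \<omega>"] by (simp add: abs_mult distrib_right power2_eq_square)
      qed
    qed
    then show ?thesis using iZ mean by (simp add: left_diff_distrib)
  qed
  ultimately have id: "(\<integral>\<omega>. (Z \<omega> - b) / s n (Z \<omega>) * g (Z \<omega>) \<partial>M) = (\<integral>\<omega>. s n (Z \<omega>) * Z \<omega> \<partial>M)" for n by simp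
  have s_lim: "(\<lambda>n. s n x) \<longlonglongrightarrow> \<bar>x - b\<bar>" for x
  proof -
    have "(\<lambda>n. sqrt ((x - b)\<^sup>2 + (e n)\<^sup>2)) \<longlonglongrightarrow> sqrt ((x - b)\<^sup>2 + 0\<^sup>2)" by (intro tendsto_intros e_lim)
    then show ?thesis by (simp add: s_def)
  qed
  have "(\<lambda>n. \<integral>\<omega>. (Z \<omega> - b) / s n (Z \<omega>) * g (Z \<omega>) \<partial>M) \<longlonglongrightarrow> (\<integral>\<omega>. sgn (Z \<omega> - b) * g (Z \<omega>) \<partial>M)"
  proof (rule integral_dominated_convergence[where w = "\<lambda>\<omega>. \<bar>g (Z \<omega>)\<bar>"])
    show "AE \<omega> in M. (\<lambda>n. (Z \<omega> - b) / s n (Z \<omega>) * g (Z \<omega>)) \<longlonglongrightarrow> sgn (Z \<omega> - b) * g (Z \<omega>)"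
    proof (rule AE_I2)
      fix \<omega>
      have "(\<lambda>n. (Z \<omega> - b) / s n (Z \<omega>)) \<longlonglongrightarrow> sgn (Z \<omega> - b)"
      proof (cases "Z \<omega> = b")
        case False
        have "(\<lambda>n. (Z \<omega> - b) / s n (Z \<omega>)) \<longlonglongrightarrow> (Z \<omega> - b) / \<bar>Z \<omega> - b\<bar>"
          using False by (intro tendsto_intros s_lim) auto
        then show ?thesis by (simp only: real_sgn_eq)
      qed simp
      then show "(\<lambda>n. (Z \<omega> - b) / s n (Z \<omega>) * g (Z \<omega>)) \<longlonglongrightarrow> sgn (Z \<omega> - b) * g (Z \<omega>)"
        by (intro tendsto_mult tendsto_const)
    qed
    show "AE \<omega> in M. norm ((Z \<omega> - b) / s n (Z \<omega>) * g (Z \<omega>)) \<le> \<bar>g (Z \<omega>)\<bar>" for n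
    proof (rule AE_I2)
      fix \<omega>
      have "\<bar>(Z \<omega> - b) / s n (Z \<omega>)\<bar> \<le> 1" using s_pos[of n "Z \<omega>"] s_ge(2)[of "Z \<omega>" n] by (simp add: abs_divide)
      then have "\<bar>(Z \<omega> - b) / s n (Z \<omega>)\<bar> * \<bar>g (Z \<omega>)\<bar> \<le> 1 * \<bar>g (Z \<omega>)\<bar>" by (intro mult_right_mono) auto
      then show "norm ((Z \<omega> - b) / s n (Z \<omega>) * g (Z \<omega>)) \<le> \<bar>g (Z \<omega>)\<bar>" by (simp add: abs_mult)
    qed
    show "integrable M (\<lambda>\<omega>. \<bar>g (Z \<omega>)\<bar>)" using gv(3) by simp
    show "(\<lambda>\<omega>. (Z \<omega> - b) / s n (Z \<omega>) * g (Z \<omega>)) \<in> borel_measurable M" for n unfolding s_def by measurable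
  qed measurable
  moreover have "(\<lambda>n. \<integral>\<omega>. s n (Z \<omega>) * Z \<omega> \<partial>M) \<longlonglongrightarrow> (\<integral>\<omega>. \<bar>Z \<omega> - b\<bar> * Z \<omega> \<partial>M)"
  proof (rule integral_dominated_convergence[where w = "\<lambda>\<omega>. (Z \<omega>)\<^sup>2 + (\<bar>b\<bar> + 1) * \<bar>Z \<omega>\<bar>"])
    show "AE \<omega> in M. (\<lambda>n. s n (Z \<omega>) * Z \<omega>) \<longlonglongrightarrow> \<bar>Z \<omega> - b\<bar> * Z \<omega>"
      by (intro AE_I2 tendsto_mult tendsto_const s_lim)
    show "AE \<omega> in M. norm (s n (Z \<omega>) * Z \<omega>) \<le> (Z \<omega>)\<^sup>2 + (\<bar>b\<bar> + 1) * \<bar>Z \<omega>\<bar>" for n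
    proof (rule AE_I2)
      fix \<omega>
      have "s n (Z \<omega>) \<le> \<bar>Z \<omega>\<bar> + (\<bar>b\<bar> + 1)" using s_le[of n "Z \<omega>"] e(2)[of n] by linarith
      then have "s n (Z \<omega>) * \<bar>Z \<omega>\<bar> \<le> (\<bar>Z \<omega>\<bar> + (\<bar>b\<bar> + 1)) * \<bar>Z \<omega>\<bar>" by (intro mult_right_mono) auto
      then show "norm (s n (Z \<omega>) * Z \<omega>) \<le> (Z \<omega>)\<^sup>2 + (\<bar>b\<bar> + 1) * \<bar>Z \<omega>\<bar>"
        using s_pos[of n "Z \<omega>"] by (simp add: abs_mult distrib_right power2_eq_square)
    qed
    show "integrable M (\<lambda>\<omega>. (Z \<omega>)\<^sup>2 + (\<bar>b\<bar> + 1) * \<bar>Z \<omega>\<bar>)" using iZ iZ2 by simp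
    show "(\<lambda>\<omega>. s n (Z \<omega>) * Z \<omega>) \<in> borel_measurable M" for n unfolding s_def by measurable
  qed measurable
  ultimately show ?thesis unfolding id by (rule LIMSEQ_unique)
qed

end

section \<open>Tails of a variable with a Stein kernel bounded below\<close>

text \<open>The tail estimates use the process only through the identities \<open>kernel\<close> and
  the lower bound on g; s stands for the square of \<sigma>min.\<close>

locale stein_kernel = prob_space M for M :: "'a measure" +
  fixes Z :: "'a \<Rightarrow> real" and g :: "real \<Rightarrow> real" and s :: real
  assumes Z_L2: "Z \<in> L2 M" and mean: "(\<integral>\<omega>. Z \<omega> \<partial>M) = 0"
    and g_measurable [measurable]: "g \<in> borel_measurable borel"
    and g_integrable: "integrable M (\<lambda>\<omega>. g (Z \<omega>))"
    and kernel: "\<And>b. (\<integral>\<omega>. sgn (Z \<omega> - b) * g (Z \<omega>) \<partial>M) = (\<integral>\<omega>. \<bar>Z \<omega> - b\<bar> * Z \<omega> \<partial>M)"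
    and s_pos: "s > 0" and g_ge: "AE \<omega> in M. s \<le> g (Z \<omega>)"
begin

lemma Z_measurable [measurable]: "Z \<in> borel_measurable M"
  using Z_L2 by (simp add: L2_def)

lemma Z_integrable: "integrable M Z"
  by (rule L2_imp_integrable[OF Z_L2])

lemma Z_sq_integrable: "integrable M (\<lambda>\<omega>. (Z \<omega>)\<^sup>2)"
  using Z_L2 by (simp add: L2_def)

lemma shift_integrable: "integrable M (\<lambda>\<omega>. \<bar>Z \<omega> - b\<bar> * Z \<omega>)"
proof (rule Bochner_Integration.integrable_bound)
  show "integrable M (\<lambda>\<omega>. (Z \<omega>)\<^sup>2 + \<bar>b\<bar> * \<bar>Z \<omega>\<bar>)" using Z_integrable Z_sq_integrable by simp
  show "AE \<omega> in M. norm (\<bar>Z \<omega> - b\<bar> * Z \<omega>) \<le> norm ((Z \<omega>)\<^sup>2 + \<bar>b\<bar> * \<bar>Z \<omega>\<bar>)"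
  proof (rule AE_I2)
    fix \<omega>
    have "\<bar>Z \<omega> - b\<bar> * \<bar>Z \<omega>\<bar> \<le> (\<bar>Z \<omega>\<bar> + \<bar>b\<bar>) * \<bar>Z \<omega>\<bar>" by (intro mult_right_mono) auto
    then show "norm (\<bar>Z \<omega> - b\<bar> * Z \<omega>) \<le> norm ((Z \<omega>)\<^sup>2 + \<bar>b\<bar> * \<bar>Z \<omega>\<bar>)"
      by (simp add: abs_mult distrib_right power2_eq_square)
  qed
qed simp

lemma integrable_g_mult:
  assumes "u \<in> borel_measurable borel" "\<And>x. \<bar>u x\<bar> \<le> C"
  shows "integrable M (\<lambda>\<omega>. u (Z \<omega>) * g (Z \<omega>))"
  using integrable_mult_bounded[OF g_integrable measurable_compose[OF Z_measurable assms(1)] assms(2)]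
  by (simp add: mult.commute)

lemma kernel_diff:
  assumes "b \<le> c"
  shows "(\<integral>\<omega>. (sgn (Z \<omega> - b) - sgn (Z \<omega> - c)) * g (Z \<omega>) \<partial>M) = (\<integral>\<omega>. (\<bar>Z \<omega> - b\<bar> - \<bar>Z \<omega> - c\<bar>) * Z \<omega> \<partial>M)"
proof -
  have "integrable M (\<lambda>\<omega>. sgn (Z \<omega> - b) * g (Z \<omega>))" for b
    by (rule integrable_g_mult[where C = 1]) (auto simp: sgn_real_def)
  then show ?thesis
    using kernel[of b] kernel[of c] shift_integrable[of b] shift_integrable[of c]
    by (simp add: left_diff_distrib)
qed

text \<open>The difference of the signs at b and b + d dominates the indicator of b, and the kernel
  identity bounds its g-weighted mean by d E|Z|. Letting d shrink, the atom has g-weight 0, hence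
  probability 0 because g(Z) >= s > 0.\<close>

lemma no_atoms: "AE \<omega> in M. Z \<omega> \<noteq> b"
proof -
  let ?a = "\<integral>\<omega>. indicator {b} (Z \<omega>) * g (Z \<omega>) \<partial>M"
  have ge: "AE \<omega> in M. 0 \<le> g (Z \<omega>)" using g_ge by eventually_elim (use s_pos in linarith)
  have ia: "integrable M (\<lambda>\<omega>. indicator {b} (Z \<omega>) * g (Z \<omega>))"
    by (rule integrable_g_mult[where C = 1]) (auto simp: indicator_def)
  have bound: "?a \<le> d * (\<integral>\<omega>. \<bar>Z \<omega>\<bar> \<partial>M)" if "d > 0" for d
  proof -
    have "?a \<le> (\<integral>\<omega>. (sgn (Z \<omega> - b) - sgn (Z \<omega> - (b + d))) * g (Z \<omega>) \<partial>M)"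
    proof (rule integral_mono_AE[OF ia])
      show "integrable M (\<lambda>\<omega>. (sgn (Z \<omega> - b) - sgn (Z \<omega> - (b + d))) * g (Z \<omega>))"
        by (rule integrable_g_mult[where C = 2]) (auto simp: sgn_real_def)
      show "AE \<omega> in M. indicator {b} (Z \<omega>) * g (Z \<omega>) \<le> (sgn (Z \<omega> - b) - sgn (Z \<omega> - (b + d))) * g (Z \<omega>)"
        using ge by eventually_elim (use that in \<open>auto intro!: mult_right_mono simp: indicator_def sgn_real_def\<close>)
    qed
    also have "\<dots> = (\<integral>\<omega>. (\<bar>Z \<omega> - b\<bar> - \<bar>Z \<omega> - (b + d)\<bar>) * Z \<omega> \<partial>M)"
      using that by (intro kernel_diff) simp
    also have "\<dots> \<le> (\<integral>\<omega>. d * \<bar>Z \<omega>\<bar> \<partial>M)"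
    proof (rule integral_mono)
      show "integrable M (\<lambda>\<omega>. (\<bar>Z \<omega> - b\<bar> - \<bar>Z \<omega> - (b + d)\<bar>) * Z \<omega>)"
        using shift_integrable[of b] shift_integrable[of "b + d"] by (simp add: left_diff_distrib)
      show "integrable M (\<lambda>\<omega>. d * \<bar>Z \<omega>\<bar>)" using Z_integrable by simp
      show "(\<bar>Z \<omega> - b\<bar> - \<bar>Z \<omega> - (b + d)\<bar>) * Z \<omega> \<le> d * \<bar>Z \<omega>\<bar>" for \<omega>
      proof -
        have "(\<bar>Z \<omega> - b\<bar> - \<bar>Z \<omega> - (b + d)\<bar>) * Z \<omega> \<le> \<bar>\<bar>Z \<omega> - b\<bar> - \<bar>Z \<omega> - (b + d)\<bar>\<bar> * \<bar>Z \<omega>\<bar>"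
          by (metis abs_ge_self abs_mult)
        also have "\<dots> \<le> d * \<bar>Z \<omega>\<bar>" using that by (intro mult_right_mono) auto
        finally show ?thesis .
      qed
    qed
    finally show ?thesis by simp
  qed
  have "?a \<le> 0"
  proof (rule ccontr)
    assume "\<not> ?a \<le> 0"
    then have a: "?a > 0" by simp
    define K where "K = (\<integral>\<omega>. \<bar>Z \<omega>\<bar> \<partial>M)"
    have K: "0 \<le> K" by (simp add: K_def)
    then have "?a * K / (K + 1) < ?a" using a by (simp add: field_simps)
    \<comment> \<open>Used as the value of d; the 1 added to K keeps the quotient defined when K =
      0.\<close>
    moreover have "0 < ?a / (K + 1)" using a K by (intro divide_pos_pos) auto
    from bound[OF this] have "?a \<le> ?a / (K + 1) * K" by (simp add: K_def)
    ultimately show False by simp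
  qed
  moreover have nn: "AE \<omega> in M. 0 \<le> indicator {b} (Z \<omega>) * g (Z \<omega>)"
    using ge by eventually_elim (auto simp: indicator_def)
  ultimately have "?a = 0" using integral_nonneg_AE[OF nn] by simp
  then have "AE \<omega> in M. indicator {b} (Z \<omega>) * g (Z \<omega>) = 0"
    using integral_nonneg_eq_0_iff_AE[OF ia nn] by simp
  then show ?thesis
    using g_ge by eventually_elim (use s_pos in \<open>auto simp: indicator_def split: if_splits\<close>)
qed

section \<open>The truncated mean and the law of Z\<close>

definition tail_mean :: "real \<Rightarrow> real" where
  "tail_mean x = (\<integral>\<omega>. (if x < Z \<omega> then Z \<omega> else 0) \<partial>M)"

lemma tail_mean_integrable: "integrable M (\<lambda>\<omega>. if x < Z \<omega> then Z \<omega> else 0)"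
  by (rule Bochner_Integration.integrable_bound[OF Z_integrable]) auto

lemma tail_mean_measurable [measurable]: "tail_mean \<in> borel_measurable borel"
  unfolding tail_mean_def[abs_def] by measurable

text \<open>For negative x the mean zero condition rewrites the integral as that of -Z over Z <= x,
  where the integrand is positive.\<close>

lemma tail_mean_nonneg: "0 \<le> tail_mean x"
proof (cases "x \<ge> 0")
  case True
  then show ?thesis unfolding tail_mean_def by (intro integral_nonneg_AE AE_I2) auto
next
  case False
  have "tail_mean x = (\<integral>\<omega>. Z \<omega> - (if x < Z \<omega> then 0 else Z \<omega>) \<partial>M)"
    unfolding tail_mean_def by (intro Bochner_Integration.integral_cong) auto
  also have "\<dots> = - (\<integral>\<omega>. (if x < Z \<omega> then 0 else Z \<omega>) \<partial>M)"
  proof -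
    have "integrable M (\<lambda>\<omega>. if x < Z \<omega> then 0 else Z \<omega>)"
      by (rule Bochner_Integration.integrable_bound[OF Z_integrable]) auto
    then show ?thesis using Z_integrable mean by simp
  qed
  also have "\<dots> = (\<integral>\<omega>. (if x < Z \<omega> then 0 else - Z \<omega>) \<partial>M)"
    by (subst Bochner_Integration.integral_minus[symmetric]) (intro Bochner_Integration.integral_cong, auto)
  also have "0 \<le> \<dots>" using False by (intro integral_nonneg_AE AE_I2) auto
  finally show ?thesis .
qed

lemma tail_mean_zero: "tail_mean 0 = (\<integral>\<omega>. \<bar>Z \<omega>\<bar> \<partial>M) / 2"
proof -
  have "(\<integral>\<omega>. \<bar>Z \<omega>\<bar> \<partial>M) = (\<integral>\<omega>. 2 * (if 0 < Z \<omega> then Z \<omega> else 0) - Z \<omega> \<partial>M)"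
    by (intro Bochner_Integration.integral_cong) auto
  also have "\<dots> = 2 * tail_mean 0"
    unfolding tail_mean_def using tail_mean_integrable[of 0] Z_integrable mean by simp
  finally show ?thesis by simp
qed

text \<open>Otherwise Z would be almost surely 0, which is an atom.\<close>

lemma tail_mean_zero_pos: "0 < tail_mean 0"
proof (rule ccontr)
  assume "\<not> 0 < tail_mean 0"
  then have "(\<integral>\<omega>. \<bar>Z \<omega>\<bar> \<partial>M) = 0" using tail_mean_nonneg[of 0] unfolding tail_mean_zero by linarith
  then have "AE \<omega> in M. \<bar>Z \<omega>\<bar> = 0"
    using Z_integrable by (subst (asm) integral_nonneg_eq_0_iff_AE) auto
  then have "AE \<omega> in M. False" using no_atoms[of 0] by eventually_elim simp
  then show False by simp
qed

text \<open>By Fubini the left side is the mean of Z times the length of (b, min(c, Z)), and this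
  length is half of |Z - b| - |Z - c| + c - b. The constant drops out by mean zero, and
  \<open>kernel_diff\<close> turns the rest into g.\<close>

lemma tail_mean_interval:
  assumes "b \<le> c"
  shows "integrable lborel (\<lambda>x. indicator {b<..c} x * tail_mean x)"
    and "(\<integral>x. indicator {b<..c} x * tail_mean x \<partial>lborel) = (\<integral>\<omega>. indicator {b<..c} (Z \<omega>) * g (Z \<omega>) \<partial>M)"
proof -
  interpret P: pair_sigma_finite lborel M ..
  let ?f = "\<lambda>x \<omega>. indicator {b<..c} x * (if x < Z \<omega> then Z \<omega> else 0)"
  have tail_mean_le: "\<bar>tail_mean x\<bar> \<le> (\<integral>\<omega>. \<bar>Z \<omega>\<bar> \<partial>M)" for x
  proof -
    have "tail_mean x \<le> (\<integral>\<omega>. \<bar>Z \<omega>\<bar> \<partial>M)"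
      unfolding tail_mean_def using Z_integrable by (intro integral_mono tail_mean_integrable) auto
    then show ?thesis using tail_mean_nonneg[of x] by simp
  qed
  have ind: "integrable lborel (\<lambda>x. indicator {b<..c} x :: real)"
    by (simp add: integrable_indicator_iff emeasure_lborel_Ioc assms)
  show "integrable lborel (\<lambda>x. indicator {b<..c} x * tail_mean x)"
    by (rule integrable_mult_bounded[OF ind _ tail_mean_le]) simp
  have abs_int: "integrable lborel (\<lambda>x. \<integral>\<omega>. norm (?f x \<omega>) \<partial>M)"
  proof (rule Bochner_Integration.integrable_bound)
    show "integrable lborel (\<lambda>x. indicator {b<..c} x * (\<integral>\<omega>. \<bar>Z \<omega>\<bar> \<partial>M))" using ind by simp
    show "(\<lambda>x. \<integral>\<omega>. norm (?f x \<omega>) \<partial>M) \<in> borel_measurable lborel" by measurable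
    show "AE x in lborel. norm (\<integral>\<omega>. norm (?f x \<omega>) \<partial>M) \<le> norm (indicator {b<..c} x * (\<integral>\<omega>. \<bar>Z \<omega>\<bar> \<partial>M))"
    proof (rule AE_I2)
      fix x
      have "(\<integral>\<omega>. norm (?f x \<omega>) \<partial>M) \<le> (\<integral>\<omega>. indicator {b<..c} x * \<bar>Z \<omega>\<bar> \<partial>M)"
        using Z_integrable tail_mean_integrable[of x] by (intro integral_mono) (auto simp: indicator_def)
      then show "norm (\<integral>\<omega>. norm (?f x \<omega>) \<partial>M) \<le> norm (indicator {b<..c} x * (\<integral>\<omega>. \<bar>Z \<omega>\<bar> \<partial>M))"
        by simp
    qed
  qed
  have int: "integrable (lborel \<Otimes>\<^sub>M M) (case_prod ?f)"
    by (rule P.Fubini_integrable) (use abs_int tail_mean_integrable in auto)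
  have "(\<integral>x. indicator {b<..c} x * tail_mean x \<partial>lborel) = (\<integral>x. (\<integral>\<omega>. ?f x \<omega> \<partial>M) \<partial>lborel)"
    by (simp add: tail_mean_def)
  also have "\<dots> = (\<integral>\<omega>. (\<integral>x. ?f x \<omega> \<partial>lborel) \<partial>M)"
    by (rule P.Fubini_integral[OF int, symmetric])
  also have "\<dots> = (\<integral>\<omega>. (\<bar>Z \<omega> - b\<bar> - \<bar>Z \<omega> - c\<bar>) * Z \<omega> / 2 + (c - b) / 2 * Z \<omega> \<partial>M)"
  proof (intro Bochner_Integration.integral_cong refl)
    fix \<omega>
    \<comment> \<open>The set of x is replaced by an open interval of known length; they differ at
      most in the point c.\<close>
    have "(\<integral>x. ?f x \<omega> \<partial>lborel) = (\<integral>x. indicator {b<..<min c (Z \<omega>)} x * Z \<omega> + indicator ({b<..c} \<inter> {..<Z \<omega>} - {b<..<min c (Z \<omega>)}) x * Z \<omega> \<partial>lborel)"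
      by (intro Bochner_Integration.integral_cong) (auto simp: indicator_def)
    also have "\<dots> = (\<integral>x. indicator {b<..<min c (Z \<omega>)} x * Z \<omega> \<partial>lborel)"
    proof (rule integral_cong_AE)
      show "AE x in lborel. indicator {b<..<min c (Z \<omega>)} x * Z \<omega> + indicator ({b<..c} \<inter> {..<Z \<omega>} - {b<..<min c (Z \<omega>)}) x * Z \<omega>
        = indicator {b<..<min c (Z \<omega>)} x * Z \<omega>"
        using AE_lborel_singleton[of c] by eventually_elim (auto simp: indicator_def)
    qed auto
    also have "\<dots> = measure lborel {b<..<min c (Z \<omega>)} * Z \<omega>" by simp
    also have "\<dots> = (\<bar>Z \<omega> - b\<bar> - \<bar>Z \<omega> - c\<bar>) * Z \<omega> / 2 + (c - b) / 2 * Z \<omega>"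
      using assms by (cases "Z \<omega> \<le> b"; cases "Z \<omega> \<le> c") (auto simp: min_def algebra_simps add_divide_distrib diff_divide_distrib)
    finally show "(\<integral>x. ?f x \<omega> \<partial>lborel) = (\<bar>Z \<omega> - b\<bar> - \<bar>Z \<omega> - c\<bar>) * Z \<omega> / 2 + (c - b) / 2 * Z \<omega>" .
  qed
  also have "\<dots> = (\<integral>\<omega>. (\<bar>Z \<omega> - b\<bar> - \<bar>Z \<omega> - c\<bar>) * Z \<omega> \<partial>M) / 2"
  proof -
    have "integrable M (\<lambda>\<omega>. (\<bar>Z \<omega> - b\<bar> - \<bar>Z \<omega> - c\<bar>) * Z \<omega>)"
      using shift_integrable[of b] shift_integrable[of c] by (simp add: left_diff_distrib)
    then show ?thesis using Z_integrable mean by simp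
  qed
  also have "\<dots> = (\<integral>\<omega>. (sgn (Z \<omega> - b) - sgn (Z \<omega> - c)) * g (Z \<omega>) \<partial>M) / 2"
    by (simp add: kernel_diff[OF assms])
  also have "(\<integral>\<omega>. (sgn (Z \<omega> - b) - sgn (Z \<omega> - c)) * g (Z \<omega>) \<partial>M) = (\<integral>\<omega>. 2 * (indicator {b<..c} (Z \<omega>) * g (Z \<omega>)) \<partial>M)"
    by (rule integral_cong_AE, measurable, use no_atoms[of b] no_atoms[of c] in eventually_elim)
      (use assms in \<open>auto simp: indicator_def sgn_real_def\<close>)
  finally show "(\<integral>x. indicator {b<..c} x * tail_mean x \<partial>lborel) = (\<integral>\<omega>. indicator {b<..c} (Z \<omega>) * g (Z \<omega>) \<partial>M)" by simp
qed

text \<open>As g(Z) is almost surely positive, \<open>ennreal\<close> cuts nothing off, and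
  half-open intervals form an intersection-stable generator.\<close>

lemma g_law: "distr (density M (\<lambda>\<omega>. ennreal (g (Z \<omega>)))) borel Z = density lborel (\<lambda>x. ennreal (tail_mean x))"
    (is "?L = ?R")
proof (rule measure_eqI_generator_eq[where \<Omega> = UNIV and E = "range (\<lambda>(a, b). {a<..b::real})" and A = "\<lambda>i. {- real (i::nat)<..real i}"])
  have L: "emeasure ?L B = ennreal (\<integral>\<omega>. indicator B (Z \<omega>) * g (Z \<omega>) \<partial>M)" if [measurable]: "B \<in> sets borel" for B
  proof -
    have "emeasure ?L B = ennreal (\<integral>\<omega>. max 0 (g (Z \<omega>)) * indicator B (Z \<omega>) \<partial>M)"
      by (rule emeasure_distr_density_real[OF g_integrable]) simp_all
    also have "(\<integral>\<omega>. max 0 (g (Z \<omega>)) * indicator B (Z \<omega>) \<partial>M) = (\<integral>\<omega>. indicator B (Z \<omega>) * g (Z \<omega>) \<partial>M)"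
      by (rule integral_cong_AE, measurable, use g_ge in eventually_elim) (use s_pos in \<open>auto simp: max_def\<close>)
    finally show ?thesis .
  qed
  fix X assume "X \<in> range (\<lambda>(a, b). {a<..b::real})"
  then obtain a b where X: "X = {a<..b}" by auto
  show "emeasure ?L X = emeasure ?R X"
  proof (cases "a \<le> b")
    case True
    have "emeasure ?R X = (\<integral>\<^sup>+x. ennreal (indicator X x * tail_mean x) \<partial>lborel)"
      unfolding X by (subst emeasure_density) (auto intro!: nn_integral_cong simp: indicator_def)
    also have "\<dots> = ennreal (\<integral>x. indicator X x * tail_mean x \<partial>lborel)"
      unfolding X by (rule nn_integral_eq_integral[OF tail_mean_interval(1)[OF True]]) (simp add: tail_mean_nonneg)
    finally show ?thesis unfolding X by (simp add: tail_mean_interval(2)[OF True] L)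
  qed (simp add: X)
next
  show "(\<Union>i. {- real (i::nat)<..real i}) = UNIV" by (rule UN_Ioc_eq_UNIV)
  show "emeasure ?L {- real i<..real i} \<noteq> \<infinity>" for i
    by (subst emeasure_distr_density_real[OF g_integrable]) auto
qed (auto simp: borel_sigma_sets_Ioc Int_stable_def)

lemma density_exists: "\<exists>\<rho>. is_density M Z \<rho>"
proof -
  have ac: "absolutely_continuous lborel (distr M borel Z)"
    unfolding absolutely_continuous_def
  proof
    fix N :: "real set" assume N: "N \<in> null_sets lborel"
    then have [measurable]: "N \<in> sets borel" by auto
    have "AE x in lborel. x \<notin> N" by (rule AE_not_in[OF N])
    then have "AE x in density lborel (\<lambda>x. ennreal (tail_mean x)). x \<notin> N"
      by (subst AE_density) auto
    then have "AE \<omega> in density M (\<lambda>\<omega>. ennreal (g (Z \<omega>))). Z \<omega> \<notin> N"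
      unfolding g_law[symmetric] by (subst (asm) AE_distr_iff) auto
    then have "AE \<omega> in M. 0 < ennreal (g (Z \<omega>)) \<longrightarrow> Z \<omega> \<notin> N"
      by (subst (asm) AE_density) auto
    then have "AE \<omega> in M. Z \<omega> \<notin> N"
      using g_ge by eventually_elim (use s_pos in auto)
    then have "AE x in distr M borel Z. x \<notin> N" by (subst AE_distr_iff) auto
    then show "N \<in> null_sets (distr M borel Z)" by (subst (asm) AE_iff_null_sets[symmetric]) auto
  qed
  interpret D: prob_space "distr M borel Z" by (rule prob_space_distr) simp
  obtain f where f: "f \<in> borel_measurable lborel" "AE x in lborel. RN_deriv lborel (distr M borel Z) x = ennreal (f x)"
    "\<And>x. 0 \<le> f x"
    using sigma_finite_lborel ac by (rule sigma_finite_measure.real_RN_deriv[OF _ D.finite_measure_axioms]) auto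
  have "distr M lborel Z = distr M borel Z" by (intro distr_cong) auto
  also have "\<dots> = density lborel (RN_deriv lborel (distr M borel Z))"
    by (rule sigma_finite_measure.density_RN_deriv[OF sigma_finite_lborel ac, symmetric]) simp
  also have "\<dots> = density lborel (\<lambda>x. ennreal (f x))"
    by (intro density_cong) (use f in auto)
  finally have "is_density M Z f"
    using f unfolding is_density_def distributed_def by auto
  then show ?thesis by blast
qed

text \<open>Both functions are densities of the law from \<open>g_law\<close>. The bound on g is
  available only where \<rho> > 0, since g is arbitrary where the law of Z has no mass.\<close>

lemma density_kernel:
  assumes \<rho>: "is_density M Z \<rho>"
  shows "AE x in lborel. tail_mean x = \<rho> x * g x \<and> (0 < \<rho> x \<longrightarrow> s \<le> g x)"
proof -
  have [measurable]: "\<rho> \<in> borel_measurable borel" and nn: "\<And>x. 0 \<le> \<rho> x"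
    and D: "distributed M lborel Z (\<lambda>x. ennreal (\<rho> x))"
    using \<rho> by (auto simp: is_density_def)
  have law: "distr M borel Z = density lborel (\<lambda>x. ennreal (\<rho> x))"
    using distributed_distr_eq_density[OF D] by (metis distr_cong sets_lborel)
  have "AE x in distr M borel Z. s \<le> g x"
    using g_ge by (subst AE_distr_iff) auto
  then have ge: "AE x in lborel. 0 < \<rho> x \<longrightarrow> s \<le> g x"
    unfolding law by (subst (asm) AE_density) auto
  have "density lborel (\<lambda>x. ennreal (tail_mean x)) = distr (density M (\<lambda>\<omega>. ennreal (g (Z \<omega>)))) borel Z"
    by (rule g_law[symmetric])
  also have "\<dots> = density (distr M borel Z) (\<lambda>x. ennreal (g x))"
    by (rule density_distr[symmetric]) auto
  also have "\<dots> = density lborel (\<lambda>x. ennreal (\<rho> x) * ennreal (g x))"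
    unfolding law by (rule density_density_eq) auto
  finally have "AE x in lborel. ennreal (tail_mean x) = ennreal (\<rho> x) * ennreal (g x)"
    by (subst (asm) sigma_finite_measure.density_unique_iff[OF sigma_finite_lborel]) auto
  with ge show ?thesis
  proof eventually_elim
    case (elim x)
    then have "ennreal (tail_mean x) = ennreal (\<rho> x * g x)" using nn by (simp add: ennreal_mult')
    moreover have "0 \<le> \<rho> x * g x"
      using elim(1) nn[of x] s_pos by (cases "\<rho> x = 0") (auto intro!: mult_nonneg_nonneg)
    ultimately show ?case using elim(1) tail_mean_nonneg[of x] by simp
  qed
qed

lemma density_integral:
  assumes \<rho>: "is_density M Z \<rho>" and [measurable]: "u \<in> borel_measurable borel"
  shows "(\<integral>\<omega>. u (Z \<omega>) \<partial>M) = (\<integral>x. \<rho> x * u x \<partial>lborel)"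
    and "integrable M (\<lambda>\<omega>. u (Z \<omega>)) \<longleftrightarrow> integrable lborel (\<lambda>x. \<rho> x * u x)"
proof -
  have nn: "\<And>x. 0 \<le> \<rho> x" and D: "distributed M lborel Z (\<lambda>x. ennreal (\<rho> x))"
    using \<rho> by (auto simp: is_density_def)
  show "(\<integral>\<omega>. u (Z \<omega>) \<partial>M) = (\<integral>x. \<rho> x * u x \<partial>lborel)"
    by (rule distributed_integral[OF D, symmetric]) (auto simp: nn)
  show "integrable M (\<lambda>\<omega>. u (Z \<omega>)) \<longleftrightarrow> integrable lborel (\<lambda>x. \<rho> x * u x)"
    by (rule distributed_integrable[OF D, symmetric]) (auto simp: nn)
qed

section \<open>The lower bound for the truncated mean\<close>

lemma tail_mean_antimono:
  assumes "0 \<le> x" "x \<le> y"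
  shows "tail_mean y \<le> tail_mean x"
  unfolding tail_mean_def using assms by (intro integral_mono tail_mean_integrable) auto

text \<open>The integrated form of T' >= -x T/s: the difference of T at x and y is the integral of z
  \<rho>(z), where \<rho> <= T/s and T is at most T(x) on the interval.\<close>

lemma tail_mean_step:
  assumes x: "0 \<le> x" "x \<le> y"
  shows "tail_mean x * (1 - (y\<^sup>2 - x\<^sup>2) / (2 * s)) \<le> tail_mean y"
proof -
  obtain \<rho> where \<rho>: "is_density M Z \<rho>" using density_exists by blast
  have [measurable]: "\<rho> \<in> borel_measurable borel" and nn: "\<And>x. 0 \<le> \<rho> x"
    using \<rho> by (auto simp: is_density_def)
  let ?u = "\<lambda>z. if x < z \<and> z \<le> y then z else 0"
  have iu: "integrable M (\<lambda>\<omega>. ?u (Z \<omega>))"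
    by (rule Bochner_Integration.integrable_bound[OF Z_integrable]) auto
  have FTC: "(\<integral>z. indicator {x..y} z *\<^sub>R (tail_mean x / s * z) \<partial>lborel) = tail_mean x / s * (y\<^sup>2 / 2) - tail_mean x / s * (x\<^sup>2 / 2)"
    by (rule integral_FTC_atLeastAtMost)
      (use x s_pos in \<open>auto intro!: derivative_eq_intros continuous_intros simp: has_real_derivative_iff_has_vector_derivative[symmetric]\<close>)
  have "tail_mean x - tail_mean y = (\<integral>\<omega>. (if x < Z \<omega> then Z \<omega> else 0) - (if y < Z \<omega> then Z \<omega> else 0) \<partial>M)"
    unfolding tail_mean_def using tail_mean_integrable by simp
  also have "\<dots> = (\<integral>\<omega>. ?u (Z \<omega>) \<partial>M)"
    using x by (intro Bochner_Integration.integral_cong) auto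
  also have "\<dots> = (\<integral>z. \<rho> z * ?u z \<partial>lborel)"
    by (rule density_integral[OF \<rho>]) measurable
  also have "\<dots> \<le> (\<integral>z. indicator {x..y} z *\<^sub>R (tail_mean x / s * z) \<partial>lborel)"
  proof (rule integral_mono_AE)
    show "integrable lborel (\<lambda>z. \<rho> z * ?u z)"
      by (subst density_integral(2)[OF \<rho>, symmetric]) (use iu in auto)
    show "integrable lborel (\<lambda>z. indicator {x..y} z *\<^sub>R (tail_mean x / s * z))"
    proof -
      have "continuous_on {x..y} (\<lambda>z. tail_mean x / s * z)" using s_pos by (intro continuous_intros) auto
      from borel_integrable_atLeastAtMost'[OF this] show ?thesis by (simp add: set_integrable_def)
    qed
    show "AE z in lborel. \<rho> z * ?u z \<le> indicator {x..y} z *\<^sub>R (tail_mean x / s * z)"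
      using density_kernel[OF \<rho>]
    proof eventually_elim
      case (elim z)
      show ?case
      proof (cases "x < z \<and> z \<le> y")
        case True
        have "s * \<rho> z \<le> tail_mean z"
          using elim nn[of z] tail_mean_nonneg[of z] s_pos by (cases "\<rho> z = 0") (auto simp: mult.commute intro: mult_left_mono)
        also have "\<dots> \<le> tail_mean x" using True x by (intro tail_mean_antimono) auto
        finally have "\<rho> z \<le> tail_mean x / s" using s_pos by (simp add: field_simps)
        then have "\<rho> z * z \<le> tail_mean x / s * z" using True x by (intro mult_right_mono) auto
        then show ?thesis using True by simp
      next
        case False
        have "0 \<le> indicator {x..y} z * (tail_mean x / s * z)"
          using tail_mean_nonneg[of x] s_pos x by (auto simp: indicator_def)
        moreover have "?u z = 0" using False by auto
        ultimately show ?thesis by (simp only: mult_zero_right real_scaleR_def)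
      qed
    qed
  qed
  also have "\<dots> = tail_mean x * ((y\<^sup>2 - x\<^sup>2) / (2 * s))"
    unfolding FTC using s_pos by (simp add: field_simps)
  finally show ?thesis by (simp add: algebra_simps)
qed

text \<open>In the variable \<open>x\<^sup>2\<close> the step bound is an Euler scheme for the exponential.\<close>

lemma tail_mean_lower:
  assumes z: "0 \<le> z"
  shows "tail_mean 0 * exp (- (z\<^sup>2 / (2 * s))) \<le> tail_mean z"
proof -
  define w where "w = z\<^sup>2 / (2 * s)"
  have w: "0 \<le> w" using s_pos by (simp add: w_def)
  \<comment> \<open>The condition n > w keeps the factor 1 - w/n nonnegative, so that the step
    bounds can be multiplied.\<close>
  have "tail_mean 0 * (1 + (- w) / real n) ^ n \<le> tail_mean z" if n: "real n > w" "n > 0" for n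
  proof -
    \<comment> \<open>The squares of the nodes are equally spaced, so every step costs the same
      factor 1 - w/n.\<close>
    define x where "x k = z * sqrt (real k / real n)" for k
    have x_sq: "(x k)\<^sup>2 = z\<^sup>2 * (real k / real n)" for k
      by (simp add: x_def power_mult_distrib)
    have x_mono: "0 \<le> x k" "x k \<le> x (Suc k)" for k
      unfolding x_def using z by (auto intro!: mult_left_mono divide_right_mono)
    have "tail_mean 0 * (1 + (- w) / real n) ^ k \<le> tail_mean (x k)" for k
    proof (induction k)
      case 0
      then show ?case by (simp add: x_def)
    next
      case (Suc k)
      have nn: "0 \<le> 1 + (- w) / real n" using n by (simp add: field_simps)
      have "tail_mean 0 * (1 + (- w) / real n) ^ Suc k = (tail_mean 0 * (1 + (- w) / real n) ^ k) * (1 + (- w) / real n)" by simp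
      also have "\<dots> \<le> tail_mean (x k) * (1 + (- w) / real n)"
        by (rule mult_right_mono[OF Suc nn])
      also have "\<dots> \<le> tail_mean (x (Suc k))"
      proof -
        have "1 + (- w) / real n = 1 - ((x (Suc k))\<^sup>2 - (x k)\<^sup>2) / (2 * s)"
          unfolding x_sq w_def using n s_pos by (simp add: field_simps)
        then show ?thesis using tail_mean_step[OF x_mono, of k] by simp
      qed
      finally show ?case .
    qed
    from this[of n] show ?thesis using n by (simp add: x_def)
  qed
  moreover obtain n0 :: nat where "w < real n0" using reals_Archimedean2 by blast
  ultimately have bound: "\<And>n. n \<ge> max 1 n0 \<Longrightarrow> tail_mean 0 * (1 + (- w) / real n) ^ n \<le> tail_mean z"
    by (meson le_trans less_le_trans max.bounded_iff of_nat_le_iff zero_less_one)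
  have "(\<lambda>n. tail_mean 0 * (1 + (- w) / real n) ^ n) \<longlonglongrightarrow> tail_mean 0 * exp (- w)"
    by (intro tendsto_mult tendsto_const tendsto_exp_limit_sequentially)
  then have "tail_mean 0 * exp (- w) \<le> tail_mean z" by (rule LIMSEQ_le_const2) (use bound in blast)
  then show ?thesis by (simp add: w_def)
qed

section \<open>From the truncated mean to tail probabilities\<close>

lemma prob_ge_density:
  assumes \<rho>: "is_density M Z \<rho>"
  shows "measure M {\<omega> \<in> space M. z \<le> Z \<omega>} = (\<integral>x. \<rho> x * indicator {z..} x \<partial>lborel)"
    and "integrable lborel (\<lambda>x. \<rho> x * indicator {z..} x)"
proof -
  have "measure M {\<omega> \<in> space M. z \<le> Z \<omega>} = (\<integral>\<omega>. indicator {\<omega> \<in> space M. z \<le> Z \<omega>} \<omega> \<partial>M)" by simp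
  also have "\<dots> = (\<integral>\<omega>. indicator {z..} (Z \<omega>) \<partial>M)"
    by (intro Bochner_Integration.integral_cong) (auto simp: indicator_def)
  also have "\<dots> = (\<integral>x. \<rho> x * indicator {z..} x \<partial>lborel)"
    by (rule density_integral[OF \<rho>]) simp
  finally show "measure M {\<omega> \<in> space M. z \<le> Z \<omega>} = (\<integral>x. \<rho> x * indicator {z..} x \<partial>lborel)" .
  have "integrable M (\<lambda>\<omega>. indicator {z..} (Z \<omega>) :: real)"
    by (rule integrable_const_bound[where B = 1]) (auto simp: indicator_def)
  then show "integrable lborel (\<lambda>x. \<rho> x * indicator {z..} x)"
    by (subst density_integral(2)[OF \<rho>, symmetric]) auto
qed

text \<open>With \<open>q y = y powr (1 + \<beta>) * \<rho> y\<close> and \<open>w y = y powr (- 1 - \<beta>) * ((1 - 1 / \<beta>) * y - z)\<close>, the weight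
  \<open>w\<close> changes sign at \<open>y\<^sub>0 = z / (1 - 1 / \<beta>)\<close>, so \<open>q * w \<le> q y\<^sub>0 * w\<close> for decreasing \<open>q\<close>; the primitive
  \<open>y powr (- \<beta>) * (z - y) / \<beta>\<close> of \<open>w\<close> vanishes at \<open>z\<close> and is negative beyond.\<close>

lemma tail_ge_tail_mean:
  assumes \<alpha>: "0 < \<alpha>" "\<alpha> \<le> z" and \<beta>: "1 < \<beta>" and \<rho>: "is_density M Z \<rho>"
    and mono: "antimono_on {\<alpha>..} (\<lambda>x. x powr (1 + \<beta>) * \<rho> x)"
  shows "(1 - 1 / \<beta>) * tail_mean z \<le> z * measure M {\<omega> \<in> space M. z \<le> Z \<omega>}"
proof -
  have [measurable]: "\<rho> \<in> borel_measurable borel" and nn: "\<And>x. 0 \<le> \<rho> x"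
    using \<rho> by (auto simp: is_density_def)
  have z: "0 < z" using \<alpha> by simp
  define c where "c = 1 - 1 / \<beta>"
  have c: "0 < c" "c \<le> 1" using \<beta> by (auto simp: c_def)
  define y0 where "y0 = z / c"
  have y0: "z \<le> y0" using c z by (simp add: y0_def field_simps)
  define q where "q y = y powr (1 + \<beta>) * \<rho> y" for y
  define w where "w y = y powr (- 1 - \<beta>) * (c * y - z)" for y
  have q_nonneg: "0 \<le> q y" for y using nn by (simp add: q_def)
  have pointwise: "(c * y - z) * \<rho> y \<le> q y0 * w y" if y: "z \<le> y" for y
  proof -
    have "y powr (- 1 - \<beta>) * y powr (1 + \<beta>) = 1" using y z by (simp flip: powr_add)
    then have "(c * y - z) * \<rho> y = q y * w y"
      unfolding q_def w_def by (simp add: mult_ac)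
    also have "\<dots> \<le> q y0 * w y"
    proof (cases "y \<le> y0")
      case True
      then have "c * y - z \<le> 0" using c by (simp add: y0_def field_simps)
      then have "w y \<le> 0" by (simp add: w_def mult_nonneg_nonpos)
      moreover have "q y0 \<le> q y"
        using mono True y y0 \<alpha> unfolding q_def monotone_on_def by auto
      ultimately show ?thesis by (intro mult_right_mono_neg)
    next
      case False
      then have "0 \<le> c * y - z" using c by (simp add: y0_def field_simps)
      then have "0 \<le> w y" by (simp add: w_def)
      moreover have "q y \<le> q y0"
        using mono False y y0 \<alpha> unfolding q_def monotone_on_def by auto
      ultimately show ?thesis by (intro mult_right_mono)
    qed
    finally show ?thesis .
  qed
  have W: "((\<lambda>y. y powr (- \<beta>) * (z - y) / \<beta>) has_real_derivative w y) (at y)" if y: "z \<le> y" for y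
  proof -
    have "y > 0" using y z by simp
    then have "((\<lambda>y. y powr (- \<beta>) * (z - y) / \<beta>) has_real_derivative
        ((- \<beta>) * y powr (- \<beta> - 1) * (z - y) + y powr (- \<beta>) * (- 1)) / \<beta>) (at y)"
      using \<beta> by (auto intro!: derivative_eq_intros)
    also have "- \<beta> - 1 = - 1 - \<beta>" by simp
    also have "y powr (- \<beta>) = y powr (- 1 - \<beta>) * y"
      using \<open>y > 0\<close> by (simp add: powr_diff powr_minus field_simps)
    also have "((- \<beta>) * y powr (- 1 - \<beta>) * (z - y) + y powr (- 1 - \<beta>) * y * (- 1)) / \<beta> = w y"
      unfolding w_def c_def using \<beta> by (simp add: field_simps)
    finally show ?thesis .
  qed
  have contw: "continuous_on {z..N} w" for N
    unfolding w_def using z by (intro continuous_intros) auto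
  define r where "r y = \<rho> y * ((c * y - z) * indicator {z..} y)" for y
  have iM: "integrable M (\<lambda>\<omega>. (c * Z \<omega> - z) * indicator {z..} (Z \<omega>))"
    by (rule integrable_mult_bounded[where C = 1]) (use Z_integrable in \<open>auto simp: indicator_def\<close>)
  have ir: "integrable lborel r"
    unfolding r_def by (subst density_integral(2)[OF \<rho>, symmetric]) (use iM in auto)
  \<comment> \<open>Truncation at N reduces the comparison to a compact interval, where the integral
    of w is read off from its primitive; N tends to infinity afterwards, by integrability of
    r.\<close>
  have le0: "(\<integral>y. indicator {..N} y *\<^sub>R r y \<partial>lborel) \<le> 0" if N: "z \<le> N" for N
  proof -
    have "(\<integral>y. indicator {..N} y *\<^sub>R r y \<partial>lborel) \<le> (\<integral>y. q y0 * (indicator {z..N} y *\<^sub>R w y) \<partial>lborel)"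
    proof (rule integral_mono)
      show "integrable lborel (\<lambda>y. indicator {..N} y *\<^sub>R r y)"
        by (rule integrable_mult_indicator[OF _ ir]) simp
      show "integrable lborel (\<lambda>y. q y0 * (indicator {z..N} y *\<^sub>R w y))"
        using borel_integrable_atLeastAtMost'[OF contw[of N]] by (intro integrable_mult_right) (simp add: set_integrable_def)
      show "indicator {..N} y *\<^sub>R r y \<le> q y0 * (indicator {z..N} y *\<^sub>R w y)" for y
        using pointwise[of y] by (auto simp: indicator_def r_def mult.commute)
    qed
    also have "\<dots> = q y0 * (\<integral>y. indicator {z..N} y *\<^sub>R w y \<partial>lborel)" by (rule integral_mult_right_zero)
    also have "(\<integral>y. indicator {z..N} y *\<^sub>R w y \<partial>lborel) = N powr (- \<beta>) * (z - N) / \<beta> - z powr (- \<beta>) * (z - z) / \<beta>"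
      by (rule integral_FTC_atLeastAtMost[OF N _ contw])
        (use W in \<open>auto simp: has_real_derivative_iff_has_vector_derivative[symmetric] intro: has_field_derivative_at_within\<close>)
    also have "q y0 * (N powr (- \<beta>) * (z - N) / \<beta> - z powr (- \<beta>) * (z - z) / \<beta>) \<le> 0"
      using N \<beta> q_nonneg by (intro mult_nonneg_nonpos) (auto intro!: divide_nonpos_pos mult_nonneg_nonpos)
    finally show ?thesis .
  qed
  have "(\<integral>y. r y \<partial>lborel) \<le> 0"
  proof (rule tendsto_upperbound)
    show "((\<lambda>N. \<integral>y. indicator {..N} y *\<^sub>R r y \<partial>lborel) \<longlongrightarrow> (\<integral>y. r y \<partial>lborel)) at_top"
      by (rule tendsto_integral_at_top[OF _ ir]) simp
    show "\<forall>\<^sub>F N in at_top. (\<integral>y. indicator {..N} y *\<^sub>R r y \<partial>lborel) \<le> 0"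
      using eventually_ge_at_top[of z] by eventually_elim (rule le0)
  qed simp
  then have "(\<integral>\<omega>. (c * Z \<omega> - z) * indicator {z..} (Z \<omega>) \<partial>M) \<le> 0"
    unfolding r_def by (subst density_integral(1)[OF \<rho>]) auto
  moreover have "(\<integral>\<omega>. (c * Z \<omega> - z) * indicator {z..} (Z \<omega>) \<partial>M)
      = (\<integral>\<omega>. c * (if z < Z \<omega> then Z \<omega> else 0) - z * indicator {z..} (Z \<omega>) \<partial>M)"
    by (rule integral_cong_AE, measurable, use no_atoms[of z] in eventually_elim) (auto simp: indicator_def)
  moreover have "\<dots> = c * tail_mean z - z * measure M {\<omega> \<in> space M. z \<le> Z \<omega>}"
  proof -
    have "integrable M (\<lambda>\<omega>. indicator {z..} (Z \<omega>) :: real)"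
      by (rule integrable_const_bound[where B = 1]) (auto simp: indicator_def)
    moreover have "(\<integral>\<omega>. indicator {z..} (Z \<omega>) \<partial>M) = measure M {\<omega> \<in> space M. z \<le> Z \<omega>}"
      unfolding prob_ge_density[OF \<rho>] by (rule density_integral[OF \<rho>]) simp
    ultimately show ?thesis using tail_mean_integrable by (simp add: tail_mean_def)
  qed
  ultimately show ?thesis by (simp add: c_def)
qed

lemma tail_bound_density:
  assumes \<alpha>: "0 < \<alpha>" "\<alpha> \<le> z" and \<beta>: "1 < \<beta>" and \<rho>: "is_density M Z \<rho>"
    and mono: "antimono_on {\<alpha>..} (\<lambda>x. x powr (1 + \<beta>) * \<rho> x)"
  shows "1 / 2 * (1 - 1 / \<beta>) * (\<integral>\<omega>. \<bar>Z \<omega>\<bar> \<partial>M) * (1 / z) * exp (- (z\<^sup>2 / (2 * s)))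
    \<le> measure M {\<omega> \<in> space M. z \<le> Z \<omega>}"
proof -
  have z: "0 < z" using \<alpha> by simp
  have "(1 - 1 / \<beta>) * (tail_mean 0 * exp (- (z\<^sup>2 / (2 * s)))) \<le> (1 - 1 / \<beta>) * tail_mean z"
    using \<beta> tail_mean_lower[of z] z by (intro mult_left_mono) auto
  also have "\<dots> \<le> z * measure M {\<omega> \<in> space M. z \<le> Z \<omega>}"
    by (rule tail_ge_tail_mean[OF assms])
  finally show ?thesis using z by (simp add: tail_mean_zero field_simps)
qed

text \<open>The bound on g is requested only where g > 0, which is what a bound on its logarithm
  provides. This suffices: \<rho> > 0 forces g >= s, and where \<rho> = 0 the truncated mean
  vanishes as well.\<close>

lemma tail_bound_kernel:
  assumes g_le: "\<And>y. z \<le> y \<Longrightarrow> 0 < g y \<Longrightarrow> g y \<le> exp (C * y powr a)"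
    and z: "0 \<le> z" and C: "0 \<le> C" and a: "0 < a"
  shows "tail_mean 0 * exp (- ((z + 1)\<^sup>2 / (2 * s)) - C * (z + 1) powr a) \<le> measure M {\<omega> \<in> space M. z \<le> Z \<omega>}"
proof -
  obtain \<rho> where \<rho>: "is_density M Z \<rho>" using density_exists by blast
  have [measurable]: "\<rho> \<in> borel_measurable borel" and nn: "\<And>x. 0 \<le> \<rho> x"
    using \<rho> by (auto simp: is_density_def)
  define K where "K = tail_mean 0 * exp (- ((z + 1)\<^sup>2 / (2 * s)) - C * (z + 1) powr a)"
  have K: "0 \<le> K" using tail_mean_zero_pos by (simp add: K_def)
  have "K = (\<integral>y. indicator {z..z + 1} y * K \<partial>lborel)" by simp
  also have "\<dots> \<le> (\<integral>y. \<rho> y * indicator {z..} y \<partial>lborel)"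
  proof (rule integral_mono_AE)
    show "integrable lborel (\<lambda>y. indicator {z..z + 1} y * K)"
      by (intro integrable_mult_left) (simp add: integrable_indicator_iff)
    show "AE y in lborel. indicator {z..z + 1} y * K \<le> \<rho> y * indicator {z..} y"
      using density_kernel[OF \<rho>]
    proof eventually_elim
      case (elim y)
      show ?case
      proof (cases "y \<in> {z..z + 1}")
        case True
        then have y: "z \<le> y" "y \<le> z + 1" by auto
        have "tail_mean y \<le> \<rho> y * exp (C * y powr a)"
        proof (cases "\<rho> y = 0")
          case False
          then have "0 < \<rho> y" using nn[of y] by simp
          then have "g y \<le> exp (C * y powr a)" using elim s_pos y by (intro g_le) auto
          then show ?thesis using elim nn[of y] by (simp add: mult_left_mono)
        qed (use elim in simp)
        also have "\<dots> \<le> \<rho> y * exp (C * (z + 1) powr a)"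
          using y z C a nn[of y] by (intro mult_left_mono) (auto intro!: mult_left_mono powr_mono2)
        finally have "tail_mean y * exp (- (C * (z + 1) powr a)) \<le> \<rho> y"
          by (simp add: exp_minus field_simps)
        moreover have "tail_mean 0 * exp (- ((z + 1)\<^sup>2 / (2 * s))) \<le> tail_mean y"
        proof -
          have "y\<^sup>2 / (2 * s) \<le> (z + 1)\<^sup>2 / (2 * s)"
            using y z s_pos by (intro divide_right_mono power_mono) auto
          then have "tail_mean 0 * exp (- ((z + 1)\<^sup>2 / (2 * s))) \<le> tail_mean 0 * exp (- (y\<^sup>2 / (2 * s)))"
            using tail_mean_zero_pos by (intro mult_left_mono) auto
          also have "\<dots> \<le> tail_mean y" using y z by (intro tail_mean_lower) simp
          finally show ?thesis .
        qed
        ultimately have "tail_mean 0 * exp (- ((z + 1)\<^sup>2 / (2 * s))) * exp (- (C * (z + 1) powr a)) \<le> \<rho> y"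
          by (meson exp_ge_zero mult_right_mono order_trans)
        then have "K \<le> \<rho> y" by (simp add: K_def exp_diff exp_minus field_simps)
        then show ?thesis using y by simp
      next
        case False
        then have "indicator {z..z + 1} y * K = 0" by simp
        also have "0 \<le> \<rho> y * indicator {z..} y" using nn by simp
        finally show ?thesis .
      qed
    qed
  qed (rule prob_ge_density[OF \<rho>])
  finally show ?thesis by (simp add: K_def prob_ge_density[OF \<rho>])
qed

text \<open>Replacing 2 by 2 - \<epsilon> in the exponent frees a quadratic term. It absorbs both
  losses of \<open>tail_bound_kernel\<close>, the shift from z to z + 1 and the growth of g, because
  both are of order below 2.\<close>

lemma tail_bound_growth:
  assumes a: "0 < a" "a < 2"
    and lim: "Limsup at_top (\<lambda>z::real. ereal (z powr (- a) * ln (g z))) < \<infinity>"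
    and \<epsilon>: "0 < \<epsilon>" "\<epsilon> < 2"
  shows "\<exists>K>0. \<exists>z0>0. \<forall>z>z0. K * exp (- (z\<^sup>2 / ((2 - \<epsilon>) * s))) \<le> measure M {\<omega> \<in> space M. z \<le> Z \<omega>}"
proof -
  obtain C0 where C0: "Limsup at_top (\<lambda>z::real. ereal (z powr (- a) * ln (g z))) < ereal C0"
    using lim by (metis ereal_dense2 less_ereal.simps(2) linorder_not_less order_less_le_trans)
  \<comment> \<open>C0 may be negative, and a nonnegative C makes the bound on g nondecreasing over
    [z, z + 1].\<close>
  define C where "C = max C0 0"
  have "0 \<le> C" by (simp add: C_def)
  have "\<forall>\<^sub>F z in at_top. ereal (z powr (- a) * ln (g z)) < ereal C0"
    by (rule Limsup_lessD[OF C0])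
  then obtain z1 where z1: "\<And>z. z \<ge> z1 \<Longrightarrow> z powr (- a) * ln (g z) < C0"
    by (auto simp: eventually_at_top_linorder)
  have g_le: "g y \<le> exp (C * y powr a)" if y: "y \<ge> max z1 1" "0 < g y" for y
  proof -
    have "y powr (- a) * ln (g y) \<le> C" using z1[of y] y by (simp add: C_def)
    then have "y powr a * (y powr (- a) * ln (g y)) \<le> y powr a * C" by (intro mult_left_mono) auto
    moreover have "y powr a * (y powr (- a) * ln (g y)) = ln (g y)"
      using y by (simp add: powr_minus)
    ultimately have "ln (g y) \<le> C * y powr a" by (simp only: mult.commute)
    then have "exp (ln (g y)) \<le> exp (C * y powr a)" by simp
    then show ?thesis using y by simp
  qed
  \<comment> \<open>The freed quadratic term: z^2/((2 - \<epsilon>) s) = z^2/(2 s) + c z^2.\<close>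
  define c where "c = (1 / (2 - \<epsilon>) - 1 / 2) / s"
  have c: "0 < c" using \<epsilon> s_pos by (simp add: c_def field_simps)
  \<comment> \<open>A common order for the linear loss from (z + 1)^2 and the loss of order a from
    the growth of g.\<close>
  define b where "b = max 1 a"
  have b: "1 \<le> b" "a \<le> b" "b < 2" using a by (auto simp: b_def)
  \<comment> \<open>For z >= 1, (z + 1)^2 <= z^2 + 3 z gives the first summand and (z + 1)^a <= (2
    z)^a gives the second.\<close>
  define A where "A = 3 / (2 * s) + C * 2 powr a"
  have A: "0 < A" using s_pos \<open>0 \<le> C\<close> by (auto simp: A_def intro!: add_pos_nonneg)
  \<comment> \<open>Beyond the last threshold, A z^b <= c z^2.\<close>
  define z0 where "z0 = max (max z1 1) ((A / c) powr (1 / (2 - b)))"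
  have "tail_mean 0 * exp (- (z\<^sup>2 / ((2 - \<epsilon>) * s))) \<le> measure M {\<omega> \<in> space M. z \<le> Z \<omega>}" if z: "z > z0" for z
  proof -
    have z': "z \<ge> max z1 1" "1 \<le> z" "(A / c) powr (1 / (2 - b)) \<le> z" using z by (auto simp: z0_def)
    have "A / c = ((A / c) powr (1 / (2 - b))) powr (2 - b)"
      using A c b by (simp add: powr_powr)
    also have "\<dots> \<le> z powr (2 - b)" using z' b by (intro powr_mono2) auto
    finally have "A / c * z powr b \<le> z powr (2 - b) * z powr b" by (intro mult_right_mono) auto
    also have "\<dots> = z\<^sup>2" using z' by (simp add: powr_numeral flip: powr_add)
    finally have main: "A * z powr b \<le> c * z\<^sup>2" using c by (simp add: field_simps)
    have "z powr 1 \<le> z powr b" using z' b by (intro powr_mono) auto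
    then have zb: "z \<le> z powr b" using z' by simp
    have "(z + 1) powr a \<le> (2 * z) powr a" using z' a by (intro powr_mono2) auto
    also have "\<dots> = 2 powr a * z powr a" by (rule powr_mult)
    also have "\<dots> \<le> 2 powr a * z powr b" using z' b by (intro mult_left_mono powr_mono) auto
    finally have p: "C * (z + 1) powr a \<le> C * 2 powr a * z powr b"
      using \<open>0 \<le> C\<close> by (simp add: mult.assoc mult_left_mono)
    have "1 \<le> z" by fact
    then have "(z + 1)\<^sup>2 \<le> z\<^sup>2 + 3 * z" by (simp add: power2_sum)
    also have "\<dots> \<le> z\<^sup>2 + 3 * z powr b" using zb by simp
    finally have "(z + 1)\<^sup>2 / (2 * s) \<le> (z\<^sup>2 + 3 * z powr b) / (2 * s)"
      using s_pos by (intro divide_right_mono) auto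
    then have "(z + 1)\<^sup>2 / (2 * s) + C * (z + 1) powr a \<le> z\<^sup>2 / (2 * s) + A * z powr b"
      using p by (simp add: A_def add_divide_distrib distrib_right)
    also have "\<dots> \<le> z\<^sup>2 / (2 * s) + c * z\<^sup>2" using main by simp
    also have "\<dots> = z\<^sup>2 / ((2 - \<epsilon>) * s)"
      using s_pos \<epsilon> by (simp add: c_def field_simps)
    finally have "exp (- (z\<^sup>2 / ((2 - \<epsilon>) * s))) \<le> exp (- ((z + 1)\<^sup>2 / (2 * s)) - C * (z + 1) powr a)" by simp
    then have "tail_mean 0 * exp (- (z\<^sup>2 / ((2 - \<epsilon>) * s))) \<le> tail_mean 0 * exp (- ((z + 1)\<^sup>2 / (2 * s)) - C * (z + 1) powr a)"
      using tail_mean_zero_pos by (intro mult_left_mono) auto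
    also have "\<dots> \<le> measure M {\<omega> \<in> space M. z \<le> Z \<omega>}"
      using z' a \<open>0 \<le> C\<close> by (intro tail_bound_kernel g_le) auto
    finally show ?thesis .
  qed
  moreover have "z0 > 0" by (simp add: z0_def)
  ultimately show ?thesis using tail_mean_zero_pos by blast
qed

end

theorem theorem4p2:
  fixes M :: "'a measure"
    and X :: "'h::{real_inner, banach, second_countable_topology} \<Rightarrow> 'a \<Rightarrow> real"
    and Z :: "'a \<Rightarrow> real" and g :: "real \<Rightarrow> real" and \<sigma>min :: real
  assumes "isonormal_gaussian M X"
    and "Z \<in> D12 M X"
    and "(\<integral>\<omega>. Z \<omega> \<partial>M) = 0"
    and "is_g_version M X Z g"
    and "\<sigma>min > 0"
    and i: "AE \<omega> in M. g (Z \<omega>) \<ge> \<sigma>min\<^sup>2"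
  shows "(\<exists>\<rho>. is_density M Z \<rho>)
    \<and> (\<forall>(\<alpha>::real) (\<beta>::real) \<rho>.
         \<alpha> > 0 \<longrightarrow> \<beta> > 1 \<longrightarrow> is_density M Z \<rho> \<longrightarrow>
         antimono_on {\<alpha>..} (\<lambda>x. x powr (1 + \<beta>) * \<rho> x) \<longrightarrow>
         (\<forall>z\<ge>\<alpha>. measure M {\<omega> \<in> space M. Z \<omega> \<ge> z}
            \<ge> 1 / 2 * (1 - 1 / \<beta>) * (\<integral>\<omega>. \<bar>Z \<omega>\<bar> \<partial>M) * (1 / z)
               * exp (- (z\<^sup>2 / (2 * \<sigma>min\<^sup>2)))))
    \<and> ((\<exists>\<alpha>::real. 0 < \<alpha> \<and> \<alpha> < 2 \<and>
           Limsup at_top (\<lambda>z::real. ereal (z powr (- \<alpha>) * ln (g z))) < \<infinity>) \<longrightarrow>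
         (\<forall>\<epsilon>::real. 0 < \<epsilon> \<and> \<epsilon> < 2 \<longrightarrow>
            (\<exists>K>0. \<exists>z0>0. \<forall>z>z0. measure M {\<omega> \<in> space M. Z \<omega> \<ge> z}
               \<ge> K * exp (- (z\<^sup>2 / ((2 - \<epsilon>) * \<sigma>min\<^sup>2))))))"
proof -
  interpret isonormal_gaussian M X by fact
  note gv = g_version_integral[OF assms(2-4)]
  interpret stein_kernel M Z g "\<sigma>min\<^sup>2"
    by unfold_locales (use gv(1-3) assms(3,5) i in \<open>auto intro: g_version_sgn[OF assms(2-4)]\<close>)
  show ?thesis
    using density_exists tail_bound_density tail_bound_growth by blast
qed

end
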